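(* Let $R$ be a graded-commutative noetherian ring and $\mathsf T$ a compactly generated $R$-linear triangulated category with arbitrary coproducts. Suppose $\mathsf T$ is noetherian and stratified by $R$, and let $\mathsf S$ be a localizing subcategory of $\mathsf T$. Let ${}^\perp\mathsf S$ be the full subcategory of objects $X$ of $\mathsf T$ such that there are no nonzero morphisms from $X$ to any object in $\mathsf S$. Then ${}^\perp\mathsf S$ is the localizing subcategory corresponding to the set of primes $\{\mathfrak p\in\operatorname{Spec}R\mid\mathcal V(\mathfrak p)\cap\operatorname{supp}_R\mathsf S=\emptyset\}$; that is, $${}^\perp\mathsf S=\bigl\{X\in\mathsf T\bigm|\operatorname{supp}_RX\subseteq\{\mathfrak p\in\operatorname{Spec}R\mid\mathcal V(\mathfrak p)\cap\operatorname{supp}_R\mathsf S=\emptyset\}\bigr\}.$$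
   Context: Graded-commutative: $R$ is $\mathbb Z$-graded with $rs=(-1)^{|r||s|}sr$ for homogeneous $r,s$. $\operatorname{Spec}R$ is the set of homogeneous prime ideals; $\mathcal V(\mathfrak a)=\{\mathfrak p\in\operatorname{Spec}R\mid\mathfrak p\supseteq\mathfrak a\}$ for a homogeneous ideal $\mathfrak a$. $R$-modules are graded and $M_{\mathfrak p}$ is homogeneous localization. A subset $\mathcal V\subseteq\operatorname{Spec}R$ is specialization closed if $\mathfrak p\in\mathcal V$, $\mathfrak p\subseteq\mathfrak q$ imply $\mathfrak q\in\mathcal V$. $\mathsf T$ has suspension $\Sigma$. A localizing subcategory is a full triangulated subcategory closed under coproducts; $\operatorname{Loc}_{\mathsf T}(\mathsf C)$ is the smallest one containing $\mathsf C$. An object $C$ is compact if $\operatorname{Hom}_{\mathsf T}(C,-)$ commutes with coproducts; $\mathsf T^c$ is the full subcategory of compact objects. $\mathsf T$ is compactly generated if $\mathsf T=\operatorname{Loc}_{\mathsf T}(\mathsf G)$ for a set $\mathsf G$ of compact objects. $\mathsf T$ is $R$-linear if there is given a homomorphism of graded rings $R\to Z^*(\mathsf T)$ to the graded center ($Z^n(\mathsf T)$ consists of natural transformations $\eta\colon\mathrm{Id}\to\Sigma^n$ with $\eta\Sigma=(-1)^n\Sigma\eta$); then $\operatorname{Hom}^*_{\mathsf T}(X,Y)=\bigoplus_i\operatorname{Hom}_{\mathsf T}(X,\Sigma^iY)$ is a graded $R$-module, and $\operatorname{End}^*_{\mathsf T}(X)=\operatorname{Hom}^*_{\mathsf T}(X,X)$.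 For specialization closed $\mathcal V$, let $\mathsf T_{\mathcal V}=\{X\in\mathsf T\mid\operatorname{Hom}^*_{\mathsf T}(C,X)_{\mathfrak p}=0\text{ for all }C\in\mathsf T^c,\ \mathfrak p\in\operatorname{Spec}R\setminus\mathcal V\}$. This is a localizing subcategory and there is a localization functor $L_{\mathcal V}\colon\mathsf T\to\mathsf T$ with $\operatorname{Ker}L_{\mathcal V}=\mathsf T_{\mathcal V}$, giving functorial exact triangles $\varGamma_{\mathcal V}X\to X\to L_{\mathcal V}X\to$ with $\varGamma_{\mathcal V}X\in\mathsf T_{\mathcal V}$ and $\operatorname{Hom}_{\mathsf T}(\mathsf T_{\mathcal V},L_{\mathcal V}X)=0$. For $\mathfrak p\in\operatorname{Spec}R$ put $\mathcal Z(\mathfrak p)=\{\mathfrak q\in\operatorname{Spec}R\mid\mathfrak q\not\subseteq\mathfrak p\}$, $X_{\mathfrak p}=L_{\mathcal Z(\mathfrak p)}X$, $\varGamma_{\mathfrak p}X=\varGamma_{\mathcal V(\mathfrak p)}(X_{\mathfrak p})$. $\varGamma_{\mathfrak p}\mathsf T$ is the essential image of $\varGamma_{\mathfrak p}$, a localizing subcategory of $\mathsf T$. The support of $X$ is $\operatorname{supp}_RX=\{\mathfrak p\in\operatorname{Spec}R\mid\varGamma_{\mathfrak p}X\neq0\}$, and $\operatorname{supp}_R\mathsf S=\bigcup_{X\in\mathsf S}\operatorname{supp}_RX$. $\mathsf T$ is stratified by $R$ if (S1) the local-global principle holds, i.e. $\operatorname{Loc}_{\mathsf T}(X)=\operatorname{Loc}_{\mathsf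 T}(\{\varGamma_{\mathfrak p}X\mid\mathfrak p\in\operatorname{Spec}R\})$ for every object $X$; and (S2) for each $\mathfrak p\in\operatorname{Spec}R$ the localizing subcategory $\varGamma_{\mathfrak p}\mathsf T$ is either zero or minimal (nonzero with no proper nonzero localizing subcategories). In the stratified case, the localizing subcategory corresponding to a set $\mathcal U$ of primes is $\{X\in\mathsf T\mid\operatorname{supp}_RX\subseteq\mathcal U\}$. $\mathsf T$ is noetherian if the $R$-module $\operatorname{End}^*_{\mathsf T}(C)$ is finitely generated for every compact object $C$. *)

theory Defs
  imports "HOL-Algebra.Ideal"
begin

unbundle cardinal_syntax

section \<open>Sets and classes\<close>

text \<open>
  A triangulated category with arbitrary coproducts lives on a class of objects, and the
  coproducts are indexed by sets. This distinction is expressed by a regular uncountable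
  cardinal \<open>\<kappa>\<close>: the ``sets'' are the collections of cardinality less than \<open>\<kappa>\<close>, whereas the
  collections of all objects and of all morphisms of the category are not restricted.
  A Grothendieck universe is the case that \<open>\<kappa>\<close> is strongly inaccessible.
  Indexing families by small subsets of \<open>Field \<kappa>\<close> gives all small families up to reindexing.
\<close>

definition size_bound :: "'k rel \<Rightarrow> bool" where
  "size_bound \<kappa> \<longleftrightarrow> Card_order \<kappa> \<and> regularCard \<kappa> \<and> natLeq <o \<kappa>"

definition small :: "'k rel \<Rightarrow> 'a set \<Rightarrow> bool" where
  "small \<kappa> A \<longleftrightarrow> |A| <o \<kappa>"

definition small_index :: "'k rel \<Rightarrow> 'k set \<Rightarrow> bool" where
  "small_index \<kappa> I \<longleftrightarrow> I \<subseteq> Field \<kappa> \<and> small \<kappa> I"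


section \<open>Graded-commutative rings\<close>

record 'r graded_ring = "'r ring" +
  grade :: "int \<Rightarrow> 'r set"

definition hom_decomp :: "('r, 'z) graded_ring_scheme \<Rightarrow> (int \<Rightarrow> 'r) \<Rightarrow> 'r \<Rightarrow> bool" where
  "hom_decomp R c x \<longleftrightarrow> (\<forall>n. c n \<in> grade R n) \<and> finite {n. c n \<noteq> \<zero>\<^bsub>R\<^esub>} \<and>
     x = finsum R c {n. c n \<noteq> \<zero>\<^bsub>R\<^esub>}"

definition rsign :: "('r, 'z) graded_ring_scheme \<Rightarrow> int \<Rightarrow> 'r \<Rightarrow> 'r" where
  "rsign R n x = (if even n then x else \<ominus>\<^bsub>R\<^esub> x)"

locale graded_commutative_ring = ring R for R :: "('r, 'z) graded_ring_scheme" (structure) +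
  assumes grade_subgroup: "\<And>n. additive_subgroup (grade R n) R"
    and grade_one: "\<one> \<in> grade R 0"
    and grade_mult: "\<And>m n r s. r \<in> grade R m \<Longrightarrow> s \<in> grade R n \<Longrightarrow> r \<otimes> s \<in> grade R (m + n)"
    and grade_direct_sum: "\<And>x. x \<in> carrier R \<Longrightarrow> \<exists>!c. hom_decomp R c x"
    and graded_commute: "\<And>m n r s. r \<in> grade R m \<Longrightarrow> s \<in> grade R n \<Longrightarrow>
      r \<otimes> s = rsign R (m * n) (s \<otimes> r)"

definition homogeneous_ideal :: "'r set \<Rightarrow> ('r, 'z) graded_ring_scheme \<Rightarrow> bool" where
  "homogeneous_ideal I R \<longleftrightarrow> ideal I R \<and> (\<forall>x\<in>I. \<forall>c. hom_decomp R c x \<longrightarrow> (\<forall>n. c n \<in> I))"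

definition graded_noetherian :: "('r, 'z) graded_ring_scheme \<Rightarrow> bool" where
  "graded_noetherian R \<longleftrightarrow>
     (\<forall>I. homogeneous_ideal I R \<longrightarrow> (\<exists>A\<subseteq>carrier R. finite A \<and> I = Idl\<^bsub>R\<^esub> A))"

text \<open>The library's \<open>primeideal\<close> is only available over commutative rings.\<close>

definition Spec :: "('r, 'z) graded_ring_scheme \<Rightarrow> 'r set set" where
  "Spec R = {\<pp>. homogeneous_ideal \<pp> R \<and> \<pp> \<noteq> carrier R \<and>
     (\<forall>a\<in>carrier R. \<forall>b\<in>carrier R. a \<otimes>\<^bsub>R\<^esub> b \<in> \<pp> \<longrightarrow> a \<in> \<pp> \<or> b \<in> \<pp>)}"

definition Vset :: "('r, 'z) graded_ring_scheme \<Rightarrow> 'r set \<Rightarrow> 'r set set" where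
  "Vset R \<aa> = {\<pp> \<in> Spec R. \<aa> \<subseteq> \<pp>}"

definition Zset :: "('r, 'z) graded_ring_scheme \<Rightarrow> 'r set \<Rightarrow> 'r set set" where
  "Zset R \<pp> = {\<qq> \<in> Spec R. \<not> \<qq> \<subseteq> \<pp>}"


section \<open>Graded modules\<close>

text \<open>
  A graded left module is given by its homogeneous components;
  \<open>gsmult M a i r x\<close> is the product of \<open>r\<close> of degree \<open>a\<close> and \<open>x\<close> of degree \<open>i\<close>,
  which lies in degree \<open>i + a\<close>.
\<close>

record ('r, 'm) gmodule =
  gcomp :: "int \<Rightarrow> 'm set"
  gzero :: "int \<Rightarrow> 'm"
  gadd :: "int \<Rightarrow> 'm \<Rightarrow> 'm \<Rightarrow> 'm"
  gsmult :: "int \<Rightarrow> int \<Rightarrow> 'r \<Rightarrow> 'm \<Rightarrow> 'm"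

text \<open>Closure under negatives follows from multiplication with the degree zero element \<open>-1\<close>.\<close>

definition graded_submodule ::
  "('r, 'z) graded_ring_scheme \<Rightarrow> ('r, 'm) gmodule \<Rightarrow> (int \<Rightarrow> 'm set) \<Rightarrow> bool" where
  "graded_submodule R M N \<longleftrightarrow>
     (\<forall>i. N i \<subseteq> gcomp M i \<and> gzero M i \<in> N i) \<and>
     (\<forall>i. \<forall>x\<in>N i. \<forall>y\<in>N i. gadd M i x y \<in> N i) \<and>
     (\<forall>a i. \<forall>r\<in>grade R a. \<forall>x\<in>N i. gsmult M a i r x \<in> N (i + a))"

definition finitely_generated_module ::
  "('r, 'z) graded_ring_scheme \<Rightarrow> ('r, 'm) gmodule \<Rightarrow> bool" where
  "finitely_generated_module R M \<longleftrightarrow>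
     (\<exists>A. finite A \<and> (\<forall>(i, x)\<in>A. x \<in> gcomp M i) \<and>
        (\<forall>N. graded_submodule R M N \<and> (\<forall>(i, x)\<in>A. x \<in> N i) \<longrightarrow> (\<forall>i. N i = gcomp M i)))"

text \<open>
  Homogeneous localization. The triple \<open>(k, x, s)\<close> stands for the left fraction \<open>s\<^sup>-\<^sup>1 x\<close> of
  degree \<open>n\<close>, where \<open>s\<close> has degree \<open>k\<close> and \<open>x\<close> has degree \<open>n + k\<close>. Since
  \<open>s s' = (-1)\<^sup>k\<^sup>k\<^sup>' s' s\<close>, the fractions \<open>s\<^sup>-\<^sup>1 x\<close> and \<open>s'\<^sup>-\<^sup>1 x'\<close> agree if and only if
  \<open>(-1)\<^sup>k\<^sup>k\<^sup>' s' x\<close> and \<open>s x'\<close> agree after multiplication with a denominator.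
\<close>

definition fractions ::
  "('r, 'z) graded_ring_scheme \<Rightarrow> ('r, 'm) gmodule \<Rightarrow> 'r set \<Rightarrow> int \<Rightarrow> (int \<times> 'm \<times> 'r) set" where
  "fractions R M \<pp> n = {(k, x, s). s \<in> grade R k \<and> s \<notin> \<pp> \<and> x \<in> gcomp M (n + k)}"

definition fraction_eq ::
  "('r, 'z) graded_ring_scheme \<Rightarrow> ('r, 'm) gmodule \<Rightarrow> 'r set \<Rightarrow> int \<Rightarrow>
     ((int \<times> 'm \<times> 'r) \<times> (int \<times> 'm \<times> 'r)) set" where
  "fraction_eq R M \<pp> n =
     {((k, x, s), (k', x', s')). (k, x, s) \<in> fractions R M \<pp> n \<and> (k', x', s') \<in> fractions R M \<pp> n \<and>
        (\<exists>j. \<exists>u\<in>grade R j - \<pp>.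
           gsmult M j (n + k + k') u (gsmult M k' (n + k) (rsign R (k * k') s') x) =
           gsmult M j (n + k + k') u (gsmult M k (n + k') s x'))}"

definition localization ::
  "('r, 'z) graded_ring_scheme \<Rightarrow> ('r, 'm) gmodule \<Rightarrow> 'r set \<Rightarrow> int \<Rightarrow> (int \<times> 'm \<times> 'r) set set" where
  "localization R M \<pp> n = fractions R M \<pp> n // fraction_eq R M \<pp> n"

definition localization_zero ::
  "('r, 'z) graded_ring_scheme \<Rightarrow> ('r, 'm) gmodule \<Rightarrow> 'r set \<Rightarrow> bool" where
  "localization_zero R M \<pp> \<longleftrightarrow>
     (\<forall>n. localization R M \<pp> n = {fraction_eq R M \<pp> n `` {(0, gzero M n, \<one>\<^bsub>R\<^esub>)}})"


section \<open>Triangulated categories\<close>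

text \<open>
  \<open>Comp T g f\<close> is the composite \<open>g \<circ> f\<close>. An element \<open>(f, g, h)\<close> of \<open>Tri T\<close> is an exact
  triangle \<open>X \<rightarrow> Y \<rightarrow> Z \<rightarrow> \<Sigma>X\<close>.
\<close>

record ('o, 'm) tricat =
  Ob :: "'o set"
  Mor :: "'m set"
  Dom :: "'m \<Rightarrow> 'o"
  Cod :: "'m \<Rightarrow> 'o"
  Idn :: "'o \<Rightarrow> 'm"
  Comp :: "'m \<Rightarrow> 'm \<Rightarrow> 'm"
  Zer :: "'o \<Rightarrow> 'o \<Rightarrow> 'm"
  Add :: "'m \<Rightarrow> 'm \<Rightarrow> 'm"
  Sus :: "'o \<Rightarrow> 'o"
  SusM :: "'m \<Rightarrow> 'm"
  Tri :: "('m \<times> 'm \<times> 'm) set"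

definition Hom :: "('o, 'm, 'z) tricat_scheme \<Rightarrow> 'o \<Rightarrow> 'o \<Rightarrow> 'm set" where
  "Hom T X Y = {f \<in> Mor T. Dom T f = X \<and> Cod T f = Y}"

definition hom_group :: "('o, 'm, 'z) tricat_scheme \<Rightarrow> 'o \<Rightarrow> 'o \<Rightarrow> 'm monoid" where
  "hom_group T X Y = \<lparr>carrier = Hom T X Y, monoid.mult = Add T, one = Zer T X Y\<rparr>"

definition Neg :: "('o, 'm, 'z) tricat_scheme \<Rightarrow> 'm \<Rightarrow> 'm" where
  "Neg T f = m_inv (hom_group T (Dom T f) (Cod T f)) f"

definition is_iso :: "('o, 'm, 'z) tricat_scheme \<Rightarrow> 'm \<Rightarrow> bool" where
  "is_iso T f \<longleftrightarrow> f \<in> Mor T \<and> (\<exists>g\<in>Hom T (Cod T f) (Dom T f).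
     Comp T g f = Idn T (Dom T f) \<and> Comp T f g = Idn T (Cod T f))"

definition isomorphic :: "('o, 'm, 'z) tricat_scheme \<Rightarrow> 'o \<Rightarrow> 'o \<Rightarrow> bool" where
  "isomorphic T X Y \<longleftrightarrow> (\<exists>f\<in>Hom T X Y. is_iso T f)"

definition zero_object :: "('o, 'm, 'z) tricat_scheme \<Rightarrow> 'o \<Rightarrow> bool" where
  "zero_object T X \<longleftrightarrow> X \<in> Ob T \<and>
     (\<forall>Y\<in>Ob T. (\<exists>!f. f \<in> Hom T X Y) \<and> (\<exists>!f. f \<in> Hom T Y X))"

locale category =
  fixes T :: "('o, 'm, 'z) tricat_scheme"
  assumes dom_cod: "\<And>f. f \<in> Mor T \<Longrightarrow> Dom T f \<in> Ob T \<and> Cod T f \<in> Ob T"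
    and idn: "\<And>X. X \<in> Ob T \<Longrightarrow> Idn T X \<in> Hom T X X"
    and comp: "\<And>X Y Z f g. f \<in> Hom T X Y \<Longrightarrow> g \<in> Hom T Y Z \<Longrightarrow> Comp T g f \<in> Hom T X Z"
    and comp_idn: "\<And>X Y f. f \<in> Hom T X Y \<Longrightarrow> Comp T f (Idn T X) = f \<and> Comp T (Idn T Y) f = f"
    and comp_assoc: "\<And>W X Y Z f g h. f \<in> Hom T W X \<Longrightarrow> g \<in> Hom T X Y \<Longrightarrow> h \<in> Hom T Y Z \<Longrightarrow>
      Comp T h (Comp T g f) = Comp T (Comp T h g) f"

locale additive_category = category T for T :: "('o, 'm, 'z) tricat_scheme" +
  assumes hom_comm_group: "\<And>X Y. X \<in> Ob T \<Longrightarrow> Y \<in> Ob T \<Longrightarrow> comm_group (hom_group T X Y)"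
    and comp_add_right: "\<And>X Y Z f f' g. f \<in> Hom T X Y \<Longrightarrow> f' \<in> Hom T X Y \<Longrightarrow> g \<in> Hom T Y Z \<Longrightarrow>
      Comp T g (Add T f f') = Add T (Comp T g f) (Comp T g f')"
    and comp_add_left: "\<And>X Y Z f g g'. f \<in> Hom T X Y \<Longrightarrow> g \<in> Hom T Y Z \<Longrightarrow> g' \<in> Hom T Y Z \<Longrightarrow>
      Comp T (Add T g g') f = Add T (Comp T g f) (Comp T g' f)"
    and ex_zero_object: "\<exists>X. zero_object T X"
    and ex_biproduct: "\<And>X Y. X \<in> Ob T \<Longrightarrow> Y \<in> Ob T \<Longrightarrow>
      \<exists>P i j p q. P \<in> Ob T \<and> i \<in> Hom T X P \<and> j \<in> Hom T Y P \<and> p \<in> Hom T P X \<and> q \<in> Hom T P Y \<and>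
        Comp T p i = Idn T X \<and> Comp T q j = Idn T Y \<and>
        Comp T p j = Zer T Y X \<and> Comp T q i = Zer T X Y \<and>
        Add T (Comp T i p) (Comp T j q) = Idn T P"

text \<open>The suspension is an automorphism of the category, so that all its integral powers exist.\<close>

locale triangulated_category = additive_category T for T :: "('o, 'm, 'z) tricat_scheme" +
  assumes sus_ob: "bij_betw (Sus T) (Ob T) (Ob T)"
    and sus_mor: "bij_betw (SusM T) (Mor T) (Mor T)"
    and sus_hom: "\<And>X Y f. f \<in> Hom T X Y \<Longrightarrow> SusM T f \<in> Hom T (Sus T X) (Sus T Y)"
    and sus_idn: "\<And>X. X \<in> Ob T \<Longrightarrow> SusM T (Idn T X) = Idn T (Sus T X)"
    and sus_comp: "\<And>X Y Z f g. f \<in> Hom T X Y \<Longrightarrow> g \<in> Hom T Y Z \<Longrightarrow>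
      SusM T (Comp T g f) = Comp T (SusM T g) (SusM T f)"
    and sus_add: "\<And>X Y f g. f \<in> Hom T X Y \<Longrightarrow> g \<in> Hom T X Y \<Longrightarrow>
      SusM T (Add T f g) = Add T (SusM T f) (SusM T g)"
    and tri_wf: "\<And>f g h. (f, g, h) \<in> Tri T \<Longrightarrow> f \<in> Mor T \<and> g \<in> Hom T (Cod T f) (Cod T g) \<and>
      h \<in> Hom T (Cod T g) (Sus T (Dom T f))"
    and tri_iso: "\<And>f g h f' g' h' a b c. (f, g, h) \<in> Tri T \<Longrightarrow>
      f' \<in> Mor T \<Longrightarrow> g' \<in> Hom T (Cod T f') (Cod T g') \<Longrightarrow> h' \<in> Hom T (Cod T g') (Sus T (Dom T f')) \<Longrightarrow>
      a \<in> Hom T (Dom T f) (Dom T f') \<Longrightarrow> b \<in> Hom T (Cod T f) (Cod T f') \<Longrightarrow>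
      c \<in> Hom T (Cod T g) (Cod T g') \<Longrightarrow> is_iso T a \<Longrightarrow> is_iso T b \<Longrightarrow> is_iso T c \<Longrightarrow>
      Comp T b f = Comp T f' a \<Longrightarrow> Comp T c g = Comp T g' b \<Longrightarrow>
      Comp T (SusM T a) h = Comp T h' c \<Longrightarrow> (f', g', h') \<in> Tri T"
    and tri_idn: "\<And>X Z. X \<in> Ob T \<Longrightarrow> zero_object T Z \<Longrightarrow>
      (Idn T X, Zer T X Z, Zer T Z (Sus T X)) \<in> Tri T"
    and tri_ex: "\<And>f. f \<in> Mor T \<Longrightarrow> \<exists>g h. (f, g, h) \<in> Tri T"
    and tri_rotate: "\<And>f g h. f \<in> Mor T \<Longrightarrow> g \<in> Hom T (Cod T f) (Cod T g) \<Longrightarrow>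
      h \<in> Hom T (Cod T g) (Sus T (Dom T f)) \<Longrightarrow>
      (f, g, h) \<in> Tri T \<longleftrightarrow> (g, h, Neg T (SusM T f)) \<in> Tri T"
    and tri_complete: "\<And>f g h f' g' h' a b. (f, g, h) \<in> Tri T \<Longrightarrow> (f', g', h') \<in> Tri T \<Longrightarrow>
      a \<in> Hom T (Dom T f) (Dom T f') \<Longrightarrow> b \<in> Hom T (Cod T f) (Cod T f') \<Longrightarrow>
      Comp T b f = Comp T f' a \<Longrightarrow>
      \<exists>c\<in>Hom T (Cod T g) (Cod T g'). Comp T c g = Comp T g' b \<and> Comp T (SusM T a) h = Comp T h' c"
    and tri_octahedral: "\<And>X Y Z f g f1 f2 g1 g2 h1 h2. f \<in> Hom T X Y \<Longrightarrow> g \<in> Hom T Y Z \<Longrightarrow>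
      (f, f1, f2) \<in> Tri T \<Longrightarrow> (g, g1, g2) \<in> Tri T \<Longrightarrow> (Comp T g f, h1, h2) \<in> Tri T \<Longrightarrow>
      \<exists>u v. (u, v, Comp T (SusM T f1) g2) \<in> Tri T \<and>
        u \<in> Hom T (Cod T f1) (Cod T h1) \<and> v \<in> Hom T (Cod T h1) (Cod T g1) \<and>
        Comp T u f1 = Comp T h1 g \<and> Comp T h2 u = f2 \<and>
        Comp T v h1 = g1 \<and> Comp T g2 v = Comp T (SusM T f) h2"

definition shift :: "('o, 'm, 'z) tricat_scheme \<Rightarrow> int \<Rightarrow> 'o \<Rightarrow> 'o" where
  "shift T n X = (if 0 \<le> n then (Sus T ^^ nat n) X else (inv_into (Ob T) (Sus T) ^^ nat (- n)) X)"

definition shiftM :: "('o, 'm, 'z) tricat_scheme \<Rightarrow> int \<Rightarrow> 'm \<Rightarrow> 'm" where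
  "shiftM T n f = (if 0 \<le> n then (SusM T ^^ nat n) f else (inv_into (Mor T) (SusM T) ^^ nat (- n)) f)"


section \<open>Coproducts, compact objects and localizing subcategories\<close>

text \<open>Full subcategories are identified with their sets of objects.\<close>

definition is_coproduct ::
  "('o, 'm, 'z) tricat_scheme \<Rightarrow> 'i set \<Rightarrow> ('i \<Rightarrow> 'o) \<Rightarrow> 'o \<Rightarrow> ('i \<Rightarrow> 'm) \<Rightarrow> bool" where
  "is_coproduct T I X P \<iota> \<longleftrightarrow> P \<in> Ob T \<and> (\<forall>i\<in>I. X i \<in> Ob T \<and> \<iota> i \<in> Hom T (X i) P) \<and>
     (\<forall>Y\<in>Ob T. \<forall>g. (\<forall>i\<in>I. g i \<in> Hom T (X i) Y) \<longrightarrow>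
        (\<exists>!h. h \<in> Hom T P Y \<and> (\<forall>i\<in>I. Comp T h (\<iota> i) = g i)))"

definition has_coproducts :: "'k rel \<Rightarrow> ('o, 'm, 'z) tricat_scheme \<Rightarrow> bool" where
  "has_coproducts \<kappa> T \<longleftrightarrow>
     (\<forall>I X. small_index \<kappa> I \<and> (\<forall>i\<in>I. X i \<in> Ob T) \<longrightarrow> (\<exists>P \<iota>. is_coproduct T I X P \<iota>))"

text \<open>
  \<open>C\<close> is compact if the canonical map from the direct sum of the groups \<open>Hom(C, X\<^sub>i)\<close> to
  \<open>Hom(C, P)\<close> is bijective whenever \<open>P\<close> is a coproduct of the \<open>X\<^sub>i\<close>.
\<close>

definition hom_direct_sum ::
  "('o, 'm, 'z) tricat_scheme \<Rightarrow> 'o \<Rightarrow> 'i set \<Rightarrow> ('i \<Rightarrow> 'o) \<Rightarrow> ('i \<Rightarrow> 'm) set" where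
  "hom_direct_sum T C I X =
     {f \<in> (\<Pi>\<^sub>E i\<in>I. Hom T C (X i)). finite {i\<in>I. f i \<noteq> Zer T C (X i)}}"

definition compact_objects :: "'k rel \<Rightarrow> ('o, 'm, 'z) tricat_scheme \<Rightarrow> 'o set" where
  "compact_objects \<kappa> T = {C \<in> Ob T. \<forall>I X P \<iota>. small_index \<kappa> I \<and> is_coproduct T I X P \<iota> \<longrightarrow>
     bij_betw (\<lambda>f. finprod (hom_group T C P) (\<lambda>i. Comp T (\<iota> i) (f i)) {i\<in>I. f i \<noteq> Zer T C (X i)})
       (hom_direct_sum T C I X) (Hom T C P)}"

definition triangulated_subcategory :: "('o, 'm, 'z) tricat_scheme \<Rightarrow> 'o set \<Rightarrow> bool" where
  "triangulated_subcategory T S \<longleftrightarrow> S \<subseteq> Ob T \<and> S \<noteq> {} \<and>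
     (\<forall>X\<in>Ob T. X \<in> S \<longleftrightarrow> Sus T X \<in> S) \<and>
     (\<forall>f g h. (f, g, h) \<in> Tri T \<longrightarrow>
        (Dom T f \<in> S \<and> Cod T f \<in> S \<longrightarrow> Cod T g \<in> S) \<and>
        (Cod T f \<in> S \<and> Cod T g \<in> S \<longrightarrow> Dom T f \<in> S) \<and>
        (Dom T f \<in> S \<and> Cod T g \<in> S \<longrightarrow> Cod T f \<in> S))"

definition localizing :: "'k rel \<Rightarrow> ('o, 'm, 'z) tricat_scheme \<Rightarrow> 'o set \<Rightarrow> bool" where
  "localizing \<kappa> T S \<longleftrightarrow> triangulated_subcategory T S \<and>
     (\<forall>I X P \<iota>. small_index \<kappa> I \<and> is_coproduct T I X P \<iota> \<and> (\<forall>i\<in>I. X i \<in> S) \<longrightarrow> P \<in> S)"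

definition Loc :: "'k rel \<Rightarrow> ('o, 'm, 'z) tricat_scheme \<Rightarrow> 'o set \<Rightarrow> 'o set" where
  "Loc \<kappa> T C = \<Inter>{S. localizing \<kappa> T S \<and> C \<subseteq> S}"

definition zero_subcategory :: "('o, 'm, 'z) tricat_scheme \<Rightarrow> 'o set \<Rightarrow> bool" where
  "zero_subcategory T S \<longleftrightarrow> (\<forall>X\<in>S. zero_object T X)"

definition minimal_localizing :: "'k rel \<Rightarrow> ('o, 'm, 'z) tricat_scheme \<Rightarrow> 'o set \<Rightarrow> bool" where
  "minimal_localizing \<kappa> T S \<longleftrightarrow> localizing \<kappa> T S \<and> \<not> zero_subcategory T S \<and>
     (\<forall>S'. localizing \<kappa> T S' \<and> S' \<subseteq> S \<longrightarrow> zero_subcategory T S' \<or> S' = S)"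

text \<open>
  The morphisms out of a compact object are required to form sets. For all objects this would
  be the usual local smallness; only the condition on compact objects is meaningful
  if \<open>\<kappa>\<close> is not a strong limit cardinal.
\<close>

definition compactly_generated :: "'k rel \<Rightarrow> ('o, 'm, 'z) tricat_scheme \<Rightarrow> bool" where
  "compactly_generated \<kappa> T \<longleftrightarrow>
     (\<forall>C\<in>compact_objects \<kappa> T. \<forall>X\<in>Ob T. small \<kappa> (Hom T C X)) \<and>
     (\<exists>G\<subseteq>compact_objects \<kappa> T. small \<kappa> G \<and> Loc \<kappa> T G = Ob T)"

definition left_perp :: "('o, 'm, 'z) tricat_scheme \<Rightarrow> 'o set \<Rightarrow> 'o set" where
  "left_perp T S = {X \<in> Ob T. \<forall>Y\<in>S. \<forall>f\<in>Hom T X Y. f = Zer T X Y}"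


section \<open>Linear categories\<close>

definition msign :: "('o, 'm, 'z) tricat_scheme \<Rightarrow> int \<Rightarrow> 'm \<Rightarrow> 'm" where
  "msign T n f = (if even n then f else Neg T f)"

definition graded_center :: "('o, 'm, 'z) tricat_scheme \<Rightarrow> int \<Rightarrow> ('o \<Rightarrow> 'm) set" where
  "graded_center T n = {\<eta>.
     (\<forall>X\<in>Ob T. \<eta> X \<in> Hom T X (shift T n X)) \<and>
     (\<forall>X Y. \<forall>f\<in>Hom T X Y. Comp T (\<eta> Y) f = Comp T (shiftM T n f) (\<eta> X)) \<and>
     (\<forall>X\<in>Ob T. \<eta> (Sus T X) = msign T n (SusM T (\<eta> X)))}"

text \<open>\<open>act T n r\<close> is the element of the graded center assigned to \<open>r\<close> of degree \<open>n\<close>.\<close>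

record ('o, 'm, 'r) lincat = "('o, 'm) tricat" +
  act :: "int \<Rightarrow> 'r \<Rightarrow> 'o \<Rightarrow> 'm"

text \<open>
  The product of \<open>\<alpha> : X \<rightarrow> \<Sigma>\<^sup>m Y\<close> and \<open>\<beta> : Y \<rightarrow> \<Sigma>\<^sup>n Z\<close> is \<open>\<Sigma>\<^sup>m(\<beta>) \<circ> \<alpha>\<close>, and the product
  in the graded center is chosen accordingly, so that evaluation at \<open>X\<close> is a ring homomorphism
  to \<open>End\<^sup>*(X)\<close>.
\<close>

locale linear_category =
  graded_commutative_ring R + triangulated_category T
  for R :: "('r, 'y) graded_ring_scheme" and T :: "('o, 'm, 'r, 'z) lincat_scheme" +
  assumes act_center: "\<And>n r. r \<in> grade R n \<Longrightarrow> act T n r \<in> graded_center T n"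
    and act_add: "\<And>n r s X. r \<in> grade R n \<Longrightarrow> s \<in> grade R n \<Longrightarrow> X \<in> Ob T \<Longrightarrow>
      act T n (r \<oplus>\<^bsub>R\<^esub> s) X = Add T (act T n r X) (act T n s X)"
    and act_mult: "\<And>m n r s X. r \<in> grade R n \<Longrightarrow> s \<in> grade R m \<Longrightarrow> X \<in> Ob T \<Longrightarrow>
      act T (n + m) (r \<otimes>\<^bsub>R\<^esub> s) X = Comp T (shiftM T m (act T n r X)) (act T m s X)"
    and act_one: "\<And>X. X \<in> Ob T \<Longrightarrow> act T 0 \<one>\<^bsub>R\<^esub> X = Idn T X"

definition graded_hom :: "('o, 'm, 'r, 'z) lincat_scheme \<Rightarrow> 'o \<Rightarrow> 'o \<Rightarrow> ('r, 'm) gmodule" where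
  "graded_hom T X Y = \<lparr>
     gcomp = (\<lambda>i. Hom T X (shift T i Y)),
     gzero = (\<lambda>i. Zer T X (shift T i Y)),
     gadd = (\<lambda>i. Add T),
     gsmult = (\<lambda>a i r f. Comp T (shiftM T i (act T a r Y)) f)\<rparr>"

definition noetherian_category ::
  "'k rel \<Rightarrow> ('r, 'y) graded_ring_scheme \<Rightarrow> ('o, 'm, 'r, 'z) lincat_scheme \<Rightarrow> bool" where
  "noetherian_category \<kappa> R T \<longleftrightarrow>
     (\<forall>C\<in>compact_objects \<kappa> T. finitely_generated_module R (graded_hom T C C))"


section \<open>Local cohomology, support and stratification\<close>

definition torsion_objects ::
  "'k rel \<Rightarrow> ('r, 'y) graded_ring_scheme \<Rightarrow> ('o, 'm, 'r, 'z) lincat_scheme \<Rightarrow> 'r set set \<Rightarrow> 'o set" where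
  "torsion_objects \<kappa> R T \<V> = {X \<in> Ob T. \<forall>C\<in>compact_objects \<kappa> T. \<forall>\<pp>\<in>Spec R - \<V>.
     localization_zero R (graded_hom T C X) \<pp>}"

text \<open>
  \<open>localization_pair \<kappa> R T \<V> X (G, L)\<close> means that there is an exact triangle
  \<open>G \<rightarrow> X \<rightarrow> L \<rightarrow> \<Sigma>G\<close> which qualifies as \<open>\<Gamma>\<^sub>\<V> X \<rightarrow> X \<rightarrow> L\<^sub>\<V> X \<rightarrow> \<Sigma>\<Gamma>\<^sub>\<V> X\<close>. Such a triangle is
  unique up to unique isomorphism, so one of them is chosen for each \<open>X\<close>; only the values
  of \<open>\<Gamma>\<^sub>\<V>\<close> and \<open>L\<^sub>\<V>\<close> on objects are needed.
\<close>

definition localization_pair ::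
  "'k rel \<Rightarrow> ('r, 'y) graded_ring_scheme \<Rightarrow> ('o, 'm, 'r, 'z) lincat_scheme \<Rightarrow> 'r set set \<Rightarrow> 'o \<Rightarrow>
     'o \<times> 'o \<Rightarrow> bool" where
  "localization_pair \<kappa> R T \<V> X = (\<lambda>(G, L). \<exists>f g h. (f, g, h) \<in> Tri T \<and>
     Dom T f = G \<and> Cod T f = X \<and> Cod T g = L \<and>
     G \<in> torsion_objects \<kappa> R T \<V> \<and>
     (\<forall>W\<in>torsion_objects \<kappa> R T \<V>. \<forall>e\<in>Hom T W L. e = Zer T W L))"

definition Gamma_V ::
  "'k rel \<Rightarrow> ('r, 'y) graded_ring_scheme \<Rightarrow> ('o, 'm, 'r, 'z) lincat_scheme \<Rightarrow> 'r set set \<Rightarrow> 'o \<Rightarrow> 'o" where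
  "Gamma_V \<kappa> R T \<V> X = fst (SOME P. localization_pair \<kappa> R T \<V> X P)"

definition L_V ::
  "'k rel \<Rightarrow> ('r, 'y) graded_ring_scheme \<Rightarrow> ('o, 'm, 'r, 'z) lincat_scheme \<Rightarrow> 'r set set \<Rightarrow> 'o \<Rightarrow> 'o" where
  "L_V \<kappa> R T \<V> X = snd (SOME P. localization_pair \<kappa> R T \<V> X P)"

definition Gamma_p ::
  "'k rel \<Rightarrow> ('r, 'y) graded_ring_scheme \<Rightarrow> ('o, 'm, 'r, 'z) lincat_scheme \<Rightarrow> 'r set \<Rightarrow> 'o \<Rightarrow> 'o" where
  "Gamma_p \<kappa> R T \<pp> X = Gamma_V \<kappa> R T (Vset R \<pp>) (L_V \<kappa> R T (Zset R \<pp>) X)"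

definition Gamma_p_image ::
  "'k rel \<Rightarrow> ('r, 'y) graded_ring_scheme \<Rightarrow> ('o, 'm, 'r, 'z) lincat_scheme \<Rightarrow> 'r set \<Rightarrow> 'o set" where
  "Gamma_p_image \<kappa> R T \<pp> = {Y \<in> Ob T. \<exists>X\<in>Ob T. isomorphic T (Gamma_p \<kappa> R T \<pp> X) Y}"

definition support ::
  "'k rel \<Rightarrow> ('r, 'y) graded_ring_scheme \<Rightarrow> ('o, 'm, 'r, 'z) lincat_scheme \<Rightarrow> 'o \<Rightarrow> 'r set set" where
  "support \<kappa> R T X = {\<pp> \<in> Spec R. \<not> zero_object T (Gamma_p \<kappa> R T \<pp> X)}"

definition support_class ::
  "'k rel \<Rightarrow> ('r, 'y) graded_ring_scheme \<Rightarrow> ('o, 'm, 'r, 'z) lincat_scheme \<Rightarrow> 'o set \<Rightarrow> 'r set set" where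
  "support_class \<kappa> R T S = (\<Union>X\<in>S. support \<kappa> R T X)"

definition local_global_principle ::
  "'k rel \<Rightarrow> ('r, 'y) graded_ring_scheme \<Rightarrow> ('o, 'm, 'r, 'z) lincat_scheme \<Rightarrow> bool" where
  "local_global_principle \<kappa> R T \<longleftrightarrow>
     (\<forall>X\<in>Ob T. Loc \<kappa> T {X} = Loc \<kappa> T {Gamma_p \<kappa> R T \<pp> X | \<pp>. \<pp> \<in> Spec R})"

definition stratified ::
  "'k rel \<Rightarrow> ('r, 'y) graded_ring_scheme \<Rightarrow> ('o, 'm, 'r, 'z) lincat_scheme \<Rightarrow> bool" where
  "stratified \<kappa> R T \<longleftrightarrow> local_global_principle \<kappa> R T \<and>
     (\<forall>\<pp>\<in>Spec R. zero_subcategory T (Gamma_p_image \<kappa> R T \<pp>) \<or>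
        minimal_localizing \<kappa> T (Gamma_p_image \<kappa> R T \<pp>))"

definition supported_on ::
  "'k rel \<Rightarrow> ('r, 'y) graded_ring_scheme \<Rightarrow> ('o, 'm, 'r, 'z) lincat_scheme \<Rightarrow> 'r set set \<Rightarrow> 'o set" where
  "supported_on \<kappa> R T \<U> = {X \<in> Ob T. support \<kappa> R T X \<subseteq> \<U>}"

end

theory Submission
  imports Defs "HOL-Algebra.Ring_Divisibility"
begin

text \<open>
  If \<open>supp X\<close> consists of primes \<open>\<pp>\<close> with \<open>V(\<pp>) \<inter> supp S
      = \<emptyset>\<close>, let \<open>W\<close> be the union of the sets \<open>V(\<pp>)\<close>.
  By the local-global principle \<open>X\<close> is \<open>W\<close>-torsion, and every \<open>Y\<close> in \<open>S\<close> is built from objects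
  \<open>\<Gamma>\<^sub>\<qq>Y\<close> with \<open>\<qq> \<notin> W\<close>, which are orthogonal to \<open>W\<close>-torsion objects; hence \<open>Hom(X, Y) = 0\<close>.

  Conversely, let \<open>\<pp> \<in> supp X\<close> and \<open>\<pp> \<subseteq> \<qq> \<in> supp S\<close>. By minimality \<open>\<Gamma>\<^sub>\<qq>T \<subseteq> S\<close>,
      and there is an element
  \<open>x\<close> of \<open>Hom(C, X)\<close>, \<open>C\<close> compact, which survives localization at \<open>\<qq>\<close>. One needs a morphism from
  \<open>X\<close> to an object of \<open>\<Gamma>\<^sub>\<qq>T\<close> which does not kill \<open>x\<close>. Brown representability and injective hulls
  over \<open>R\<close> would provide it. Instead, \<open>X \<rightarrow> J\<close> is constructed as a homotopy colimit which turns
  \<open>Hom(-, J)\<^sub>\<qq>\<close> into an essential extension of the functor generated by \<open>x\<close>, by repeatedly coning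
  off a maximal family of morphisms avoiding \<open>x\<close>. As \<open>End\<^sup>*(C)\<close> is a noetherian \<open>R\<close>-module, \<open>\<qq>\<close>
      annihilates
  \<open>x\<close> in \<open>J\<close>, and essentiality makes \<open>J\<close> both \<open>\<qq>\<close>-local and \<open>\<qq>\<close>-torsion.
\<close>

section \<open>Small sets\<close>

text \<open>The families that are coned off avoid every \<open>s x\<close> with \<open>s\<close>
  outside \<qq>, not only \<open>x\<close>. This makes the functor generated by \<open>x\<close>
  simple after localization at \<qq>: each nonzero multiple of \<open>x\<close> has some such
  \<open>s x\<close> as a multiple. Commutative algebra suggests that \<qq> kills a simple object,
  since \<qq> acts through the radical of a finite algebra over the local ring; as End^*(C) is
  noncommutative and no localized category is formed, integral dependence takes the place of this
  argument. Coning off creates new morphisms into the cone about which the step says nothing, hence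
  the iteration: compact objects see only images of finite stages of the homotopy colimit. The
  hypothesis on End^*(C \<oplus> D) bounds chains in Hom^*(C, D), and this makes all of J torsion,
  not only \<open>x\<close>. The functors \<Gamma> and L are fixed by a choice operator, so the
  existence of their triangles is proved first; the same kind of iteration serves. Only morphisms
  from a small set of compact objects are coned off, since neither all compact objects nor all
  morphisms between two objects need form a small set.\<close>

lemma small_mono: "small \<kappa> B \<Longrightarrow> A \<subseteq> B \<Longrightarrow> small \<kappa> A"
  unfolding small_def by (rule ordLeq_ordLess_trans[OF card_of_mono1])

lemma small_image: "small \<kappa> A \<Longrightarrow> small \<kappa> (f ` A)"
  unfolding small_def by (rule ordLeq_ordLess_trans[OF card_of_image])

lemma size_bound_Cinfinite:
  assumes "size_bound \<kappa>" shows "Cinfinite \<kappa>"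
proof -
  have c: "Card_order \<kappa>" "natLeq <o \<kappa>" using assms by (auto simp: size_bound_def)
  have "natLeq \<le>o |Field \<kappa>|"
    using c(2) card_of_Field_ordIso[OF c(1)] ordLess_imp_ordLeq ordIso_symmetric ordLeq_ordIso_trans
    by blast
  then have "infinite (Field \<kappa>)" using infinite_iff_natLeq_ordLeq by blast
  then show ?thesis using c(1) by (auto simp: cinfinite_def)
qed


lemma small_nat: 
  assumes "size_bound \<kappa>" shows "small \<kappa> (A :: nat set)"
proof -
  have "|UNIV :: nat set| =o natLeq" by (rule card_of_nat)
  then have "small \<kappa> (UNIV :: nat set)"
    using assms unfolding small_def size_bound_def using ordIso_ordLess_trans by blast
  then show ?thesis by (rule small_mono) simp
qed

text \<open>This is the use of regularity of \<kappa>. Finite unions are covered by infinity of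
  \<kappa> alone, but products, countable closures and sets of morphisms go through this
  bound.\<close>

lemma small_UNION:
  assumes "size_bound \<kappa>" and "small \<kappa> I" and "\<And>i. i \<in> I \<Longrightarrow> small \<kappa> (A i)"
  shows "small \<kappa> (\<Union>i\<in>I. A i)"
  using card_of_UNION_ordLess_infinite_Field_regularCard[of \<kappa> I A] assms size_bound_Cinfinite
  unfolding small_def size_bound_def by blast

lemma small_Un:
  assumes "size_bound \<kappa>" and "small \<kappa> A" and "small \<kappa> B"
  shows "small \<kappa> (A \<union> B)"
  using card_of_Un_ordLess_infinite_Field[of \<kappa> A B] assms size_bound_Cinfinite[OF assms(1)]
  unfolding small_def cinfinite_def by blast

lemma small_Times:
  assumes "size_bound \<kappa>" and "small \<kappa> A" and "small \<kappa> B"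
  shows "small \<kappa> (A \<times> B)"
proof -
  have "A \<times> B = (\<Union>a\<in>A. Pair a ` B)" by auto
  then show ?thesis using small_UNION[OF assms(1,2)] small_image[OF assms(3)] by metis
qed

lemma small_int: 
  assumes "size_bound \<kappa>" shows "small \<kappa> (A :: int set)"
proof -
  have "A \<subseteq> (\<lambda>(m, n). int m - int n) ` (UNIV \<times> UNIV)"
    using int_diff_cases by (auto simp: image_def) metis
  then show ?thesis using small_mono small_image small_Times[OF assms small_nat[OF assms]
      small_nat[OF assms]] by blast
qed

text \<open>Coproducts and compactness are specified only for index sets inside
  \<open>Field \<kappa>\<close>. Transport along this bijection allows sets of morphisms and the set
  of natural numbers as index sets.\<close>

lemma small_indexE:
  assumes "size_bound \<kappa>" and "small \<kappa> A"
  obtains e I where "small_index \<kappa> I" and "bij_betw e A I"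
proof -
  have c: "Card_order \<kappa>" using assms by (auto simp: size_bound_def)
  have "|A| \<le>o |Field \<kappa>|"
    using assms(2) card_of_Field_ordIso[OF c] ordLess_imp_ordLeq ordIso_symmetric
        ordLeq_ordIso_trans
    unfolding small_def by blast
  then obtain e where e: "inj_on e A" "e ` A \<subseteq> Field \<kappa>" by (auto simp: card_of_ordLeq[symmetric])
  show ?thesis
    by (rule that[of "e ` A" e]) (use e small_image[OF assms(2)] in \<open>auto simp: small_index_def
        bij_betw_def\<close>)
qed

section \<open>Coproducts over arbitrary small index sets\<close>

lemma is_coproduct_reindex:
  assumes "bij_betw e A I" and "is_coproduct T I (\<lambda>i. X (inv_into A e i)) P \<iota>"
  shows "is_coproduct T A X P (\<lambda>a. \<iota> (e a))"
proof -
  have inv: "\<And>a. a \<in> A \<Longrightarrow> inv_into A e (e a) = a"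
    using assms(1) by (simp add: bij_betw_inv_into_left)
  have I: "I = e ` A" using assms(1) by (simp add: bij_betw_def)
  show ?thesis
    unfolding is_coproduct_def
  proof (intro conjI ballI allI impI)
    show "P \<in> Ob T" using assms(2) by (simp add: is_coproduct_def)
    fix a assume "a \<in> A"
    then have "e a \<in> I" by (simp add: I)
    then show "X a \<in> Ob T" "\<iota> (e a) \<in> Hom T (X a) P"
      using assms(2) inv[OF \<open>a \<in> A\<close>] by (auto simp: is_coproduct_def)
  next
    fix Y g assume Y: "Y \<in> Ob T" and g: "\<forall>i\<in>A. g i \<in> Hom T (X i) Y"
    have "\<forall>i\<in>I. g (inv_into A e i) \<in> Hom T (X (inv_into A e i)) Y"
      using g inv by (auto simp: I)
    then have "\<exists>!h. h \<in> Hom T P Y \<and> (\<forall>i\<in>I. Comp T h (\<iota> i) = g (inv_into A e i))"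
      using assms(2) Y unfolding is_coproduct_def by (elim conjE allE[of _ "\<lambda>i. g (inv_into A e
          i)"]) auto
    moreover have "(\<forall>i\<in>I. Comp T h (\<iota> i) = g (inv_into A e i))
        \<longleftrightarrow> (\<forall>a\<in>A. Comp T h (\<iota> (e a)) = g a)" for h
      using inv by (auto simp: I)
    ultimately show "\<exists>!h. h \<in> Hom T P Y \<and> (\<forall>a\<in>A. Comp T h (\<iota> (e a)) = g a)" by simp
  qed
qed

lemma has_coproductsE:
  assumes "has_coproducts \<kappa> T" and "size_bound \<kappa>" and "small \<kappa> A" and "\<And>a. a \<in> A \<Longrightarrow> X a \<in> Ob T"
  obtains P \<iota> where "is_coproduct T A X P \<iota>"
proof -
  obtain e I where e: "small_index \<kappa> I" "bij_betw e A I" by (rule small_indexE[OF assms(2,3)])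
  have "\<forall>i\<in>I. X (inv_into A e i) \<in> Ob T"
    using e(2) assms(4) by (metis bij_betw_imp_surj_on inv_into_into)
  then obtain P \<iota> where "is_coproduct T I (\<lambda>i. X (inv_into A e i)) P \<iota>"
    using assms(1) e(1) unfolding has_coproducts_def
        by (elim allE[of _ I] allE[of _ "\<lambda>i. X (inv_into A e i)"]) blast
  from is_coproduct_reindex[OF e(2) this] show ?thesis by (rule that)
qed

lemma is_coproduct_reindex_back:
  assumes "bij_betw e A I" and "is_coproduct T A X P \<iota>"
  shows "is_coproduct T I (\<lambda>i. X (inv_into A e i)) P (\<lambda>i. \<iota> (inv_into A e i))"
proof -
  have b: "bij_betw (inv_into A e) I A" using assms(1) by (rule bij_betw_inv_into)
  have r: "inv_into I (inv_into A e) a = e a" if "a \<in> A" for a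
    using that assms(1) by (rule inv_into_inv_into_eq[rotated])
  have "is_coproduct T A (\<lambda>i. X (inv_into A e (inv_into I (inv_into A e) i))) P \<iota>"
    using assms(2) r assms(1) unfolding is_coproduct_def
    by (simp add: bij_betw_inv_into_left cong: ball_cong)
  from is_coproduct_reindex[OF b this] show ?thesis .
qed

section \<open>Additive categories\<close>

context category
begin

abbreviation compose (infixl "\<cdot>" 70) where "g \<cdot> f \<equiv> Comp T g f"

lemma hom_ob: assumes "f \<in> Hom T X Y" shows "X \<in> Ob T" "Y \<in> Ob T"
  using dom_cod assms by (auto simp: Hom_def)

lemma hom_mor: "f \<in> Hom T X Y \<Longrightarrow> f \<in> Mor T" by (simp add: Hom_def)

lemma hom_dom_cod: assumes "f \<in> Hom T X Y" shows "Dom T f = X" "Cod T f = Y"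
  using assms by (auto simp: Hom_def)

lemma mor_hom: "f \<in> Mor T \<Longrightarrow> f \<in> Hom T (Dom T f) (Cod T f)" by (simp add: Hom_def)

lemma comp_idn_right: "f \<in> Hom T X Y \<Longrightarrow> f \<cdot> Idn T X = f"
  and comp_idn_left: "f \<in> Hom T X Y \<Longrightarrow> Idn T Y \<cdot> f = f"
  using comp_idn by auto

lemma comp_mor: "f \<in> Mor T \<Longrightarrow> g \<in> Mor T \<Longrightarrow> Cod T f = Dom T g \<Longrightarrow> g \<cdot> f \<in> Mor T"
  and dom_comp: "f \<in> Mor T \<Longrightarrow> g \<in> Mor T \<Longrightarrow> Cod T f = Dom T g \<Longrightarrow> Dom T (g \<cdot> f) = Dom T f"
  and cod_comp: "f \<in> Mor T \<Longrightarrow> g \<in> Mor T \<Longrightarrow> Cod T f = Dom T g \<Longrightarrow> Cod T (g \<cdot> f) = Cod T g"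
  using comp[of f "Dom T f" "Cod T f" g "Cod T g"] by (auto simp: Hom_def)

lemma assoc: "f \<in> Mor T \<Longrightarrow> g \<in> Mor T \<Longrightarrow> h \<in> Mor T \<Longrightarrow> Cod T f = Dom T g \<Longrightarrow> Cod T g = Dom T h \<Longrightarrow>
    (h \<cdot> g) \<cdot> f = h \<cdot> (g \<cdot> f)"
  by (rule comp_assoc[symmetric]) (auto simp: Hom_def)

lemma idn_left: "f \<in> Mor T \<Longrightarrow> Cod T f = Y \<Longrightarrow> Idn T Y \<cdot> f = f"
  and idn_right: "f \<in> Mor T \<Longrightarrow> Dom T f = X \<Longrightarrow> f \<cdot> Idn T X = f"
  using comp_idn mor_hom by blast+

lemma idn_mor: "X \<in> Ob T \<Longrightarrow> Idn T X \<in> Mor T"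
  and dom_idn: "X \<in> Ob T \<Longrightarrow> Dom T (Idn T X) = X"
  and cod_idn: "X \<in> Ob T \<Longrightarrow> Cod T (Idn T X) = X"
  using idn by (auto simp: Hom_def)

lemmas cat = comp_mor dom_comp cod_comp assoc idn_left idn_right idn_mor dom_idn cod_idn

lemma assoc4:
  assumes "f \<in> Hom T W X" "g \<in> Hom T X Y" "h \<in> Hom T Y Z" "k \<in> Hom T Z V"
  shows "(k \<cdot> h) \<cdot> (g \<cdot> f) = k \<cdot> ((h \<cdot> g) \<cdot> f)"
  using assms by (simp add: Hom_def cat)

lemma is_isoI:
  assumes "f \<in> Hom T X Y" "g \<in> Hom T Y X" "g \<cdot> f = Idn T X" "f \<cdot> g = Idn T Y"
  shows "is_iso T f"
  using assms unfolding is_iso_def by (auto simp: Hom_def)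

lemma is_isoE:
  assumes "is_iso T f" "f \<in> Hom T X Y"
  obtains g where "g \<in> Hom T Y X" "g \<cdot> f = Idn T X" "f \<cdot> g = Idn T Y"
  using assms unfolding is_iso_def by (auto simp: Hom_def)

lemma is_iso_idn: "X \<in> Ob T \<Longrightarrow> is_iso T (Idn T X)"
  using is_isoI[OF idn idn] comp_idn_left idn by metis

lemma isomorphicI: "f \<in> Hom T X Y \<Longrightarrow> is_iso T f \<Longrightarrow> isomorphic T X Y"
  unfolding isomorphic_def by blast

lemma isomorphic_sym: "isomorphic T X Y \<Longrightarrow> isomorphic T Y X"
  unfolding isomorphic_def by (metis is_isoE is_isoI)

lemma isomorphic_trans:
  assumes "isomorphic T X Y" "isomorphic T Y Z" shows "isomorphic T X Z"
proof -
  obtain f where f: "f \<in> Hom T X Y" "is_iso T f" using assms(1) by (auto simp: isomorphic_def)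
  obtain g where g: "g \<in> Hom T Y Z" "is_iso T g" using assms(2) by (auto simp: isomorphic_def)
  obtain f' where f': "f' \<in> Hom T Y X" "f' \<cdot> f = Idn T X"
      "f \<cdot> f' = Idn T Y" by (rule is_isoE[OF f(2,1)])
  obtain g' where g': "g' \<in> Hom T Z Y" "g' \<cdot> g = Idn T Y"
      "g \<cdot> g' = Idn T Z" by (rule is_isoE[OF g(2,1)])
  have "(f' \<cdot> g') \<cdot> (g \<cdot> f) = f' \<cdot> ((g' \<cdot> g) \<cdot> f)"
    using f f' g g' by (intro assoc4) auto
  then have 1: "(f' \<cdot> g') \<cdot> (g \<cdot> f) = Idn T X" using f f' g' by (simp add: comp_idn_left[OF f(1)])
  have "(g \<cdot> f) \<cdot> (f' \<cdot> g') = g \<cdot> ((f \<cdot> f') \<cdot> g')"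
    using f f' g g' by (intro assoc4) auto
  then have 2: "(g \<cdot> f) \<cdot> (f' \<cdot> g') = Idn T Z" using f' g' by (simp add: comp_idn_left[OF g'(1)])
  show ?thesis
    using is_isoI[OF comp[OF f(1) g(1)] comp[OF g'(1) f'(1)] 1 2] comp[OF f(1) g(1)]
    by (rule isomorphicI[rotated])
qed

end

section \<open>Morphism groups and zero objects\<close>

context additive_category
begin

lemma zer_in: "X \<in> Ob T \<Longrightarrow> Y \<in> Ob T \<Longrightarrow> Zer T X Y \<in> Hom T X Y"
  using monoid.one_closed[OF group.is_monoid[OF comm_group.axioms(2)[OF hom_comm_group[of X Y]]]]
      by (simp add: hom_group_def)

lemma group_hom_group: "f \<in> Hom T X Y \<Longrightarrow> comm_group (hom_group T X Y)"
  using hom_comm_group hom_ob by blast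

lemma add_in: "f \<in> Hom T X Y \<Longrightarrow> g \<in> Hom T X Y \<Longrightarrow> Add T f g \<in> Hom T X Y"
  using monoid.m_closed[OF group.is_monoid[OF comm_group.axioms(2)[OF group_hom_group[of f X Y]]],
      of f g]
  by (simp add: hom_group_def)

lemma add_zer: "f \<in> Hom T X Y \<Longrightarrow> Add T f (Zer T X Y) = f"
  using monoid.r_one[OF group.is_monoid[OF comm_group.axioms(2)[OF group_hom_group[of f X Y]]], of
      f]
  by (simp add: hom_group_def)

lemma zer_add: "f \<in> Hom T X Y \<Longrightarrow> Add T (Zer T X Y) f = f"
  using monoid.l_one[OF group.is_monoid[OF comm_group.axioms(2)[OF group_hom_group[of f X Y]]], of
      f]
  by (simp add: hom_group_def)

lemma add_assoc: "f \<in> Hom T X Y \<Longrightarrow> g \<in> Hom T X Y \<Longrightarrow> h \<in> Hom T X Y \<Longrightarrow>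
    Add T (Add T f g) h = Add T f (Add T g h)"
  using monoid.m_assoc[OF group.is_monoid[OF comm_group.axioms(2)[OF group_hom_group[of f X Y]]], of
      f g h]
  by (simp add: hom_group_def)

lemma add_commute: "f \<in> Hom T X Y \<Longrightarrow> g \<in> Hom T X Y \<Longrightarrow> Add T f g = Add T g f"
  using comm_monoid.m_comm[OF comm_group.axioms(1)[OF group_hom_group[of f X Y]], of f g]
  by (simp add: hom_group_def)

lemma neg_in: "f \<in> Hom T X Y \<Longrightarrow> Neg T f \<in> Hom T X Y"
  using group.inv_closed[OF comm_group.axioms(2)[OF group_hom_group[of f X Y]], of f]
  by (simp add: hom_group_def Neg_def hom_dom_cod)

lemma add_neg: "f \<in> Hom T X Y \<Longrightarrow> Add T f (Neg T f) = Zer T X Y"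
  using group.r_inv[OF comm_group.axioms(2)[OF group_hom_group[of f X Y]], of f]
  by (simp add: hom_group_def Neg_def hom_dom_cod)

lemma neg_add: "f \<in> Hom T X Y \<Longrightarrow> Add T (Neg T f) f = Zer T X Y"
  using add_commute add_neg neg_in by metis

lemma add_cancel:
  assumes "f \<in> Hom T X Y" "g \<in> Hom T X Y" "h \<in> Hom T X Y" "Add T f h = Add T g h"
  shows "f = g"
proof -
  have "Add T (Add T f h) (Neg T h) = f"
    using add_assoc[OF assms(1,3) neg_in[OF assms(3)]] add_neg[OF assms(3)] add_zer[OF assms(1)]
        by simp
  moreover have "Add T (Add T g h) (Neg T h) = g"
    using add_assoc[OF assms(2,3) neg_in[OF assms(3)]] add_neg[OF assms(3)] add_zer[OF assms(2)]
        by simp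
  ultimately show ?thesis using assms(4) by metis
qed

lemma neg_unique: "f \<in> Hom T X Y \<Longrightarrow> g \<in> Hom T X Y \<Longrightarrow> Add T f g = Zer T X Y \<Longrightarrow> f = Neg T g"
  by (rule add_cancel[of f X Y "Neg T g" g]) (simp_all add: neg_add neg_in)

lemma neg_neg: "f \<in> Hom T X Y \<Longrightarrow> Neg T (Neg T f) = f"
  by (rule neg_unique[symmetric]) (auto intro: add_neg neg_in)

lemma neg_zer: "X \<in> Ob T \<Longrightarrow> Y \<in> Ob T \<Longrightarrow> Neg T (Zer T X Y) = Zer T X Y"
  by (rule neg_unique[symmetric]) (auto intro: add_zer zer_in)

lemma diff_zer_eq: "f \<in> Hom T X Y \<Longrightarrow> g \<in> Hom T X Y \<Longrightarrow> Add T f (Neg T g) = Zer T X Y \<Longrightarrow> f = g"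
  using neg_unique[OF _ neg_in] neg_neg by metis

lemma neg_eq_zer: "f \<in> Hom T X Y \<Longrightarrow> Neg T f = Zer T X Y \<longleftrightarrow> f = Zer T X Y"
  using neg_neg[of f X Y] neg_zer[OF hom_ob[of f X Y]] by auto

lemma comp_zer_right:
  assumes "g \<in> Hom T Y Z" "X \<in> Ob T" shows "g \<cdot> Zer T X Y = Zer T X Z"
proof -
  have z: "Zer T X Y \<in> Hom T X Y" using assms zer_in hom_ob by blast
  have "Add T (g \<cdot> Zer T X Y) (g \<cdot> Zer T X Y) = g \<cdot> Zer T X Y"
    using comp_add_right[OF z z assms(1)] add_zer[OF z] by simp
  then show ?thesis
    using add_cancel[OF comp[OF z assms(1)] zer_in comp[OF z assms(1)]] zer_add[OF comp[OF z
        assms(1)]] assms hom_ob(2)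
    by simp
qed

lemma comp_zer_left:
  assumes "f \<in> Hom T X Y" "Z \<in> Ob T" shows "Zer T Y Z \<cdot> f = Zer T X Z"
proof -
  have z: "Zer T Y Z \<in> Hom T Y Z" using assms zer_in hom_ob by blast
  have "Add T (Zer T Y Z \<cdot> f) (Zer T Y Z \<cdot> f) = Zer T Y Z \<cdot> f"
    using comp_add_left[OF assms(1) z z] add_zer[OF z] by simp
  then show ?thesis
    using add_cancel[OF comp[OF assms(1) z] zer_in comp[OF assms(1) z]] zer_add[OF comp[OF assms(1)
        z]] assms hom_ob(1)
    by simp
qed

lemma comp_neg_right:
  assumes "f \<in> Hom T X Y" "g \<in> Hom T Y Z" shows "g \<cdot> Neg T f = Neg T (g \<cdot> f)"
proof (rule neg_unique)
  show "Add T (g \<cdot> Neg T f) (g \<cdot> f) = Zer T X Z"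
    using comp_add_right[OF neg_in[OF assms(1)] assms] neg_add[OF assms(1)] comp_zer_right[OF
        assms(2)]
      hom_ob[OF assms(1)] by simp
qed (use assms comp neg_in in blast)+

lemma comp_neg_left:
  assumes "f \<in> Hom T X Y" "g \<in> Hom T Y Z" shows "Neg T g \<cdot> f = Neg T (g \<cdot> f)"
proof (rule neg_unique)
  show "Add T (Neg T g \<cdot> f) (g \<cdot> f) = Zer T X Z"
    using comp_add_left[OF assms(1) neg_in[OF assms(2)] assms(2)] neg_add[OF assms(2)]
        comp_zer_left[OF assms(1)]
      hom_ob[OF assms(2)] by simp
qed (use assms comp neg_in in blast)+

lemma zero_object_iff: "zero_object T X \<longleftrightarrow> X \<in> Ob T \<and> Idn T X = Zer T X X"
proof
  assume "zero_object T X"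
  then show "X \<in> Ob T \<and> Idn T X = Zer T X X"
    unfolding zero_object_def using idn zer_in by blast
next
  assume X: "X \<in> Ob T \<and> Idn T X = Zer T X X"
  show "zero_object T X"
    unfolding zero_object_def
  proof (intro conjI ballI)
    fix Y assume Y: "Y \<in> Ob T"
    have "f = Zer T X Y" if "f \<in> Hom T X Y" for f
      using X comp_idn_right[OF that] comp_zer_right[OF that, of X] by simp
    then show "\<exists>!f. f \<in> Hom T X Y" using zer_in X Y by blast
    have "f = Zer T Y X" if "f \<in> Hom T Y X" for f
      using X comp_idn_left[OF that] comp_zer_left[OF that, of X] by simp
    then show "\<exists>!f. f \<in> Hom T Y X" using zer_in X Y by blast
  qed (use X in simp)
qed

lemma zero_object_hom_from: "zero_object T X \<Longrightarrow> f \<in> Hom T X Y \<Longrightarrow> f = Zer T X Y"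
  unfolding zero_object_def by (metis hom_ob(1,2) zer_in)

lemma zero_object_hom_to: "zero_object T X \<Longrightarrow> f \<in> Hom T Y X \<Longrightarrow> f = Zer T Y X"
  unfolding zero_object_def by (metis hom_ob(1,2) zer_in)

lemma zero_object_ob: "zero_object T X \<Longrightarrow> X \<in> Ob T"
  unfolding zero_object_def by simp

lemma is_coproduct_eqI:
  assumes "is_coproduct T I X P \<iota>" "f \<in> Hom T P Y" "g \<in> Hom T P Y" "\<And>i. i \<in> I \<Longrightarrow> f \<cdot> \<iota> i = g \<cdot> \<iota> i"
  shows "f = g"
proof -
  have "\<forall>i\<in>I. g \<cdot> \<iota> i \<in> Hom T (X i) Y" using assms(1,3) comp unfolding is_coproduct_def by blast
  then have "\<exists>!h. h \<in> Hom T P Y \<and> (\<forall>i\<in>I. h \<cdot> \<iota> i = g \<cdot> \<iota> i)"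
    using assms(1) hom_ob(2)[OF assms(2)] unfolding is_coproduct_def
        by (elim conjE ballE[of _ _ Y] allE[of _ "\<lambda>i. g \<cdot> \<iota> i"]) auto
  then show ?thesis using assms(2-4) by blast
qed

lemma is_coproductE:
  assumes "is_coproduct T I X P \<iota>" "Y \<in> Ob T" "\<And>i. i \<in> I \<Longrightarrow> g i \<in> Hom T (X i) Y"
  obtains h where "h \<in> Hom T P Y" "\<And>i. i \<in> I \<Longrightarrow> h \<cdot> \<iota> i = g i"
proof -
  have "\<exists>!h. h \<in> Hom T P Y \<and> (\<forall>i\<in>I. h \<cdot> \<iota> i = g i)"
    using assms unfolding is_coproduct_def by (elim conjE ballE[of _ _ Y] allE[of _ "g"]) auto
  then show ?thesis using that by blast
qed

lemma is_coproduct_inj: "is_coproduct T I X P \<iota> \<Longrightarrow> i \<in> I \<Longrightarrow> \<iota> i \<in> Hom T (X i) P"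
  and is_coproduct_ob: "is_coproduct T I X P \<iota> \<Longrightarrow> P \<in> Ob T"
  and is_coproduct_summand: "is_coproduct T I X P \<iota> \<Longrightarrow> i \<in> I \<Longrightarrow> X i \<in> Ob T"
  unfolding is_coproduct_def by auto

end

section \<open>Powers of the suspension\<close>

context triangulated_category
begin

abbreviation Sh where "Sh \<equiv> shift T"
abbreviation Sm where "Sm \<equiv> shiftM T"

lemma sus_in: "X \<in> Ob T \<Longrightarrow> Sus T X \<in> Ob T"
  using sus_ob by (meson bij_betwE)

lemma sus_inv_ob: assumes "X \<in> Ob T"
  shows "inv_into (Ob T) (Sus T) X \<in> Ob T" "Sus T (inv_into (Ob T) (Sus T) X) = X"
    "inv_into (Ob T) (Sus T) (Sus T X) = X"
  using assms sus_ob by (auto simp: bij_betw_def inv_into_into f_inv_into_f)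

lemma sus_inv_mor: assumes "f \<in> Mor T"
  shows "inv_into (Mor T) (SusM T) f \<in> Mor T" "SusM T (inv_into (Mor T) (SusM T) f) = f"
    "inv_into (Mor T) (SusM T) (SusM T f) = f"
  using assms sus_mor by (auto simp: bij_betw_def inv_into_into f_inv_into_f)

lemma sus_inv_hom:
  assumes "f \<in> Hom T X Y"
  shows "inv_into (Mor T) (SusM T) f \<in> Hom T (inv_into (Ob T) (Sus T) X) (inv_into (Ob T) (Sus T)
      Y)"
proof -
  let ?g = "inv_into (Mor T) (SusM T) f"
  have g: "?g \<in> Mor T" "SusM T ?g = f" using sus_inv_mor hom_mor[OF assms] by auto
  have "f \<in> Hom T (Sus T (Dom T ?g)) (Sus T (Cod T ?g))"
    using sus_hom[OF mor_hom[OF g(1)]] g(2) by simp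
  then have "X = Sus T (Dom T ?g)" "Y = Sus T (Cod T ?g)"
    using assms by (auto simp: Hom_def)
  then show ?thesis using mor_hom[OF g(1)] sus_inv_ob(3) dom_cod[OF g(1)] by simp
qed

lemma funpow_sus_in: "X \<in> Ob T \<Longrightarrow> (Sus T ^^ n) X \<in> Ob T"
  and funpow_inv_in: "X \<in> Ob T \<Longrightarrow> (inv_into (Ob T) (Sus T) ^^ n) X \<in> Ob T"
  by (induction n) (auto simp: sus_in sus_inv_ob)

lemma funpow_sus_hom: "f \<in> Hom T X Y \<Longrightarrow> (SusM T ^^ n) f \<in> Hom T ((Sus T ^^ n) X) ((Sus T ^^ n) Y)"
  and funpow_inv_hom: "f \<in> Hom T X Y \<Longrightarrow> (inv_into (Mor T) (SusM T) ^^ n) f \<in>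
    Hom T ((inv_into (Ob T) (Sus T) ^^ n) X) ((inv_into (Ob T) (Sus T) ^^ n) Y)"
  by (induction n) (auto simp: sus_hom sus_inv_hom)

lemma sh_in: "X \<in> Ob T \<Longrightarrow> Sh n X \<in> Ob T"
  by (simp add: shift_def funpow_sus_in funpow_inv_in)

lemma sm_in: "f \<in> Hom T X Y \<Longrightarrow> Sm n f \<in> Hom T (Sh n X) (Sh n Y)"
  by (simp add: shift_def shiftM_def funpow_sus_hom funpow_inv_hom)

lemma sh_0: "Sh 0 X = X" and sm_0: "Sm 0 f = f"
  by (simp_all add: shift_def shiftM_def)

lemma sh_1: "Sh 1 X = Sus T X" and sm_1: "Sm 1 f = SusM T f"
  by (simp_all add: shift_def shiftM_def)

lemma sh_Suc: assumes "X \<in> Ob T" shows "Sh (n + 1) X = Sus T (Sh n X)"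
proof (cases "0 \<le> n")
  case True
  then show ?thesis by (simp add: shift_def nat_add_distrib)
next
  case False
  define m where "m = nat (- (n + 1))"
  have m: "nat (- n) = Suc m" "nat (- (n + 1)) = m" using False by (simp_all add: m_def)
  have "Sh n X = inv_into (Ob T) (Sus T) ((inv_into (Ob T) (Sus T) ^^ m) X)"
    using False m by (simp add: shift_def)
  moreover have "Sh (n + 1) X = (inv_into (Ob T) (Sus T) ^^ m) X"
    using False m by (auto simp: shift_def)
  ultimately show ?thesis using funpow_inv_in[OF assms] sus_inv_ob(2) by simp
qed

lemma sm_Suc: assumes "f \<in> Mor T" shows "Sm (n + 1) f = SusM T (Sm n f)"
proof (cases "0 \<le> n")
  case True
  then show ?thesis by (simp add: shiftM_def nat_add_distrib)
next
  case False
  define m where "m = nat (- (n + 1))"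
  have m: "nat (- n) = Suc m" using False by (simp add: m_def)
  have i: "(inv_into (Mor T) (SusM T) ^^ k) f \<in> Mor T" for k
    by (induction k) (auto simp: assms sus_inv_mor)
  have "Sm n f = inv_into (Mor T) (SusM T) ((inv_into (Mor T) (SusM T) ^^ m) f)"
    using False m by (simp add: shiftM_def)
  moreover have "Sm (n + 1) f = (inv_into (Mor T) (SusM T) ^^ m) f"
    using False by (auto simp: shiftM_def m_def)
  ultimately show ?thesis using i sus_inv_mor(2) by simp
qed

lemma sh_sh: assumes "X \<in> Ob T" shows "Sh m (Sh n X) = Sh (m + n) X"
proof (induction m rule: int_induct[where k = 0])
  case base then show ?case by (simp add: sh_0)
next
  case (step1 i)
  then show ?case using sh_Suc[OF sh_in[OF assms], of i] sh_Suc[OF assms, of "i + n"]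
      by (simp add: ac_simps)
next
  case (step2 i)
  have "Sus T (Sh (i - 1) (Sh n X)) = Sus T (Sh (i - 1 + n) X)"
    using step2 sh_Suc[OF sh_in[OF assms], of "i - 1"] sh_Suc[OF assms, of "i - 1 + n"]
        by (simp add: ac_simps)
  then show ?case using sus_inv_ob(3) sh_in[OF assms] sh_in[OF sh_in[OF assms]] by metis
qed

lemma sm_mor: "f \<in> Mor T \<Longrightarrow> Sm n f \<in> Mor T"
  using sm_in mor_hom hom_mor by blast

lemma sm_sm: assumes "f \<in> Mor T" shows "Sm m (Sm n f) = Sm (m + n) f"
proof (induction m rule: int_induct[where k = 0])
  case base then show ?case by (simp add: sm_0)
next
  case (step1 i)
  then show ?case using sm_Suc[OF sm_mor[OF assms], of i] sm_Suc[OF assms, of "i + n"]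
      by (simp add: ac_simps)
next
  case (step2 i)
  have "SusM T (Sm (i - 1) (Sm n f)) = SusM T (Sm (i - 1 + n) f)"
    using step2 sm_Suc[OF sm_mor[OF assms], of "i - 1"] sm_Suc[OF assms, of "i - 1 + n"]
        by (simp add: ac_simps)
  then show ?case using sus_inv_mor(3) sm_mor[OF assms] sm_mor[OF sm_mor[OF assms]] by metis
qed

lemma susM_inject: "f \<in> Mor T \<Longrightarrow> g \<in> Mor T \<Longrightarrow> SusM T f = SusM T g \<Longrightarrow> f = g"
  using sus_inv_mor(3) by metis

lemma sm_comp:
  assumes "f \<in> Hom T X Y" "g \<in> Hom T Y Z" shows "Sm n (g \<cdot> f) = Sm n g \<cdot> Sm n f"
proof -
  have m: "f \<in> Mor T" "g \<in> Mor T" "g \<cdot> f \<in> Mor T" using assms comp hom_mor by blast+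
  show ?thesis
  proof (induction n rule: int_induct[where k = 0])
    case base then show ?case by (simp add: sm_0)
  next
    case (step1 i)
    then show ?case using sus_comp[OF sm_in[OF assms(1)] sm_in[OF assms(2)], of i] m
        by (simp add: sm_Suc)
  next
    case (step2 i)
    have e: "SusM T (Sm (i - 1) f) = Sm i f" if "f \<in> Mor T" for f
      using sm_Suc[OF that, of "i - 1"] by simp
    have "SusM T (Sm (i - 1) (g \<cdot> f)) = SusM T (Sm (i - 1) g \<cdot> Sm (i - 1) f)"
      using step2 sus_comp[OF sm_in[OF assms(1)] sm_in[OF assms(2)], of "i - 1"] m e by simp
    then show ?case
      using susM_inject sm_mor[OF m(3)] comp[OF sm_in[OF assms(1)] sm_in[OF assms(2)]] hom_mor
          by metis
  qed
qed

lemma sm_idn: assumes "X \<in> Ob T" shows "Sm n (Idn T X) = Idn T (Sh n X)"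
proof -
  let ?e = "Sm n (Idn T X)"
  have e: "?e \<in> Hom T (Sh n X) (Sh n X)" using sm_in[OF idn[OF assms]] .
  \<comment> \<open>\<open>?g\<close> is the preimage of the identity under \<open>Sm n\<close>.
    Applying \<open>Sm n\<close> to \<open>Idn T X \<cdot> ?g = ?g\<close> shows that
    \<open>?e\<close> composed with an identity is that identity.\<close>
  let ?g = "Sm (- n) (Idn T (Sh n X))"
  have g: "?g \<in> Hom T X X"
    using sm_in[OF idn[OF sh_in[OF assms, of n]], of "- n"] sh_sh[OF assms, of "-n" n]
        by (simp add: sh_0)
  have "Sm n ?g = Idn T (Sh n X)"
    using sm_sm[OF hom_mor[OF idn[OF sh_in[OF assms]]]] by (simp add: sm_0)
  then show ?thesis
    using sm_comp[OF g idn[OF assms], of n] comp_idn_left[OF g] comp_idn_right[OF e] by simp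
qed

lemma sm_inj: "f \<in> Mor T \<Longrightarrow> g \<in> Mor T \<Longrightarrow> Sm n f = Sm n g \<Longrightarrow> f = g"
  using sm_sm[of _ "- n" n] by (metis ab_left_minus sm_0)

lemma sm_add:
  assumes "f \<in> Hom T X Y" "g \<in> Hom T X Y" shows "Sm n (Add T f g) = Add T (Sm n f) (Sm n g)"
proof -
  have m: "f \<in> Mor T" "g \<in> Mor T" "Add T f g \<in> Mor T" using assms add_in hom_mor by blast+
  show ?thesis
  proof (induction n rule: int_induct[where k = 0])
    case base then show ?case by (simp add: sm_0)
  next
    case (step1 i)
    then show ?case using sus_add[OF sm_in[OF assms(1)] sm_in[OF assms(2)], of i] m
        by (simp add: sm_Suc)
  next
    case (step2 i)
    have e: "SusM T (Sm (i - 1) f) = Sm i f" if "f \<in> Mor T" for f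
      using sm_Suc[OF that, of "i - 1"] by simp
    have "SusM T (Sm (i - 1) (Add T f g)) = SusM T (Add T (Sm (i - 1) f) (Sm (i - 1) g))"
      using step2 sus_add[OF sm_in[OF assms(1)] sm_in[OF assms(2)], of "i - 1"] m e by simp
    then show ?case
      using susM_inject sm_mor[OF m(3)] add_in[OF sm_in[OF assms(1)] sm_in[OF assms(2)]] hom_mor
          by metis
  qed
qed

lemma sm_zer: assumes "X \<in> Ob T" "Y \<in> Ob T" shows "Sm n (Zer T X Y) = Zer T (Sh n X) (Sh n Y)"
proof -
  let ?z = "Zer T X Y"
  have z: "?z \<in> Hom T X Y" using zer_in assms by blast
  have s: "Sm n ?z \<in> Hom T (Sh n X) (Sh n Y)" using sm_in[OF z] .
  have "Add T (Sm n ?z) (Sm n ?z) = Add T (Zer T (Sh n X) (Sh n Y)) (Sm n ?z)"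
    using sm_add[OF z z, of n] add_zer[OF z] zer_add[OF s] by simp
  then show ?thesis using add_cancel[OF s zer_in s] sh_in assms by blast
qed

lemma sm_neg: assumes "f \<in> Hom T X Y" shows "Sm n (Neg T f) = Neg T (Sm n f)"
proof (rule neg_unique)
  show "Add T (Sm n (Neg T f)) (Sm n f) = Zer T (Sh n X) (Sh n Y)"
    using sm_add[OF neg_in[OF assms] assms, of n] neg_add[OF assms] sm_zer hom_ob[OF assms] by simp
qed (use assms sm_in neg_in in blast)+

lemma sm_eq_zer: assumes "f \<in> Hom T X Y" 
  shows "Sm n f = Zer T (Sh n X) (Sh n Y) \<longleftrightarrow> f = Zer T X Y"
  using sm_inj[OF hom_mor[OF assms] hom_mor[OF zer_in[OF hom_ob[OF assms]]], of n] 
    sm_zer[OF hom_ob[OF assms], of n] by auto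

lemma sh_back: "X \<in> Ob T \<Longrightarrow> Sh (- n) (Sh n X) = X" "X \<in> Ob T \<Longrightarrow> Sh n (Sh (- n) X) = X"
  by (simp_all add: sh_sh sh_0)

lemma sm_back: "f \<in> Mor T \<Longrightarrow> Sm (- n) (Sm n f) = f" "f \<in> Mor T \<Longrightarrow> Sm n (Sm (- n) f) = f"
  by (simp_all add: sm_sm sm_0)

lemma sm_in_back: "f \<in> Hom T X (Sh n Y) \<Longrightarrow> Y \<in> Ob T \<Longrightarrow> Sm (- n) f \<in> Hom T (Sh (- n) X) Y"
  using sm_in[of f X "Sh n Y" "- n"] by (simp add: sh_back)

lemma sm_in_forth: "f \<in> Hom T (Sh (- n) X) Y \<Longrightarrow> X \<in> Ob T \<Longrightarrow> Sm n f \<in> Hom T X (Sh n Y)"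
  using sm_in[of f "Sh (- n) X" Y n] by (simp add: sh_back)

lemma zero_object_sh: "zero_object T X \<Longrightarrow> zero_object T (Sh n X)"
  by (metis sh_in sm_idn sm_zer zero_object_iff)

section \<open>Exact triangles\<close>

lemma triE:
  assumes "(f, g, h) \<in> Tri T"
  obtains X Y Z where "f \<in> Hom T X Y" "g \<in> Hom T Y Z" "h \<in> Hom T Z (Sus T X)"
  using tri_wf[OF assms] mor_hom by (metis hom_dom_cod(2))

lemma tri_rot: assumes "(f, g, h) \<in> Tri T" shows "(g, h, Neg T (SusM T f)) \<in> Tri T"
  using tri_rotate[of f g h] tri_wf[OF assms] assms by blast

lemma sus_zer: "X \<in> Ob T \<Longrightarrow> Y \<in> Ob T \<Longrightarrow> SusM T (Zer T X Y) = Zer T (Sus T X) (Sus T Y)"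
  using sm_zer[of X Y 1] by (simp add: sh_1 sm_1)

lemma zero_object_sus: "zero_object T X \<Longrightarrow> zero_object T (Sus T X)"
  using zero_object_sh[of X 1] by (simp add: sh_1)

lemma tri_zero:
  assumes t: "(f, g, h) \<in> Tri T" and f: "f \<in> Hom T X Y" and g: "g \<in> Hom T Y Z"
  shows "g \<cdot> f = Zer T X Z"
proof -
  obtain N where N: "zero_object T N" using ex_zero_object by blast
  have X: "X \<in> Ob T" using hom_ob f by blast
  have Z: "Zer T X N \<in> Hom T X N" using zer_in X N zero_object_ob by blast
  \<comment> \<open>The triangle of the identity of \<open>X\<close> maps to the given one by
    \<open>Idn T X\<close> and \<open>f\<close>. The completing map starts at a zero object, and
    \<open>g \<cdot> f\<close> factors through it.\<close>
  have "\<exists>c\<in>Hom T (Cod T (Zer T X N)) (Cod T g). c \<cdot> Zer T X N = g \<cdot> f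
      \<and> SusM T (Idn T X) \<cdot> Zer T N (Sus T X) = h \<cdot> c"
    using tri_complete[OF tri_idn[OF X N] t, of "Idn T X" f] idn[OF X] f hom_dom_cod[OF f]
        hom_dom_cod[OF idn[OF X]]
    by (simp add: )
  then obtain c where "c \<in> Hom T N Z" "c \<cdot> Zer T X N = g \<cdot> f"
      using hom_dom_cod[OF Z] hom_dom_cod[OF g] by auto
  then show ?thesis using comp_zer_right X by metis
qed

text \<open>The rotated triangle \<open>W \<rightarrow> 0 \<rightarrow> \<Sigma>W\<close> maps to
  the rotation of the given one by \<open>y\<close> and zero. The signs of the two rotations cancel,
  so the completing map lifts the suspension of \<open>y\<close> along that of \<open>f\<close>, and
  it is desuspended at the end.\<close>

lemma tri_exact:
  assumes t: "(f, g, h) \<in> Tri T" and f: "f \<in> Hom T X Y" and g: "g \<in> Hom T Y Z"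
    and y: "y \<in> Hom T W Y" and 0: "g \<cdot> y = Zer T W Z"
  obtains z where "z \<in> Hom T W X" "y = f \<cdot> z"
proof -
  obtain N where N: "zero_object T N" using ex_zero_object by blast
  have ob: "W \<in> Ob T" "Z \<in> Ob T" "N \<in> Ob T" using hom_ob y g N zero_object_ob by blast+
  note ZO = zer_in[OF ob(1,3)] and OZ = zer_in[OF ob(3,2)]
  have "(Zer T W N, Zer T N (Sus T W), Neg T (SusM T (Idn T W))) \<in> Tri T"
    by (rule tri_rot[OF tri_idn[OF ob(1) N]])
  from tri_complete[OF this tri_rot[OF t], of y "Zer T N Z"]
  obtain c where c: "c \<in> Hom T (Sus T W) (Sus T X)"
      "SusM T y \<cdot> Neg T (SusM T (Idn T W)) = Neg T (SusM T f) \<cdot> c"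
    using hom_dom_cod[OF ZO] hom_dom_cod[OF g] hom_dom_cod[OF zer_in[OF ob(3) sus_in[OF ob(1)]]] y
        OZ 0
      comp_zer_left[OF ZO ob(2)] tri_wf[OF t] hom_dom_cod[OF f] hom_dom_cod(2)
    by (smt (verit, best))
  have sf: "SusM T f \<in> Hom T (Sus T X) (Sus T Y)" and sy: "SusM T y \<in> Hom T (Sus T W) (Sus T Y)"
    using f y sus_hom by blast+
  have "Neg T (SusM T y) = Neg T (SusM T f \<cdot> c)"
    using c comp_neg_left[OF c(1) sf] comp_neg_right[OF idn[OF sus_in[OF ob(1)]] sy]
        comp_idn_right[OF sy]
    by (simp add: sus_idn[OF ob(1)])
  then have e: "SusM T y = SusM T f \<cdot> c" using neg_neg[OF sy] neg_neg[OF comp[OF c(1) sf]] by metis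
  define z where "z = Sm (- 1) c"
  have z: "z \<in> Hom T W X" using sm_in[OF c(1), of "-1"] hom_ob[OF f] ob(1) sh_back(1)[of _ 1]
      unfolding z_def
    by (simp add: sh_1)
  have "SusM T z = c" using sm_back(2)[OF hom_mor[OF c(1)], of 1] by (simp add: z_def sm_1)
  then have "SusM T y = SusM T (f \<cdot> z)" using e sus_comp[OF z f] by simp
  then have "y = f \<cdot> z" using susM_inject hom_mor y comp[OF z f] by metis
  then show ?thesis using that z by blast
qed

text \<open>Dual comparison with the triangle \<open>0 \<rightarrow> W = W\<close>, which is a
  backward rotation of the identity triangle of \<open>W\<close>.\<close>

lemma tri_coexact:
  assumes t: "(f, g, h) \<in> Tri T" and f: "f \<in> Hom T X Y" and g: "g \<in> Hom T Y Z"
    and y: "y \<in> Hom T Y W" and 0: "y \<cdot> f = Zer T X W"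
  obtains z where "z \<in> Hom T Z W" "y = z \<cdot> g"
proof -
  obtain N where N: "zero_object T N" using ex_zero_object by blast
  have ob: "W \<in> Ob T" "X \<in> Ob T" "N \<in> Ob T" using hom_ob y f N zero_object_ob by blast+
  have sO: "zero_object T (Sus T N)" "Sus T N \<in> Ob T"
      using zero_object_sus N zero_object_ob by blast+
  note ZO = zer_in[OF ob(2,3)] and OW = zer_in[OF ob(3,1)] and WO = zer_in[OF ob(1) sO(2)]
  have "Neg T (SusM T (Zer T N W)) = Zer T (Sus T N) (Sus T W)"
    using sus_zer[OF ob(3,1)] neg_zer[OF sO(2) sus_in[OF ob(1)]] by simp
  then have t': "(Zer T N W, Idn T W, Zer T W (Sus T N)) \<in> Tri T"
    using tri_rotate[of "Zer T N W" "Idn T W" "Zer T W (Sus T N)"] tri_idn[OF ob(1) sO(1)] 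
      hom_dom_cod[OF OW] hom_dom_cod[OF idn[OF ob(1)]] idn[OF ob(1)] hom_mor[OF OW] WO by simp
  from tri_complete[OF t t', of "Zer T X N" y]
  obtain c where c: "c \<in> Hom T Z W" "c \<cdot> g = Idn T W \<cdot> y"
    using hom_dom_cod[OF OW] hom_dom_cod[OF g] hom_dom_cod[OF f] y ZO 0
      comp_zer_left[OF ZO ob(1)] hom_dom_cod[OF idn[OF ob(1)]]
    by auto
  then show ?thesis using that comp_idn_left[OF y] by metis
qed

end

context triangulated_category
begin

lemma tri_rot2:
  assumes t: "(f, g, h) \<in> Tri T" shows "(h, Neg T (SusM T f), Neg T (SusM T g)) \<in> Tri T"
  using tri_rot[OF tri_rot[OF t]] .

lemma tri_exact2:
  assumes t: "(f, g, h) \<in> Tri T" and g: "g \<in> Hom T Y Z" and h: "h \<in> Hom T Z V"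
    and y: "y \<in> Hom T W Z" and 0: "h \<cdot> y = Zer T W V"
  obtains z where "z \<in> Hom T W Y" "y = g \<cdot> z"
  using tri_exact[OF tri_rot[OF t] g h y 0] .

lemma tri_exact3:
  assumes t: "(f, g, h) \<in> Tri T" and f: "f \<in> Hom T X Y" and h: "h \<in> Hom T Z (Sus T X)"
    and y: "y \<in> Hom T W (Sus T X)" and 0: "SusM T f \<cdot> y = Zer T W (Sus T Y)"
  obtains z where "z \<in> Hom T W Z" "y = h \<cdot> z"
proof -
  have sf: "SusM T f \<in> Hom T (Sus T X) (Sus T Y)" using sus_hom[OF f] .
  have "Neg T (SusM T f) \<cdot> y = Zer T W (Sus T Y)"
    using comp_neg_left[OF y sf] 0 neg_zer hom_ob[OF y] hom_ob[OF sf] by simp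
  from tri_exact[OF tri_rot2[OF t] h neg_in[OF sf] y this] show ?thesis using that .
qed

lemma tri_coexact2:
  assumes t: "(f, g, h) \<in> Tri T" and g: "g \<in> Hom T Y Z" and h: "h \<in> Hom T Z V"
    and y: "y \<in> Hom T Z W" and 0: "y \<cdot> g = Zer T Y W"
  obtains z where "z \<in> Hom T V W" "y = z \<cdot> h"
  using tri_coexact[OF tri_rot[OF t] g h y 0] .

lemma tri_zero2:
  assumes "(f, g, h) \<in> Tri T" "g \<in> Hom T Y Z" "h \<in> Hom T Z V" shows "h \<cdot> g = Zer T Y V"
  using tri_zero[OF tri_rot[OF assms(1)] assms(2,3)] .

lemma tri_zero3:
  assumes t: "(f, g, h) \<in> Tri T" and f: "f \<in> Hom T X Y" and h: "h \<in> Hom T Z (Sus T X)"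
  shows "SusM T f \<cdot> h = Zer T Z (Sus T Y)"
proof -
  have sf: "SusM T f \<in> Hom T (Sus T X) (Sus T Y)" using sus_hom[OF f] .
  have "Neg T (SusM T f) \<cdot> h = Zer T Z (Sus T Y)"
    using tri_zero[OF tri_rot2[OF t] h neg_in[OF sf]] .
  then show ?thesis using comp_neg_left[OF h sf] neg_eq_zer[OF comp[OF h sf]] by simp
qed

text \<open>Shifting the triangle would introduce signs, so the morphism is moved to degree zero
  instead and the lift is shifted back.\<close>

lemma sh_tri_exact:
  assumes t: "(f, g, h) \<in> Tri T" and f: "f \<in> Hom T X Y" and g: "g \<in> Hom T Y Z"
    and y: "y \<in> Hom T W (Sh a Y)" and 0: "Sm a g \<cdot> y = Zer T W (Sh a Z)"
  obtains z where "z \<in> Hom T W (Sh a X)" "y = Sm a f \<cdot> z"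
proof -
  have ob: "X \<in> Ob T" "Y \<in> Ob T" "Z \<in> Ob T" "W \<in> Ob T" using hom_ob f g y by blast+
  let ?y = "Sm (- a) y"
  have y': "?y \<in> Hom T (Sh (- a) W) Y" by (rule sm_in_back[OF y ob(2)])
  have "Sm (- a) (Sm a g \<cdot> y) = g \<cdot> ?y"
    using sm_comp[OF y sm_in[OF g], of "- a"] sm_back(1)[OF hom_mor[OF g]] by simp
  then have "g \<cdot> ?y = Zer T (Sh (- a) W) Z"
    using 0 sm_zer[OF ob(4) sh_in[OF ob(3)], of "- a" a] sh_back(1)[OF ob(3)] by simp
  from tri_exact[OF t f g y' this]
  obtain z where z: "z \<in> Hom T (Sh (- a) W) X" "?y = f \<cdot> z" .
  have "y = Sm a f \<cdot> Sm a z"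
    using sm_comp[OF z(1) f, of a] z(2) sm_back(2)[OF hom_mor[OF y], of a] by simp
  then show ?thesis using that sm_in_forth[OF z(1) ob(4)] by blast
qed

lemma sh_tri_exact2:
  assumes t: "(f, g, h) \<in> Tri T" and g: "g \<in> Hom T Y Z" and h: "h \<in> Hom T Z V"
    and y: "y \<in> Hom T W (Sh a Z)" and 0: "Sm a h \<cdot> y = Zer T W (Sh a V)"
  obtains z where "z \<in> Hom T W (Sh a Y)" "y = Sm a g \<cdot> z"
  using sh_tri_exact[OF tri_rot[OF t] g h y 0] .

lemma sm_susM: "f \<in> Mor T \<Longrightarrow> Sm a (SusM T f) = Sm (a + 1) f"
  using sm_sm[of f a 1] by (simp add: sm_1)

lemma sh_sus: "X \<in> Ob T \<Longrightarrow> Sh a (Sus T X) = Sh (a + 1) X"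
  using sh_sh[of X a 1] by (simp add: sh_1)

lemma sh_tri_exact3:
  assumes t: "(f, g, h) \<in> Tri T" and f: "f \<in> Hom T X Y" and h: "h \<in> Hom T Z (Sus T X)"
    and y: "y \<in> Hom T W (Sh (a + 1) X)" and 0: "Sm (a + 1) f \<cdot> y = Zer T W (Sh (a + 1) Y)"
  obtains z where "z \<in> Hom T W (Sh a Z)" "y = Sm a h \<cdot> z"
proof -
  have sf: "SusM T f \<in> Hom T (Sus T X) (Sus T Y)" using sus_hom[OF f] .
  have ob: "X \<in> Ob T" "Y \<in> Ob T" using hom_ob f by blast+
  have y': "y \<in> Hom T W (Sh a (Sus T X))" using y sh_sus[OF ob(1)] by simp
  have e: "Sm a (Neg T (SusM T f)) = Neg T (Sm (a + 1) f)"
    using sm_neg[OF sf] sm_susM[OF hom_mor[OF f]] by simp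
  have "Sm a (Neg T (SusM T f)) \<cdot> y = Zer T W (Sh a (Sus T Y))"
    using comp_neg_left[OF y sm_in[OF f]] 0 neg_zer hom_ob[OF y] sh_in[OF ob(2)] sh_sus[OF ob(2)] e
        by simp
  from sh_tri_exact[OF tri_rot2[OF t] h neg_in[OF sf] y' this] show ?thesis using that .
qed

text \<open>Exactness at \<open>Y\<close> gives a section \<open>s\<close> of \<open>f\<close>. The
  defect \<open>s \<cdot> f - 1\<close> is killed by \<open>f\<close>, so its suspension factors
  through the zero cone and vanishes.\<close>

lemma tri_iso_of_zero_cone:
  assumes t: "(f, g, h) \<in> Tri T" and f: "f \<in> Hom T X Y" and z: "zero_object T (Cod T g)"
  shows "is_iso T f"
proof -
  obtain Z where g: "g \<in> Hom T Y Z" and h: "h \<in> Hom T Z (Sus T X)" and zZ: "zero_object T Z"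
    using triE[OF t] f z hom_dom_cod by metis
  have ob: "X \<in> Ob T" "Y \<in> Ob T" using hom_ob f by blast+
  have "g \<cdot> Idn T Y = Zer T Y Z" using comp_idn_right[OF g] zero_object_hom_to[OF zZ g] by simp
  from tri_exact[OF t f g idn[OF ob(2)] this]
  obtain s where s: "s \<in> Hom T Y X" "Idn T Y = f \<cdot> s" .
  let ?d = "Add T (s \<cdot> f) (Neg T (Idn T X))"
  have d: "?d \<in> Hom T X X" using add_in[OF comp[OF f s(1)] neg_in[OF idn[OF ob(1)]]] .
  have "f \<cdot> (s \<cdot> f) = f" using comp_assoc[OF f s(1) f] s(2) comp_idn_left[OF f] by simp
  then have "f \<cdot> ?d = Zer T X Y"
    using comp_add_right[OF comp[OF f s(1)] neg_in[OF idn[OF ob(1)]] f] comp_neg_right[OF idn[OF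
        ob(1)] f]
      comp_idn_right[OF f] add_neg[OF f] by simp
  then have "SusM T f \<cdot> SusM T ?d = Zer T (Sus T X) (Sus T Y)"
    using sus_comp[OF d f] sus_zer[OF ob] by simp
  from tri_exact3[OF t f h sus_hom[OF d] this]
  obtain w where w: "w \<in> Hom T (Sus T X) Z" "SusM T ?d = h \<cdot> w" .
  have "SusM T ?d = Zer T (Sus T X) (Sus T X)"
    using zero_object_hom_to[OF zZ w(1)] w(2) comp_zer_right[OF h sus_in[OF ob(1)]] by simp
  then have "?d = Zer T X X" using sus_zer[OF ob(1,1)] susM_inject[OF hom_mor[OF d] hom_mor[OF
      zer_in[OF ob(1,1)]]] by simp
  then have "s \<cdot> f = Idn T X" using diff_zer_eq comp[OF f s(1)] idn[OF ob(1)] by blast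
  then show ?thesis using is_isoI[OF f s(1)] s(2) by simp
qed

lemma tri_iso_of_zero_fibre:
  assumes t: "(f, g, h) \<in> Tri T" and g: "g \<in> Hom T Y Z" and z: "zero_object T (Dom T f)"
  shows "is_iso T g"
proof -
  have "Cod T h = Sus T (Dom T f)" using tri_wf[OF t] hom_dom_cod by blast
  then show ?thesis using tri_iso_of_zero_cone[OF tri_rot[OF t] g] zero_object_sus[OF z] by simp
qed

section \<open>Localizing subcategories\<close>

text \<open>Closure in the middle is enough: the other two cases are middle cases of the rotated
  triangles, in which some objects are replaced by their suspensions.\<close>

lemma triangulated_subcategoryI:
  assumes "S \<subseteq> Ob T" "S \<noteq> {}" and sus: "\<And>X. X \<in> Ob T \<Longrightarrow> X \<in> S \<longleftrightarrow> Sus T X \<in> S"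
    and mid: "\<And>f g h X Y Z. (f, g, h) \<in> Tri T \<Longrightarrow> f \<in> Hom T X Y \<Longrightarrow> g \<in> Hom T Y Z \<Longrightarrow>
      h \<in> Hom T Z (Sus T X) \<Longrightarrow> X \<in> S \<Longrightarrow> Z \<in> S \<Longrightarrow> Y \<in> S"
  shows "triangulated_subcategory T S"
  unfolding triangulated_subcategory_def
proof (intro conjI allI impI ballI)
  fix f g h assume t: "(f, g, h) \<in> Tri T"
  obtain X Y Z where fgh: "f \<in> Hom T X Y" "g \<in> Hom T Y Z"
      "h \<in> Hom T Z (Sus T X)" by (rule triE[OF t])
  have ob: "X \<in> Ob T" "Y \<in> Ob T" "Z \<in> Ob T" using fgh hom_ob by blast+
  note dc = hom_dom_cod[OF fgh(1)] hom_dom_cod[OF fgh(2)]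
  have sf: "Neg T (SusM T f) \<in> Hom T (Sus T X) (Sus T Y)"
    and sg: "Neg T (SusM T g) \<in> Hom T (Sus T Y) (Sus T Z)" using neg_in sus_hom fgh by blast+
  show "Cod T f \<in> S" if "Dom T f \<in> S \<and> Cod T g \<in> S" using mid[OF t fgh] that dc by simp
  show "Cod T g \<in> S" if "Dom T f \<in> S \<and> Cod T f \<in> S"
    using mid[OF tri_rot[OF t] fgh(2,3) sf] that dc sus[OF ob(1)] by simp
  show "Dom T f \<in> S" if "Cod T f \<in> S \<and> Cod T g \<in> S"
    using mid[OF tri_rot2[OF t] fgh(3) sf sg] that dc sus[OF ob(1)] sus[OF ob(2)] by simp
qed (use assms in auto)

lemma localizingI:
  assumes "S \<subseteq> Ob T" "\<And>X. zero_object T X \<Longrightarrow> X \<in> S" "\<And>X. X \<in> Ob T \<Longrightarrow> X \<in> S \<longleftrightarrow> Sus T X \<in> S"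
    and "\<And>f g h X Y Z. (f, g, h) \<in> Tri T \<Longrightarrow> f \<in> Hom T X Y \<Longrightarrow> g \<in> Hom T Y Z \<Longrightarrow>
      h \<in> Hom T Z (Sus T X) \<Longrightarrow> X \<in> S \<Longrightarrow> Z \<in> S \<Longrightarrow> Y \<in> S"
    and "\<And>I X P \<iota>. small_index \<kappa> I \<Longrightarrow> is_coproduct T I X P \<iota> \<Longrightarrow> (\<And>i. i \<in> I \<Longrightarrow> X i \<in> S) \<Longrightarrow> P \<in> S"
  shows "localizing \<kappa> T S"
  unfolding localizing_def using assms ex_zero_object by (auto intro!: triangulated_subcategoryI)

lemma triangulated_subcategory_zero:
  assumes S: "triangulated_subcategory T S" and z: "zero_object T Z" shows "Z \<in> S"
proof -
  obtain X where X: "X \<in> S" "X \<in> Ob T" using S unfolding triangulated_subcategory_def by blast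
  note t = tri_idn[OF X(2) z]
  have "Cod T (Zer T X Z) = Z" using hom_dom_cod zer_in X(2) z zero_object_ob by blast
  then show ?thesis
    using S t X hom_dom_cod[OF idn[OF X(2)]] unfolding triangulated_subcategory_def by metis
qed

lemma iso_tri:
  assumes f: "f \<in> Hom T X Y" "is_iso T f" and z: "zero_object T Z"
  shows "(f, Zer T Y Z, Zer T Z (Sus T X)) \<in> Tri T"
proof -
  have ob: "X \<in> Ob T" "Y \<in> Ob T" "Z \<in> Ob T"
      "Sus T X \<in> Ob T" using hom_ob f sus_in z zero_object_ob by blast+
  note d = hom_dom_cod[OF f(1)] hom_dom_cod[OF zer_in[OF ob(2,3)]] hom_dom_cod[OF zer_in[OF
      ob(1,3)]] 
    hom_dom_cod[OF idn[OF ob(1)]]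
  show ?thesis
    by (rule tri_iso[OF tri_idn[OF ob(1) z], of f "Zer T Y Z" "Zer T Z (Sus T X)"
        "Idn T X" f "Idn T Z"])
      (use d f ob zer_in idn is_iso_idn hom_mor in \<open>simp_all add: comp_idn_left[OF zer_in]
          comp_idn_right[OF zer_in]
        comp_zer_left sus_idn\<close>)
qed

lemma triangulated_subcategory_iso:
  assumes S: "triangulated_subcategory T S" and i: "isomorphic T X Y" and X: "X \<in> S" shows "Y \<in> S"
proof -
  obtain f where f: "f \<in> Hom T X Y" "is_iso T f" using i unfolding isomorphic_def by blast
  obtain Z where z: "zero_object T Z" using ex_zero_object by blast
  have "Cod T (Zer T Y Z) = Z" using hom_dom_cod zer_in hom_ob f z zero_object_ob by blast
  then show ?thesis
    using S iso_tri[OF f z] X hom_dom_cod[OF f(1)] triangulated_subcategory_zero[OF S z]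
    unfolding triangulated_subcategory_def by metis
qed

lemma triangulated_subcategory_sh:
  assumes S: "triangulated_subcategory T S" and X: "X \<in> Ob T" shows "Sh n X \<in> S \<longleftrightarrow> X \<in> S"
proof -
  have sus: "\<And>X. X \<in> Ob T \<Longrightarrow> X \<in> S \<longleftrightarrow> Sus T X \<in> S" using S
      unfolding triangulated_subcategory_def by blast
  show ?thesis
  proof (induction n rule: int_induct[where k = 0])
    case base then show ?case by (simp add: sh_0)
  next
    case (step1 i) then show ?case using sus[OF sh_in[OF X, of i]] sh_Suc[OF X, of i] by simp
  next
    case (step2 i) then show ?case using sus[OF sh_in[OF X, of "i - 1"]] sh_Suc[OF X, of "i - 1"]
        by simp
  qed
qed

lemma triangulated_subcategory_tri:
  assumes "triangulated_subcategory T S" "(f, g, h) \<in> Tri T" "f \<in> Hom T X Y" "g \<in> Hom T Y Z"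
  shows "X \<in> S \<Longrightarrow> Y \<in> S \<Longrightarrow> Z \<in> S" "Y \<in> S \<Longrightarrow> Z \<in> S \<Longrightarrow> X \<in> S" "X \<in> S \<Longrightarrow> Z \<in> S \<Longrightarrow> Y \<in> S"
  using assms(1,2) hom_dom_cod[OF assms(3)] hom_dom_cod[OF assms(4)]
      unfolding triangulated_subcategory_def
  by blast+

lemma localizing_triangulated: "localizing \<kappa> T S \<Longrightarrow> triangulated_subcategory T S"
  by (simp add: localizing_def)

lemma localizing_ob: "localizing \<kappa> T S \<Longrightarrow> S \<subseteq> Ob T"
  by (simp add: localizing_def triangulated_subcategory_def)

lemma localizing_Int:
  assumes "localizing \<kappa> T S" "localizing \<kappa> T S'" shows "localizing \<kappa> T (S \<inter> S')"
proof (rule localizingI)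
  note tr = localizing_triangulated[OF assms(1)] localizing_triangulated[OF assms(2)]
  show "S \<inter> S' \<subseteq> Ob T" using localizing_ob assms by blast
  show "X \<in> S \<inter> S'" if "zero_object T X" for X using triangulated_subcategory_zero[OF _ that] tr
      by blast
  show "X \<in> S \<inter> S' \<longleftrightarrow> Sus T X \<in> S \<inter> S'" if "X \<in> Ob T" for X
    using tr that unfolding triangulated_subcategory_def by blast
  show "Y \<in> S \<inter> S'" if "(f, g, h) \<in> Tri T" "f \<in> Hom T X Y" "g \<in> Hom T Y Z" "X \<in> S \<inter> S'" "Z \<in> S \<inter> S'"
    for f g h X Y Z
    using triangulated_subcategory_tri(3)[OF _ that(1-3)] tr that(4,5) by blast
  show "P \<in> S \<inter> S'" if "small_index \<kappa> I" "is_coproduct T I X P \<iota>"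
      "\<And>i. i \<in> I \<Longrightarrow> X i \<in> S \<inter> S'" for I X P \<iota>
    using assms that unfolding localizing_def by blast
qed

lemma Loc_least: "localizing \<kappa> T S \<Longrightarrow> C \<subseteq> S \<Longrightarrow> Loc \<kappa> T C \<subseteq> S"
  unfolding Loc_def by blast

lemma Loc_superset: "C \<subseteq> Loc \<kappa> T C"
  unfolding Loc_def by blast

definition orth :: "'o \<Rightarrow> 'o \<Rightarrow> bool" where
  "orth X Y \<longleftrightarrow> (\<forall>f\<in>Hom T X Y. f = Zer T X Y)"

lemma orth_sh:
  assumes "X \<in> Ob T" "Y \<in> Ob T" shows "orth (Sh n X) (Sh n Y) \<longleftrightarrow> orth X Y"
proof
  assume a: "orth (Sh n X) (Sh n Y)"
  show "orth X Y" unfolding orth_def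
  proof
    fix f assume f: "f \<in> Hom T X Y"
    then show "f = Zer T X Y" using sm_in[OF f, of n] a sm_eq_zer[OF f, of n]
        unfolding orth_def by blast
  qed
next
  assume a: "orth X Y"
  show "orth (Sh n X) (Sh n Y)" unfolding orth_def
  proof
    fix f assume f: "f \<in> Hom T (Sh n X) (Sh n Y)"
    then have "Sm (- n) f \<in> Hom T X Y" using sm_in[OF f, of "- n"] sh_back assms by simp
    then have "Sm n (Sm (- n) f) = Zer T (Sh n X) (Sh n Y)"
        using a sm_zer[OF assms] unfolding orth_def by simp
    then show "f = Zer T (Sh n X) (Sh n Y)" using sm_back(2)[OF hom_mor[OF f]] by simp
  qed
qed

lemma orth_mid_right:
  assumes t: "(f, g, h) \<in> Tri T" and f: "f \<in> Hom T X Y" and g: "g \<in> Hom T Y Z"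
    and "orth W X" "orth W Z"
  shows "orth W Y"
  unfolding orth_def
proof
  fix y assume y: "y \<in> Hom T W Y"
  then have "g \<cdot> y = Zer T W Z" using assms(5) comp[OF y g] unfolding orth_def by blast
  from tri_exact[OF t f g y this] obtain z where z: "z \<in> Hom T W X" "y = f \<cdot> z" .
  then show "y = Zer T W Y" using assms(4) comp_zer_right[OF f] hom_ob(1)[OF y]
      unfolding orth_def by auto
qed

lemma orth_mid_left:
  assumes t: "(f, g, h) \<in> Tri T" and f: "f \<in> Hom T X Y" and g: "g \<in> Hom T Y Z"
    and "orth X W" "orth Z W"
  shows "orth Y W"
  unfolding orth_def
proof
  fix y assume y: "y \<in> Hom T Y W"
  then have "y \<cdot> f = Zer T X W" using assms(4) comp[OF f y] unfolding orth_def by blast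
  from tri_coexact[OF t f g y this] obtain z where z: "z \<in> Hom T Z W" "y = z \<cdot> g" .
  then show "y = Zer T Y W" using assms(5) comp_zer_left[OF g] hom_ob(2)[OF y]
      unfolding orth_def by auto
qed

lemma left_perp_localizing:
  assumes S: "S \<subseteq> Ob T" and sh: "\<And>n X. X \<in> S \<Longrightarrow> Sh n X \<in> S"
  shows "localizing \<kappa> T (left_perp T S)"
proof -
  have lp: "left_perp T S = {X \<in> Ob T. \<forall>Y\<in>S. orth X Y}" unfolding left_perp_def orth_def by simp
  have sus: "orth X (Sh (- 1) Y) \<longleftrightarrow> orth (Sus T X) Y" if "X \<in> Ob T" "Y \<in> Ob T" for X Y
    using orth_sh[OF that(1) sh_in[OF that(2), of "- 1"], of 1] sh_back(2)[OF that(2), of 1]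
        by (simp add: sh_1)
  show ?thesis unfolding lp
  proof (rule localizingI)
    show "X \<in> {X \<in> Ob T. \<forall>Y\<in>S. orth X Y}" if "zero_object T X" for X
      using that zero_object_hom_from zero_object_ob unfolding orth_def by blast
    show "X \<in> {X \<in> Ob T. \<forall>Y\<in>S. orth X Y} \<longleftrightarrow> Sus T X \<in> {X \<in> Ob T. \<forall>Y\<in>S. orth X Y}"
        if X: "X \<in> Ob T" for X
    proof -
      \<comment> \<open>\<open>S\<close> is closed under all shifts, so testing against its objects
        and against their desuspensions is the same.\<close>
      have "(\<forall>Y\<in>S. orth X Y) \<longleftrightarrow> (\<forall>Y\<in>S. orth X (Sh (- 1) Y))"
        using sh S sh_back(1)[of _ 1] by (metis subsetD)
      moreover have "(\<forall>Y\<in>S. orth X (Sh (- 1) Y)) \<longleftrightarrow> (\<forall>Y\<in>S. orth (Sus T X) Y)"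
        using sus[OF X] S by blast
      ultimately show ?thesis using X sus_in by simp
    qed
    show "Y \<in> {X \<in> Ob T. \<forall>Y\<in>S. orth X Y}" if "(f, g, h) \<in> Tri T" "f \<in> Hom T X Y" "g \<in> Hom T Y Z"
      "X \<in> {X \<in> Ob T. \<forall>Y\<in>S. orth X Y}" "Z \<in> {X \<in> Ob T. \<forall>Y\<in>S. orth X Y}" for f g h X Y Z
      using that hom_ob orth_mid_left[OF that(1-3)] by blast
    show "P \<in> {X \<in> Ob T. \<forall>Y\<in>S. orth X Y}" if P: "is_coproduct T I X P \<iota>"
      "\<And>i. i \<in> I \<Longrightarrow> X i \<in> {X \<in> Ob T. \<forall>Y\<in>S. orth X Y}" for I :: "'k set" and X P \<iota>
    proof -
      have "orth P Y" if "Y \<in> S" for Y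
        unfolding orth_def
      proof
        fix f assume f: "f \<in> Hom T P Y"
        show "f = Zer T P Y"
        proof (rule is_coproduct_eqI[OF P(1) f])
          show "Zer T P Y \<in> Hom T P Y" using hom_ob f zer_in by blast
          fix i assume i: "i \<in> I"
          note ii = is_coproduct_inj[OF P(1) i]
          have "f \<cdot> \<iota> i = Zer T (X i) Y"
            using P(2)[OF i] \<open>Y \<in> S\<close> comp[OF ii f] unfolding orth_def by blast
          then show "f \<cdot> \<iota> i = Zer T P Y \<cdot> \<iota> i" using comp_zer_left[OF ii] hom_ob f by metis
        qed
      qed
      then show ?thesis using is_coproduct_ob[OF P(1)] by blast
    qed
  qed auto
qed

end

section \<open>Compact objects\<close>

context additive_category
begin

lemma finprod_in:
  assumes C: "C \<in> Ob T" "P \<in> Ob T" and g: "\<And>i. i \<in> F \<Longrightarrow> g i \<in> Hom T C P"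
  shows "finprod (hom_group T C P) g F \<in> Hom T C P"
proof -
  interpret G: comm_group "hom_group T C P" using hom_comm_group C by blast
  show ?thesis using G.finprod_closed[of g F] g by (auto simp: hom_group_def)
qed

lemma finprod_in_set:
  assumes "finite F" and C: "C \<in> Ob T" "P \<in> Ob T" and N: "N \<subseteq> Hom T C P"
    and "Zer T C P \<in> N" "\<And>a b. a \<in> N \<Longrightarrow> b \<in> N \<Longrightarrow> Add T a b \<in> N" "\<And>i. i \<in> F \<Longrightarrow> g i \<in> N"
  shows "finprod (hom_group T C P) g F \<in> N"
proof -
  interpret G: comm_group "hom_group T C P" using hom_comm_group C by blast
  show ?thesis
    using assms(1,7)
  proof (induction F)
    case empty then show ?case using assms(5) unfolding G.finprod_empty by (simp add: hom_group_def)
  next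
    case (insert i F)
    have g: "g \<in> F \<rightarrow> carrier (hom_group T C P)" "g i \<in> carrier (hom_group T C P)"
      using insert N by (auto simp: hom_group_def)
    show ?case using G.finprod_insert[OF insert(1,2) g] insert assms(6) by (simp add: hom_group_def)
  qed
qed

lemma comp_finprod:
  assumes "finite F" and C: "C \<in> Ob T" and g: "\<And>i. i \<in> F \<Longrightarrow> g i \<in> Hom T C P" and v: "v \<in> Hom T P Q"
  shows "v \<cdot> finprod (hom_group T C P) g F = finprod (hom_group T C Q) (\<lambda>i. v \<cdot> g i) F"
proof -
  have ob: "P \<in> Ob T" "Q \<in> Ob T" using hom_ob v by blast+
  interpret G: comm_group "hom_group T C P" using hom_comm_group C ob by blast
  interpret H: comm_group "hom_group T C Q" using hom_comm_group C ob by blast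
  show ?thesis
    using assms(1,3)
  proof (induction F)
    case empty then show ?case using comp_zer_right[OF v C]
        unfolding G.finprod_empty H.finprod_empty by (simp add: hom_group_def)
  next
    case (insert i F)
    have g: "g \<in> F \<rightarrow> carrier (hom_group T C P)" "g i \<in> carrier (hom_group T C P)"
      using insert by (auto simp: hom_group_def)
    have vg: "(\<lambda>i. v \<cdot> g i) \<in> F \<rightarrow> carrier (hom_group T C Q)" "v \<cdot> g i \<in> carrier (hom_group T C Q)"
      using insert comp[OF _ v] by (auto simp: hom_group_def)
    have fin: "finprod (hom_group T C P) g F \<in> Hom T C P"
        using finprod_in[OF C ob(1), of F g] insert by simp
    have gi: "g i \<in> Hom T C P" using insert by simp
    show ?case
      using G.finprod_insert[OF insert(1,2) g] H.finprod_insert[OF insert(1,2) vg] insert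
          comp_add_right[OF gi fin v]
      by (simp add: hom_group_def)
  qed
qed

lemma finprod_comp:
  assumes "finite F" and Q: "Q \<in> Ob T" and g: "\<And>i. i \<in> F \<Longrightarrow> g i \<in> Hom T P Q" and v: "v \<in> Hom T C P"
  shows "finprod (hom_group T P Q) g F \<cdot> v = finprod (hom_group T C Q) (\<lambda>i. g i \<cdot> v) F"
proof -
  have ob: "P \<in> Ob T" "C \<in> Ob T" using hom_ob v by blast+
  interpret G: comm_group "hom_group T P Q" using hom_comm_group Q ob by blast
  interpret H: comm_group "hom_group T C Q" using hom_comm_group Q ob by blast
  show ?thesis
    using assms(1,3)
  proof (induction F)
    case empty then show ?case using comp_zer_left[OF v Q]
        unfolding G.finprod_empty H.finprod_empty by (simp add: hom_group_def)
  next
    case (insert i F)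
    have g: "g \<in> F \<rightarrow> carrier (hom_group T P Q)" "g i \<in> carrier (hom_group T P Q)"
      using insert by (auto simp: hom_group_def)
    have vg: "(\<lambda>i. g i \<cdot> v) \<in> F \<rightarrow> carrier (hom_group T C Q)" "g i \<cdot> v \<in> carrier (hom_group T C Q)"
      using insert comp[OF v] by (auto simp: hom_group_def)
    have fin: "finprod (hom_group T P Q) g F \<in> Hom T P Q"
        using finprod_in[OF ob(1) Q, of F g] insert by simp
    have gi: "g i \<in> Hom T P Q" using insert by simp
    show ?case
      using G.finprod_insert[OF insert(1,2) g] H.finprod_insert[OF insert(1,2) vg] insert
          comp_add_left[OF v gi fin]
      by (simp add: hom_group_def)
  qed
qed

lemma coproduct_projections:
  assumes P: "is_coproduct T I X P \<iota>"
  obtains \<pi> where "\<And>j. j \<in> I \<Longrightarrow> \<pi> j \<in> Hom T P (X j)" "\<And>j. j \<in> I \<Longrightarrow> \<pi> j \<cdot> \<iota> j = Idn T (X j)"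
    "\<And>i j. i \<in> I \<Longrightarrow> j \<in> I \<Longrightarrow> i \<noteq> j \<Longrightarrow> \<pi> j \<cdot> \<iota> i = Zer T (X i) (X j)"
proof -
  have "\<exists>p. p \<in> Hom T P (X j) \<and> p \<cdot> \<iota> j = Idn T (X j) \<and> (\<forall>i\<in>I. i \<noteq> j \<longrightarrow> p \<cdot> \<iota> i = Zer T (X i) (X j))"
    if j: "j \<in> I" for j
  proof -
    let ?g = "\<lambda>i. if i = j then Idn T (X j) else Zer T (X i) (X j)"
    have "?g i \<in> Hom T (X i) (X j)" if "i \<in> I" for i
      using idn zer_in is_coproduct_summand[OF P] that j by auto
    then obtain p where "p \<in> Hom T P (X j)" "\<And>i. i \<in> I \<Longrightarrow> p \<cdot> \<iota> i = ?g i"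
      using is_coproductE[OF P is_coproduct_summand[OF P j], of ?g] by blast
    then show ?thesis using j by (intro exI[of _ p]) simp
  qed
  then obtain \<pi> where "\<And>j. j \<in> I \<Longrightarrow> \<pi> j \<in> Hom T P (X j) \<and> \<pi> j \<cdot> \<iota> j = Idn T (X j) \<and>
    (\<forall>i\<in>I. i \<noteq> j \<longrightarrow> \<pi> j \<cdot> \<iota> i = Zer T (X i) (X j))" by metis
  then show ?thesis using that by blast
qed

lemma compact_ob: "C \<in> compact_objects \<kappa> T \<Longrightarrow> C \<in> Ob T"
  by (simp add: compact_objects_def)

lemma compact_finprod_index:
  assumes C: "C \<in> compact_objects \<kappa> T" and I: "small_index \<kappa> I" and P: "is_coproduct T I X P \<iota>"
    and w: "w \<in> Hom T C P"
  obtains F f where "finite F" "F \<subseteq> I" "\<And>i. i \<in> F \<Longrightarrow> f i \<in> Hom T C (X i)"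
    "w = finprod (hom_group T C P) (\<lambda>i. \<iota> i \<cdot> f i) F"
proof -
  have "bij_betw (\<lambda>f. finprod (hom_group T C P) (\<lambda>i. \<iota> i \<cdot> f i) {i\<in>I. f i \<noteq> Zer T C (X i)})
       (hom_direct_sum T C I X) (Hom T C P)"
    using C I P unfolding compact_objects_def by blast
  then obtain f where f: "f \<in> hom_direct_sum T C I X"
    "w = finprod (hom_group T C P) (\<lambda>i. \<iota> i \<cdot> f i) {i\<in>I. f i \<noteq> Zer T C (X i)}"
    using w unfolding bij_betw_def by blast
  then show ?thesis
    by (intro that[of "{i\<in>I. f i \<noteq> Zer T C (X i)}" f]) (auto simp: hom_direct_sum_def)
qed

lemma compact_finprod:
  assumes C: "C \<in> compact_objects \<kappa> T" and \<kappa>: "size_bound \<kappa>" and I: "small \<kappa> A" 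
    and P: "is_coproduct T A X P \<iota>" and w: "w \<in> Hom T C P"
  obtains F f where "finite F" "F \<subseteq> A" "\<And>i. i \<in> F \<Longrightarrow> f i \<in> Hom T C (X i)"
    "w = finprod (hom_group T C P) (\<lambda>i. \<iota> i \<cdot> f i) F"
proof -
  obtain e I where e: "small_index \<kappa> I" "bij_betw e A I" by (rule small_indexE[OF \<kappa> I])
  let ?d = "inv_into A e"
  obtain F f where F: "finite F" "F \<subseteq> I" "\<And>i. i \<in> F \<Longrightarrow> f i \<in> Hom T C (X (?d i))"
    "w = finprod (hom_group T C P) (\<lambda>i. \<iota> (?d i) \<cdot> f i) F"
    using compact_finprod_index[OF C e(1) is_coproduct_reindex_back[OF e(2) P] w] by blast
  have I: "I = e ` A" using e(2) by (auto simp: bij_betw_def)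
  have ed: "e (?d i) = i" if "i \<in> F" for i using that F(2) I f_inv_into_f by (metis subsetD)
  have "inj_on ?d F" by (metis ed inj_onI)
  have dA: "?d i \<in> A" if "i \<in> F" for i using that F(2) I inv_into_into by (metis subsetD)
  have ob: "C \<in> Ob T" "P \<in> Ob T" using hom_ob w by blast+
  interpret G: comm_group "hom_group T C P" using hom_comm_group ob by blast
  have in1: "\<iota> (?d i) \<cdot> f i \<in> Hom T C P" if "i \<in> F" for i
    using comp[OF F(3)[OF that] is_coproduct_inj[OF P dA[OF that]]] .
  have "finprod (hom_group T C P) (\<lambda>a. \<iota> a \<cdot> f (e a)) (?d ` F)
      = finprod (hom_group T C P) (\<lambda>i. \<iota> (?d i) \<cdot> f (e (?d i))) F"
    by (rule G.finprod_reindex) (use \<open>inj_on ?d F\<close> in1 ed in \<open>auto simp: hom_group_def\<close>)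
  also have "\<dots> = w" unfolding F(4)
    by (rule G.finprod_cong') (use in1 ed in \<open>auto simp: hom_group_def\<close>)
  finally have "w = finprod (hom_group T C P) (\<lambda>a. \<iota> a \<cdot> f (e a)) (?d ` F)" by simp
  then show ?thesis
    by (rule that[rotated 3]) (use F(1,3) dA ed in auto)
qed

text \<open>The conclusion says that \<open>w\<close> factors through the coproduct of the \<open>X i\<close> with \<open>i \<in> F\<close>. In this
  form, which avoids sums, it characterizes compact objects.\<close>

lemma compact_support:
  assumes C: "C \<in> compact_objects \<kappa> T" and \<kappa>: "size_bound \<kappa>" and A: "small \<kappa> A" 
    and P: "is_coproduct T A X P \<iota>" and w: "w \<in> Hom T C P"
  obtains F where "finite F" "F \<subseteq> A"
    "\<And>Y v. v \<in> Hom T P Y \<Longrightarrow> (\<And>i. i \<in> F \<Longrightarrow> v \<cdot> \<iota> i = Zer T (X i) Y) \<Longrightarrow> v \<cdot> w = Zer T C Y"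
proof -
  obtain F f where F: "finite F" "F \<subseteq> A" "\<And>i. i \<in> F \<Longrightarrow> f i \<in> Hom T C (X i)"
    "w = finprod (hom_group T C P) (\<lambda>i. \<iota> i \<cdot> f i) F" using compact_finprod[OF assms] by blast
  show ?thesis
  proof (rule that[OF F(1,2)])
    fix Y v assume v: "v \<in> Hom T P Y" and 0: "\<And>i. i \<in> F \<Longrightarrow> v \<cdot> \<iota> i = Zer T (X i) Y"
    have ob: "C \<in> Ob T" "Y \<in> Ob T" using hom_ob w v by blast+
    have in1: "\<iota> i \<cdot> f i \<in> Hom T C P" if "i \<in> F" for i
      using comp[OF F(3)[OF that] is_coproduct_inj[OF P]] that F(2) by blast
    have z: "v \<cdot> (\<iota> i \<cdot> f i) = Zer T C Y" if "i \<in> F" for i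
      using comp_assoc[OF F(3)[OF that] is_coproduct_inj[OF P] v] that F(2) 0[OF that]
          comp_zer_left[OF F(3)[OF that] ob(2)]
      by auto
    have "v \<cdot> w = finprod (hom_group T C Y) (\<lambda>i. v \<cdot> (\<iota> i \<cdot> f i)) F"
      unfolding F(4) by (rule comp_finprod[OF F(1) ob(1) in1 v])
    then show "v \<cdot> w = Zer T C Y"
      using finprod_in_set[OF F(1) ob, of "{Zer T C Y}"
          "\<lambda>i. v \<cdot> (\<iota> i \<cdot> f i)"] z zer_in[OF ob] add_zer by simp
  qed
qed

lemma compact_support_eq:
  assumes C: "C \<in> compact_objects \<kappa> T" and \<kappa>: "size_bound \<kappa>" and A: "small \<kappa> A" 
    and P: "is_coproduct T A X P \<iota>" and w: "w \<in> Hom T C P"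
  obtains F where "finite F" "F \<subseteq> A"
    "\<And>Y v v'. v \<in> Hom T P Y \<Longrightarrow> v' \<in> Hom T P Y \<Longrightarrow> (\<And>i. i \<in> F \<Longrightarrow> v \<cdot> \<iota> i = v' \<cdot> \<iota> i) \<Longrightarrow> v \<cdot> w = v' \<cdot> w"
proof -
  obtain F where F: "finite F" "F \<subseteq> A"
    "\<And>Y v. v \<in> Hom T P Y \<Longrightarrow> (\<And>i. i \<in> F \<Longrightarrow> v \<cdot> \<iota> i = Zer T (X i) Y) \<Longrightarrow> v \<cdot> w = Zer T C Y"
    using compact_support[OF assms] by blast
  show ?thesis
  proof (rule that[OF F(1,2)])
    fix Y v v' assume v: "v \<in> Hom T P Y" "v' \<in> Hom T P Y" and e: "\<And>i. i \<in> F \<Longrightarrow> v \<cdot> \<iota> i = v' \<cdot> \<iota> i"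
    let ?d = "Add T v (Neg T v')"
    have d: "?d \<in> Hom T P Y" using add_in neg_in v by blast
    have "?d \<cdot> \<iota> i = Zer T (X i) Y" if "i \<in> F" for i
    proof -
      have ii: "\<iota> i \<in> Hom T (X i) P" using is_coproduct_inj[OF P] that F(2) by blast
      show ?thesis
        using comp_add_left[OF ii v(1) neg_in[OF v(2)]] comp_neg_left[OF ii v(2)] e[OF that]
            add_neg[OF comp[OF ii v(2)]]
        by simp
    qed
    then have "?d \<cdot> w = Zer T C Y" by (rule F(3)[OF d])
    then have "Add T (v \<cdot> w) (Neg T (v' \<cdot> w)) = Zer T C Y"
      using comp_add_left[OF w v(1) neg_in[OF v(2)]] comp_neg_left[OF w v(2)] by simp
    then show "v \<cdot> w = v' \<cdot> w" using diff_zer_eq comp w v by blast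
  qed
qed

text \<open>A morphism from \<open>C\<close> is a finite sum of morphisms through summands, so an
  additive property is checked there. This form hides the finite products of the definition.\<close>

lemma compact_induct:
  assumes C: "C \<in> compact_objects \<kappa> T" and \<kappa>: "size_bound \<kappa>" and A: "small \<kappa> A" 
    and P: "is_coproduct T A X P \<iota>" and w: "w \<in> Hom T C P"
    and zer: "Q (Zer T C P)"
    and add: "\<And>a b. a \<in> Hom T C P \<Longrightarrow> b \<in> Hom T C P \<Longrightarrow> Q a \<Longrightarrow> Q b \<Longrightarrow> Q (Add T a b)"
    and inj: "\<And>i u. i \<in> A \<Longrightarrow> u \<in> Hom T C (X i) \<Longrightarrow> Q (\<iota> i \<cdot> u)"
  shows "Q w"
proof -
  obtain F f where F: "finite F" "F \<subseteq> A" "\<And>i. i \<in> F \<Longrightarrow> f i \<in> Hom T C (X i)"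
    "w = finprod (hom_group T C P) (\<lambda>i. \<iota> i \<cdot> f i) F" using compact_finprod[OF assms(1-5)] by blast
  have ob: "C \<in> Ob T" "P \<in> Ob T" using hom_ob w by blast+
  have "finprod (hom_group T C P) (\<lambda>i. \<iota> i \<cdot> f i) F \<in> {a \<in> Hom T C P. Q a}"
    by (rule finprod_in_set[OF F(1) ob])
      (use zer add inj F(2,3) zer_in[OF ob] add_in in \<open>auto intro!: comp[OF F(3) is_coproduct_inj[OF
          P]]\<close>)
  then show ?thesis using F(4) by simp
qed

text \<open>The converse of \<open>compact_support\<close>. A vanishing criterion is easily combined
  for cones and biproducts, whereas direct sums of morphism groups are not.\<close>

lemma compactI:
  assumes C: "C \<in> Ob T"
    and fs: "\<And>(I :: 'k set) X P \<iota> w. small_index \<kappa> I \<Longrightarrow> is_coproduct T I X P \<iota> \<Longrightarrow> w \<in> Hom T C P \<Longrightarrow>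
      \<exists>F\<subseteq>I. finite F \<and> (\<forall>Y. \<forall>v\<in>Hom T P Y. (\<forall>i\<in>F. v \<cdot> \<iota> i = Zer T (X i) Y) \<longrightarrow> v \<cdot> w = Zer T C Y)"
  shows "C \<in> compact_objects (\<kappa> :: 'k rel) T"
  unfolding compact_objects_def
proof (intro CollectI conjI C allI impI)
  fix I :: "'k set" and X P \<iota>
  assume a: "small_index \<kappa> I \<and> is_coproduct T I X P \<iota>"
  then have I: "small_index \<kappa> I" and P: "is_coproduct T I X P \<iota>" by auto
  note Pob = is_coproduct_ob[OF P] and Xob = is_coproduct_summand[OF P]
      and inj = is_coproduct_inj[OF P]
  obtain \<pi> where \<pi>: "\<And>j. j \<in> I \<Longrightarrow> \<pi> j \<in> Hom T P (X j)" "\<And>j. j \<in> I \<Longrightarrow> \<pi> j \<cdot> \<iota> j = Idn T (X j)"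
    "\<And>i j. i \<in> I \<Longrightarrow> j \<in> I \<Longrightarrow> i \<noteq> j \<Longrightarrow> \<pi> j \<cdot> \<iota> i = Zer T (X i) (X j)" 
    using coproduct_projections[OF P] by blast
  interpret G: comm_group "hom_group T C P" using hom_comm_group C Pob by blast
  let ?\<Phi> = "\<lambda>f. finprod (hom_group T C P) (\<lambda>i. \<iota> i \<cdot> f i) {i\<in>I. f i \<noteq> Zer T C (X i)}"
  \<comment> \<open>The projections recover the components of a finite sum, which gives
    injectivity.\<close>
  have pr: "\<pi> j \<cdot> ?\<Phi> f = f j" if f: "f \<in> hom_direct_sum T C I X" and j: "j \<in> I" for f j
  proof -
    let ?F = "{i\<in>I. f i \<noteq> Zer T C (X i)}"
    have fin: "finite ?F" and fi: "\<And>i. i \<in> I \<Longrightarrow> f i \<in> Hom T C (X i)"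
        using f by (auto simp: hom_direct_sum_def)
    interpret H: comm_group "hom_group T C (X j)" using hom_comm_group C Xob j by blast
    have t: "\<pi> j \<cdot> (\<iota> i \<cdot> f i) = (if j = i then f i else Zer T C (X j))" if i: "i \<in> I" for i
    proof -
      have "\<pi> j \<cdot> (\<iota> i \<cdot> f i) = (\<pi> j \<cdot> \<iota> i) \<cdot> f i"
          using comp_assoc[OF fi[OF i] inj[OF i] \<pi>(1)[OF j]] .
      also have "\<dots> = (if j = i then f i else Zer T C (X j))"
        using \<pi>(2)[OF j] \<pi>(3)[OF i j] comp_idn_left[OF fi[OF i]] comp_zer_left[OF fi[OF i] Xob[OF
            j]] by auto
      finally show ?thesis .
    qed
    have "\<pi> j \<cdot> ?\<Phi> f = finprod (hom_group T C (X j)) (\<lambda>i. \<pi> j \<cdot> (\<iota> i \<cdot> f i)) ?F"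
      by (rule comp_finprod[OF fin C _ \<pi>(1)[OF j]]) (use fi inj in \<open>auto intro!: comp[OF fi inj]\<close>)
    also have "\<dots> = f j"
    proof (cases "f j = Zer T C (X j)")
      case True
      have "finprod (hom_group T C (X j)) (\<lambda>i. \<pi> j \<cdot> (\<iota> i \<cdot> f i)) ?F \<in> {Zer T C (X j)}"
        by (rule finprod_in_set[OF fin C Xob[OF j]]) (use t True zer_in[OF C Xob[OF j]] add_zer in
            auto)
      then show ?thesis using True by simp
    next
      case False
      have "finprod (hom_group T C (X j)) (\<lambda>i. \<pi> j \<cdot> (\<iota> i \<cdot> f i)) ?F =
        finprod (hom_group T C (X j)) (\<lambda>i. if j = i then (if i
            = j then f i else Zer T C (X j)) else \<one>\<^bsub>hom_group T C (X j)\<^esub>) ?F"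
        by (rule H.finprod_cong') (use t fi[OF j] zer_in[OF C Xob[OF j]] in \<open>auto simp:
            hom_group_def\<close>)
      also have "\<dots> = (if j = j then f j else Zer T C (X j))"
        by (rule H.finprod_singleton) (use False fin fi[OF j] j zer_in[OF C Xob[OF j]] in \<open>auto
            simp: hom_group_def\<close>)
      finally show ?thesis by simp
    qed
    finally show ?thesis .
  qed
  show "bij_betw ?\<Phi> (hom_direct_sum T C I X) (Hom T C P)"
    unfolding bij_betw_def
  proof
    show "inj_on ?\<Phi> (hom_direct_sum T C I X)"
    proof (rule inj_onI)
      fix f f' assume f: "f \<in> hom_direct_sum T C I X" "f' \<in> hom_direct_sum T C I X" "?\<Phi> f = ?\<Phi> f'"
      show "f = f'"
      proof (rule extensionalityI[of _ I])
        show "f \<in> extensional I" "f' \<in> extensional I"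
            using f(1,2) by (auto simp: hom_direct_sum_def PiE_def)
        show "f j = f' j" if "j \<in> I" for j using pr[OF f(1) that] pr[OF f(2) that] f(3) by simp
      qed
    qed
    show "?\<Phi> ` hom_direct_sum T C I X = Hom T C P"
    proof (intro equalityI subsetI)
      fix y assume "y \<in> ?\<Phi> ` hom_direct_sum T C I X"
      then obtain f where f: "f \<in> hom_direct_sum T C I X" "y = ?\<Phi> f" by blast
      then have "\<And>i. i \<in> I \<Longrightarrow> f i \<in> Hom T C (X i)" by (auto simp: hom_direct_sum_def)
      then show "y \<in> Hom T C P" unfolding f(2) by (intro finprod_in[OF C Pob]) (use comp inj in
          blast)
    next
      fix w assume w: "w \<in> Hom T C P"
      obtain F where F: "F \<subseteq> I" "finite F"
        "\<And>Y v. v \<in> Hom T P Y \<Longrightarrow> (\<forall>i\<in>F. v \<cdot> \<iota> i = Zer T (X i) Y) \<Longrightarrow> v \<cdot> w = Zer T C Y"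
        using fs[OF I P w] by blast
      define f where "f = restrict (\<lambda>i. \<pi> i \<cdot> w) I"
      have fi: "f i \<in> Hom T C (X i)" if "i \<in> I" for i
          using comp[OF w \<pi>(1)] that by (simp add: f_def)
      have sub: "{i\<in>I. f i \<noteq> Zer T C (X i)} \<subseteq> F"
      proof
        fix i assume i: "i \<in> {i\<in>I. f i \<noteq> Zer T C (X i)}"
        show "i \<in> F"
        proof (rule ccontr)
          assume n: "i \<notin> F"
          then have "\<pi> i \<cdot> w = Zer T C (X i)"
            using i F(1) \<pi>(3) by (intro F(3) \<pi>(1)) auto
          then show False using i by (auto simp: f_def)
        qed
      qed
      have fds: "f \<in> hom_direct_sum T C I X"
      proof -
        have "f \<in> (\<Pi>\<^sub>E i\<in>I. Hom T C (X i))" by (rule PiE_I) (use fi in \<open>auto simp: f_def\<close>)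
        then show ?thesis using finite_subset[OF sub F(2)] by (simp add: hom_direct_sum_def)
      qed
      interpret K: comm_group "hom_group T P P" using hom_comm_group Pob by blast
      \<comment> \<open>\<open>?e\<close> is the projector of \<open>P\<close> onto the summands in
        \<open>F\<close>. Since \<open>1 - ?e\<close> vanishes on these, \<open>w\<close> equals
        \<open>?e \<cdot> w\<close>, a finite sum of components.\<close>
      let ?e = "finprod (hom_group T P P) (\<lambda>i. \<iota> i \<cdot> \<pi> i) F"
      have ii: "\<iota> i \<cdot> \<pi> i \<in> Hom T P P" if "i \<in> F" for i using comp \<pi>(1) inj that F(1) by blast
      have e: "?e \<in> Hom T P P" by (rule finprod_in[OF Pob Pob ii])
      have ei: "?e \<cdot> \<iota> j = \<iota> j" if j: "j \<in> F" for j
      proof -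
        have jI: "j \<in> I" using F(1) j by blast
        interpret H: comm_group "hom_group T (X j) P" using hom_comm_group Xob[OF jI] Pob by blast
        have t: "(\<iota> i \<cdot> \<pi> i) \<cdot> \<iota> j = (if j = i then \<iota> i else Zer T (X j) P)" if i: "i \<in> F" for i
        proof -
          have iI: "i \<in> I" using F(1) i by blast
          have "(\<iota> i \<cdot> \<pi> i) \<cdot> \<iota> j = \<iota> i \<cdot> (\<pi> i \<cdot> \<iota> j)"
              using comp_assoc[OF inj[OF jI] \<pi>(1)[OF iI] inj[OF iI]] by simp
          then show ?thesis
            using \<pi>(2)[OF jI] \<pi>(3)[OF jI iI] comp_idn_right[OF inj[OF iI]] comp_zer_right[OF inj[OF
                iI] Xob[OF jI]] by auto
        qed
        have "?e \<cdot> \<iota> j = finprod (hom_group T (X j) P) (\<lambda>i. (\<iota> i \<cdot> \<pi> i) \<cdot> \<iota> j) F"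
          by (rule finprod_comp[OF F(2) Pob ii inj[OF jI]])
        also have "\<dots> = finprod (hom_group T (X j) P) (\<lambda>i. if j = i then (if i
            = j then \<iota> i else Zer T (X j) P) else \<one>\<^bsub>hom_group T (X j) P\<^esub>) F"
          by (rule H.finprod_cong') (use t inj[OF jI] zer_in[OF Xob[OF jI] Pob] in \<open>auto simp:
              hom_group_def\<close>)
        also have "\<dots> = (if j = j then \<iota> j else Zer T (X j) P)"
          by (rule H.finprod_singleton) (use F(2) j inj[OF jI] zer_in[OF Xob[OF jI] Pob] in \<open>auto
              simp: hom_group_def\<close>)
        finally show ?thesis by simp
      qed
      let ?d = "Add T (Idn T P) (Neg T ?e)"
      have d: "?d \<in> Hom T P P" using add_in[OF idn[OF Pob] neg_in[OF e]] .
      have "?d \<cdot> \<iota> j = Zer T (X j) P" if "j \<in> F" for j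
      proof -
        have jI: "j \<in> I" using F(1) that by blast
        show ?thesis
          using comp_add_left[OF inj[OF jI] idn[OF Pob] neg_in[OF e]] comp_neg_left[OF inj[OF jI] e]
              ei[OF that]
            comp_idn_left[OF inj[OF jI]] add_neg[OF inj[OF jI]] by simp
      qed
      then have "?d \<cdot> w = Zer T C P" using F(3)[OF d] by blast
      then have "Add T w (Neg T (?e \<cdot> w)) = Zer T C P"
        using comp_add_left[OF w idn[OF Pob] neg_in[OF e]] comp_neg_left[OF w e] comp_idn_left[OF w]
            by simp
      then have "w = ?e \<cdot> w" using diff_zer_eq[OF w comp[OF w e]] by simp
      also have "\<dots> = finprod (hom_group T C P) (\<lambda>i. (\<iota> i \<cdot> \<pi> i) \<cdot> w) F"
        by (rule finprod_comp[OF F(2) Pob ii w])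
      also have "\<dots> = ?\<Phi> f"
      proof (rule G.finprod_mono_neutral_cong_right[OF F(2) sub])
        have s: "(\<iota> i \<cdot> \<pi> i) \<cdot> w = \<iota> i \<cdot> f i" if "i \<in> F" for i
          using comp_assoc[OF w \<pi>(1)[of i] inj[of i]] that F(1) by (auto simp: f_def)
        show "(\<iota> i \<cdot> \<pi> i) \<cdot> w = \<one>\<^bsub>hom_group T C P\<^esub>" if "i \<in> F - {i \<in> I. f i \<noteq> Zer T C (X i)}" for i
          using s[of i] that F(1) comp_zer_right[OF inj[of i] C] by (auto simp: hom_group_def)
        show "(\<iota> i \<cdot> \<pi> i) \<cdot> w = \<iota> i \<cdot> f i" if "i \<in> {i \<in> I. f i \<noteq> Zer T C (X i)}" for i
          using s[of i] that sub by blast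
        show "(\<lambda>i. (\<iota> i \<cdot> \<pi> i) \<cdot> w) \<in> F \<rightarrow> carrier (hom_group T C P)"
          using comp[OF w ii] by (auto simp: hom_group_def)
      qed
      finally show "w \<in> ?\<Phi> ` hom_direct_sum T C I X" using fds by blast
    qed
  qed
qed

end

section \<open>Triangulated categories with coproducts\<close>

context triangulated_category
begin

lemma is_coproduct_sh:
  assumes P: "is_coproduct T I X P \<iota>"
  shows "is_coproduct T I (\<lambda>i. Sh n (X i)) (Sh n P) (\<lambda>i. Sm n (\<iota> i))"
  unfolding is_coproduct_def
proof (intro conjI ballI allI impI)
  note Pob = is_coproduct_ob[OF P] and Xob = is_coproduct_summand[OF P]
      and inj = is_coproduct_inj[OF P]
  show "Sh n P \<in> Ob T" using sh_in[OF Pob] .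
  show "Sh n (X i) \<in> Ob T" "Sm n (\<iota> i) \<in> Hom T (Sh n (X i)) (Sh n P)" if "i \<in> I" for i
    using sh_in[OF Xob[OF that]] sm_in[OF inj[OF that]] by auto
  fix Y g assume Y: "Y \<in> Ob T" and g: "\<forall>i\<in>I. g i \<in> Hom T (Sh n (X i)) Y"
  have g': "Sm (- n) (g i) \<in> Hom T (X i) (Sh (- n) Y)" if "i \<in> I" for i
    using sm_in[of "g i" _ _ "- n"] g that sh_back(1)[OF Xob[OF that]] by metis
  from is_coproductE[OF P sh_in[OF Y, of "- n"] g']
  obtain h where h: "h \<in> Hom T P (Sh (- n) Y)" "\<And>i. i \<in> I \<Longrightarrow> h \<cdot> \<iota> i = Sm (- n) (g i)" by blast
  have hn: "Sm n h \<in> Hom T (Sh n P) Y" using sm_in[OF h(1), of n] sh_back(2)[OF Y] by simp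
  show "\<exists>!h. h \<in> Hom T (Sh n P) Y \<and> (\<forall>i\<in>I. h \<cdot> Sm n (\<iota> i) = g i)"
  proof (rule ex1I[of _ "Sm n h"], intro conjI ballI hn)
    fix i assume i: "i \<in> I"
    have "Sm n h \<cdot> Sm n (\<iota> i) = Sm n (h \<cdot> \<iota> i)" using sm_comp[OF inj[OF i] h(1)] by simp
    then show "Sm n h \<cdot> Sm n (\<iota> i) = g i" using h(2)[OF i] sm_back(2)[OF hom_mor] g i by metis
  next
    fix k assume k: "k \<in> Hom T (Sh n P) Y \<and> (\<forall>i\<in>I. k \<cdot> Sm n (\<iota> i) = g i)"
    then have k': "Sm (- n) k \<in> Hom T P (Sh (- n) Y)"
      using sm_in[of k _ _ "- n"] sh_back(1)[OF Pob] by metis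
    have "Sm (- n) k \<cdot> \<iota> i = h \<cdot> \<iota> i" if i: "i \<in> I" for i
    proof -
      have "Sm (- n) (k \<cdot> Sm n (\<iota> i)) = Sm (- n) k \<cdot> \<iota> i"
        using sm_comp[OF sm_in[OF inj[OF i]], of k] k sm_back(1)[OF hom_mor[OF inj[OF i]]] by metis
      then show ?thesis using k h(2)[OF i] i by simp
    qed
    then have "Sm (- n) k = h" using is_coproduct_eqI[OF P k' h(1)] by blast
    then show "k = Sm n h" using sm_back(2)[OF hom_mor] k by metis
  qed
qed

end

locale cocomplete_triangulated_category = triangulated_category T
  for T :: "('o, 'm, 'z) tricat_scheme" +
  fixes \<kappa> :: "'k rel"
  assumes size: "size_bound \<kappa>" and coproducts: "has_coproducts \<kappa> T"
begin

abbreviation Cpt where "Cpt \<equiv> compact_objects \<kappa> T"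

lemma small_index_small: "small_index \<kappa> I \<Longrightarrow> small \<kappa> I"
  by (simp add: small_index_def)

lemma compact_sh:
  assumes C: "C \<in> Cpt" shows "Sh n C \<in> Cpt"
proof (rule compactI[OF sh_in[OF compact_ob[OF C]]])
  fix I :: "'k set" and X P \<iota> w
  assume I: "small_index \<kappa> I" and P: "is_coproduct T I X P \<iota>" and w: "w \<in> Hom T (Sh n C) P"
  note inj = is_coproduct_inj[OF P]
  have w': "Sm (- n) w \<in> Hom T C (Sh (- n) P)"
    using sm_in[OF w, of "- n"] sh_back(1)[OF compact_ob[OF C]] by simp
  obtain F where F: "finite F" "F \<subseteq> I"
    "\<And>Y v. v \<in> Hom T (Sh (- n) P) Y \<Longrightarrow> (\<And>i. i \<in> F \<Longrightarrow> v \<cdot> Sm (- n) (\<iota> i) = Zer T (Sh (- n) (X i)) Y) \<Longrightarrow>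
      v \<cdot> Sm (- n) w = Zer T C Y"
    using compact_support[OF C size small_index_small[OF I] is_coproduct_sh[OF P] w'] by blast
  show "\<exists>F\<subseteq>I. finite F \<and> (\<forall>Y. \<forall>v\<in>Hom T P Y. (\<forall>i\<in>F. v \<cdot> \<iota> i = Zer T (X i) Y)
      \<longrightarrow> v \<cdot> w = Zer T (Sh n C) Y)"
  proof (intro exI[of _ F] conjI F(1,2) allI ballI impI)
    fix Y v assume v: "v \<in> Hom T P Y" and 0: "\<forall>i\<in>F. v \<cdot> \<iota> i = Zer T (X i) Y"
    have "Sm (- n) v \<cdot> Sm (- n) w = Zer T C (Sh (- n) Y)"
    proof (rule F(3)[OF sm_in[OF v]])
      fix i assume i: "i \<in> F"
      then have ii: "\<iota> i \<in> Hom T (X i) P" using inj F(2) by blast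
      show "Sm (- n) v \<cdot> Sm (- n) (\<iota> i) = Zer T (Sh (- n) (X i)) (Sh (- n) Y)"
        using sm_comp[OF ii v, of "- n"] 0 i sm_zer hom_ob[OF ii] hom_ob[OF v] by simp
    qed
    then have "Sm (- n) (v \<cdot> w) = Zer T (Sh (- n) (Sh n C)) (Sh (- n) Y)"
      using sm_comp[OF w v] sh_back(1)[OF compact_ob[OF C]] by simp
    then show "v \<cdot> w = Zer T (Sh n C) Y" using sm_eq_zer[OF comp[OF w v]] by simp
  qed
qed

text \<open>Supports take the place of the five lemma: once the summands met by
  \<open>w \<cdot> g\<close> are discarded, \<open>w\<close> factors through the suspension of
  \<open>C\<close>, which meets only finitely many more.\<close>

lemma compact_cone:
  assumes t: "(f, g, h) \<in> Tri T" and f: "f \<in> Hom T C D" and g: "g \<in> Hom T D E"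
    and C: "C \<in> Cpt" and D: "D \<in> Cpt"
  shows "E \<in> Cpt"
proof (rule compactI)
  have h: "h \<in> Hom T E (Sus T C)" using triE[OF t] f g hom_dom_cod by metis
  show "E \<in> Ob T" using hom_ob g by blast
  fix I :: "'k set" and X P \<iota> w
  assume I: "small_index \<kappa> I" and P: "is_coproduct T I X P \<iota>" and w: "w \<in> Hom T E P"
  note Pob = is_coproduct_ob[OF P] and inj = is_coproduct_inj[OF P]
  obtain F where F: "finite F" "F \<subseteq> I"
    "\<And>Y v. v \<in> Hom T P Y \<Longrightarrow> (\<And>i. i \<in> F \<Longrightarrow> v \<cdot> \<iota> i = Zer T (X i) Y) \<Longrightarrow> v \<cdot> (w \<cdot> g) = Zer T D Y"
    using compact_support[OF D size small_index_small[OF I] P comp[OF g w]] by blast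
  \<comment> \<open>The endomorphism \<open>e\<close> kills the summands in \<open>F\<close> and
    fixes the others, so \<open>v \<cdot> e = v\<close> for each \<open>v\<close> that vanishes on
    \<open>F\<close>.\<close>
  let ?k = "\<lambda>i. if i \<in> F then Zer T (X i) P else \<iota> i"
  have "?k i \<in> Hom T (X i) P" if "i \<in> I" for i using inj[OF that] zer_in is_coproduct_summand[OF P
      that] Pob by simp
  then obtain e where e: "e \<in> Hom T P P"
      "\<And>i. i \<in> I \<Longrightarrow> e \<cdot> \<iota> i = ?k i" using is_coproductE[OF P Pob, of ?k] by blast
  have "e \<cdot> (w \<cdot> g) = Zer T D P" using F(2) e(2) by (intro F(3)[OF e(1)]) auto
  then have "(e \<cdot> w) \<cdot> g = Zer T D P" using comp_assoc[OF g w e(1)] by simp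
  from tri_coexact2[OF t g h comp[OF w e(1)] this]
  obtain u where u: "u \<in> Hom T (Sus T C) P" "e \<cdot> w = u \<cdot> h" .
  have "Sus T C \<in> Cpt" using compact_sh[OF C, of 1] by (simp add: sh_1)
  from compact_support[OF this size small_index_small[OF I] P u(1)]
  obtain F' where F': "finite F'" "F' \<subseteq> I"
    "\<And>Y v. v \<in> Hom T P Y \<Longrightarrow> (\<And>i. i \<in> F' \<Longrightarrow> v \<cdot> \<iota> i = Zer T (X i) Y) \<Longrightarrow> v \<cdot> u = Zer T (Sus T C) Y"
        by blast
  show "\<exists>F\<subseteq>I. finite F \<and> (\<forall>Y. \<forall>v\<in>Hom T P Y. (\<forall>i\<in>F. v \<cdot> \<iota> i = Zer T (X i) Y) \<longrightarrow> v \<cdot> w = Zer T E Y)"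
  proof (intro exI[of _ "F \<union> F'"] conjI allI ballI impI)
    show "F \<union> F' \<subseteq> I" "finite (F \<union> F')" using F F' by auto
    fix Y v assume v: "v \<in> Hom T P Y" and 0: "\<forall>i\<in>F \<union> F'. v \<cdot> \<iota> i = Zer T (X i) Y"
    have Y: "Y \<in> Ob T" using hom_ob v by blast
    have "v \<cdot> e = v"
    proof (rule is_coproduct_eqI[OF P comp[OF e(1) v] v])
      fix i assume i: "i \<in> I"
      have "(v \<cdot> e) \<cdot> \<iota> i = v \<cdot> ?k i" using comp_assoc[OF inj[OF i] e(1) v] e(2)[OF i] by simp
      then show "(v \<cdot> e) \<cdot> \<iota> i = v \<cdot> \<iota> i"
        using 0 comp_zer_right[OF v is_coproduct_summand[OF P i]] by auto
    qed
    then have "v \<cdot> w = v \<cdot> (u \<cdot> h)" using comp_assoc[OF w e(1) v] u(2) by simp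
    also have "\<dots> = (v \<cdot> u) \<cdot> h" using comp_assoc[OF h u(1) v] .
    also have "v \<cdot> u = Zer T (Sus T C) Y" using 0 by (intro F'(3)[OF v]) auto
    finally show "v \<cdot> w = Zer T E Y" using comp_zer_left[OF h Y] by simp
  qed
qed

text \<open>Makes \<open>C \<oplus> D\<close> compact, so that Hom^*(C, D) can be viewed inside
  End^*(C \<oplus> D).\<close>

lemma compact_biproduct:
  assumes C: "C \<in> Cpt" and D: "D \<in> Cpt" and E: "E \<in> Ob T"
    and i: "i \<in> Hom T C E" and j: "j \<in> Hom T D E" and p: "p \<in> Hom T E C" and q: "q \<in> Hom T E D"
    and s: "Add T (i \<cdot> p) (j \<cdot> q) = Idn T E"
  shows "E \<in> Cpt"
proof (rule compactI[OF E])
  fix I :: "'k set" and X P \<iota> w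
  assume I: "small_index \<kappa> I" and P: "is_coproduct T I X P \<iota>" and w: "w \<in> Hom T E P"
  obtain F where F: "finite F" "F \<subseteq> I"
    "\<And>Y v. v \<in> Hom T P Y \<Longrightarrow> (\<And>i. i \<in> F \<Longrightarrow> v \<cdot> \<iota> i = Zer T (X i) Y) \<Longrightarrow> v \<cdot> (w \<cdot> i) = Zer T C Y"
    using compact_support[OF C size small_index_small[OF I] P comp[OF i w]] by blast
  obtain F' where F': "finite F'" "F' \<subseteq> I"
    "\<And>Y v. v \<in> Hom T P Y \<Longrightarrow> (\<And>i. i \<in> F' \<Longrightarrow> v \<cdot> \<iota> i = Zer T (X i) Y) \<Longrightarrow> v \<cdot> (w \<cdot> j) = Zer T D Y"
    using compact_support[OF D size small_index_small[OF I] P comp[OF j w]] by blast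
  show "\<exists>F\<subseteq>I. finite F \<and> (\<forall>Y. \<forall>v\<in>Hom T P Y. (\<forall>i\<in>F. v \<cdot> \<iota> i = Zer T (X i) Y) \<longrightarrow> v \<cdot> w = Zer T E Y)"
  proof (intro exI[of _ "F \<union> F'"] conjI allI ballI impI)
    show "F \<union> F' \<subseteq> I" "finite (F \<union> F')" using F F' by auto
    fix Y v assume v: "v \<in> Hom T P Y" and 0: "\<forall>i\<in>F \<union> F'. v \<cdot> \<iota> i = Zer T (X i) Y"
    have Y: "Y \<in> Ob T" using hom_ob v by blast
    note vw = comp[OF w v]
    have a: "(v \<cdot> w) \<cdot> i = Zer T C Y"
      using F(3)[OF v] 0 comp_assoc[OF i w v] by simp
    have b: "(v \<cdot> w) \<cdot> j = Zer T D Y"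
      using F'(3)[OF v] 0 comp_assoc[OF j w v] by simp
    have "v \<cdot> w = (v \<cdot> w) \<cdot> Add T (i \<cdot> p) (j \<cdot> q)" using s comp_idn_right[OF vw] by simp
    also have "\<dots> = Add T ((v \<cdot> w) \<cdot> (i \<cdot> p)) ((v \<cdot> w) \<cdot> (j \<cdot> q))"
      by (rule comp_add_right[OF comp[OF p i] comp[OF q j] vw])
    also have "\<dots> = Add T (Zer T E Y) (Zer T E Y)"
      using comp_assoc[OF p i vw] comp_assoc[OF q j vw] a b comp_zer_left[OF p Y] comp_zer_left[OF q
          Y] by simp
    finally show "v \<cdot> w = Zer T E Y" using add_zer[OF zer_in[OF E Y]] by simp
  qed
qed

lemma orth_coproduct:
  assumes C: "C \<in> Cpt" and A: "small \<kappa> A" and P: "is_coproduct T A X P \<iota>"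
      and o: "\<And>i. i \<in> A \<Longrightarrow> orth C (X i)"
  shows "orth C P"
  unfolding orth_def
proof
  fix w assume w: "w \<in> Hom T C P"
  have Cob: "C \<in> Ob T" using compact_ob C .
  show "w = Zer T C P"
  proof (rule compact_induct[OF C size A P w, where Q = "\<lambda>w. w = Zer T C P"])
    fix i u assume "i \<in> A" "u \<in> Hom T C (X i)"
    then show "\<iota> i \<cdot> u = Zer T C P"
      using o comp_zer_right[OF is_coproduct_inj[OF P] Cob] unfolding orth_def by metis
  qed (use add_zer zer_in Cob is_coproduct_ob[OF P] in auto)
qed

lemma right_perp_localizing:
  assumes K: "K \<subseteq> Cpt" and sh: "\<And>C. C \<in> K \<Longrightarrow> Sus T C \<in> K" "\<And>C. C \<in> K \<Longrightarrow> Sh (- 1) C \<in> K"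
  shows "localizing \<kappa> T {Y \<in> Ob T. \<forall>C\<in>K. orth C Y}"
proof (rule localizingI)
  show "X \<in> {Y \<in> Ob T. \<forall>C\<in>K. orth C Y}" if "zero_object T X" for X
    using that zero_object_hom_to zero_object_ob unfolding orth_def by blast
  show "X \<in> {Y \<in> Ob T. \<forall>C\<in>K. orth C Y} \<longleftrightarrow> Sus T X \<in> {Y \<in> Ob T. \<forall>C\<in>K. orth C Y}"
      if X: "X \<in> Ob T" for X
  proof -
    have Kob: "C \<in> Ob T" if "C \<in> K" for C using K compact_ob that by blast
    have e: "orth (Sus T C) (Sus T X) \<longleftrightarrow> orth C X" if "C \<in> K" for C
      using orth_sh[OF Kob[OF that] X, of 1] by (simp add: sh_1)
    have "(\<forall>C\<in>K. orth C X) \<longleftrightarrow> (\<forall>C\<in>K. orth C (Sus T X))"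
    proof safe
      fix C assume a: "\<forall>C\<in>K. orth C X" and C: "C \<in> K"
      show "orth C (Sus T X)" using e[OF sh(2)[OF C]] a sh(2)[OF C] sh_back(2)[OF Kob[OF C], of 1]
          by (simp add: sh_1)
    next
      fix C assume a: "\<forall>C\<in>K. orth C (Sus T X)" and C: "C \<in> K"
      show "orth C X" using e[OF C] a sh(1)[OF C] by simp
    qed
    then show ?thesis using X sus_in by simp
  qed
  show "Y \<in> {Y \<in> Ob T. \<forall>C\<in>K. orth C Y}" if "(f, g, h) \<in> Tri T" "f \<in> Hom T X Y" "g \<in> Hom T Y Z"
      "X \<in> {Y \<in> Ob T. \<forall>C\<in>K. orth C Y}" "Z \<in> {Y \<in> Ob T. \<forall>C\<in>K. orth C Y}" for f g h X Y Z
    using that hom_ob orth_mid_right[OF that(1-3)] by blast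
  show "P \<in> {Y \<in> Ob T. \<forall>C\<in>K. orth C Y}" if "small_index \<kappa> I" "is_coproduct T I X P \<iota>"
      "\<And>i. i \<in> I \<Longrightarrow> X i \<in> {Y \<in> Ob T. \<forall>C\<in>K. orth C Y}" for I :: "'k set" and X P \<iota>
    using orth_coproduct[OF _ small_index_small[OF that(1)] that(2)] that(3) K is_coproduct_ob[OF
        that(2)] by blast
qed auto

section \<open>Coning off small sets of morphisms\<close>

text \<open>The set of morphisms is its own index set: the summand at \<open>y\<close> is the domain
  of \<open>y\<close>.\<close>

lemma cone_off:
  assumes X: "X \<in> Ob T" and N: "small \<kappa> N" "\<And>y. y \<in> N \<Longrightarrow> y \<in> Hom T (Dom T y) X"
  obtains P \<iota> m Y g h where "is_coproduct T N (Dom T) P \<iota>" "m \<in> Hom T P X" "\<forall>y\<in>N. m \<cdot> \<iota> y = y"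
    "(m, g, h) \<in> Tri T" "g \<in> Hom T X Y" "h \<in> Hom T Y (Sus T P)"
proof -
  obtain P \<iota> where P: "is_coproduct T N (Dom T) P \<iota>"
    using has_coproductsE[OF coproducts size N(1), of "Dom T"] hom_ob N(2) by blast
  obtain m where m: "m \<in> Hom T P X" "\<And>y. y \<in> N \<Longrightarrow> m \<cdot> \<iota> y = y"
    using is_coproductE[OF P X, of "\<lambda>y. y"] N(2) by blast
  obtain g h where t: "(m, g, h) \<in> Tri T" using tri_ex[OF hom_mor[OF m(1)]] by blast
  have "g \<in> Hom T X (Cod T g)" "h \<in> Hom T (Cod T g) (Sus T P)"
    using tri_wf[OF t] hom_dom_cod[OF m(1)] by auto
  moreover have "\<forall>y\<in>N. m \<cdot> \<iota> y = y" using m(2) by blast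
  ultimately show ?thesis using that[OF P m(1) _ t] by blast
qed

lemma cone_off_kills:
  assumes "is_coproduct T N (Dom T) P \<iota>" "m \<in> Hom T P X" "\<forall>y\<in>N. m \<cdot> \<iota> y = y"
    "(m, g, h) \<in> Tri T" "g \<in> Hom T X Y" "y \<in> N"
  shows "g \<cdot> y = Zer T (Dom T y) Y"
proof -
  note ii = is_coproduct_inj[OF assms(1,6)]
  have "g \<cdot> y = (g \<cdot> m) \<cdot> \<iota> y" using comp_assoc[OF ii assms(2,5)] assms(3,6) by simp
  then show ?thesis using tri_zero[OF assms(4,2,5)] comp_zer_left[OF ii] hom_ob(2)[OF assms(5)]
      by simp
qed

text \<open>\<open>C\<close> meets finitely many summands, so every morphism from \<open>C\<close>
  killed by \<open>g\<close> is a finite sum of morphisms \<open>y \<cdot> u\<close> with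
  \<open>y\<close> in \<open>N\<close>. If \<open>N\<close> is closed under these operations, the
  morphism lies in \<open>N\<close> itself.\<close>

lemma cone_off_kernel:
  assumes P: "is_coproduct T N (Dom T) P \<iota>" and m: "m \<in> Hom T P X" "\<forall>y\<in>N. m \<cdot> \<iota> y = y"
    and t: "(m, g, h) \<in> Tri T" and g: "g \<in> Hom T X Y" and N: "small \<kappa> N"
    and C: "C \<in> Cpt" and z: "z \<in> Hom T C X" "g \<cdot> z = Zer T C Y"
    and zer: "Q (Zer T C X)"
    and add: "\<And>a b. a \<in> Hom T C X \<Longrightarrow> b \<in> Hom T C X \<Longrightarrow> Q a \<Longrightarrow> Q b \<Longrightarrow> Q (Add T a b)"
    and N': "\<And>y u. y \<in> N \<Longrightarrow> u \<in> Hom T C (Dom T y) \<Longrightarrow> Q (y \<cdot> u)"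
  shows "Q z"
proof -
  from tri_exact[OF t m(1) g z] obtain w where w: "w \<in> Hom T C P" "z = m \<cdot> w" .
  have "Q (m \<cdot> w)"
  proof (rule compact_induct[OF C size N P w(1)])
    show "Q (m \<cdot> Zer T C P)" using zer comp_zer_right[OF m(1)] compact_ob[OF C] by simp
    show "Q (m \<cdot> Add T a b)" if "a \<in> Hom T C P" "b \<in> Hom T C P" "Q (m \<cdot> a)" "Q (m \<cdot> b)" for a b
      using comp_add_right[OF that(1,2) m(1)] add comp[OF _ m(1)] that by simp
    show "Q (m \<cdot> (\<iota> y \<cdot> u))" if "y \<in> N" "u \<in> Hom T C (Dom T y)" for y u
      using comp_assoc[OF that(2) is_coproduct_inj[OF P that(1)] m(1)] m(2) that(1) N'[OF that]
          by simp
  qed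
  then show ?thesis using w(2) by simp
qed

section \<open>Sequential homotopy colimits\<close>

primrec trans_map :: "(nat \<Rightarrow> 'o) \<Rightarrow> (nat \<Rightarrow> 'm) \<Rightarrow> nat \<Rightarrow> nat \<Rightarrow> 'm" where
  "trans_map X f 0 n = Idn T (X n)"
| "trans_map X f (Suc k) n = trans_map X f k (Suc n) \<cdot> f n"

text \<open>The map \<open>\<iota>\<^sub>n + \<iota>\<^sub>n\<^sub>+\<^sub>1 f\<^sub>n + \<dots>\<close> with \<open>k\<close> summands. These are the components of a partial
  inverse of \<open>1 - \<sigma>\<close>, where \<open>\<sigma>\<close> is the shift map of the telescope.\<close>

primrec geometric_map :: "(nat \<Rightarrow> 'o) \<Rightarrow> (nat \<Rightarrow> 'm) \<Rightarrow> 'o \<Rightarrow> (nat \<Rightarrow> 'm) \<Rightarrow> nat \<Rightarrow> nat \<Rightarrow> 'm" where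
  "geometric_map X f P \<iota> 0 n = Zer T (X n) P"
| "geometric_map X f P \<iota> (Suc k) n = Add T (\<iota> n) (geometric_map X f P \<iota> k (Suc n) \<cdot> f n)"

lemma finite_nat_boundE:
  assumes "finite (F :: nat set)" obtains N where "N > n" "\<And>i. i \<in> F \<Longrightarrow> i < N"
proof -
  have k: "\<And>i. i \<in> F \<Longrightarrow> i \<le> k" if "\<forall>i\<in>F. i \<le> k" for k using that by blast
  obtain k where "\<forall>i\<in>F. i \<le> k" using assms unfolding finite_nat_set_iff_bounded_le ..
  note k = k[OF this]
  show ?thesis
  proof (rule that[of "Suc (max k n)"])
    show "n < Suc (max k n)" by linarith
    show "i < Suc (max k n)" if "i \<in> F" for i using k[OF that] by linarith
  qed
qed

text \<open>The fourth clause is an induction principle equivalent to the statement that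
  \<open>z\<close> vanishes at a finite stage if it vanishes in \<open>J\<close>. The last clause is the existence
  part of the universal property of a colimit; uniqueness fails for homotopy colimits.\<close>

definition hocolim :: "(nat \<Rightarrow> 'o) \<Rightarrow> (nat \<Rightarrow> 'm) \<Rightarrow> 'o \<Rightarrow> (nat \<Rightarrow> 'm) \<Rightarrow> bool" where
  "hocolim X f J j \<longleftrightarrow> (\<forall>n. j n \<in> Hom T (X n) J) \<and> (\<forall>n. j (Suc n) \<cdot> f n = j n) \<and>
    (\<forall>C\<in>Cpt. \<forall>y\<in>Hom T C J. \<exists>n. \<exists>z\<in>Hom T C (X n). y = j n \<cdot> z) \<and>
    (\<forall>C\<in>Cpt. \<forall>n. \<forall>z\<in>Hom T C (X n). \<forall>Q. j n \<cdot> z = Zer T C J \<longrightarrow> (\<forall>m. Q m (Zer T C (X m))) \<longrightarrow>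
      (\<forall>m. \<forall>z\<in>Hom T C (X m). Q (Suc m) (f m \<cdot> z) \<longrightarrow> Q m z) \<longrightarrow> Q n z) \<and>
    (\<forall>L e. (\<forall>n. e n \<in> Hom T (X n) L) \<longrightarrow> (\<forall>n. e (Suc n) \<cdot> f n = e n) \<longrightarrow>
      (\<exists>e'\<in>Hom T J L. \<forall>n. e' \<cdot> j n = e n))"

lemma hocolim_in: "hocolim X f J j \<Longrightarrow> j n \<in> Hom T (X n) J"
  and hocolim_compat: "hocolim X f J j \<Longrightarrow> j (Suc n) \<cdot> f n = j n"
  unfolding hocolim_def by blast+

lemma hocolim_lift:
  assumes "hocolim X f J j" "C \<in> Cpt" "y \<in> Hom T C J"
  obtains n z where "z \<in> Hom T C (X n)" "y = j n \<cdot> z"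
  using assms unfolding hocolim_def by blast

lemma hocolim_kernel:
  assumes "hocolim X f J j" "C \<in> Cpt" "z \<in> Hom T C (X n)" "j n \<cdot> z = Zer T C J"
    "\<And>m. Q m (Zer T C (X m))" "\<And>m z. z \<in> Hom T C (X m) \<Longrightarrow> Q (Suc m) (f m \<cdot> z) \<Longrightarrow> Q m z"
  shows "Q n z"
  using assms(1)[unfolded hocolim_def, THEN conjunct2, THEN conjunct2, THEN conjunct2, THEN
      conjunct1,
      rule_format, OF assms(2-4), of Q] assms(5,6) by blast

lemma hocolim_weak_universal:
  assumes "hocolim X f J j" "\<And>n. e n \<in> Hom T (X n) L" "\<And>n. e (Suc n) \<cdot> f n = e n"
  obtains e' where "e' \<in> Hom T J L" "\<And>n. e' \<cdot> j n = e n"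
  using assms(1)[unfolded hocolim_def, THEN conjunct2, THEN conjunct2, THEN conjunct2, THEN
      conjunct2,
      rule_format, of e L] assms(2,3) that by blast

text \<open>The colimit is the cone of \<open>1 - \<sigma>\<close> on the coproduct. Compact objects
  meet only finitely many summands, and there a finite geometric series is a left inverse of
  \<open>1 - \<sigma>\<close>.\<close>

lemma ex_hocolim:
  fixes X :: "nat \<Rightarrow> 'o" and f :: "nat \<Rightarrow> 'm"
  assumes f: "\<And>n. f n \<in> Hom T (X n) (X (Suc n))"
  shows "\<exists>J j. hocolim X f J j"
proof -
  have Xob: "X n \<in> Ob T" for n using hom_ob f by blast
  have sm: "small \<kappa> (UNIV :: nat set)" by (rule small_nat[OF size])
  obtain P \<iota> where P: "is_coproduct T UNIV X P \<iota>"
    by (rule has_coproductsE[OF coproducts size sm]) (use Xob in auto)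
  have i: "\<iota> n \<in> Hom T (X n) P" for n using is_coproduct_inj[OF P] by simp
  note Pob = is_coproduct_ob[OF P]
  have ifn: "\<iota> (Suc n) \<cdot> f n \<in> Hom T (X n) P" for n using comp[OF f i] .
  obtain \<sigma> where \<sigma>: "\<sigma> \<in> Hom T P P" "\<And>n. \<sigma> \<cdot> \<iota> n = \<iota> (Suc n) \<cdot> f n"
    using is_coproductE[OF P Pob, of "\<lambda>n. \<iota> (Suc n) \<cdot> f n"] ifn by (metis UNIV_I)
  define d where "d = Add T (Idn T P) (Neg T \<sigma>)"
  have d: "d \<in> Hom T P P" unfolding d_def using add_in[OF idn[OF Pob] neg_in[OF \<sigma>(1)]] .
  have dv: "(v \<cdot> d) \<cdot> \<iota> n = Add T (v \<cdot> \<iota> n) (Neg T ((v \<cdot> \<iota> (Suc n)) \<cdot> f n))"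
      if v: "v \<in> Hom T P Y" for v Y n
  proof -
    have "(v \<cdot> d) \<cdot> \<iota> n = v \<cdot> (d \<cdot> \<iota> n)" using comp_assoc[OF i d v] by simp
    also have "d \<cdot> \<iota> n = Add T (\<iota> n) (Neg T (\<iota> (Suc n) \<cdot> f n))"
      unfolding d_def using comp_add_left[OF i idn[OF Pob] neg_in[OF \<sigma>(1)]] comp_neg_left[OF i \<sigma>(1)]
          \<sigma>(2)
        comp_idn_left[OF i] by simp
    also have "v \<cdot> \<dots> = Add T (v \<cdot> \<iota> n) (Neg T (v \<cdot> (\<iota> (Suc n) \<cdot> f n)))"
      using comp_add_right[OF i neg_in[OF ifn] v] comp_neg_right[OF ifn v] by simp
    finally show ?thesis using comp_assoc[OF f i v] by simp
  qed
  obtain g h where t: "(d, g, h) \<in> Tri T" using tri_ex[OF hom_mor[OF d]] by blast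
  define J where "J = Cod T g"
  have g: "g \<in> Hom T P J" and h: "h \<in> Hom T J (Sus T P)"
    using tri_wf[OF t] hom_dom_cod[OF d] by (auto simp: J_def)
  have Job: "J \<in> Ob T" using hom_ob g by blast
  define j where "j n = g \<cdot> \<iota> n" for n
  have j: "j n \<in> Hom T (X n) J" for n unfolding j_def using comp[OF i g] .
  have jf: "j (Suc n) \<cdot> f n = j n" for n
  proof -
    have "Add T (j n) (Neg T (j (Suc n) \<cdot> f n)) = Zer T (X n) J"
      using dv[OF g, of n] tri_zero[OF t d g] comp_zer_left[OF i Job] by (simp add: j_def)
    from diff_zer_eq[OF j comp[OF f j] this] show ?thesis by (rule sym)
  qed
  let ?tr = "trans_map X f"
  have tr: "?tr k n \<in> Hom T (X n) (X (n + k))" for k n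
  proof (induction k arbitrary: n)
    case 0 then show ?case using idn[OF Xob] by simp
  next
    case (Suc k)
    show ?case using comp[OF f Suc.IH[of "Suc n"]] by simp
  qed
  have jtr: "j (n + k) \<cdot> ?tr k n = j n" for k n
  proof (induction k arbitrary: n)
    case 0 then show ?case using comp_idn_right[OF j] by simp
  next
    case (Suc k)
    have "j (n + Suc k) \<cdot> ?tr (Suc k) n = (j (Suc n + k) \<cdot> ?tr k (Suc n)) \<cdot> f n"
      using comp_assoc[OF f tr[of k "Suc n"] j] by simp
    then show ?case using Suc.IH[of "Suc n"] jf by simp
  qed
  \<comment> \<open>This map pushes the summands up to \<open>M\<close> forward to stage
    \<open>M\<close> and is zero on the later ones.\<close>
  have "\<exists>t. t \<in> Hom T P (X M) \<and> (\<forall>n\<le>M. t \<cdot> \<iota> n = ?tr (M - n) n)" for M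
  proof -
    let ?u = "\<lambda>n. if n \<le> M then ?tr (M - n) n else Zer T (X n) (X M)"
    have "?u n \<in> Hom T (X n) (X M)" for n
      using tr[where k = "M - n" and n = n] zer_in[OF Xob Xob] by (cases "n \<le> M") auto
    then show ?thesis using is_coproductE[OF P Xob, of ?u] by (metis UNIV_I)
  qed
  then obtain tt where tt: "\<And>M. tt M \<in> Hom T P (X M)"
      "\<And>M n. n \<le> M \<Longrightarrow> tt M \<cdot> \<iota> n = ?tr (M - n) n" by metis
  have d_inj: "w = Zer T C P" if C: "C \<in> Cpt" and w: "w \<in> Hom T C P" "d \<cdot> w = Zer T C P" for C w
  proof -
    obtain F where F: "finite F"
      "\<And>Y v v'. v \<in> Hom T P Y \<Longrightarrow> v' \<in> Hom T P Y \<Longrightarrow> (\<And>i. i \<in> F \<Longrightarrow> v \<cdot> \<iota> i = v' \<cdot> \<iota> i) \<Longrightarrow> v \<cdot> w = v' \<cdot> w"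
      using compact_support_eq[OF C size sm P w(1)] by metis
    obtain N where N: "\<And>i. i \<in> F \<Longrightarrow> i < N" by (rule finite_nat_boundE[OF F(1), of 0]) blast
    let ?b = "geometric_map X f P \<iota>"
    have b: "?b k n \<in> Hom T (X n) P" for k n
      by (induction k arbitrary: n) (use zer_in Xob Pob in \<open>auto intro!: add_in i intro: comp[OF
          f]\<close>)
    \<comment> \<open>The series is cut at \<open>N\<close>: summand \<open>n\<close> gets
      \<open>N - n\<close> terms, so that for \<open>n < N\<close> everything in
      \<open>v \<cdot> d\<close> cancels except the inclusion.\<close>
    obtain v where v: "v \<in> Hom T P P" "\<And>n. v \<cdot> \<iota> n = ?b (N - n) n"
      using is_coproductE[OF P Pob, of "\<lambda>n. ?b (N - n) n"] b by (metis UNIV_I)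
    have "(v \<cdot> d) \<cdot> w = Idn T P \<cdot> w"
    proof (rule F(2)[OF comp[OF d v(1)] idn[OF Pob]])
      fix n assume "n \<in> F"
      then have "N - n = Suc (N - Suc n)" using N Suc_diff_Suc by auto
      then have "(v \<cdot> d) \<cdot> \<iota> n = Add T (Add T (\<iota> n) (?b (N - Suc n) (Suc n) \<cdot> f n)) (Neg T (?b (N -
          Suc n) (Suc n) \<cdot> f n))"
        using dv[OF v(1), of n] v(2) by simp
      also have "\<dots> = \<iota> n"
        using add_assoc[OF i comp[OF f b] neg_in[OF comp[OF f b]]] add_neg[OF comp[OF f b]]
            add_zer[OF i] by simp
      finally show "(v \<cdot> d) \<cdot> \<iota> n = Idn T P \<cdot> \<iota> n" using comp_idn_left[OF i] by simp
    qed
    then have "w = v \<cdot> (d \<cdot> w)" using comp_assoc[OF w(1) d v(1)] comp_idn_left[OF w(1)] by simp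
    then show ?thesis using w(2) comp_zer_right[OF v(1)] compact_ob[OF C] by simp
  qed
  have lift: "\<exists>n. \<exists>z\<in>Hom T C (X n). y = j n \<cdot> z" if C: "C \<in> Cpt" and y: "y \<in> Hom T C J" for C y
  proof -
    note hy = comp[OF y h]
    have Cob: "C \<in> Ob T" using compact_ob[OF C] .
    have sd: "SusM T d \<in> Hom T (Sus T P) (Sus T P)" using sus_hom[OF d] .
    have 0: "SusM T d \<cdot> (h \<cdot> y) = Zer T C (Sus T P)"
      using comp_assoc[OF y h sd] tri_zero3[OF t d h] comp_zer_left[OF y sus_in[OF Pob]] by simp
    \<comment> \<open>Injectivity of \<open>d\<close> on compact objects makes the boundary
      \<open>h \<cdot> y\<close> vanish, so \<open>y\<close> comes from the coproduct.\<close>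
    let ?w = "Sm (- 1) (h \<cdot> y)"
    have w: "?w \<in> Hom T (Sh (- 1) C) P" using sm_in[OF hy, of "-1"] sh_back(1)[OF Pob, of 1]
        by (simp add: sh_1)
    have "Sm (- 1) (SusM T d) = d" using sm_back(1)[OF hom_mor[OF d], of 1] by (simp add: sm_1)
    then have "d \<cdot> ?w = Zer T (Sh (- 1) C) P"
      using sm_comp[OF hy sd, of "-1"] 0 sm_zer[OF Cob sus_in[OF Pob], of "-1"] sh_back(1)[OF Pob,
          of 1]
      by (simp add: sh_1)
    then have "?w = Zer T (Sh (- 1) C) P" using d_inj[OF compact_sh[OF C] w] by simp
    then have "?w = Zer T (Sh (- 1) C) (Sh (- 1) (Sus T P))"
        using sh_back(1)[OF Pob, of 1] by (simp add: sh_1)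
    then have "h \<cdot> y = Zer T C (Sus T P)" using sm_eq_zer[OF hy] by blast
    from tri_exact2[OF t g h y this] obtain z where z: "z \<in> Hom T C P" "y = g \<cdot> z" .
    obtain F where F: "finite F"
      "\<And>Y v v'. v \<in> Hom T P Y \<Longrightarrow> v' \<in> Hom T P Y \<Longrightarrow> (\<And>i. i \<in> F \<Longrightarrow> v \<cdot> \<iota> i = v' \<cdot> \<iota> i) \<Longrightarrow> v \<cdot> z = v' \<cdot> z"
      using compact_support_eq[OF C size sm P z(1)] by metis
    obtain N where N: "\<And>i. i \<in> F \<Longrightarrow> i < N" by (rule finite_nat_boundE[OF F(1), of 0]) blast
    \<comment> \<open>On the summands up to \<open>N\<close> the maps \<open>g\<close> and
      \<open>j N \<cdot> tt N\<close> agree, and \<open>z\<close> meets no others.\<close>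
    have "g \<cdot> z = (j N \<cdot> tt N) \<cdot> z"
    proof (rule F(2)[OF g comp[OF tt(1) j]])
      fix n assume "n \<in> F"
      then have n: "n \<le> N" using N less_imp_le by blast
      have "(j N \<cdot> tt N) \<cdot> \<iota> n = j (n + (N - n)) \<cdot> ?tr (N - n) n"
        using comp_assoc[OF i tt(1) j, symmetric] tt(2)[OF n] n by simp
      then show "g \<cdot> \<iota> n = (j N \<cdot> tt N) \<cdot> \<iota> n" using jtr by (simp add: j_def)
    qed
    then have "y = j N \<cdot> (tt N \<cdot> z)" using z comp_assoc[OF z(1) tt(1) j] by simp
    then show ?thesis using comp[OF z(1) tt(1)] by blast
  qed
  have die: "Q n z" if C: "C \<in> Cpt" and z: "z \<in> Hom T C (X n)" "j n \<cdot> z = Zer T C J"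
    and Q0: "\<forall>m. Q m (Zer T C (X m))" and QS: "\<forall>m. \<forall>z\<in>Hom T C (X m). Q (Suc m) (f m \<cdot> z)
        \<longrightarrow> Q m z" for C n z Q
  proof -
    have Cob: "C \<in> Ob T" using compact_ob[OF C] .
    have iz: "\<iota> n \<cdot> z \<in> Hom T C P" using comp[OF z(1) i] .
    have "g \<cdot> (\<iota> n \<cdot> z) = Zer T C J" using comp_assoc[OF z(1) i g] z(2) by (simp add: j_def)
    from tri_exact[OF t d g iz this] obtain w where w: "w \<in> Hom T C P" "\<iota> n \<cdot> z = d \<cdot> w" .
    obtain F where F: "finite F"
      "\<And>Y v. v \<in> Hom T P Y \<Longrightarrow> (\<And>i. i \<in> F \<Longrightarrow> v \<cdot> \<iota> i = Zer T (X i) Y) \<Longrightarrow> v \<cdot> w = Zer T C Y"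
      using compact_support[OF C size sm P w(1)] by metis
    obtain M where M: "M > n" "\<And>i. i \<in> F \<Longrightarrow> i < M" by (rule finite_nat_boundE[OF F(1)]) blast
    \<comment> \<open>The cancellation on summand \<open>i\<close> uses the value of
      \<open>tt M\<close> on summand \<open>Suc i\<close>, hence the strict bound
      \<open>i < M\<close> in the choice of \<open>M\<close>.\<close>
    have "(tt M \<cdot> d) \<cdot> w = Zer T C (X M)"
    proof (rule F(2)[OF comp[OF d tt(1)]])
      fix i assume "i \<in> F"
      then have iM: "i < M" using M by blast
      then have "?tr (M - i) i = ?tr (M - Suc i) (Suc i) \<cdot> f i"
          using Suc_diff_Suc[OF iM] by (metis trans_map.simps(2))
      then have "(tt M \<cdot> d) \<cdot> \<iota> i = Add T (tt M \<cdot> \<iota> i) (Neg T (tt M \<cdot> \<iota> i))"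
        using dv[OF tt(1), of M i] tt(2)[of i M] tt(2)[of "Suc i" M] iM by simp
      then show "(tt M \<cdot> d) \<cdot> \<iota> i = Zer T (X i) (X M)"
          using add_neg[OF comp[OF assms(1)]] comp tt(1) \<open>\<And>n. \<iota> n \<in> Hom T (X n) P\<close> add_neg by metis
    qed
    then have "tt M \<cdot> (\<iota> n \<cdot> z) = Zer T C (X M)" using w comp_assoc[OF w(1) d tt(1)] by simp
    then have 0: "?tr (M - n) n \<cdot> z = Zer T C (X M)"
        using comp_assoc[OF z(1) i tt(1)] tt(2)[of n M] M(1) by simp
    \<comment> \<open>The transition map kills \<open>z\<close> at stage \<open>M\<close>; there
      \<open>Q\<close> holds because it holds for zero, and it descends stage by stage.\<close>
    have "Q m z'" if "z' \<in> Hom T C (X m)" "?tr k m \<cdot> z' = Zer T C (X (m + k))" for k m z'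
      using that
    proof (induction k arbitrary: m z')
      case 0 then show ?case using Q0 comp_idn_left[OF 0(1)] by simp
    next
      case (Suc k)
      have "?tr k (Suc m) \<cdot> (f m \<cdot> z') = Zer T C (X (Suc m + k))"
        using Suc.prems(2) comp_assoc[OF Suc.prems(1) f tr] by simp
      then show ?case using Suc.IH[OF comp[OF Suc.prems(1) f]] QS Suc.prems(1) by blast
    qed
    from this[OF z(1), of "M - n"] show ?thesis using 0 M(1) by simp
  qed
  have weak: "\<exists>e'\<in>Hom T J L. \<forall>n. e' \<cdot> j n = e n"
    if "\<forall>n. e n \<in> Hom T (X n) L" "\<forall>n. e (Suc n) \<cdot> f n = e n" for L e
  proof -
    have e: "\<And>n. e n \<in> Hom T (X n) L" and ef: "\<And>n. e (Suc n) \<cdot> f n = e n" using that by auto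
    have L: "L \<in> Ob T" using hom_ob e by blast
    obtain E where E: "E \<in> Hom T P L" "\<And>n. E \<cdot> \<iota> n = e n"
      using is_coproductE[OF P L, of e] e by (metis UNIV_I)
    have "E \<cdot> d = Zer T P L"
    proof (rule is_coproduct_eqI[OF P comp[OF d E(1)] zer_in[OF Pob L]])
      fix n
      show "(E \<cdot> d) \<cdot> \<iota> n = Zer T P L \<cdot> \<iota> n"
        using dv[OF E(1), of n] E(2) ef add_neg[OF e] comp_zer_left[OF i L] by simp
    qed
    from tri_coexact[OF t d g E(1) this] obtain e' where e': "e' \<in> Hom T J L" "E = e' \<cdot> g" .
    have "e' \<cdot> j n = e n" for n using comp_assoc[OF i g e'(1)] e'(2) E(2) by (simp add: j_def)
    then show ?thesis using e'(1) by blast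
  qed
  have "hocolim X f J j"
    unfolding hocolim_def
  proof (intro conjI)
    show "\<forall>n. j n \<in> Hom T (X n) J" "\<forall>n. j (Suc n) \<cdot> f n = j n" using j jf by auto
    show "\<forall>C\<in>Cpt. \<forall>y\<in>Hom T C J. \<exists>n. \<exists>z\<in>Hom T C (X n). y = j n \<cdot> z" using lift by blast
    show "\<forall>L e. (\<forall>n. e n \<in> Hom T (X n) L) \<longrightarrow> (\<forall>n. e (Suc n) \<cdot> f n = e n) \<longrightarrow>
      (\<exists>e'\<in>Hom T J L. \<forall>n. e' \<cdot> j n = e n)" by (intro allI impI) (rule weak)
    show "\<forall>C\<in>Cpt. \<forall>n. \<forall>z\<in>Hom T C (X n). \<forall>Q. j n \<cdot> z = Zer T C J \<longrightarrow> (\<forall>m. Q m (Zer T C (X m))) \<longrightarrow>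
      (\<forall>m. \<forall>z\<in>Hom T C (X m). Q (Suc m) (f m \<cdot> z) \<longrightarrow> Q m z) \<longrightarrow> Q n z"
      by (intro ballI allI impI) (rule die)
  qed
  then show ?thesis by blast
qed

end

section \<open>The action of the ring and torsion\<close>

context graded_commutative_ring
begin

lemma grade_carrier: "r \<in> grade R n \<Longrightarrow> r \<in> carrier R"
  using additive_subgroup.a_subset[OF grade_subgroup] by blast

lemma grade_zero: "\<zero> \<in> grade R n"
  using additive_subgroup.zero_closed[OF grade_subgroup] .

lemma grade_add: "r \<in> grade R n \<Longrightarrow> s \<in> grade R n \<Longrightarrow> r \<oplus> s \<in> grade R n"
  using additive_subgroup.a_closed[OF grade_subgroup] .

lemma grade_minus: "r \<in> grade R n \<Longrightarrow> \<ominus> r \<in> grade R n"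
  using additive_subgroup.a_inv_closed[OF grade_subgroup] .

lemma Spec_ideal: "\<pp> \<in> Spec R \<Longrightarrow> ideal \<pp> R"
  by (simp add: Spec_def homogeneous_ideal_def)

lemma Spec_one: "\<pp> \<in> Spec R \<Longrightarrow> \<one> \<notin> \<pp>"
  using ideal.one_imp_carrier[OF Spec_ideal, of \<pp>] unfolding Spec_def by blast

lemma Spec_zero: "\<pp> \<in> Spec R \<Longrightarrow> \<zero> \<in> \<pp>"
  using additive_subgroup.zero_closed[OF ideal.axioms(1)[OF Spec_ideal]] .

lemma Spec_mult: "\<pp> \<in> Spec R \<Longrightarrow> r \<in> grade R a \<Longrightarrow> r \<notin> \<pp> \<Longrightarrow> s \<in> grade R b \<Longrightarrow> s \<notin> \<pp> \<Longrightarrow> r \<otimes> s \<notin> \<pp>"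
  using grade_carrier unfolding Spec_def by blast

lemma Spec_minus: "\<pp> \<in> Spec R \<Longrightarrow> r \<in> carrier R \<Longrightarrow> \<ominus> r \<in> \<pp> \<longleftrightarrow> r \<in> \<pp>"
  using additive_subgroup.a_inv_closed[OF ideal.axioms(1)[OF Spec_ideal]] minus_minus by metis

lemma rsign_cases: "rsign R n x = x \<or> rsign R n x = \<ominus> x"
  by (simp add: rsign_def)

end

context linear_category
begin

lemma act_in: "r \<in> grade R n \<Longrightarrow> X \<in> Ob T \<Longrightarrow> act T n r X \<in> Hom T X (Sh n X)"
  and act_nat: "r \<in> grade R n \<Longrightarrow> f \<in> Hom T X Y \<Longrightarrow> act T n r Y \<cdot> f = Sm n f \<cdot> act T n r X"
  and act_sus: "r \<in> grade R n \<Longrightarrow> X \<in> Ob T \<Longrightarrow> act T n r (Sus T X) = msign T n (SusM T (act T n r X))"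
  using act_center[of r n] unfolding graded_center_def by auto

text \<open>Signs are not computed: vanishing of morphisms and membership in primes do not depend on
  them.\<close>

definition up_to_sign :: "'m \<Rightarrow> 'm \<Rightarrow> bool" where
  "up_to_sign f g \<longleftrightarrow> f = g \<or> f = Neg T g"

lemma act_sh:
  assumes r: "r \<in> grade R n" and X: "X \<in> Ob T"
  shows "up_to_sign (act T n r (Sh m X)) (Sm m (act T n r X))"
proof (induction m rule: int_induct[where k = 0])
  case base then show ?case by (simp add: sh_0 sm_0 up_to_sign_def)
next
  case (step1 i)
  note a = act_in[OF r X] and aS = act_in[OF r sh_in[OF X, of i]]
  have "act T n r (Sh (i + 1) X) = msign T n (SusM T (act T n r (Sh i X)))"
    using act_sus[OF r sh_in[OF X]] sh_Suc[OF X] by simp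
  moreover have "SusM T (Neg T (Sm i (act T n r X))) = Neg T (Sm (i + 1) (act T n r X))"
    using sm_neg[OF sm_in[OF a], of 1 i] sm_Suc[OF hom_mor[OF a], of i] by (simp add: sm_1)
  moreover have "Neg T (Neg T (Sm (i + 1) (act T n r X))) = Sm (i + 1) (act T n r X)"
      using neg_neg[OF sm_in[OF a]] .
  ultimately show ?case
    using step1 sm_Suc[OF hom_mor[OF a], of i] by (auto simp: up_to_sign_def msign_def)
next
  case (step2 i)
  note a = act_in[OF r X] and aS = act_in[OF r sh_in[OF X, of "i - 1"]]
  have e: "act T n r (Sh i X) = msign T n (SusM T (act T n r (Sh (i - 1) X)))"
    using act_sus[OF r sh_in[OF X]] sh_Suc[OF X, of "i - 1"] by simp
  have s: "SusM T (Neg T (Sm (i - 1) (act T n r X))) = Neg T (Sm i (act T n r X))"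
    using sm_neg[OF sm_in[OF a], of 1 "i - 1"] sm_Suc[OF hom_mor[OF a], of "i - 1"]
        by (simp add: sm_1)
  have nn: "Neg T (Neg T (Sm i (act T n r X))) = Sm i (act T n r X)" using neg_neg[OF sm_in[OF a]] .
  have nn': "Neg T (Neg T (SusM T (act T n r (Sh (i - 1) X)))) = SusM T (act T n r (Sh (i - 1) X))"
    using neg_neg[OF sus_hom[OF aS]] .
  have "SusM T (act T n r (Sh (i - 1) X)) = act T n r (Sh i X) \<or> SusM T (act T n r (Sh (i - 1) X))
      = Neg T (act T n r (Sh i X))"
    using e nn' by (auto simp: msign_def split: if_splits)
  then have "SusM T (act T n r (Sh (i - 1) X)) = Sm i (act T n r X) \<or> SusM T (act T n r (Sh (i - 1)
      X)) = Neg T (Sm i (act T n r X))"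
    using step2 nn by (auto simp: up_to_sign_def)
  then have "SusM T (act T n r (Sh (i - 1) X)) = SusM T (Sm (i - 1) (act T n r X)) \<or>
    SusM T (act T n r (Sh (i - 1) X)) = SusM T (Neg T (Sm (i - 1) (act T n r X)))"
    using s sm_Suc[OF hom_mor[OF a], of "i - 1"] by simp
  then show ?case
    using susM_inject hom_mor[OF aS] hom_mor[OF sm_in[OF a]] hom_mor[OF neg_in[OF sm_in[OF a]]]
    unfolding up_to_sign_def by blast
qed


text \<open>The product of \<open>r\<close> of degree \<open>a\<close> with a morphism \<open>C \<rightarrow> \<Sigma>\<^sup>kX\<close>, as in \<open>graded_hom\<close>.
  No signs occur in the associative laws for this form of the action.\<close>

definition smul :: "int \<Rightarrow> 'r \<Rightarrow> int \<Rightarrow> 'o \<Rightarrow> 'm \<Rightarrow> 'm" where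
  "smul a r k X z = Sm k (act T a r X) \<cdot> z"

lemma gsmult_graded_hom: "gsmult (graded_hom T C X) a k r z = smul a r k X z"
  by (simp add: graded_hom_def smul_def)

lemma sm_act_in: "r \<in> grade R a \<Longrightarrow> X \<in> Ob T \<Longrightarrow> Sm k (act T a r X) \<in> Hom T (Sh k X) (Sh (k + a) X)"
  using sm_in[OF act_in, of r a X k] sh_sh[of X k a] by simp

lemma smul_in: "r \<in> grade R a \<Longrightarrow> X \<in> Ob T \<Longrightarrow> z \<in> Hom T C (Sh k X)
    \<Longrightarrow> smul a r k X z \<in> Hom T C (Sh (k + a) X)"
  unfolding smul_def using comp[OF _ sm_act_in] .

lemma smul_mult:
  assumes r: "r \<in> grade R a" and s: "s \<in> grade R b" and X: "X \<in> Ob T" and z: "z \<in> Hom T C (Sh k X)"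
  shows "smul (a + b) (r \<otimes>\<^bsub>R\<^esub> s) k X z = smul a r (k + b) X (smul b s k X z)"
proof -
  have 1: "Sm b (act T a r X) \<in> Hom T (Sh b X) (Sh (b + a) X)" using sm_act_in[OF r X] .
  have "Sm k (act T (a + b) (r \<otimes>\<^bsub>R\<^esub> s) X) = Sm k (Sm b (act T a r X)) \<cdot> Sm k (act T b s X)"
    using act_mult[OF r s X] sm_comp[OF act_in[OF s X] 1] by simp
  also have "Sm k (Sm b (act T a r X)) = Sm (k + b) (act T a r X)"
      using sm_sm[OF hom_mor[OF act_in[OF r X]]] .
  finally show ?thesis
    unfolding smul_def using comp_assoc[OF z sm_act_in[OF s X] sm_act_in[OF r X]] by simp
qed

lemma smul_one: "X \<in> Ob T \<Longrightarrow> z \<in> Hom T C (Sh k X) \<Longrightarrow> smul 0 \<one>\<^bsub>R\<^esub> k X z = z"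
  unfolding smul_def using act_one sm_idn comp_idn_left by simp

lemma act_zero: assumes X: "X \<in> Ob T" shows "act T a \<zero>\<^bsub>R\<^esub> X = Zer T X (Sh a X)"
proof -
  note z = act_in[OF grade_zero X, of a]
  have "Add T (act T a \<zero>\<^bsub>R\<^esub> X) (act T a \<zero>\<^bsub>R\<^esub> X) = Add T (Zer T X (Sh a X)) (act T a \<zero>\<^bsub>R\<^esub> X)"
    using act_add[OF grade_zero grade_zero X, of a] zer_add[OF z] by simp
  then show ?thesis using add_cancel[OF z zer_in[OF hom_ob[OF z]] z] by simp
qed

lemma act_minus: assumes r: "r \<in> grade R a" and X: "X \<in> Ob T" shows "act T a (\<ominus>\<^bsub>R\<^esub> r) X
    = Neg T (act T a r X)"
proof (rule neg_unique[OF act_in[OF grade_minus[OF r] X] act_in[OF r X]])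
  show "Add T (act T a (\<ominus>\<^bsub>R\<^esub> r) X) (act T a r X) = Zer T X (Sh a X)"
    using act_add[OF grade_minus[OF r] r X] act_zero[OF X] grade_carrier[OF r] by (simp add: l_neg)
qed

lemma smul_minus:
  assumes r: "r \<in> grade R a" and X: "X \<in> Ob T" and z: "z \<in> Hom T C (Sh k X)"
  shows "smul a (\<ominus>\<^bsub>R\<^esub> r) k X z = Neg T (smul a r k X z)"
  unfolding smul_def act_minus[OF r X] sm_neg[OF act_in[OF r X]]
      using comp_neg_left[OF z sm_act_in[OF r X]] .

lemma smul_add_left:
  assumes r: "r \<in> grade R a" "s \<in> grade R a" and X: "X \<in> Ob T" and z: "z \<in> Hom T C (Sh k X)"
  shows "smul a (r \<oplus>\<^bsub>R\<^esub> s) k X z = Add T (smul a r k X z) (smul a s k X z)"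
  unfolding smul_def act_add[OF r X] sm_add[OF act_in[OF r(1) X] act_in[OF r(2) X]]
  using comp_add_left[OF z sm_act_in[OF r(1) X] sm_act_in[OF r(2) X]] .

lemma smul_add_right:
  assumes r: "r \<in> grade R a" and X: "X \<in> Ob T" and z: "z \<in> Hom T C (Sh k X)" "z' \<in> Hom T C (Sh k X)"
  shows "smul a r k X (Add T z z') = Add T (smul a r k X z) (smul a r k X z')"
  unfolding smul_def using comp_add_right[OF z sm_act_in[OF r X]] .

lemma smul_zer:
  assumes r: "r \<in> grade R a" and X: "X \<in> Ob T" and C: "C \<in> Ob T"
  shows "smul a r k X (Zer T C (Sh k X)) = Zer T C (Sh (k + a) X)"
  unfolding smul_def using comp_zer_right[OF sm_act_in[OF r X] C] .

lemma smul_comp: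
  assumes r: "r \<in> grade R a" and X: "X \<in> Ob T" and z: "z \<in> Hom T C (Sh k X)" and g: "g \<in> Hom T D C"
  shows "smul a r k X (z \<cdot> g) = smul a r k X z \<cdot> g"
  unfolding smul_def using comp_assoc[OF g z sm_act_in[OF r X]] .

lemma smul_nat:
  assumes r: "r \<in> grade R a" and y: "y \<in> Hom T X Y" and z: "z \<in> Hom T C (Sh k X)"
  shows "smul a r k Y (Sm k y \<cdot> z) = Sm (k + a) y \<cdot> smul a r k X z"
proof -
  have ob: "X \<in> Ob T" "Y \<in> Ob T" using hom_ob y by blast+
  have "Sm k (act T a r Y) \<cdot> Sm k y = Sm k (Sm a y) \<cdot> Sm k (act T a r X)"
    using act_nat[OF r y] sm_comp[OF y act_in[OF r ob(2)], of k] sm_comp[OF act_in[OF r ob(1)]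
        sm_in[OF y], of k]
    by simp
  also have "Sm k (Sm a y) = Sm (k + a) y" using sm_sm[OF hom_mor[OF y]] .
  finally show ?thesis
    unfolding smul_def
    using comp_assoc[OF z sm_in[OF y] sm_act_in[OF r ob(2)]] comp_assoc[OF z sm_act_in[OF r ob(1)]
        sm_in[OF y]] by simp
qed

lemma smul_shift:
  assumes r: "r \<in> grade R a" and X: "X \<in> Ob T" and z: "z \<in> Hom T C (Sh k X)"
  shows "Sm n (smul a r k X z) = smul a r (n + k) X (Sm n z)"
  unfolding smul_def using sm_comp[OF z sm_act_in[OF r X], of n] sm_sm[OF hom_mor[OF act_in[OF r
      X]]] by simp

lemma smul_0: "smul a r 0 X z = act T a r X \<cdot> z"
  by (simp add: smul_def sm_0)

lemma up_to_sign_smul_commute: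
  assumes r: "r \<in> grade R a" and s: "s \<in> grade R b" and X: "X \<in> Ob T" and z: "z \<in> Hom T C (Sh k X)"
  shows "up_to_sign (smul a r (k + b) X (smul b s k X z)) (smul b s (k + a) X (smul a r k X z))"
proof -
  have sr: "s \<otimes>\<^bsub>R\<^esub> r \<in> grade R (b + a)" using grade_mult[OF s r] .
  have "smul (a + b) (r \<otimes>\<^bsub>R\<^esub> s) k X z = smul (b + a) (s \<otimes>\<^bsub>R\<^esub> r) k X z \<or>
    smul (a + b) (r \<otimes>\<^bsub>R\<^esub> s) k X z = Neg T (smul (b + a) (s \<otimes>\<^bsub>R\<^esub> r) k X z)"
    using graded_commute[OF r s] rsign_cases[of "a * b"
        "s \<otimes>\<^bsub>R\<^esub> r"] smul_minus[OF sr X z] by (auto simp: add.commute)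
  then show ?thesis
    unfolding up_to_sign_def using smul_mult[OF r s X z] smul_mult[OF s r X z] by simp
qed

lemma up_to_sign_zer: "up_to_sign f g \<Longrightarrow> g \<in> Hom T X Y \<Longrightarrow> f = Zer T X Y \<longleftrightarrow> g = Zer T X Y"
  unfolding up_to_sign_def using neg_eq_zer by auto

lemma act_sh_zer:
  assumes r: "r \<in> grade R a" and X: "X \<in> Ob T" and z: "z \<in> Hom T C (Sh k X)"
  shows "act T a r (Sh k X) \<cdot> z = Zer T C (Sh a (Sh k X)) \<longleftrightarrow> smul a r k X z = Zer T C (Sh (k + a) X)"
proof -
  have "up_to_sign (act T a r (Sh k X) \<cdot> z) (smul a r k X z)"
    using act_sh[OF r X, of k] comp_neg_left[OF z sm_act_in[OF r X]]
        unfolding up_to_sign_def smul_def by auto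
  from up_to_sign_zer[OF this smul_in[OF r X z]] show ?thesis
      using sh_sh[OF X] by (simp add: add.commute)
qed

text \<open>The image of \<open>y\<close> under homogeneous localization at \<open>\<pp>\<close> vanishes.\<close>

definition tors :: "'r set \<Rightarrow> 'm \<Rightarrow> bool" where
  "tors \<pp> y \<longleftrightarrow> (\<exists>a. \<exists>u\<in>grade R a - \<pp>. act T a u (Cod T y) \<cdot> y = Zer T (Dom T y) (Sh a (Cod T y)))"

lemma torsI: "y \<in> Hom T D X \<Longrightarrow> u \<in> grade R a \<Longrightarrow> u \<notin> \<pp> \<Longrightarrow> act T a u X \<cdot> y = Zer T D (Sh a X) \<Longrightarrow> tors \<pp> y"
  unfolding tors_def using hom_dom_cod by blast

lemma torsE:
  assumes "tors \<pp> y" "y \<in> Hom T D X"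
  obtains a u where "u \<in> grade R a" "u \<notin> \<pp>" "act T a u X \<cdot> y = Zer T D (Sh a X)"
  using assms unfolding tors_def using hom_dom_cod by blast

lemma act_kill_left:
  assumes r: "r \<in> grade R a" and s: "s \<in> grade R b" and y: "y \<in> Hom T D X"
    and 0: "act T b s X \<cdot> y = Zer T D (Sh b X)"
  shows "act T (a + b) (r \<otimes>\<^bsub>R\<^esub> s) X \<cdot> y = Zer T D (Sh (a + b) X)"
proof -
  have ob: "D \<in> Ob T" "X \<in> Ob T" using hom_ob y by blast+
  show ?thesis
    using smul_mult[OF r s ob(2), of y D 0] y 0 smul_zer[OF r ob(2,1), of b]
        by (simp add: smul_0 sh_0 add.commute)
qed

lemma act_kill_right:
  assumes r: "r \<in> grade R a" and s: "s \<in> grade R b" and y: "y \<in> Hom T D X"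
    and 0: "act T a r X \<cdot> y = Zer T D (Sh a X)"
  shows "act T (a + b) (r \<otimes>\<^bsub>R\<^esub> s) X \<cdot> y = Zer T D (Sh (a + b) X)"
proof -
  have ob: "D \<in> Ob T" "X \<in> Ob T" using hom_ob y by blast+
  have sr: "s \<otimes>\<^bsub>R\<^esub> r \<in> grade R (a + b)" using grade_mult[OF s r] by (simp add: add.commute)
  have "act T (a + b) (s \<otimes>\<^bsub>R\<^esub> r) X \<cdot> y = Zer T D (Sh (a + b) X)"
    using act_kill_left[OF s r y 0] by (simp add: add.commute)
  moreover have "act T (a + b) (\<ominus>\<^bsub>R\<^esub> (s \<otimes>\<^bsub>R\<^esub> r)) X \<cdot> y = Neg T (act T (a + b) (s \<otimes>\<^bsub>R\<^esub> r) X \<cdot> y)"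
    using act_minus[OF sr ob(2)] comp_neg_left[OF y act_in[OF sr ob(2)]] by simp
  ultimately show ?thesis
    using graded_commute[OF r s] rsign_cases[of "a * b"
        "s \<otimes>\<^bsub>R\<^esub> r"] neg_zer[OF ob(1) sh_in[OF ob(2)]] by auto
qed

lemma tors_zer: "\<pp> \<in> Spec R \<Longrightarrow> D \<in> Ob T \<Longrightarrow> X \<in> Ob T \<Longrightarrow> tors \<pp> (Zer T D X)"
  using torsI[OF zer_in grade_one Spec_one] comp_zer_right[OF act_in[OF grade_one]] by blast

lemma tors_add:
  assumes p: "\<pp> \<in> Spec R" and y: "y \<in> Hom T D X" "y' \<in> Hom T D X" and t: "tors \<pp> y" "tors \<pp> y'"
  shows "tors \<pp> (Add T y y')"
proof -
  obtain a u where u: "u \<in> grade R a" "u \<notin> \<pp>"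
      "act T a u X \<cdot> y = Zer T D (Sh a X)" by (rule torsE[OF t(1) y(1)])
  obtain b v where v: "v \<in> grade R b" "v \<notin> \<pp>"
      "act T b v X \<cdot> y' = Zer T D (Sh b X)" by (rule torsE[OF t(2) y(2)])
  have ob: "D \<in> Ob T" "X \<in> Ob T" using hom_ob y by blast+
  note uv = grade_mult[OF u(1) v(1)]
  show ?thesis
  proof (rule torsI[OF add_in[OF y] uv Spec_mult[OF p u(1,2) v(1,2)]])
    show "act T (a + b) (u \<otimes>\<^bsub>R\<^esub> v) X \<cdot> Add T y y' = Zer T D (Sh (a + b) X)"
      using comp_add_right[OF y act_in[OF uv ob(2)]] act_kill_right[OF u(1) v(1) y(1) u(3)]
        act_kill_left[OF u(1) v(1) y(2) v(3)] add_zer[OF zer_in[OF ob(1) sh_in[OF ob(2)]]] by simp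
  qed
qed

lemma tors_comp_right:
  assumes t: "tors \<pp> y" and y: "y \<in> Hom T D X" and g: "g \<in> Hom T D' D" shows "tors \<pp> (y \<cdot> g)"
proof -
  obtain a u where u: "u \<in> grade R a" "u \<notin> \<pp>"
      "act T a u X \<cdot> y = Zer T D (Sh a X)" by (rule torsE[OF t y])
  show ?thesis
    by (rule torsI[OF comp[OF g y] u(1,2)])
      (use comp_assoc[OF g y act_in[OF u(1)]] u(3) comp_zer_left[OF g] hom_ob[OF y] sh_in in auto)
qed

lemma tors_comp_left:
  assumes t: "tors \<pp> y" and y: "y \<in> Hom T D X" and f: "f \<in> Hom T X Y" shows "tors \<pp> (f \<cdot> y)"
proof -
  obtain a u where u: "u \<in> grade R a" "u \<notin> \<pp>"
      "act T a u X \<cdot> y = Zer T D (Sh a X)" by (rule torsE[OF t y])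
  have ob: "D \<in> Ob T" "X \<in> Ob T" "Y \<in> Ob T" using hom_ob y f by blast+
  show ?thesis
  proof (rule torsI[OF comp[OF y f] u(1,2)])
    have "act T a u Y \<cdot> (f \<cdot> y) = (Sm a f \<cdot> act T a u X) \<cdot> y"
      using comp_assoc[OF y f act_in[OF u(1) ob(3)]] act_nat[OF u(1) f] by simp
    also have "\<dots> = Sm a f \<cdot> (act T a u X \<cdot> y)" using comp_assoc[OF y act_in[OF u(1) ob(2)] sm_in[OF
        f]] by simp
    finally show "act T a u Y \<cdot> (f \<cdot> y) = Zer T D (Sh a Y)"
        using u(3) comp_zer_right[OF sm_in[OF f] ob(1)] by simp
  qed
qed

lemma tors_sm1:
  assumes t: "tors \<pp> y" and y: "y \<in> Hom T D X" shows "tors \<pp> (Sm n y)"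
proof -
  obtain a u where u: "u \<in> grade R a" "u \<notin> \<pp>"
      "act T a u X \<cdot> y = Zer T D (Sh a X)" by (rule torsE[OF t y])
  have ob: "D \<in> Ob T" "X \<in> Ob T" using hom_ob y by blast+
  show ?thesis
  proof (rule torsI[OF sm_in[OF y] u(1,2)])
    have "smul a u n X (Sm n y) = Zer T (Sh n D) (Sh (n + a) X)"
      using sm_comp[OF y act_in[OF u(1) ob(2)], of n] u(3) sm_zer[OF ob(1) sh_in[OF ob(2)]] sh_sh[OF
          ob(2)]
      by (simp add: smul_def)
    then show "act T a u (Sh n X) \<cdot> Sm n y = Zer T (Sh n D) (Sh a (Sh n X))"
      using act_sh_zer[OF u(1) ob(2) sm_in[OF y]] by simp
  qed
qed

lemma tors_sm: "y \<in> Hom T D X \<Longrightarrow> tors \<pp> (Sm n y) \<longleftrightarrow> tors \<pp> y"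
  using tors_sm1[of \<pp> y D X n] tors_sm1[OF _ sm_in, of \<pp> n y D X "- n"] sm_back(1)[OF hom_mor]
      by metis

text \<open>In the localization \<open>u\<close> is a unit, so nothing is lost by multiplying with
  it.\<close>

lemma tors_mult:
  assumes p: "\<pp> \<in> Spec R" and y: "y \<in> Hom T D X" and u: "u \<in> grade R a" "u \<notin> \<pp>"
    and t: "tors \<pp> (act T a u X \<cdot> y)"
  shows "tors \<pp> y"
proof -
  have ob: "D \<in> Ob T" "X \<in> Ob T" using hom_ob y by blast+
  note uy = comp[OF y act_in[OF u(1) ob(2)]]
  obtain b v where v: "v \<in> grade R b" "v \<notin> \<pp>"
      "act T b v (Sh a X) \<cdot> (act T a u X \<cdot> y) = Zer T D (Sh b (Sh a X))"
    by (rule torsE[OF t uy])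
  have "smul b v a X (act T a u X \<cdot> y) = Zer T D (Sh (a + b) X)"
    using act_sh_zer[OF v(1) ob(2) uy] v(3) by simp
  then have "act T (b + a) (v \<otimes>\<^bsub>R\<^esub> u) X \<cdot> y = Zer T D (Sh (b + a) X)"
    using smul_mult[OF v(1) u(1) ob(2), of y D 0] y by (simp add: smul_0 sh_0 add.commute)
  then show ?thesis by (rule torsI[OF y grade_mult[OF v(1) u(1)] Spec_mult[OF p v(1,2) u]])
qed

lemma tors_mono: "tors \<pp> y \<Longrightarrow> \<qq> \<subseteq> \<pp> \<Longrightarrow> tors \<qq> y"
  unfolding tors_def by blast

section \<open>Torsion of morphism groups at a prime\<close>

definition tors_hom :: "'r set \<Rightarrow> 'o \<Rightarrow> 'o \<Rightarrow> bool" where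
  "tors_hom \<pp> D X \<longleftrightarrow> (\<forall>y\<in>Hom T D X. tors \<pp> y)"

lemma tors_hom_sh:
  assumes "D \<in> Ob T" "X \<in> Ob T" shows "tors_hom \<pp> (Sh n D) (Sh n X) \<longleftrightarrow> tors_hom \<pp> D X"
  unfolding tors_hom_def
proof
  assume a: "\<forall>y\<in>Hom T (Sh n D) (Sh n X). tors \<pp> y"
  then show "\<forall>y\<in>Hom T D X. tors \<pp> y" using sm_in tors_sm by blast
next
  assume a: "\<forall>y\<in>Hom T D X. tors \<pp> y"
  show "\<forall>y\<in>Hom T (Sh n D) (Sh n X). tors \<pp> y"
  proof
    fix y assume y: "y \<in> Hom T (Sh n D) (Sh n X)"
    then have "Sm (- n) y \<in> Hom T D X" using sm_in[OF y, of "- n"] sh_back(1) assms by simp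
    then show "tors \<pp> y" using a tors_sm[OF y] by blast
  qed
qed

lemma tors_hom_sh_left:
  assumes "D \<in> Ob T" "X \<in> Ob T" shows "tors_hom \<pp> D (Sh n X) \<longleftrightarrow> tors_hom \<pp> (Sh (- n) D) X"
  using tors_hom_sh[OF assms(1) sh_in[OF assms(2)], of \<pp> "- n" n] sh_back(1)[OF assms(2)] by simp

text \<open>Exactness of localization on Hom(D, -): a denominator moves \<open>y\<close> into the
  image of \<open>X\<close>, a second one kills the lift. The lift lands in a shift of
  \<open>X\<close>, hence the hypothesis for all shifts of \<open>D\<close>.\<close>

lemma tors_hom_mid:
  assumes p: "\<pp> \<in> Spec R" and t: "(f, g, h) \<in> Tri T" and f: "f \<in> Hom T X Y" and g: "g \<in> Hom T Y Z"
    and X: "\<And>n. tors_hom \<pp> (Sh n D) X" and Z: "tors_hom \<pp> D Z" 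
  shows "tors_hom \<pp> D Y"
  unfolding tors_hom_def
proof
  fix y assume y: "y \<in> Hom T D Y"
  have ob: "D \<in> Ob T" "X \<in> Ob T" "Y \<in> Ob T" "Z \<in> Ob T" using hom_ob y f g by blast+
  have "tors \<pp> (g \<cdot> y)" using Z comp[OF y g] unfolding tors_hom_def by blast
  then obtain a u where u: "u \<in> grade R a" "u \<notin> \<pp>" "act T a u Z \<cdot> (g \<cdot> y) = Zer T D (Sh a Z)"
    using torsE comp[OF y g] by blast
  note au = act_in[OF u(1) ob(3)]
  have "Sm a g \<cdot> (act T a u Y \<cdot> y) = (act T a u Z \<cdot> g) \<cdot> y"
    using comp_assoc[OF y au sm_in[OF g]] act_nat[OF u(1) g] by simp
  then have "Sm a g \<cdot> (act T a u Y \<cdot> y) = Zer T D (Sh a Z)"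
    using comp_assoc[OF y g act_in[OF u(1) ob(4)]] u(3) by simp
  from sh_tri_exact[OF t f g comp[OF y au] this]
  obtain z where z: "z \<in> Hom T D (Sh a X)" "act T a u Y \<cdot> y = Sm a f \<cdot> z" .
  have "tors \<pp> z" using X[of "- a"] tors_hom_sh_left[OF ob(1,2)] z(1)
      unfolding tors_hom_def by blast
  then have "tors \<pp> (act T a u Y \<cdot> y)" using tors_comp_left[OF _ z(1) sm_in[OF f]] z(2) by simp
  then show "tors \<pp> y" by (rule tors_mult[OF p y u(1,2)])
qed

text \<open>No equivalence relation has to be verified. If the localization is a single class,
  reflexivity at \<open>(0, z, 1)\<close> puts \<open>z\<close> in the class of zero. If all
  elements are torsion, any two fractions are related, because the product of two annihilators kills
  both sides of the defining equation.\<close>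

lemma localization_zero_iff:
  assumes p: "\<pp> \<in> Spec R" and C: "C \<in> Ob T" and X: "X \<in> Ob T"
  shows "localization_zero R (graded_hom T C X) \<pp> \<longleftrightarrow> (\<forall>n. tors_hom \<pp> C (Sh n X))"
proof
  let ?M = "graded_hom T C X"
  have Mc: "gcomp ?M n = Hom T C (Sh n X)" for n by (simp add: graded_hom_def)
  have Mz: "gzero ?M n = Zer T C (Sh n X)" for n by (simp add: graded_hom_def)
  note zin = zer_in[OF C sh_in[OF X]]
  {
    assume a: "localization_zero R ?M \<pp>"
    show "\<forall>n. tors_hom \<pp> C (Sh n X)"
      unfolding tors_hom_def
    proof (intro allI ballI)
      fix n z assume z: "z \<in> Hom T C (Sh n X)"
      have fr: "(0, z, \<one>\<^bsub>R\<^esub>) \<in> fractions R ?M \<pp> n"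
        using z grade_one Spec_one[OF p] by (simp add: fractions_def Mc)
      have "((0, z, \<one>\<^bsub>R\<^esub>), (0, z, \<one>\<^bsub>R\<^esub>)) \<in> fraction_eq R ?M \<pp> n"
        unfolding fraction_eq_def using fr grade_one Spec_one[OF p]
        by (auto simp: rsign_def intro!: exI[of _ 0] bexI[of _ "\<one>\<^bsub>R\<^esub>"])
      moreover have "fraction_eq R ?M \<pp> n `` {(0, z, \<one>\<^bsub>R\<^esub>)} \<in> localization R ?M \<pp> n"
        unfolding localization_def by (rule quotientI[OF fr])
      then have "fraction_eq R ?M \<pp> n `` {(0, z, \<one>\<^bsub>R\<^esub>)}
          = fraction_eq R ?M \<pp> n `` {(0, gzero ?M n, \<one>\<^bsub>R\<^esub>)}"
        using a unfolding localization_zero_def by simp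
      ultimately have "((0, gzero ?M n, \<one>\<^bsub>R\<^esub>), (0, z, \<one>\<^bsub>R\<^esub>)) \<in> fraction_eq R ?M \<pp> n" by blast
      then obtain j u where u: "u \<in> grade R j" "u \<notin> \<pp>"
        "smul j u n X (smul 0 \<one>\<^bsub>R\<^esub> n X (Zer T C (Sh n X))) = smul j u n X (smul 0 \<one>\<^bsub>R\<^esub> n X z)"
        unfolding fraction_eq_def by (auto simp: rsign_def gsmult_graded_hom Mz)
      then have "smul j u n X z = Zer T C (Sh (n + j) X)"
        using smul_one[OF X z] smul_one[OF X zin] smul_zer[OF u(1) X C] by simp
      then show "tors \<pp> z" using act_sh_zer[OF u(1) X z] torsI[OF z u(1,2)] by simp
    qed
  next
    assume a: "\<forall>n. tors_hom \<pp> C (Sh n X)"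
    have kill: "\<exists>j. \<exists>u\<in>grade R j - \<pp>. smul j u n X z
        = Zer T C (Sh (n + j) X)" if z: "z \<in> Hom T C (Sh n X)" for n z
      using a z torsE[of \<pp> z C "Sh n X"] act_sh_zer[OF _ X z]
          unfolding tors_hom_def by (metis DiffI)
    have all: "fraction_eq R ?M \<pp> n = fractions R ?M \<pp> n \<times> fractions R ?M \<pp> n" for n
    proof (intro equalityI subrelI)
      fix x y assume "(x, y) \<in> fraction_eq R ?M \<pp> n"
      then show "(x, y) \<in> fractions R ?M \<pp> n \<times> fractions R ?M \<pp> n"
          unfolding fraction_eq_def by blast
    next
      fix x y assume "(x, y) \<in> fractions R ?M \<pp> n \<times> fractions R ?M \<pp> n"
      then have fxy: "x \<in> fractions R ?M \<pp> n" "y \<in> fractions R ?M \<pp> n" by auto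
      obtain k z s where x: "x = (k, z, s)" by (cases x)
      obtain k' z' s' where y: "y = (k', z', s')" by (cases y)
      have s: "s \<in> grade R k" "s' \<in> grade R k'" and z: "z \<in> Hom T C (Sh (n + k) X)"
          "z' \<in> Hom T C (Sh (n + k') X)"
        using fxy x y by (auto simp: fractions_def Mc)
      have rs: "rsign R (k * k') s' \<in> grade R k'" using s(2) grade_minus by (simp add: rsign_def)
      have w: "smul k' (rsign R (k * k') s') (n + k) X z \<in> Hom T C (Sh (n + k + k') X)"
          using smul_in[OF rs X z(1)] .
      have w': "smul k s (n + k') X z' \<in> Hom T C (Sh (n + k + k') X)"
        using smul_in[OF s(1) X z(2)] by (simp add: ac_simps)
      obtain i u where u: "u \<in> grade R i" "u \<notin> \<pp>"
        "smul i u (n + k + k') X (smul k' (rsign R (k * k') s') (n + k) X z)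
            = Zer T C (Sh (n + k + k' + i) X)"
        using kill[OF w] by blast
      obtain j v where v: "v \<in> grade R j" "v \<notin> \<pp>"
        "smul j v (n + k + k') X (smul k s (n + k') X z') = Zer T C (Sh (n + k + k' + j) X)"
        using kill[OF w'] by blast
      have uv: "u \<otimes>\<^bsub>R\<^esub> v \<in> grade R (i + j)"
          "u \<otimes>\<^bsub>R\<^esub> v \<notin> \<pp>" using grade_mult[OF u(1) v(1)] Spec_mult[OF p u(1,2) v(1,2)] by auto
      have "up_to_sign (smul i u (n + k + k' + j) X (smul j v (n + k + k') X (smul k' (rsign R (k *
          k') s') (n + k) X z)))
         (smul j v (n + k + k' + i) X (smul i u (n + k + k') X (smul k' (rsign R (k * k') s') (n +
             k) X z)))"
        by (rule up_to_sign_smul_commute[OF u(1) v(1) X w])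
      then have "smul i u (n + k + k' + j) X (smul j v (n + k + k') X (smul k' (rsign R (k * k') s')
          (n + k) X z)) =
        Zer T C (Sh (n + k + k' + i + j) X)"
        using u(3) smul_zer[OF v(1) X C] up_to_sign_zer[OF _ zer_in[OF C sh_in[OF X]]] by simp
      then have "smul (i + j) (u \<otimes>\<^bsub>R\<^esub> v) (n + k + k') X (smul k' (rsign R (k * k') s') (n + k) X z)
          =
        smul (i + j) (u \<otimes>\<^bsub>R\<^esub> v) (n + k + k') X (smul k s (n + k') X z')"
        using smul_mult[OF u(1) v(1) X w] smul_mult[OF u(1) v(1) X w'] v(3) smul_zer[OF u(1) X C]
            by (simp add: ac_simps)
      then have "\<exists>j. \<exists>u\<in>grade R j - \<pp>.
           gsmult ?M j (n + k + k') u (gsmult ?M k' (n + k) (rsign R (k * k') s') z) =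
           gsmult ?M j (n + k + k') u (gsmult ?M k (n + k') s z')"
        using uv by (intro exI[of _ "i + j"] bexI[of _ "u \<otimes>\<^bsub>R\<^esub> v"]) (auto simp: gsmult_graded_hom)
      then show "(x, y) \<in> fraction_eq R ?M \<pp> n" unfolding fraction_eq_def using fxy x y by blast
    qed
    show "localization_zero R ?M \<pp>"
      unfolding localization_zero_def
    proof
      fix n
      have fr: "(0, gzero ?M n, \<one>\<^bsub>R\<^esub>) \<in> fractions R ?M \<pp> n"
        using zin grade_one Spec_one[OF p] by (simp add: fractions_def Mc Mz)
      then have im: "fraction_eq R ?M \<pp> n `` {x} = fractions R ?M \<pp> n"
          if "x \<in> fractions R ?M \<pp> n" for x
        using all that by auto
      show "localization R ?M \<pp> n = {fraction_eq R ?M \<pp> n `` {(0, gzero ?M n, \<one>\<^bsub>R\<^esub>)}}"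
        unfolding localization_def quotient_def using im fr by auto
    qed
  }
qed

end

section \<open>Homogeneous ideals of noetherian rings\<close>

context graded_commutative_ring
begin

lemma homogeneous_ideal_chain:
  fixes I :: "nat \<Rightarrow> 'r set"
  assumes I: "\<And>n. homogeneous_ideal (I n) R" and mono: "\<And>n. I n \<subseteq> I (Suc n)"
      and noeth: "graded_noetherian R"
  obtains N where "\<And>n. I n \<subseteq> I N"
proof -
  have le: "I m \<subseteq> I n" if "m \<le> n" for m n using lift_Suc_mono_le[of I, OF mono that] .
  have "ideal (if range I = {} then {\<zero>} else \<Union>(range I)) R"
  proof (rule chain_Union_is_ideal)
    show "subset.chain {I. ideal I R} (range I)"
      unfolding subset_chain_def
    proof (intro conjI ballI)
      show "range I \<subseteq> {I. ideal I R}" using I unfolding homogeneous_ideal_def by blast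
      fix X Y assume "X \<in> range I" "Y \<in> range I"
      then obtain m n where "X = I m" "Y = I n" by blast
      then show "X \<subseteq> Y \<or> Y \<subseteq> X" using le[of m n] le[of n m] nat_le_linear[of m n] by blast
    qed
  qed
  then have "ideal (\<Union>n. I n) R" by simp
  then have "homogeneous_ideal (\<Union>n. I n) R" using I unfolding homogeneous_ideal_def by blast
  then have "\<exists>A\<subseteq>carrier R. finite A \<and> (\<Union>n. I n) = Idl A"
    using noeth unfolding graded_noetherian_def by (elim allE[of _ "\<Union>n. I n"]) simp
  then obtain A where A: "A \<subseteq> carrier R" "finite A" "(\<Union>n. I n) = Idl A" by (elim exE conjE)
  have "A \<subseteq> (\<Union>n. I n)" using A genideal_self by simp
  then have "\<forall>a\<in>A. \<exists>n. a \<in> I n" by blast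
  then obtain k where k: "\<And>a. a \<in> A \<Longrightarrow> a \<in> I (k a)" by metis
  have "finite (k ` A)" using A(2) by simp
  then obtain N where N: "\<forall>i\<in>k ` A. i \<le> N" unfolding finite_nat_set_iff_bounded_le ..
  have "A \<subseteq> I N" using k N le by blast
  moreover have "ideal (I N) R" using I[of N] by (simp add: homogeneous_ideal_def)
  ultimately have "Idl A \<subseteq> I N" by (rule genideal_minimal[rotated])
  then have "I n \<subseteq> I N" for n using A(3) by (metis UN_upper UNIV_I subset_trans)
  then show ?thesis by (rule that)
qed

lemma homogeneous_ideal_maximal:
  fixes I :: "'i \<Rightarrow> 'r set"
  assumes noeth: "graded_noetherian R" and I: "\<And>i. i \<in> S \<Longrightarrow> homogeneous_ideal (I i) R"
      and S: "i0 \<in> S"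
  obtains i where "i \<in> S" "\<And>j. j \<in> S \<Longrightarrow> I i \<subseteq> I j \<Longrightarrow> I j = I i"
proof (rule ccontr)
  assume "\<not> thesis"
  then have "\<not> (\<forall>j\<in>S. I i \<subseteq> I j \<longrightarrow> I j = I i)" if "i \<in> S" for i
    using that \<open>\<And>i. i \<in> S \<Longrightarrow> (\<And>j. j \<in> S \<Longrightarrow> I i \<subseteq> I j \<Longrightarrow> I j = I i) \<Longrightarrow> thesis\<close> by blast
  then have step: "\<exists>j\<in>S. I i \<subset> I j" if "i \<in> S" for i using that by blast
  have "\<exists>f. \<forall>n. f n \<in> S \<and> I (f n) \<subset> I (f (Suc n))"
  proof (rule dependent_nat_choice)
    show "\<exists>i. i \<in> S" using S by blast
    show "\<exists>j. j \<in> S \<and> I i \<subset> I j" if "i \<in> S" for i and n :: nat using step[OF that] by blast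
  qed
  then obtain f where f: "\<And>n. f n \<in> S" "\<And>n. I (f n) \<subset> I (f (Suc n))" by blast
  show False
    by (rule homogeneous_ideal_chain[of "\<lambda>n. I (f n)", OF I[OF f(1)] psubset_imp_subset[OF f(2)]
        noeth])
      (use f(2) in blast)
qed

text \<open>The vanishing ideal of a set of primes. Smaller sets have larger ideals, so noetherian
  maximality will yield minimal supports.\<close>

lemma homogeneous_ideal_Spec_Inter:
  assumes "U \<subseteq> Spec R" shows "homogeneous_ideal {x \<in> carrier R. \<forall>\<pp>\<in>U. x \<in> \<pp>} R"
  unfolding homogeneous_ideal_def
proof (intro conjI ballI allI impI)
  have "ideal (\<Inter>(insert (carrier R) U)) R"
    by (rule i_Intersect) (use oneideal Spec_ideal assms in auto)
  moreover have "\<Inter>(insert (carrier R) U) = {x \<in> carrier R. \<forall>\<pp>\<in>U. x \<in> \<pp>}" by auto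
  ultimately show "ideal {x \<in> carrier R. \<forall>\<pp>\<in>U. x \<in> \<pp>} R" by simp
  fix x c n assume x: "x \<in> {x \<in> carrier R. \<forall>\<pp>\<in>U. x \<in> \<pp>}" and c: "hom_decomp R c x"
  have "c n \<in> \<pp>" if "\<pp> \<in> U" for \<pp>
    using that assms x c unfolding Spec_def homogeneous_ideal_def by blast
  moreover have "c n \<in> carrier R" using c grade_carrier unfolding hom_decomp_def by blast
  ultimately show "c n \<in> {x \<in> carrier R. \<forall>\<pp>\<in>U. x \<in> \<pp>}" by blast
qed

end

section \<open>Koszul objects and good generating sets\<close>

locale bik_category = linear_category R T + cocomplete_triangulated_category T \<kappa>
  for R :: "('r, 'y) graded_ring_scheme" and T :: "('o, 'm, 'r, 'z) lincat_scheme"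
      and \<kappa> :: "'k rel" +
  assumes small_ring: "small \<kappa> (carrier R)" and noetherian_ring: "graded_noetherian R"
    and generated: "compactly_generated \<kappa> T"
begin

abbreviation torsion where "torsion \<equiv> torsion_objects \<kappa> R T"

lemma torsion_iff:
  \<comment> \<open>Degrees disappear because the shifts of a compact object are compact.\<close>
  "X \<in> torsion \<V> \<longleftrightarrow> X \<in> Ob T \<and> (\<forall>C\<in>Cpt. \<forall>\<pp>\<in>Spec R - \<V>. tors_hom \<pp> C X)"
proof -
  have lz: "localization_zero R (graded_hom T C X) \<pp> \<longleftrightarrow> (\<forall>n. tors_hom \<pp> (Sh (- n) C) X)"
    if "C \<in> Cpt" "X \<in> Ob T" "\<pp> \<in> Spec R" for \<pp> C
    using localization_zero_iff[OF that(3) compact_ob[OF that(1)] that(2)]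
      tors_hom_sh_left[OF compact_ob[OF that(1)] that(2)] by simp
  show ?thesis
  proof
    assume a: "X \<in> torsion \<V>"
    then have X: "X \<in> Ob T" by (simp add: torsion_objects_def)
    have "tors_hom \<pp> C X" if C: "C \<in> Cpt" and p: "\<pp> \<in> Spec R - \<V>" for C \<pp>
    proof -
      have "localization_zero R (graded_hom T C X) \<pp>"
          using a C p unfolding torsion_objects_def by blast
      then have "tors_hom \<pp> (Sh (- 0) C) X" using lz[OF C X] p by blast
      then show ?thesis by (simp add: sh_0)
    qed
    then show "X \<in> Ob T \<and> (\<forall>C\<in>Cpt. \<forall>\<pp>\<in>Spec R - \<V>. tors_hom \<pp> C X)" using X by blast
  next
    assume a: "X \<in> Ob T \<and> (\<forall>C\<in>Cpt. \<forall>\<pp>\<in>Spec R - \<V>. tors_hom \<pp> C X)"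
    then show "X \<in> torsion \<V>" unfolding torsion_objects_def using lz compact_sh by blast
  qed
qed

lemma tors_hom_coproduct:
  assumes p: "\<pp> \<in> Spec R" and C: "C \<in> Cpt" and A: "small \<kappa> A" and P: "is_coproduct T A X P \<iota>"
    and t: "\<And>i. i \<in> A \<Longrightarrow> tors_hom \<pp> C (X i)"
  shows "tors_hom \<pp> C P"
  unfolding tors_hom_def
proof
  fix w assume w: "w \<in> Hom T C P"
  show "tors \<pp> w"
    by (rule compact_induct[OF C size A P w])
      (use tors_zer[OF p compact_ob[OF C] is_coproduct_ob[OF P]] tors_add[OF p]
        tors_comp_left[OF _ _ is_coproduct_inj[OF P]] t in \<open>auto simp: tors_hom_def\<close>)
qed

lemma tors_hom_zero_object: "\<pp> \<in> Spec R \<Longrightarrow> D \<in> Ob T \<Longrightarrow> zero_object T X \<Longrightarrow> tors_hom \<pp> D X"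
  unfolding tors_hom_def using zero_object_hom_to tors_zer zero_object_ob by metis

lemma torsion_localizing: "localizing \<kappa> T (torsion \<V>)"
proof (rule localizingI)
  show "torsion \<V> \<subseteq> Ob T" using torsion_iff by blast
  show "X \<in> torsion \<V>" if "zero_object T X" for X
    unfolding torsion_iff using that tors_hom_zero_object compact_ob zero_object_ob by blast
  show "X \<in> torsion \<V> \<longleftrightarrow> Sus T X \<in> torsion \<V>" if X: "X \<in> Ob T" for X
  proof -
    have e: "tors_hom \<pp> (Sh 1 C) (Sus T X) \<longleftrightarrow> tors_hom \<pp> C X" if "C \<in> Cpt" for C \<pp>
      using tors_hom_sh[OF compact_ob[OF that] X, of _ 1] by (simp add: sh_1)
    have "(\<forall>C\<in>Cpt. tors_hom \<pp> C (Sus T X)) \<longleftrightarrow> (\<forall>C\<in>Cpt. tors_hom \<pp> C X)" for \<pp>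
    proof safe
      fix C assume a: "\<forall>C\<in>Cpt. tors_hom \<pp> C (Sus T X)" and C: "C \<in> Cpt"
      show "tors_hom \<pp> C X" using e[OF C] a compact_sh[OF C] by blast
    next
      fix C assume a: "\<forall>C\<in>Cpt. tors_hom \<pp> C X" and C: "C \<in> Cpt"
      show "tors_hom \<pp> C (Sus T X)"
        using e[OF compact_sh[OF C, of "- 1"]] sh_back(2)[OF compact_ob[OF C], of 1] a compact_sh[OF
            C, of "- 1"] by simp
    qed
    then show ?thesis unfolding torsion_iff using X sus_in by blast
  qed
  show "Y \<in> torsion \<V>" if t: "(f, g, h) \<in> Tri T" and f: "f \<in> Hom T X Y" and g: "g \<in> Hom T Y Z"
    and X: "X \<in> torsion \<V>" and Z: "Z \<in> torsion \<V>" for f g h X Y Z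
    unfolding torsion_iff
  proof (intro conjI ballI)
    show "Y \<in> Ob T" using hom_ob f by blast
    show "tors_hom \<pp> C Y" if "C \<in> Cpt" "\<pp> \<in> Spec R - \<V>" for C \<pp>
      using tors_hom_mid[OF _ t f g, of \<pp> C] that X Z compact_sh[OF that(1)]
          unfolding torsion_iff by blast
  qed
  show "P \<in> torsion \<V>" if "small_index \<kappa> I" "is_coproduct T I X P \<iota>" "\<And>i. i \<in> I \<Longrightarrow> X i \<in> torsion \<V>"
    for I :: "'k set" and X P \<iota>
    unfolding torsion_iff using is_coproduct_ob[OF that(2)] that(3)
      tors_hom_coproduct[OF _ _ small_index_small[OF that(1)] that(2)]
          unfolding torsion_iff by blast
qed

lemmas torsion_triangulated = localizing_triangulated[OF torsion_localizing]

lemma torsion_ob: "X \<in> torsion \<V> \<Longrightarrow> X \<in> Ob T"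
  using torsion_iff by blast

lemma tors_idn: assumes "E \<in> Ob T"
  shows "tors \<pp> (Idn T E) \<Longrightarrow> tors_hom \<pp> W E" "tors \<pp> (Idn T E) \<Longrightarrow> tors_hom \<pp> E X"
  unfolding tors_hom_def
  using tors_comp_right[OF _ idn[OF assms]] tors_comp_left[OF _ idn[OF assms]] comp_idn_left
      comp_idn_right
  by metis+

text \<open>The Koszul object, often written \<open>D//r\<close>: the cone of multiplication by
  \<open>r\<close> on \<open>D\<close>, with one cone chosen.\<close>

definition kos :: "int \<Rightarrow> 'r \<Rightarrow> 'o \<Rightarrow> 'o" where
  "kos a r D = Cod T (SOME g. \<exists>h. (act T a r D, g, h) \<in> Tri T)"

lemma kos_tri:
  assumes r: "r \<in> grade R a" and D: "D \<in> Ob T"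
  obtains g h where "(act T a r D, g, h) \<in> Tri T" "g \<in> Hom T (Sh a D) (kos a r D)"
      "h \<in> Hom T (kos a r D) (Sus T D)"
proof -
  note f = act_in[OF r D]
  have "\<exists>g h. (act T a r D, g, h) \<in> Tri T" using tri_ex[OF hom_mor[OF f]] .
  then have "\<exists>h. (act T a r D, (SOME g. \<exists>h. (act T a r D, g, h) \<in> Tri T), h) \<in> Tri T"
      by (rule someI_ex)
  then obtain h where t: "(act T a r D, (SOME g. \<exists>h. (act T a r D, g, h) \<in> Tri T), h) \<in> Tri T"
      by blast
  show ?thesis
    by (rule that[OF t]) (use tri_wf[OF t] hom_dom_cod[OF f] in \<open>auto simp: kos_def\<close>)
qed

lemma kos_ob: "r \<in> grade R a \<Longrightarrow> D \<in> Ob T \<Longrightarrow> kos a r D \<in> Ob T"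
  using kos_tri hom_ob(2) by metis

lemma kos_compact: assumes r: "r \<in> grade R a" and D: "D \<in> Cpt" shows "kos a r D \<in> Cpt"
  using kos_tri[OF r compact_ob[OF D]] compact_cone[OF _ act_in[OF r compact_ob[OF D]] _ D
      compact_sh[OF D]] by metis

lemma kos_tors:
  assumes p: "\<pp> \<in> Spec R" and r: "r \<in> grade R a" and D: "D \<in> Ob T" and t: "tors \<pp> (Idn T D)"
  shows "tors \<pp> (Idn T (kos a r D))"
proof -
  obtain g h where k: "(act T a r D, g, h) \<in> Tri T" "g \<in> Hom T (Sh a D) (kos a r D)"
      "h \<in> Hom T (kos a r D) (Sus T D)"
    by (rule kos_tri[OF r D])
  have s: "tors_hom \<pp> W (Sh n D)" for n W
    using tors_idn(1)[OF sh_in[OF D]] tors_sm[OF idn[OF D], of \<pp> n] t sm_idn[OF D] by simp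
  have "tors_hom \<pp> (kos a r D) (kos a r D)"
    by (rule tors_hom_mid[OF p tri_rot[OF k(1)] k(2,3)]) (use s s[of _ 1] in \<open>auto simp: sh_1\<close>)
  then show ?thesis unfolding tors_hom_def using idn[OF kos_ob[OF r D]] by blast
qed

text \<open>The square of \<open>r\<close> annihilates the cone of \<open>r\<close>: as
  \<open>g\<close> composed with \<open>r\<close> is zero, the action of \<open>r\<close> on the
  cone factors through \<open>h\<close>, and \<open>r\<close> kills \<open>h\<close>.\<close>

lemma kos_tors_self:
  assumes p: "\<pp> \<in> Spec R" and r: "r \<in> grade R a" "r \<notin> \<pp>" and D: "D \<in> Ob T"
  shows "tors \<pp> (Idn T (kos a r D))"
proof -
  let ?K = "kos a r D"
  have K: "?K \<in> Ob T" using kos_ob[OF r(1) D] .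
  obtain g h where k: "(act T a r D, g, h) \<in> Tri T" "g \<in> Hom T (Sh a D) ?K" "h \<in> Hom T ?K (Sus T D)"
    by (rule kos_tri[OF r(1) D])
  note f = act_in[OF r(1) D] and fK = act_in[OF r(1) K]
  have gf: "g \<cdot> act T a r D = Zer T D ?K" using tri_zero[OF k(1) f k(2)] .
  have ns: "up_to_sign (act T a r (Sh a D)) (Sm a (act T a r D))" by (rule act_sh[OF r(1) D])
  have z1: "Sm a g \<cdot> Sm a (act T a r D) = Zer T (Sh a D) (Sh a ?K)"
    using sm_comp[OF f k(2), of a] gf sm_zer[OF D K] by simp
  have "act T a r ?K \<cdot> g = Zer T (Sh a D) (Sh a ?K)"
    using act_nat[OF r(1) k(2)] ns z1 comp_neg_right[OF sm_in[OF f] sm_in[OF k(2)]]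
      neg_zer[OF sh_in[OF D] sh_in[OF K]] unfolding up_to_sign_def by metis
  from tri_coexact2[OF k(1) k(2,3) fK this]
  obtain w where w: "w \<in> Hom T (Sus T D) (Sh a ?K)" "act T a r ?K = w \<cdot> h" .
  have "act T a r (Sus T D) \<cdot> h = Zer T ?K (Sh a (Sus T D))"
  proof -
    have e: "SusM T (act T a r D) \<cdot> h = Zer T ?K (Sus T (Sh a D))" using tri_zero3[OF k(1) f k(3)] .
    have "Sus T (Sh a D) = Sh a (Sus T D)" using sh_sus[OF D, of a] sh_Suc[OF D, of a] by simp
    then show ?thesis
      using act_sus[OF r(1) D] e comp_neg_left[OF k(3) sus_hom[OF f]] neg_zer[OF K sus_in[OF
          sh_in[OF D, of a]]]
      by (auto simp: msign_def)
  qed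
  then have "tors \<pp> h" by (rule torsI[OF k(3) r])
  then have "tors \<pp> (act T a r ?K \<cdot> Idn T ?K)"
    using tors_comp_left[OF _ k(3) w(1)] w(2) comp_idn_right[OF fK] by simp
  then show ?thesis by (rule tors_mult[OF p idn[OF K] r])
qed

definition good_generators :: "'o set \<Rightarrow> bool" where
  "good_generators G \<longleftrightarrow> G \<subseteq> Cpt \<and> small \<kappa> G \<and> (\<forall>D\<in>G. \<forall>n. Sh n D \<in> G) \<and>
    (\<forall>D\<in>G. \<forall>a. \<forall>r\<in>grade R a. kos a r D \<in> G) \<and> (\<forall>X\<in>Ob T. (\<forall>D\<in>G. orth D X) \<longrightarrow> zero_object T X)"

lemma ex_good_generators:
  assumes A: "A \<subseteq> Cpt" "small \<kappa> A"
  obtains G where "good_generators G" "A \<subseteq> G"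
proof -
  obtain G0 where G0: "G0 \<subseteq> Cpt" "small \<kappa> G0" "Loc \<kappa> T G0 = Ob T"
    using generated unfolding compactly_generated_def by blast
  \<comment> \<open>One round of closure. Iterating it countably often reaches all shifts, and
    smallness of the ring keeps every round small.\<close>
  define ph where "ph B = B \<union> Sus T ` B \<union> Sh (- 1) ` B \<union>
    (\<lambda>(D, a, r). kos a r D) ` {(D, a, r). D \<in> B \<and> r \<in> grade R a}" for B
  define F where "F n = (ph ^^ n) (G0 \<union> A)" for n
  have F0: "F 0 = G0 \<union> A" and FS: "F (Suc n) = ph (F n)" for n by (simp_all add: F_def)
  have sm: "small \<kappa> (F n)" for n
  proof (induction n)
    case 0 show ?case unfolding F0 by (rule small_Un[OF size G0(2) A(2)])
  next
    case (Suc n)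
    have "{(D, a, r). D \<in> F n \<and> r \<in> grade R a} \<subseteq> F n \<times> UNIV \<times> carrier R" using grade_carrier by auto
    then have "small \<kappa> {(D, a, r). D \<in> F n \<and> r \<in> grade R a}"
      using small_mono small_Times[OF size Suc small_Times[OF size small_int[OF size] small_ring]]
          by blast
    then show ?case unfolding FS ph_def by (intro small_Un[OF size] small_image Suc)
  qed
  have cp: "F n \<subseteq> Cpt" for n
  proof (induction n)
    case 0 show ?case unfolding F0 using G0 A by blast
  next
    case (Suc n)
    then show ?case unfolding FS ph_def using compact_sh[of _ 1] compact_sh[of _ "- 1"] kos_compact
        by (auto simp: sh_1)
  qed
  define G where "G = (\<Union>n. F n)"
  have GC: "G \<subseteq> Cpt" using cp unfolding G_def by blast
  have G1: "Sus T D \<in> G" "Sh (- 1) D \<in> G" if "D \<in> G" for D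
    using that FS unfolding G_def ph_def by blast+
  have Gn: "Sh n D \<in> G" if D: "D \<in> G" for D n
  proof -
    have Dob: "D \<in> Ob T" using D GC compact_ob by blast
    show ?thesis
    proof (induction n rule: int_induct[where k = 0])
      case base then show ?case using D by (simp add: sh_0)
    next
      case (step1 i) then show ?case using sh_Suc[OF Dob, of i] G1(1) by simp
    next
      case (step2 i) then show ?case using sh_sh[OF Dob, of "- 1" i] G1(2)
          by (metis uminus_add_conv_diff)
    qed
  qed
  have Gk: "kos a r D \<in> G" if D: "D \<in> G" and r: "r \<in> grade R a" for D a r
  proof -
    obtain n where "D \<in> F n" using D unfolding G_def by blast
    then have "kos a r D \<in> F (Suc n)" unfolding FS ph_def using r by force
    then show ?thesis unfolding G_def by blast
  qed
  have Gz: "zero_object T X" if X: "X \<in> Ob T" and o: "\<forall>D\<in>G. orth D X" for X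
  proof -
    \<comment> \<open>The objects without nonzero morphisms to shifts of \<open>X\<close> form a
      localizing subcategory that contains the generators, hence also \<open>X\<close>; so the
      identity of \<open>X\<close> is zero.\<close>
    let ?S = "range (\<lambda>n. Sh n X)"
    have loc: "localizing \<kappa> T (left_perp T ?S)"
      by (rule left_perp_localizing) (use sh_in[OF X] sh_sh[OF X] in auto)
    have "G0 \<subseteq> left_perp T ?S"
    proof
      fix D assume D: "D \<in> G0"
      then have DG: "D \<in> G" using F0 unfolding G_def by blast
      then have Dob: "D \<in> Ob T" using GC compact_ob by blast
      have "orth D (Sh n X)" for n
        using orth_sh[OF sh_in[OF Dob, of "- n"] X, of n] sh_back(2)[OF Dob, of n] o Gn[OF DG, of "-
            n"] by simp
      then show "D \<in> left_perp T ?S" using Dob unfolding left_perp_def orth_def by blast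
    qed
    then have "X \<in> left_perp T ?S" using Loc_least[OF loc] G0(3) X by blast
    moreover have "X \<in> ?S" using sh_0[of X] by (metis rangeI)
    ultimately have "Idn T X = Zer T X X" using idn[OF X] unfolding left_perp_def by blast
    then show ?thesis using zero_object_iff X by blast
  qed
  have "small \<kappa> G" unfolding G_def by (rule small_UNION[OF size small_nat[OF size] sm])
  then have "good_generators G" unfolding good_generators_def using GC Gn Gk Gz by blast
  moreover have "A \<subseteq> G" using F0 unfolding G_def by blast
  ultimately show ?thesis by (rule that)
qed

text \<open>A nonzero \<open>y : E \<rightarrow> Z\<close> with \<open>r y = 0\<close> extends over a shift of the Koszul object of \<open>r\<close>, which
  is supported on \<open>V(r) \<inter> supp E\<close>. Choosing \<open>y\<close> with \<open>supp E\<close> minimal makes \<open>E\<close> torsion.\<close>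

lemma torsion_local_zero:
  assumes G: "good_generators G" and Z: "Z \<in> Ob T"
    and tor: "\<And>D \<pp>. D \<in> G \<Longrightarrow> \<pp> \<in> Spec R - \<V> \<Longrightarrow> tors_hom \<pp> D Z"
    and loc: "\<And>E. E \<in> G \<inter> torsion \<V> \<Longrightarrow> orth E Z"
  shows "zero_object T Z"
proof (rule ccontr)
  assume "\<not> zero_object T Z"
  then obtain D where D: "D \<in> G" "\<not> orth D Z" using G Z unfolding good_generators_def by blast
  let ?S = "{E \<in> G. \<not> orth E Z}"
  \<comment> \<open>\<open>?U E\<close> consists of the primes at which \<open>E\<close> survives
    localization, and \<open>?I E\<close> is its vanishing ideal. Minimal support is expressed by
    maximality of \<open>?I E\<close>.\<close>
  let ?U = "\<lambda>E. {\<pp> \<in> Spec R. \<not> tors \<pp> (Idn T E)}"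
  let ?I = "\<lambda>E. {x \<in> carrier R. \<forall>\<pp>\<in>?U E. x \<in> \<pp>}"
  have Gob: "E \<in> Ob T" if "E \<in> G" for E using that G compact_ob
      unfolding good_generators_def by blast
  have hi: "homogeneous_ideal (?I E) R" if "E \<in> ?S" for E
      by (rule homogeneous_ideal_Spec_Inter) blast
  obtain E where E: "E \<in> ?S" "\<And>E'. E' \<in> ?S \<Longrightarrow> ?I E \<subseteq> ?I E' \<Longrightarrow> ?I E' = ?I E"
    by (rule homogeneous_ideal_maximal[of ?S ?I D, OF noetherian_ring hi]) (use D in blast)+
  have Eob: "E \<in> Ob T" using E(1) Gob by blast
  obtain y where y: "y \<in> Hom T E Z" "y \<noteq> Zer T E Z" using E(1) unfolding orth_def by blast
  \<comment> \<open>If \<open>r\<close> annihilates \<open>y\<close>, then \<open>y\<close> extends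
    over a Koszul object, a shift of which is again a candidate. Its ideal contains
    \<open>?I E\<close> and \<open>r\<close>, so maximality puts \<open>r\<close> in
    \<open>?I E\<close> already.\<close>
  have key: "r \<in> ?I E" if r: "r \<in> grade R a" and 0: "act T a r Z \<cdot> y = Zer T E (Sh a Z)" for r a
  proof -
    let ?K = "kos a r E"
    obtain g h where k: "(act T a r E, g, h) \<in> Tri T" "g \<in> Hom T (Sh a E) ?K"
        "h \<in> Hom T ?K (Sus T E)"
      by (rule kos_tri[OF r Eob])
    have K: "?K \<in> Ob T" using kos_ob[OF r Eob] .
    have "Sm a y \<cdot> act T a r E = Zer T E (Sh a Z)" using act_nat[OF r y(1)] 0 by simp
    from tri_coexact[OF k(1) act_in[OF r Eob] k(2) sm_in[OF y(1)] this]
    obtain y1 where y1: "y1 \<in> Hom T ?K (Sh a Z)" "Sm a y = y1 \<cdot> g" .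
    let ?E = "Sh (- a) ?K"
    have EG: "?E \<in> G" using E(1) G r unfolding good_generators_def by blast
    have "y1 \<noteq> Zer T ?K (Sh a Z)"
      using y1(2) comp_zer_left[OF k(2) sh_in[OF Z]] sm_eq_zer[OF y(1), of a] y(2) by metis
    then have "\<not> orth ?K (Sh a Z)" using y1(1) unfolding orth_def by blast
    then have "\<not> orth ?E Z" using orth_sh[OF sh_in[OF K] Z, of a "- a"] sh_back(2)[OF K] by simp
    then have ES: "?E \<in> ?S" using EG by blast
    have te: "tors \<pp> (Idn T ?E) \<longleftrightarrow> tors \<pp> (Idn T ?K)" for \<pp>
        using tors_sm[OF idn[OF K], of \<pp> "- a"] sm_idn[OF K] by simp
    have "?I E \<subseteq> ?I ?E" unfolding te using kos_tors[OF _ r Eob] by blast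
    then have "?I ?E = ?I E" using E(2)[OF ES] by blast
    moreover have "r \<in> ?I ?E" unfolding te using kos_tors_self[OF _ r _ Eob] grade_carrier[OF r]
        by blast
    ultimately show ?thesis by simp
  qed
  have "E \<in> torsion \<V>"
    unfolding torsion_iff
  proof (intro conjI Eob ballI)
    fix C \<pp> assume C: "C \<in> Cpt" and p: "\<pp> \<in> Spec R - \<V>"
    have "tors \<pp> y" using tor[OF _ p] E(1) y(1) unfolding tors_hom_def by blast
    then obtain a u where u: "u \<in> grade R a" "u \<notin> \<pp>"
        "act T a u Z \<cdot> y = Zer T E (Sh a Z)" using torsE[OF _ y(1)] by blast
    then have "u \<in> ?I E" using key by blast
    then have "tors \<pp> (Idn T E)" using u(2) p by blast
    then show "tors_hom \<pp> C E" using tors_idn(1)[OF Eob] by blast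
  qed
  then show False using loc E(1) by blast
qed

end

context triangulated_category
begin

lemma tri_ex_fibre:
  assumes g: "g \<in> Hom T X L"
  obtains \<Gamma> f h where "(f, g, h) \<in> Tri T" "f \<in> Hom T \<Gamma> X" "h \<in> Hom T L (Sus T \<Gamma>)"
proof -
  have X: "X \<in> Ob T" using hom_ob g by blast
  obtain a b where t: "(g, a, b) \<in> Tri T" using tri_ex[OF hom_mor[OF g]] by blast
  obtain A where a: "a \<in> Hom T L A" and b: "b \<in> Hom T A (Sus T X)"
    using tri_wf[OF t] hom_dom_cod[OF g] by auto
  have A: "A \<in> Ob T" using hom_ob a by blast
  define \<Gamma> where "\<Gamma> = Sh (- 1) A"
  define f where "f = Sm (- 1) (Neg T b)"
  have s\<Gamma>: "Sus T \<Gamma> = A" using sh_back(2)[OF A, of 1] by (simp add: \<Gamma>_def sh_1)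
  have f: "f \<in> Hom T \<Gamma> X"
    using sm_in[OF neg_in[OF b], of "- 1"] sh_back(1)[OF X, of 1] by (simp add: \<Gamma>_def f_def sh_1)
  have "Neg T (SusM T f) = b"
    using sm_back(2)[OF hom_mor[OF neg_in[OF b]], of 1] neg_neg[OF b] by (simp add: f_def sm_1)
  then have "(f, g, a) \<in> Tri T"
    using tri_rotate[of f g a] t hom_mor[OF f] hom_dom_cod[OF f] hom_dom_cod[OF g] hom_dom_cod[OF a]
        g a s\<Gamma> by simp
  then show ?thesis using that f a s\<Gamma> by blast
qed

end

section \<open>Localization at compact torsion objects\<close>

context bik_category
begin

lemma small_homs:
  assumes "K \<subseteq> Cpt" "small \<kappa> K" "X \<in> Ob T" shows "small \<kappa> (\<Union>E\<in>K. Hom T E X)"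
  by (rule small_UNION[OF size assms(2)]) (use generated assms in \<open>auto simp:
      compactly_generated_def\<close>)

text \<open>The last clause says that Hom(C, g) becomes bijective after localization at \<pp>
  whenever the objects of \<open>K\<close> vanish there: kernel and cokernel are controlled by the
  coproduct of objects of \<open>K\<close>, which is torsion at \<pp>.\<close>

lemma bousfield_step:
  assumes K: "K \<subseteq> Cpt" "small \<kappa> K" and Y: "Y \<in> Ob T"
  shows "\<exists>Y' g. g \<in> Hom T Y Y' \<and> (\<forall>E\<in>K. \<forall>y\<in>Hom T E Y. g \<cdot> y = Zer T E Y') \<and>
    (\<forall>L. (\<forall>E\<in>K. orth E L) \<longrightarrow> (\<forall>e\<in>Hom T Y L. \<exists>e'\<in>Hom T Y' L. e = e' \<cdot> g)) \<and>
    (\<forall>\<pp>\<in>Spec R. (\<forall>E\<in>K. \<forall>C\<in>Cpt. tors_hom \<pp> C E) \<longrightarrow> (\<forall>C\<in>Cpt.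
      (\<forall>y\<in>Hom T C Y. g \<cdot> y = Zer T C Y' \<longrightarrow> tors \<pp> y) \<and>
      (\<forall>y\<in>Hom T C Y'. \<exists>a u z. u \<in> grade R a \<and> u \<notin> \<pp> \<and> z \<in> Hom T C (Sh a Y) \<and>
        act T a u Y' \<cdot> y = Sm a g \<cdot> z)))"
proof -
  let ?N = "\<Union>E\<in>K. Hom T E Y"
  have N: "small \<kappa> ?N" by (rule small_homs[OF K Y])
  have N': "y \<in> Hom T (Dom T y) Y" if "y \<in> ?N" for y using that hom_dom_cod(1) by blast
  from cone_off[OF Y N N'] obtain P \<iota> m Y' g h where P: "is_coproduct T ?N (Dom T) P \<iota>"
    and m: "m \<in> Hom T P Y" "\<forall>y\<in>?N. m \<cdot> \<iota> y = y"
    and t: "(m, g, h) \<in> Tri T" and g: "g \<in> Hom T Y Y'" and h: "h \<in> Hom T Y' (Sus T P)" .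
  have DK: "Dom T y \<in> K" if "y \<in> ?N" for y using that hom_dom_cod(1) by auto
  note Pob = is_coproduct_ob[OF P]
  have Y': "Y' \<in> Ob T" using hom_ob g by blast
  show ?thesis
  proof (intro exI[of _ Y'] exI[of _ g] conjI g ballI allI impI)
    fix E y assume E: "E \<in> K" and y: "y \<in> Hom T E Y"
    then have "y \<in> ?N" by blast
    then show "g \<cdot> y = Zer T E Y'" using cone_off_kills[OF P m t g] hom_dom_cod(1)[OF y] by simp
  next
    fix L e assume L: "\<forall>E\<in>K. orth E L" and e: "e \<in> Hom T Y L"
    have Lob: "L \<in> Ob T" using hom_ob e by blast
    have "e \<cdot> m = Zer T P L"
    proof (rule is_coproduct_eqI[OF P comp[OF m(1) e] zer_in[OF Pob Lob]])
      fix y assume y: "y \<in> ?N"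
      note i = is_coproduct_inj[OF P y]
      have "(e \<cdot> m) \<cdot> \<iota> y \<in> Hom T (Dom T y) L" using comp[OF i comp[OF m(1) e]] .
      then have "(e \<cdot> m) \<cdot> \<iota> y = Zer T (Dom T y) L" using L DK[OF y] unfolding orth_def by blast
      then show "(e \<cdot> m) \<cdot> \<iota> y = Zer T P L \<cdot> \<iota> y" using comp_zer_left[OF i Lob] by simp
    qed
    from tri_coexact[OF t m(1) g e this] show "\<exists>e'\<in>Hom T Y' L. e = e' \<cdot> g" by blast
  next
    fix \<pp> C y assume p: "\<pp> \<in> Spec R" and tK: "\<forall>E\<in>K. \<forall>C\<in>Cpt. tors_hom \<pp> C E" and C: "C \<in> Cpt"
      and y: "y \<in> Hom T C Y" and 0: "g \<cdot> y = Zer T C Y'"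
    from tri_exact[OF t m(1) g y 0] obtain w where w: "w \<in> Hom T C P" "y = m \<cdot> w" .
    have "tors \<pp> w" using tors_hom_coproduct[OF p C N P] tK DK C w(1)
        unfolding tors_hom_def by blast
    then show "tors \<pp> y" using tors_comp_left[OF _ w(1) m(1)] w(2) by simp
  next
    fix \<pp> C y assume p: "\<pp> \<in> Spec R" and tK: "\<forall>E\<in>K. \<forall>C\<in>Cpt. tors_hom \<pp> C E" and C: "C \<in> Cpt"
      and y: "y \<in> Hom T C Y'"
    note hy = comp[OF y h]
    have "tors_hom \<pp> (Sh (- 1) C) P"
      using tors_hom_coproduct[OF p compact_sh[OF C] N P] tK DK compact_sh[OF C] by blast
    then have "tors_hom \<pp> C (Sus T P)"
      using tors_hom_sh_left[OF compact_ob[OF C] Pob, of _ 1] by (simp add: sh_1)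
    then have "tors \<pp> (h \<cdot> y)" using hy unfolding tors_hom_def by blast
    then obtain a u where u: "u \<in> grade R a" "u \<notin> \<pp>"
        "act T a u (Sus T P) \<cdot> (h \<cdot> y) = Zer T C (Sh a (Sus T P))"
      using torsE[OF _ hy] by blast
    have "Sm a h \<cdot> (act T a u Y' \<cdot> y) = Zer T C (Sh a (Sus T P))"
      using u(3) comp_assoc[OF y act_in[OF u(1) Y'] sm_in[OF h]] act_nat[OF u(1) h]
        comp_assoc[OF y h act_in[OF u(1) sus_in[OF Pob]]] by simp
    from sh_tri_exact2[OF t g h comp[OF y act_in[OF u(1) Y']] this]
    obtain z where "z \<in> Hom T C (Sh a Y)" "act T a u Y' \<cdot> y = Sm a g \<cdot> z" .
    then show "\<exists>a u z. u \<in> grade R a \<and> u \<notin> \<pp> \<and> z \<in> Hom T C (Sh a Y) \<and> act T a u Y' \<cdot> y = Sm a g \<cdot> z"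
      using u by blast
  qed
qed

text \<open>\<open>L\<close> is the homotopy colimit of the sequence which arises from \<open>X\<close> by repeatedly coning off all
  morphisms from objects of \<open>K\<close>. That \<open>\<Gamma>\<close> is torsion is read off from the sequence, so that it is
      not
  necessary to construct \<open>\<Gamma>\<close> from objects of \<open>K\<close>.\<close>

lemma bousfield:
  assumes K: "K \<subseteq> Cpt" "small \<kappa> K" and X: "X \<in> Ob T"
  obtains \<Gamma> L f g h where "(f, g, h) \<in> Tri T" "f \<in> Hom T \<Gamma> X" "g \<in> Hom T X L"
    "\<forall>E\<in>K. orth E L"
    "\<forall>L'. (\<forall>E\<in>K. orth E L') \<longrightarrow> (\<forall>e\<in>Hom T X L'. \<exists>e'\<in>Hom T L L'. e = e' \<cdot> g)"
    "\<forall>\<pp>\<in>Spec R. (\<forall>E\<in>K. \<forall>C\<in>Cpt. tors_hom \<pp> C E) \<longrightarrow> (\<forall>C\<in>Cpt. tors_hom \<pp> C \<Gamma>)"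
proof -
  have "\<forall>Y\<in>Ob T. \<exists>Y' g. g \<in> Hom T Y Y' \<and> (\<forall>E\<in>K. \<forall>y\<in>Hom T E Y. g \<cdot> y = Zer T E Y') \<and>
    (\<forall>L. (\<forall>E\<in>K. orth E L) \<longrightarrow> (\<forall>e\<in>Hom T Y L. \<exists>e'\<in>Hom T Y' L. e = e' \<cdot> g)) \<and>
    (\<forall>\<pp>\<in>Spec R. (\<forall>E\<in>K. \<forall>C\<in>Cpt. tors_hom \<pp> C E) \<longrightarrow> (\<forall>C\<in>Cpt.
      (\<forall>y\<in>Hom T C Y. g \<cdot> y = Zer T C Y' \<longrightarrow> tors \<pp> y) \<and>
      (\<forall>y\<in>Hom T C Y'. \<exists>a u z. u \<in> grade R a \<and> u \<notin> \<pp> \<and> z \<in> Hom T C (Sh a Y) \<and>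
        act T a u Y' \<cdot> y = Sm a g \<cdot> z)))" (is "\<forall>Y\<in>_. \<exists>Y' g. ?\<Psi> Y Y' g")
    by (intro ballI bousfield_step[OF K])
  from bchoice[OF this] obtain nx where "\<forall>Y\<in>Ob T. \<exists>g. ?\<Psi> Y (nx Y) g" by (elim exE)
  from bchoice[OF this] obtain gg where "\<forall>Y\<in>Ob T. ?\<Psi> Y (nx Y) (gg Y)" by (elim exE)
  then have st: "?\<Psi> Y (nx Y) (gg Y)" if "Y \<in> Ob T" for Y using that by (rule bspec)
  define XX where "XX n = (nx ^^ n) X" for n
  define f where "f n = gg (XX n)" for n
  have Xob: "XX n \<in> Ob T" for n
  proof (induction n)
    case 0 then show ?case using X by (simp add: XX_def)
  next
    case (Suc n)
    then have "gg (XX n) \<in> Hom T (XX n) (nx (XX n))" using st[OF Suc, THEN conjunct1] by simp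
    then show ?case using hom_ob(2) by (simp add: XX_def)
  qed
  have \<Psi>: "?\<Psi> (XX n) (XX (Suc n)) (f n)" for n using st[OF Xob[of n]] by (simp add: XX_def f_def)
  have fin: "f n \<in> Hom T (XX n) (XX (Suc n))" for n using \<Psi>[of n] by (rule conjunct1)
  have fkill: "f n \<cdot> y = Zer T E (XX (Suc n))" if "E \<in> K" "y \<in> Hom T E (XX n)" for n E y
    using \<Psi>[of n, THEN conjunct2, THEN conjunct1] that by blast
  have fext: "\<exists>e'\<in>Hom T (XX (Suc n)) L. e = e' \<cdot> f n" if "\<forall>E\<in>K. orth E L"
      "e \<in> Hom T (XX n) L" for n L e
    using \<Psi>[of n, THEN conjunct2, THEN conjunct2, THEN conjunct1] that by blast
  have ftors1: "tors \<pp> y" if "\<pp> \<in> Spec R" "\<forall>E\<in>K. \<forall>C\<in>Cpt. tors_hom \<pp> C E" "C \<in> Cpt"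
      "y \<in> Hom T C (XX n)"
    "f n \<cdot> y = Zer T C (XX (Suc n))" for \<pp> C y n
    using \<Psi>[of n, THEN conjunct2, THEN conjunct2, THEN conjunct2] that by blast
  have ftors2: "\<exists>a u z. u \<in> grade R a \<and> u \<notin> \<pp> \<and> z \<in> Hom T C (Sh a (XX n))
      \<and> act T a u (XX (Suc n)) \<cdot> y = Sm a (f n) \<cdot> z"
    if "\<pp> \<in> Spec R" "\<forall>E\<in>K. \<forall>C\<in>Cpt. tors_hom \<pp> C E" "C \<in> Cpt" "y \<in> Hom T C (XX (Suc n))" for \<pp> C y n
    using \<Psi>[of n, THEN conjunct2, THEN conjunct2, THEN conjunct2] that by blast
  obtain L j where hc: "hocolim XX f L j" using ex_hocolim[of f XX] fin by blast
  note jin = hocolim_in[OF hc] and jf = hocolim_compat[OF hc]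
  have L: "L \<in> Ob T" using hom_ob(2)[OF jin[of 0]] .
  have j0: "j 0 \<in> Hom T X L" using jin[of 0] by (simp add: XX_def)
  obtain \<Gamma> k h where t: "(k, j 0, h) \<in> Tri T" and k: "k \<in> Hom T \<Gamma> X" and h: "h \<in> Hom T L (Sus T \<Gamma>)"
    by (rule tri_ex_fibre[OF j0])
  have \<Gamma>: "\<Gamma> \<in> Ob T" using hom_ob k by blast
  have loc: "orth E L" if E: "E \<in> K" for E
    unfolding orth_def
  proof
    fix y assume y: "y \<in> Hom T E L"
    have EC: "E \<in> Cpt" using K E by blast
    obtain n z where z: "z \<in> Hom T E (XX n)" "y = j n \<cdot> z" by (rule hocolim_lift[OF hc EC y])
    have "y = j (Suc n) \<cdot> (f n \<cdot> z)" using comp_assoc[OF z(1) fin jin] jf[of n] z(2) by simp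
    then show "y = Zer T E L" using fkill[OF E z(1)] comp_zer_right[OF jin compact_ob[OF EC]]
        by simp
  qed
  have univ: "\<exists>e'\<in>Hom T L L'. e = e' \<cdot> j 0" if L': "\<forall>E\<in>K. orth E L'"
      and e: "e \<in> Hom T X L'" for L' e
  proof -
    \<comment> \<open>Extensions to the stages are chosen one after the other; the condition at zero
      anchors the sequence at \<open>e\<close>.\<close>
    have "\<exists>es. \<forall>n. (es n \<in> Hom T (XX n) L' \<and> (n = 0 \<longrightarrow> es n = e)) \<and> es n = es (Suc n) \<cdot> f n"
    proof (rule dependent_nat_choice)
      show "\<exists>x. x \<in> Hom T (XX 0) L' \<and> ((0 :: nat) = 0 \<longrightarrow> x = e)" using e by (simp add: XX_def)
      fix x n assume "x \<in> Hom T (XX n) L' \<and> (n = 0 \<longrightarrow> x = e)"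
      then show "\<exists>y. (y \<in> Hom T (XX (Suc n)) L' \<and> (Suc n = 0 \<longrightarrow> y = e)) \<and> x = y \<cdot> f n"
        using fext[OF L', of x n] by auto
    qed
    then obtain es where es: "\<And>n. es n \<in> Hom T (XX n) L'" "es 0 = e"
        "\<And>n. es (Suc n) \<cdot> f n = es n" by metis
    obtain e' where "e' \<in> Hom T L L'" "\<And>n. e' \<cdot> j n = es n"
      by (rule hocolim_weak_universal[OF hc, of es L', OF es(1,3)]) blast
    then show ?thesis using es(2) by metis
  qed
  have tor: "tors_hom \<pp> C \<Gamma>" if p: "\<pp> \<in> Spec R" and tK: "\<forall>E\<in>K. \<forall>C\<in>Cpt. tors_hom \<pp> C E"
      and C: "C \<in> Cpt" for \<pp> C
  proof -
    \<comment> \<open>The kernel of the map from a stage to \<open>L\<close> is torsion.\<close>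
    have kill: "tors \<pp> z" if C: "C \<in> Cpt" and z: "z \<in> Hom T C (XX n)"
        "j n \<cdot> z = Zer T C L" for C n z
    proof (rule hocolim_kernel[OF hc C z])
      show "tors \<pp> (Zer T C (XX m))" for m by (rule tors_zer[OF p compact_ob[OF C] Xob])
      fix m z assume z: "z \<in> Hom T C (XX m)" and tf: "tors \<pp> (f m \<cdot> z)"
      obtain a u where u: "u \<in> grade R a" "u \<notin> \<pp>"
          "act T a u (XX (Suc m)) \<cdot> (f m \<cdot> z) = Zer T C (Sh a (XX (Suc m)))"
        by (rule torsE[OF tf comp[OF z fin]])
      let ?w = "act T a u (XX m) \<cdot> z"
      have w: "?w \<in> Hom T C (Sh a (XX m))" using comp[OF z act_in[OF u(1) Xob]] .
      have w': "Sm (- a) ?w \<in> Hom T (Sh (- a) C) (XX m)" by (rule sm_in_back[OF w Xob])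
      have "Sm a (f m) \<cdot> ?w = Zer T C (Sh a (XX (Suc m)))"
        using comp_assoc[OF z act_in[OF u(1) Xob] sm_in[OF fin]] act_nat[OF u(1) fin]
          comp_assoc[OF z fin act_in[OF u(1) Xob]] u(3) by simp
      then have "Sm (- a) (Sm a (f m)) \<cdot> Sm (- a) ?w = Zer T (Sh (- a) C) (XX (Suc m))"
        using sm_comp[OF w sm_in[OF fin], of "- a"] sm_zer[OF compact_ob[OF C] sh_in[OF Xob], of "-
            a" a] sh_back(1)[OF Xob]
        by simp
      then have "f m \<cdot> Sm (- a) ?w = Zer T (Sh (- a) C) (XX (Suc m))"
        using sm_back(1)[OF hom_mor[OF fin]] by simp
      then have "tors \<pp> (Sm (- a) ?w)" by (rule ftors1[OF p tK compact_sh[OF C] w'])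
      then have "tors \<pp> ?w" using tors_sm[OF w] by blast
      then show "tors \<pp> z" by (rule tors_mult[OF p z u(1,2)])
    qed
    \<comment> \<open>The cokernel of \<open>j 0\<close> is torsion: \<open>z\<close> is pulled back
      stage by stage, and the denominators multiply.\<close>
    have push: "\<exists>a u x. u \<in> grade R a \<and> u \<notin> \<pp> \<and> x \<in> Hom T C (Sh a X)
        \<and> act T a u L \<cdot> (j n \<cdot> z) = Sm a (j 0) \<cdot> x"
      if "C \<in> Cpt" "z \<in> Hom T C (XX n)" for n C z
      using that
    proof (induction n arbitrary: C z)
      case 0
      have "act T 0 \<one>\<^bsub>R\<^esub> L \<cdot> (j 0 \<cdot> z) = Sm 0 (j 0) \<cdot> z"
        using act_one[OF L] comp_idn_left[OF comp[OF 0(2) jin]] by (simp add: sm_0)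
      moreover have "z \<in> Hom T C (Sh 0 X)" using 0(2) by (simp add: XX_def sh_0)
      ultimately show ?case using grade_one Spec_one[OF p] by blast
    next
      case (Suc n)
      obtain a u z' where u: "u \<in> grade R a" "u \<notin> \<pp>" and z': "z' \<in> Hom T C (Sh a (XX n))"
        "act T a u (XX (Suc n)) \<cdot> z = Sm a (f n) \<cdot> z'" using ftors2[OF p tK Suc.prems] by blast
      let ?z = "Sm (- a) z'"
      have z: "?z \<in> Hom T (Sh (- a) C) (XX n)" by (rule sm_in_back[OF z'(1) Xob])
      obtain b v x where v: "v \<in> grade R b" "v \<notin> \<pp>" and x: "x \<in> Hom T (Sh (- a) C) (Sh b X)"
        "act T b v L \<cdot> (j n \<cdot> ?z) = Sm b (j 0) \<cdot> x"
            using Suc.IH[OF compact_sh[OF Suc.prems(1)] z] by blast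
      note zz = Suc.prems(2)
      have jz: "j (Suc n) \<cdot> z \<in> Hom T C L" using comp[OF zz jin] .
      have saz: "Sm a ?z = z'" using sm_back(2)[OF hom_mor[OF z'(1)]] .
      have 1: "act T a u L \<cdot> (j (Suc n) \<cdot> z) = Sm a (j n \<cdot> ?z)"
      proof -
        have "act T a u L \<cdot> (j (Suc n) \<cdot> z) = (Sm a (j (Suc n)) \<cdot> act T a u (XX (Suc n))) \<cdot> z"
          using comp_assoc[OF zz jin act_in[OF u(1) L]] act_nat[OF u(1) jin, of "Suc n"] by simp
        also have "\<dots> = Sm a (j (Suc n)) \<cdot> (Sm a (f n) \<cdot> z')"
          using comp_assoc[OF zz act_in[OF u(1) Xob] sm_in[OF jin]] z'(2) by simp
        also have "\<dots> = Sm a (j n) \<cdot> z'"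
          using comp_assoc[OF z'(1) sm_in[OF fin] sm_in[OF jin]] sm_comp[OF fin jin, of a n] jf[of
              n] by simp
        finally show ?thesis using sm_comp[OF z jin, of a] saz by simp
      qed
      have "act T (b + a) (v \<otimes>\<^bsub>R\<^esub> u) L \<cdot> (j (Suc n) \<cdot> z) = Sm a (act T b v L) \<cdot> Sm a (j n \<cdot> ?z)"
        using smul_mult[OF v(1) u(1) L, of "j (Suc n) \<cdot> z" C 0] jz 1
            by (simp add: smul_0 sh_0) (simp add: smul_def)
      also have "\<dots> = Sm a (Sm b (j 0) \<cdot> x)"
        using sm_comp[OF comp[OF z jin] act_in[OF v(1) L], of a] x(2) by simp
      also have "\<dots> = Sm (b + a) (j 0) \<cdot> Sm a x"
        using sm_comp[OF x(1) sm_in[OF j0], of a] sm_sm[OF hom_mor[OF j0]]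
            by (simp add: add.commute)
      finally have "act T (b + a) (v \<otimes>\<^bsub>R\<^esub> u) L \<cdot> (j (Suc n) \<cdot> z) = Sm (b + a) (j 0) \<cdot> Sm a x" .
      moreover have "Sm a x \<in> Hom T C (Sh (b + a) X)"
        using sm_in_forth[OF x(1) compact_ob[OF Suc.prems(1)]] sh_sh[OF X, of a b]
            by (simp add: add.commute)
      ultimately show ?case using grade_mult[OF v(1) u(1)] Spec_mult[OF p v u] by blast
    qed
    \<comment> \<open>A morphism to \<Gamma> that dies in \<open>X\<close> comes from
      \<open>L\<close>. Up to a denominator it then passes through \<open>h \<cdot> j 0\<close>,
      which is zero.\<close>
    have zero_case: "tors \<pp> y" if C: "C \<in> Cpt" and y: "y \<in> Hom T C \<Gamma>"
        and 0: "k \<cdot> y = Zer T C X" for C y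
    proof -
      have ob: "C \<in> Ob T" using compact_ob[OF C] .
      have "SusM T k \<cdot> SusM T y = Zer T (Sus T C) (Sus T X)"
        using sus_comp[OF y k] 0 sus_zer[OF ob X] by simp
      from tri_exact3[OF t k h sus_hom[OF y] this]
      obtain z where z: "z \<in> Hom T (Sus T C) L" "SusM T y = h \<cdot> z" .
      have sC: "Sus T C \<in> Cpt" using compact_sh[OF C, of 1] by (simp add: sh_1)
      obtain n z' where z': "z' \<in> Hom T (Sus T C) (XX n)"
          "z = j n \<cdot> z'" by (rule hocolim_lift[OF hc sC z(1)])
      obtain a u x where u: "u \<in> grade R a" "u \<notin> \<pp>" and x: "x \<in> Hom T (Sus T C) (Sh a X)"
          "act T a u L \<cdot> z = Sm a (j 0) \<cdot> x"
        using push[OF sC z'(1)] z'(2) by blast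
      have "act T a u (Sus T \<Gamma>) \<cdot> SusM T y = (Sm a h \<cdot> act T a u L) \<cdot> z"
        using z(2) comp_assoc[OF z(1) h act_in[OF u(1) sus_in[OF \<Gamma>]]] act_nat[OF u(1) h] by simp
      also have "\<dots> = Sm a h \<cdot> (Sm a (j 0) \<cdot> x)" using comp_assoc[OF z(1) act_in[OF u(1) L] sm_in[OF
          h]] x(2) by simp
      also have "\<dots> = Sm a (h \<cdot> j 0) \<cdot> x" using comp_assoc[OF x(1) sm_in[OF j0] sm_in[OF h]]
          sm_comp[OF j0 h, of a] by simp
      also have "\<dots> = Zer T (Sus T C) (Sh a (Sus T \<Gamma>))"
        using tri_zero2[OF t j0 h] sm_zer[OF X sus_in[OF \<Gamma>]] comp_zer_left[OF x(1) sh_in[OF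
            sus_in[OF \<Gamma>]]] by simp
      finally have "tors \<pp> (SusM T y)" by (rule torsI[OF sus_hom[OF y] u])
      then show ?thesis using tors_sm[OF y, of \<pp> 1] by (simp add: sm_1)
    qed
    show ?thesis
      unfolding tors_hom_def
    proof
      fix y assume y: "y \<in> Hom T C \<Gamma>"
      have ob: "C \<in> Ob T" using compact_ob[OF C] .
      note ky = comp[OF y k]
      have ky': "k \<cdot> y \<in> Hom T C (XX 0)" using ky by (simp add: XX_def)
      have "j 0 \<cdot> (k \<cdot> y) = Zer T C L"
        using comp_assoc[OF y k j0] tri_zero[OF t k j0] comp_zer_left[OF y L] by simp
      then have "tors \<pp> (k \<cdot> y)" by (rule kill[OF C ky'])
      then obtain a u where u: "u \<in> grade R a" "u \<notin> \<pp>" "act T a u X \<cdot> (k \<cdot> y) = Zer T C (Sh a X)"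
        using torsE[OF _ ky] by blast
      let ?w = "act T a u \<Gamma> \<cdot> y"
      have w: "?w \<in> Hom T C (Sh a \<Gamma>)" using comp[OF y act_in[OF u(1) \<Gamma>]] .
      have w': "Sm (- a) ?w \<in> Hom T (Sh (- a) C) \<Gamma>" by (rule sm_in_back[OF w \<Gamma>])
      have "Sm a k \<cdot> ?w = Zer T C (Sh a X)"
        using comp_assoc[OF y act_in[OF u(1) \<Gamma>] sm_in[OF k]] act_nat[OF u(1) k]
          comp_assoc[OF y k act_in[OF u(1) X]] u(3) by simp
      then have "Sm (- a) (Sm a k) \<cdot> Sm (- a) ?w = Zer T (Sh (- a) C) X"
        using sm_comp[OF w sm_in[OF k], of "- a"] sm_zer[OF ob sh_in[OF X], of "- a" a]
            sh_back(1)[OF X] by simp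
      then have "k \<cdot> Sm (- a) ?w = Zer T (Sh (- a) C) X" using sm_back(1)[OF hom_mor[OF k]] by simp
      then have "tors \<pp> (Sm (- a) ?w)" by (rule zero_case[OF compact_sh[OF C] w'])
      then have "tors \<pp> ?w" using tors_sm[OF w] by blast
      then show "tors \<pp> y" by (rule tors_mult[OF p y u(1,2)])
    qed
  qed
  show ?thesis by (rule that[OF t k j0]) (use loc univ tor in blast)+
qed

lemma good_generators_sub: assumes "good_generators G" shows "G \<subseteq> Cpt" "small \<kappa> G"
  using assms unfolding good_generators_def by auto

lemma torsion_localization_triangle:
  assumes G: "good_generators G" and X: "X \<in> Ob T"
  obtains \<Gamma> L f g h where "(f, g, h) \<in> Tri T" "f \<in> Hom T \<Gamma> X" "g \<in> Hom T X L" "\<Gamma> \<in> torsion \<V>"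
    "\<forall>E\<in>G \<inter> torsion \<V>. orth E L"
    "\<forall>L'. (\<forall>E\<in>G \<inter> torsion \<V>. orth E L') \<longrightarrow> (\<forall>e\<in>Hom T X L'. \<exists>e'\<in>Hom T L L'. e = e' \<cdot> g)"
proof -
  have K: "G \<inter> torsion \<V> \<subseteq> Cpt" "small \<kappa> (G \<inter> torsion \<V>)" 
    using good_generators_sub[OF G] small_mono by blast+
  from bousfield[OF K X] obtain \<Gamma> L f g h where t: "(f, g, h) \<in> Tri T" "f \<in> Hom T \<Gamma> X"
      "g \<in> Hom T X L"
    "\<forall>E\<in>G \<inter> torsion \<V>. orth E L"
    "\<forall>L'. (\<forall>E\<in>G \<inter> torsion \<V>. orth E L') \<longrightarrow> (\<forall>e\<in>Hom T X L'. \<exists>e'\<in>Hom T L L'. e = e' \<cdot> g)"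
    "\<forall>\<pp>\<in>Spec R. (\<forall>E\<in>G \<inter> torsion \<V>. \<forall>C\<in>Cpt. tors_hom \<pp> C E) \<longrightarrow> (\<forall>C\<in>Cpt. tors_hom \<pp> C \<Gamma>)" .
  have "\<Gamma> \<in> torsion \<V>" unfolding torsion_iff
  proof (intro conjI ballI)
    show "\<Gamma> \<in> Ob T" using hom_ob t(2) by blast
    fix C \<pp> assume "C \<in> Cpt" "\<pp> \<in> Spec R - \<V>"
    moreover have "\<forall>E\<in>G \<inter> torsion \<V>. \<forall>C\<in>Cpt. tors_hom \<pp> C E" if "\<pp> \<in> Spec R - \<V>"
        using that torsion_iff by blast
    ultimately show "tors_hom \<pp> C \<Gamma>" using t(6) by blast
  qed
  then show ?thesis by (rule that[OF t(1-3) _ t(4,5)])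
qed

text \<open>Localization is applied to \<open>W\<close> itself: the resulting \<open>L\<close> is
  both torsion and local, hence zero, and every morphism from \<open>W\<close> to \<open>L'\<close>
  factors through it. This replaces the statement that \<open>G \<inter> torsion \<V>\<close>
  generates the torsion objects.\<close>

lemma orth_torsion_local:
  assumes G: "good_generators G" and W: "W \<in> torsion \<V>" and L': "\<And>E. E \<in> G \<inter> torsion \<V> \<Longrightarrow> orth E L'"
  shows "orth W L'"
  unfolding orth_def
proof
  fix e assume e: "e \<in> Hom T W L'"
  have Wob: "W \<in> Ob T" using torsion_ob[OF W] .
  obtain \<Gamma> L f g h where t: "(f, g, h) \<in> Tri T" "f \<in> Hom T \<Gamma> W" "g \<in> Hom T W L" "\<Gamma> \<in> torsion \<V>"
    "\<forall>E\<in>G \<inter> torsion \<V>. orth E L"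
    "\<forall>L'. (\<forall>E\<in>G \<inter> torsion \<V>. orth E L') \<longrightarrow> (\<forall>e\<in>Hom T W L'. \<exists>e'\<in>Hom T L L'. e = e' \<cdot> g)"
    by (rule torsion_localization_triangle[OF G Wob])
  have "L \<in> torsion \<V>"
    using triangulated_subcategory_tri(1)[OF torsion_triangulated t(1-3)] t(4) W by blast
  then have "zero_object T L"
    using torsion_local_zero[OF G, of L \<V>] t(5) good_generators_sub(1)[OF G]
        unfolding torsion_iff by blast
  then have "g = Zer T W L" using zero_object_hom_to t(3) by blast
  moreover obtain e' where "e' \<in> Hom T L L'" "e = e' \<cdot> g" using t(6) L' e by blast
  ultimately show "e = Zer T W L'" using comp_zer_right Wob by metis
qed

text \<open>The cone \<open>L\<close> of the torsion part is torsion when tested on \<open>G\<close>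
  and it is local, so \<open>torsion_local_zero\<close> makes it vanish.\<close>

lemma torsionI_generators:
  assumes G: "good_generators G" and X: "X \<in> Ob T"
    and t: "\<And>D \<pp>. D \<in> G \<Longrightarrow> \<pp> \<in> Spec R - \<V> \<Longrightarrow> tors_hom \<pp> D X"
  shows "X \<in> torsion \<V>"
proof -
  obtain \<Gamma> L f g h where tr: "(f, g, h) \<in> Tri T" "f \<in> Hom T \<Gamma> X" "g \<in> Hom T X L" "\<Gamma> \<in> torsion \<V>"
    "\<forall>E\<in>G \<inter> torsion \<V>. orth E L"
    by (rule torsion_localization_triangle[OF G X])
  have GC: "G \<subseteq> Cpt" using good_generators_sub[OF G] by blast
  have Gsh: "Sh n D \<in> G" if "D \<in> G" for D n using G that unfolding good_generators_def by blast
  have h: "h \<in> Hom T L (Sus T \<Gamma>)" using triE[OF tr(1)] tr(2,3) hom_dom_cod by metis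
  have L: "L \<in> Ob T" and \<Gamma>: "\<Gamma> \<in> Ob T" using hom_ob tr by blast+
  have "tors_hom \<pp> D L" if D: "D \<in> G" and p: "\<pp> \<in> Spec R - \<V>" for D \<pp>
  proof (rule tors_hom_mid[OF _ tri_rot[OF tr(1)] tr(3) h])
    show "\<pp> \<in> Spec R" using p by blast
    show "tors_hom \<pp> (Sh n D) X" for n using t Gsh[OF D] p by blast
    have "tors_hom \<pp> (Sh (- 1) D) \<Gamma>" using tr(4) GC Gsh[OF D, of "- 1"] p
        unfolding torsion_iff by blast
    then show "tors_hom \<pp> D (Sus T \<Gamma>)"
      using tors_hom_sh_left[OF _ \<Gamma>, of D _ 1] D GC compact_ob by (auto simp: sh_1)
  qed
  then have "zero_object T L" using torsion_local_zero[OF G L, of \<V>] tr(5) by blast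
  then have "L \<in> torsion \<V>" using triangulated_subcategory_zero[OF torsion_triangulated] by blast
  then show ?thesis using triangulated_subcategory_tri(3)[OF torsion_triangulated tr(1-3)] tr(4)
      by blast
qed

lemma some_good_generators: obtains G where "good_generators G"
  using ex_good_generators[of "{}"] small_image[OF small_nat[OF size], of _ "{}"] by auto

lemma localization_pair_iff:
  "localization_pair \<kappa> R T \<V> X (\<Gamma>, L) \<longleftrightarrow> (\<exists>f g h. (f, g, h) \<in> Tri T \<and> f \<in> Hom T \<Gamma> X \<and> g \<in> Hom T X L \<and>
    \<Gamma> \<in> torsion \<V> \<and> (\<forall>W\<in>torsion \<V>. orth W L))"
proof -
  have "f \<in> Hom T \<Gamma> X \<and> g \<in> Hom T X L \<longleftrightarrow> Dom T f = \<Gamma> \<and> Cod T f = X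
      \<and> Cod T g = L" if "(f, g, h) \<in> Tri T" for f g h
    using tri_wf[OF that] by (auto simp: Hom_def)
  then have "(f, g, h) \<in> Tri T \<and> Dom T f = \<Gamma> \<and> Cod T f = X \<and> Cod T g = L \<and> P \<longleftrightarrow>
    (f, g, h) \<in> Tri T \<and> f \<in> Hom T \<Gamma> X \<and> g \<in> Hom T X L \<and> P" for f g h P by blast
  then show ?thesis by (simp only: localization_pair_def orth_def prod.case)
qed

lemma localization_pair_exists:
  assumes X: "X \<in> Ob T" shows "\<exists>\<Gamma> L. localization_pair \<kappa> R T \<V> X (\<Gamma>, L)"
proof -
  obtain G where G: "good_generators G" by (rule some_good_generators)
  obtain \<Gamma> L f g h where tr: "(f, g, h) \<in> Tri T" "f \<in> Hom T \<Gamma> X" "g \<in> Hom T X L" "\<Gamma> \<in> torsion \<V>"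
    "\<forall>E\<in>G \<inter> torsion \<V>. orth E L"
    by (rule torsion_localization_triangle[OF G X])
  then have "\<forall>W\<in>torsion \<V>. orth W L" using orth_torsion_local[OF G] by blast
  then show ?thesis unfolding localization_pair_iff using tr by blast
qed

lemma localization_triangle:
  assumes X: "X \<in> Ob T"
  obtains f g h where "(f, g, h) \<in> Tri T" "f \<in> Hom T (Gamma_V \<kappa> R T \<V> X) X"
      "g \<in> Hom T X (L_V \<kappa> R T \<V> X)"
    "h \<in> Hom T (L_V \<kappa> R T \<V> X) (Sus T (Gamma_V \<kappa> R T \<V> X))"
    "Gamma_V \<kappa> R T \<V> X \<in> torsion \<V>" "\<And>W. W \<in> torsion \<V> \<Longrightarrow> orth W (L_V \<kappa> R T \<V> X)"
proof -
  obtain \<Gamma> L where "localization_pair \<kappa> R T \<V> X (\<Gamma>, L)"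
      using localization_pair_exists[OF X, of \<V>] by (elim exE)
  then have "localization_pair \<kappa> R T \<V> X (SOME P. localization_pair \<kappa> R T \<V> X P)" by (rule someI)
  then have "localization_pair \<kappa> R T \<V> X (Gamma_V \<kappa> R T \<V> X, L_V \<kappa> R T \<V> X)"
    unfolding Gamma_V_def L_V_def by simp
  then obtain f g h where t: "(f, g, h) \<in> Tri T" "f \<in> Hom T (Gamma_V \<kappa> R T \<V> X) X"
      "g \<in> Hom T X (L_V \<kappa> R T \<V> X)"
    "Gamma_V \<kappa> R T \<V> X \<in> torsion \<V>" "\<forall>W\<in>torsion \<V>. orth W (L_V \<kappa> R T \<V> X)"
    unfolding localization_pair_iff by (elim exE conjE)
  have "h \<in> Hom T (L_V \<kappa> R T \<V> X) (Sus T (Gamma_V \<kappa> R T \<V> X))"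
      using triE[OF t(1)] t(2,3) hom_dom_cod by metis
  then show ?thesis using that[OF t(1-3) _ t(4)] t(5) by blast
qed

end

context triangulated_category
begin

lemma zero_object_isomorphic:
  assumes "isomorphic T X Y" "zero_object T Y" shows "zero_object T X"
proof -
  obtain f where f: "f \<in> Hom T X Y" "is_iso T f" using assms(1) unfolding isomorphic_def by blast
  obtain g where g: "g \<in> Hom T Y X" "g \<cdot> f = Idn T X" by (rule is_isoE[OF f(2,1)])
  have X: "X \<in> Ob T" using hom_ob f by blast
  have "f = Zer T X Y" using zero_object_hom_to[OF assms(2) f(1)] .
  then show ?thesis using g comp_zer_right[OF g(1) X] X zero_object_iff by metis
qed

end

section \<open>Local objects\<close>

context bik_category
begin

definition local_for :: "'r set set \<Rightarrow> 'o \<Rightarrow> bool" where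
  "local_for \<V> X \<longleftrightarrow> X \<in> Ob T \<and> (\<forall>W\<in>torsion \<V>. orth W X)"

lemma torsion_mono: "\<V> \<subseteq> \<W> \<Longrightarrow> torsion \<V> \<subseteq> torsion \<W>"
  unfolding torsion_objects_def by blast

lemma torsionD: "X \<in> torsion \<V> \<Longrightarrow> C \<in> Cpt \<Longrightarrow> \<pp> \<in> Spec R - \<V> \<Longrightarrow> tors_hom \<pp> C X"
  using torsion_iff by blast

lemma local_for_sh:
  assumes "local_for \<V> L" "W \<in> torsion \<V>" shows "orth W (Sh n L)"
proof -
  have ob: "L \<in> Ob T" "W \<in> Ob T" using assms torsion_ob by (auto simp: local_for_def)
  have "Sh (- n) W \<in> torsion \<V>" using triangulated_subcategory_sh[OF torsion_triangulated ob(2)]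
      assms(2) by blast
  then have "orth (Sh (- n) W) L" using assms(1) unfolding local_for_def by blast
  then show ?thesis using orth_sh[OF sh_in[OF ob(2), of "- n"] ob(1), of n] sh_back(2)[OF ob(2)]
      by simp
qed

lemma torsion_local_for_zero: "X \<in> torsion \<V> \<Longrightarrow> local_for \<V> X \<Longrightarrow> zero_object T X"
  unfolding local_for_def orth_def zero_object_iff using idn by blast

lemma L_V_local: "X \<in> Ob T \<Longrightarrow> local_for \<V> (L_V \<kappa> R T \<V> X)"
  unfolding local_for_def using localization_triangle[of X \<V>] hom_ob by metis

lemma L_V_ob: "X \<in> Ob T \<Longrightarrow> L_V \<kappa> R T \<V> X \<in> Ob T"
  using L_V_local unfolding local_for_def by blast

lemma Gamma_V_torsion: "X \<in> Ob T \<Longrightarrow> Gamma_V \<kappa> R T \<V> X \<in> torsion \<V>"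
  using localization_triangle[of X \<V>] by metis

lemma Gamma_V_of_torsion:
  assumes X: "X \<in> torsion \<V>" shows "isomorphic T (Gamma_V \<kappa> R T \<V> X) X"
      "zero_object T (L_V \<kappa> R T \<V> X)"
proof -
  have Xob: "X \<in> Ob T" using torsion_ob[OF X] .
  obtain f g h where t: "(f, g, h) \<in> Tri T" "f \<in> Hom T (Gamma_V \<kappa> R T \<V> X) X"
      "g \<in> Hom T X (L_V \<kappa> R T \<V> X)"
    using localization_triangle[OF Xob] by metis
  have "L_V \<kappa> R T \<V> X \<in> torsion \<V>"
    using triangulated_subcategory_tri(1)[OF torsion_triangulated t Gamma_V_torsion[OF Xob] X] .
  then show z: "zero_object T (L_V \<kappa> R T \<V> X)" using torsion_local_for_zero L_V_local[OF Xob]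
      by blast
  have "is_iso T f" by (rule tri_iso_of_zero_cone[OF t(1,2)]) (use z hom_dom_cod[OF t(3)] in simp)
  then show "isomorphic T (Gamma_V \<kappa> R T \<V> X) X" using t(2) isomorphicI by blast
qed

text \<open>The map from the torsion part to \<open>X\<close> is zero, so the identity of its
  suspension factors through the local part. As the suspension is torsion, that factor is zero
  too.\<close>

lemma L_V_of_local:
  assumes X: "local_for \<V> X" shows "isomorphic T X (L_V \<kappa> R T \<V> X)"
proof -
  have Xob: "X \<in> Ob T" using X unfolding local_for_def by blast
  let ?G = "Gamma_V \<kappa> R T \<V> X" and ?L = "L_V \<kappa> R T \<V> X"
  obtain f g h where t: "(f, g, h) \<in> Tri T" "f \<in> Hom T ?G X" "g \<in> Hom T X ?L"
      "h \<in> Hom T ?L (Sus T ?G)"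
    using localization_triangle[OF Xob] by metis
  have G: "?G \<in> Ob T" and L: "?L \<in> Ob T" using hom_ob t by blast+
  have "f = Zer T ?G X" using X t(2) Gamma_V_torsion[OF Xob]
      unfolding local_for_def orth_def by blast
  then have "SusM T f \<cdot> Idn T (Sus T ?G) = Zer T (Sus T ?G) (Sus T X)"
    using sus_zer[OF G Xob] comp_idn_right[OF zer_in[OF sus_in[OF G] sus_in[OF Xob]]] by simp
  from tri_exact3[OF t(1,2,4) idn[OF sus_in[OF G]] this]
  obtain z where z: "z \<in> Hom T (Sus T ?G) ?L" "Idn T (Sus T ?G) = h \<cdot> z" .
  have "Sus T ?G \<in> torsion \<V>" using Gamma_V_torsion[OF Xob] triangulated_subcategory_sh[OF
      torsion_triangulated G, of 1]
    by (simp add: sh_1)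
  then have "z = Zer T (Sus T ?G) ?L" using L_V_local[OF Xob] z(1)
      unfolding local_for_def orth_def by blast
  then have "Idn T (Sus T ?G) = Zer T (Sus T ?G) (Sus T ?G)"
      using z(2) comp_zer_right[OF t(4) sus_in[OF G]] by simp
  then have "zero_object T (Sus T ?G)" using zero_object_iff sus_in[OF G] by blast
  then have "zero_object T ?G" using zero_object_sh[of "Sus T ?G"
      "- 1"] sh_back(1)[OF G, of 1] by (simp add: sh_1)
  then have "is_iso T g" using tri_iso_of_zero_fibre[OF t(1,3)] hom_dom_cod[OF t(2)] by simp
  then show ?thesis using t(3) isomorphicI by blast
qed

text \<open>An elementary form of \<qq>-locality. It is the form that is carried over to \<Gamma> in
  \<open>Gamma_V_inverts\<close>.\<close>

definition inverts :: "'r set \<Rightarrow> 'o \<Rightarrow> bool" where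
  "inverts \<qq> X \<longleftrightarrow> (\<forall>a. \<forall>s\<in>grade R a - \<qq>. is_iso T (act T a s X))"

text \<open>By \<open>kos_tors_self\<close> the cone of \<open>s\<close> vanishes at every prime
  inside \<qq>, so it is torsion and has no nonzero morphisms to shifts of \<open>X\<close>. Its
  connecting map is then zero, its identity factors through a shift of \<open>X\<close>, and it
  vanishes.\<close>

lemma local_for_inverts:
  assumes X: "local_for (Zset R \<qq>) X" shows "inverts \<qq> X"
  unfolding inverts_def
proof (intro allI ballI)
  fix a s assume "s \<in> grade R a - \<qq>"
  then have s: "s \<in> grade R a" "s \<notin> \<qq>" by auto
  have Xob: "X \<in> Ob T" using X unfolding local_for_def by blast
  let ?K = "kos a s X"
  obtain g h where k: "(act T a s X, g, h) \<in> Tri T" "g \<in> Hom T (Sh a X) ?K" "h \<in> Hom T ?K (Sus T X)"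
    by (rule kos_tri[OF s(1) Xob])
  have K: "?K \<in> Ob T" using kos_ob[OF s(1) Xob] .
  have "tors_hom \<pp> C ?K" if "\<pp> \<in> Spec R - Zset R \<qq>" for \<pp> C
    using tors_idn(1)[OF K kos_tors_self[OF _ s(1) _ Xob]] that s(2) unfolding Zset_def by blast
  then have Kt: "?K \<in> torsion (Zset R \<qq>)" unfolding torsion_iff using K by blast
  have "h = Zer T ?K (Sus T X)" using local_for_sh[OF X Kt, of 1] k(3)
      unfolding orth_def by (simp add: sh_1)
  then have "h \<cdot> Idn T ?K = Zer T ?K (Sus T X)" using comp_idn_right[OF k(3)] by simp
  from tri_exact2[OF k(1,2,3) idn[OF K] this] obtain z where z: "z \<in> Hom T ?K (Sh a X)"
      "Idn T ?K = g \<cdot> z" .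
  have "z = Zer T ?K (Sh a X)" using local_for_sh[OF X Kt] z(1) unfolding orth_def by blast
  then have "zero_object T ?K" using z(2) comp_zer_right[OF k(2) K] K zero_object_iff by simp
  then show "is_iso T (act T a s X)"
    using tri_iso_of_zero_cone[OF k(1) act_in[OF s(1) Xob]] hom_dom_cod[OF k(2)] by simp
qed

text \<open>A torsion object \<open>E\<close> of \<open>G\<close> has its identity killed by a
  single \<open>u\<close> outside \<qq>, so every morphism from \<open>E\<close> to \<open>X\<close>
  is killed by \<open>u\<close>.\<close>

lemma local_forI:
  assumes q: "\<qq> \<in> Spec R" and G: "good_generators G" and X: "X \<in> Ob T"
    and inj: "\<And>D y a s. D \<in> G \<Longrightarrow> y \<in> Hom T D X \<Longrightarrow> s \<in> grade R a \<Longrightarrow> s \<notin> \<qq> \<Longrightarrow>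
      act T a s X \<cdot> y = Zer T D (Sh a X) \<Longrightarrow> y = Zer T D X"
  shows "local_for (Zset R \<qq>) X"
  unfolding local_for_def
proof (intro conjI X ballI)
  fix W assume "W \<in> torsion (Zset R \<qq>)"
  then show "orth W X"
  proof (rule orth_torsion_local[OF G])
    fix E assume E: "E \<in> G \<inter> torsion (Zset R \<qq>)"
    then have Eob: "E \<in> Ob T" using torsion_ob by blast
    have "\<qq> \<in> Spec R - Zset R \<qq>" using q by (simp add: Zset_def)
    then have "tors_hom \<qq> E E" by (rule torsionD[rotated 2]) (use E good_generators_sub(1)[OF G] in
        auto)
    then have "tors \<qq> (Idn T E)" using idn[OF Eob] unfolding tors_hom_def by blast
    then obtain a u where u: "u \<in> grade R a" "u \<notin> \<qq>" "act T a u E \<cdot> Idn T E = Zer T E (Sh a E)"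
      using torsE idn[OF Eob] by blast
    then have 0: "act T a u E = Zer T E (Sh a E)" using comp_idn_right[OF act_in[OF u(1) Eob]]
        by simp
    show "orth E X"
      unfolding orth_def
    proof
      fix y assume y: "y \<in> Hom T E X"
      have "act T a u X \<cdot> y = Zer T E (Sh a X)"
        using act_nat[OF u(1) y] 0 comp_zer_right[OF sm_in[OF y] Eob] by simp
      then show "y = Zer T E X" using inj E y u by blast
    qed
  qed
qed

lemma inverts_local_for:
  assumes q: "\<qq> \<in> Spec R" and X: "X \<in> Ob T" and inv: "inverts \<qq> X" shows "local_for (Zset R \<qq>) X"
proof -
  obtain G where G: "good_generators G" by (rule some_good_generators)
  show ?thesis
  proof (rule local_forI[OF q G X])
    fix D y a s assume y: "y \<in> Hom T D X" and s: "s \<in> grade R a"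
        "s \<notin> \<qq>" and 0: "act T a s X \<cdot> y = Zer T D (Sh a X)"
    note f = act_in[OF s(1) X]
    have "is_iso T (act T a s X)" using inv s unfolding inverts_def by blast
    then obtain i where i: "i \<in> Hom T (Sh a X) X"
        "i \<cdot> act T a s X = Idn T X" using is_isoE[OF _ f] by blast
    have "y = i \<cdot> (act T a s X \<cdot> y)" using comp_assoc[OF y f i(1)] i(2) comp_idn_left[OF y] by simp
    then show "y = Zer T D X" using 0 comp_zer_right[OF i(1)] hom_ob(1)[OF y] by simp
  qed
qed

text \<open>Morphisms from torsion objects lift uniquely along \<open>f\<close>, because
  \<open>L\<close> and its shifts receive none but zero. The inverse of \<open>s\<close> on
  \<open>X\<close> therefore restricts to \<Gamma>. This replaces the commutation of the functors
  \<Gamma> and L.\<close>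

lemma Gamma_V_inverts:
  assumes X: "X \<in> Ob T" and inv: "inverts \<qq> X" shows "inverts \<qq> (Gamma_V \<kappa> R T \<V> X)"
  unfolding inverts_def
proof (intro allI ballI)
  fix a s assume "s \<in> grade R a - \<qq>"
  then have s: "s \<in> grade R a" and "is_iso T (act T a s X)"
      using inv unfolding inverts_def by simp_all
  let ?G = "Gamma_V \<kappa> R T \<V> X" and ?L = "L_V \<kappa> R T \<V> X"
  obtain f g h where t: "(f, g, h) \<in> Tri T" "f \<in> Hom T ?G X" "g \<in> Hom T X ?L"
      "h \<in> Hom T ?L (Sus T ?G)"
    using localization_triangle[OF X] by metis
  have G: "?G \<in> Ob T" and L: "?L \<in> Ob T" using hom_ob t by blast+
  have Gt: "?G \<in> torsion \<V>" using Gamma_V_torsion[OF X] .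
  have aGt: "Sh a ?G \<in> torsion \<V>" using triangulated_subcategory_sh[OF torsion_triangulated G] Gt
      by blast
  \<comment> \<open>The difference of two lifts factors through \<open>Sh (n - 1) ?L\<close>, which
    receives no nonzero morphism from \<open>W\<close>.\<close>
  have inj: "v = v'" if W: "W \<in> torsion \<V>" and v: "v \<in> Hom T W (Sh n ?G)"
      "v' \<in> Hom T W (Sh n ?G)" and e: "Sm n f \<cdot> v = Sm n f \<cdot> v'"
    for W v v' n
  proof -
    let ?d = "Add T v (Neg T v')"
    have d: "?d \<in> Hom T W (Sh (n - 1 + 1) ?G)" using add_in[OF v(1) neg_in[OF v(2)]] by simp
    have "Sm (n - 1 + 1) f \<cdot> ?d = Zer T W (Sh (n - 1 + 1) X)"
      using comp_add_right[OF v(1) neg_in[OF v(2)] sm_in[OF t(2)]] comp_neg_right[OF v(2) sm_in[OF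
          t(2)]]
        e add_neg[OF comp[OF v(2) sm_in[OF t(2)]]] by simp
    from sh_tri_exact3[OF t(1,2,4) d this]
    obtain z where z: "z \<in> Hom T W (Sh (n - 1) ?L)" "?d = Sm (n - 1) h \<cdot> z" .
    have "z = Zer T W (Sh (n - 1) ?L)" using local_for_sh[OF L_V_local[OF X] W] z(1)
        unfolding orth_def by blast
    then have "?d = Zer T W (Sh n ?G)"
      using z(2) comp_zer_right[OF sm_in[OF t(4)] torsion_ob[OF W], of "n - 1"] sh_sus[OF G, of "n -
          1"] by simp
    then show ?thesis using diff_zer_eq[OF v] by blast
  qed
  note sX = act_in[OF s X] and sG = act_in[OF s G]
  obtain i where i: "i \<in> Hom T (Sh a X) X" "i \<cdot> act T a s X = Idn T X"
      "act T a s X \<cdot> i = Idn T (Sh a X)"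
    by (rule is_isoE[OF \<open>is_iso T (act T a s X)\<close> sX])
  note w = comp[OF sm_in[OF t(2)] i(1)]
  have "g \<cdot> (i \<cdot> Sm a f) = Zer T (Sh a ?G) ?L"
    using comp[OF w t(3)] L_V_local[OF X] aGt unfolding local_for_def orth_def by blast
  from tri_exact[OF t(1,2,3) w this] obtain u where u: "u \<in> Hom T (Sh a ?G) ?G"
      "i \<cdot> Sm a f = f \<cdot> u" .
  have 1: "act T a s ?G \<cdot> u = Idn T (Sh a ?G)"
  proof (rule inj[OF aGt comp[OF u(1) sG] idn[OF sh_in[OF G]]])
    have "Sm a f \<cdot> (act T a s ?G \<cdot> u) = (act T a s X \<cdot> f) \<cdot> u"
      using comp_assoc[OF u(1) sG sm_in[OF t(2)]] act_nat[OF s t(2)] by simp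
    also have "\<dots> = act T a s X \<cdot> (i \<cdot> Sm a f)" using comp_assoc[OF u(1) t(2) sX] u(2) by simp
    also have "\<dots> = Sm a f" using comp_assoc[OF sm_in[OF t(2)] i(1) sX] i(3) comp_idn_left[OF
        sm_in[OF t(2)]] by simp
    finally show "Sm a f \<cdot> (act T a s ?G \<cdot> u) = Sm a f \<cdot> Idn T (Sh a ?G)"
        using comp_idn_right[OF sm_in[OF t(2)]] by simp
  qed
  have 2: "u \<cdot> act T a s ?G = Idn T ?G"
  proof (rule inj[OF Gt, of _ 0])
    show "u \<cdot> act T a s ?G \<in> Hom T ?G (Sh 0 ?G)" "Idn T ?G \<in> Hom T ?G (Sh 0 ?G)"
      using comp[OF sG u(1)] idn[OF G] by (simp_all add: sh_0)
    have "f \<cdot> (u \<cdot> act T a s ?G) = (i \<cdot> Sm a f) \<cdot> act T a s ?G"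
        using comp_assoc[OF sG u(1) t(2)] u(2) by simp
    also have "\<dots> = i \<cdot> (act T a s X \<cdot> f)" using comp_assoc[OF sG sm_in[OF t(2)] i(1)] act_nat[OF s
        t(2)] by simp
    also have "\<dots> = f" using comp_assoc[OF t(2) sX i(1)] i(2) comp_idn_left[OF t(2)] by simp
    finally show "Sm 0 f \<cdot> (u \<cdot> act T a s ?G) = Sm 0 f \<cdot> Idn T ?G"
        using comp_idn_right[OF t(2)] by (simp add: sm_0)
  qed
  show "is_iso T (act T a s ?G)" by (rule is_isoI[OF sG u(1) 2 1])
qed

lemma Gamma_p_torsion: "X \<in> Ob T \<Longrightarrow> Gamma_p \<kappa> R T \<pp> X \<in> torsion (Vset R \<pp>)"
  unfolding Gamma_p_def by (rule Gamma_V_torsion[OF L_V_ob])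

lemma Gamma_p_ob: "X \<in> Ob T \<Longrightarrow> Gamma_p \<kappa> R T \<pp> X \<in> Ob T"
  using Gamma_p_torsion torsion_ob by blast

lemma Gamma_p_local:
  assumes p: "\<pp> \<in> Spec R" and X: "X \<in> Ob T" shows "local_for (Zset R \<pp>) (Gamma_p \<kappa> R T \<pp> X)"
  by (rule inverts_local_for[OF p Gamma_p_ob[OF X]], unfold Gamma_p_def)
    (rule Gamma_V_inverts[OF L_V_ob[OF X] local_for_inverts[OF L_V_local[OF X]]])

lemma Gamma_p_zero:
  assumes X: "X \<in> torsion (Zset R \<pp>)" shows "zero_object T (Gamma_p \<kappa> R T \<pp> X)"
proof -
  have z: "zero_object T (L_V \<kappa> R T (Zset R \<pp>) X)" by (rule Gamma_V_of_torsion(2)[OF X])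
  then have "L_V \<kappa> R T (Zset R \<pp>) X \<in> torsion (Vset R \<pp>)"
      by (rule triangulated_subcategory_zero[OF torsion_triangulated])
  then have "isomorphic T (Gamma_p \<kappa> R T \<pp> X) (L_V \<kappa> R T (Zset R \<pp>) X)"
    unfolding Gamma_p_def by (rule Gamma_V_of_torsion(1))
  then show ?thesis using z by (rule zero_object_isomorphic)
qed

text \<open>Up to isomorphism, L changes nothing on a local object and \<Gamma> nothing on a torsion
  one, so \<open>J\<close> is its own image.\<close>

lemma Gamma_p_imageI:
  assumes J: "J \<in> torsion (Vset R \<pp>)" and loc: "local_for (Zset R \<pp>) J" shows "J \<in> Gamma_p_image \<kappa> R
      T \<pp>"
proof -
  have i: "isomorphic T J (L_V \<kappa> R T (Zset R \<pp>) J)" by (rule L_V_of_local[OF loc])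
  then have "L_V \<kappa> R T (Zset R \<pp>) J \<in> torsion (Vset R \<pp>)"
    using triangulated_subcategory_iso[OF torsion_triangulated] J by blast
  then have "isomorphic T (Gamma_p \<kappa> R T \<pp> J) (L_V \<kappa> R T (Zset R \<pp>) J)"
    unfolding Gamma_p_def by (rule Gamma_V_of_torsion(1))
  then have "isomorphic T (Gamma_p \<kappa> R T \<pp> J) J" using i isomorphic_sym isomorphic_trans by blast
  then show ?thesis unfolding Gamma_p_image_def using torsion_ob[OF J] by blast
qed

section \<open>Orthogonality from disjoint supports\<close>

lemma Loc_Gamma_p:
  assumes "local_global_principle \<kappa> R T" "X \<in> Ob T" "localizing \<kappa> T S"
  shows "X \<in> S \<longleftrightarrow> (\<forall>\<pp>\<in>Spec R. Gamma_p \<kappa> R T \<pp> X \<in> S)"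
proof -
  have e: "Loc \<kappa> T {X} = Loc \<kappa> T {Gamma_p \<kappa> R T \<pp> X | \<pp>. \<pp> \<in> Spec R}"
    using assms(1,2) unfolding local_global_principle_def by blast
  show ?thesis
  proof
    assume "X \<in> S"
    then have "Loc \<kappa> T {X} \<subseteq> S" by (intro Loc_least[OF assms(3)]) simp
    moreover have "Gamma_p \<kappa> R T \<pp> X \<in> Loc \<kappa> T {X}" if "\<pp> \<in> Spec R" for \<pp>
      unfolding e by (rule subsetD[OF Loc_superset]) (use that in blast)
    ultimately show "\<forall>\<pp>\<in>Spec R. Gamma_p \<kappa> R T \<pp> X \<in> S" by blast
  next
    assume "\<forall>\<pp>\<in>Spec R. Gamma_p \<kappa> R T \<pp> X \<in> S"
    then have "Loc \<kappa> T {X} \<subseteq> S" unfolding e by (intro Loc_least[OF assms(3)]) blast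
    then show "X \<in> S" using subsetD[OF Loc_superset[of "{X}"], of X] by blast
  qed
qed

lemma orth_of_supports:
  assumes lg: "local_global_principle \<kappa> R T" and X: "X \<in> Ob T" and Y: "Y \<in> Ob T"
    and disj: "\<And>\<pp> \<qq>. \<pp> \<in> support \<kappa> R T X \<Longrightarrow> \<qq> \<in> support \<kappa> R T Y \<Longrightarrow> \<not> \<pp> \<subseteq> \<qq>"
  shows "orth X Y"
proof -
  obtain G where G: "good_generators G" by (rule some_good_generators)
  define W where "W = {\<qq> \<in> Spec R. \<exists>\<pp>\<in>support \<kappa> R T X. \<pp> \<subseteq> \<qq>}"
  have XW: "X \<in> torsion W"
    unfolding Loc_Gamma_p[OF lg X torsion_localizing]
  proof
    fix \<pp> assume p: "\<pp> \<in> Spec R"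
    show "Gamma_p \<kappa> R T \<pp> X \<in> torsion W"
    proof (cases "\<pp> \<in> support \<kappa> R T X")
      case True
      then have "Vset R \<pp> \<subseteq> W" unfolding Vset_def W_def by blast
      then show ?thesis using Gamma_p_torsion[OF X] torsion_mono by blast
    next
      case False
      then show ?thesis using p triangulated_subcategory_zero[OF torsion_triangulated]
          unfolding support_def by blast
    qed
  qed
  \<comment> \<open>\<open>?N\<close> tests against compact torsion objects only, because
    orthogonality to these is preserved by coproducts; \<open>orth_torsion_local\<close> passes to
    all torsion objects at the end.\<close>
  let ?K = "G \<inter> torsion W" and ?N = "{Y \<in> Ob T. \<forall>E\<in>G \<inter> torsion W. orth E Y}"
  have Gob: "E \<in> Ob T" if "E \<in> G" for E using good_generators_sub(1)[OF G] compact_ob that by blast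
  have Ksh: "Sh n E \<in> ?K" if "E \<in> ?K" for E n
    using that G triangulated_subcategory_sh[OF torsion_triangulated Gob]
        unfolding good_generators_def by blast
  have loc: "localizing \<kappa> T ?N"
    by (rule right_perp_localizing) (use good_generators_sub(1)[OF G] Ksh[of _ 1] Ksh[of _ "- 1"] in
        \<open>auto simp: sh_1\<close>)
  have "Y \<in> ?N"
    unfolding Loc_Gamma_p[OF lg Y loc]
  proof
    fix \<qq> assume q: "\<qq> \<in> Spec R"
    show "Gamma_p \<kappa> R T \<qq> Y \<in> ?N"
    proof (cases "\<qq> \<in> W")
      case True
      then have "\<qq> \<notin> support \<kappa> R T Y" using disj unfolding W_def by blast
      then have "zero_object T (Gamma_p \<kappa> R T \<qq> Y)" using q unfolding support_def by blast
      then show ?thesis by (rule triangulated_subcategory_zero[OF localizing_triangulated[OF loc]])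
    next
      case False
      have "W \<subseteq> Zset R \<qq>" unfolding Zset_def
      proof
        fix r assume r: "r \<in> W"
        then have "\<not> r \<subseteq> \<qq>" using False q unfolding W_def by blast
        then show "r \<in> {r \<in> Spec R. \<not> r \<subseteq> \<qq>}" using r unfolding W_def by blast
      qed
      then show ?thesis using Gamma_p_local[OF q Y] torsion_mono Gamma_p_ob[OF Y]
          unfolding local_for_def by blast
    qed
  qed
  then show ?thesis using orth_torsion_local[OF G XW] by blast
qed

end

section \<open>Chain conditions\<close>

context graded_commutative_ring
begin

lemma hom_decompI:
  assumes "finite F" "\<And>n. c n \<in> grade R n" "\<And>n. n \<notin> F \<Longrightarrow> c n = \<zero>"
  shows "hom_decomp R c (finsum R c F)"
  unfolding hom_decomp_def
proof (intro conjI allI assms(2))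
  have s: "{n. c n \<noteq> \<zero>} \<subseteq> F" using assms(3) by blast
  then show "finite {n. c n \<noteq> \<zero>}" using assms(1) finite_subset by blast
  show "finsum R c F = finsum R c {n. c n \<noteq> \<zero>}"
    by (rule add.finprod_mono_neutral_cong_right[OF assms(1) s]) (use assms(2) grade_carrier in
        auto)
qed

lemma hom_decompE:
  assumes "hom_decomp R c x"
  obtains F where "finite F" "\<And>n. c n \<in> grade R n" "\<And>n. n \<notin> F \<Longrightarrow> c n = \<zero>" "x = finsum R c F"
  using that[of "{n. c n \<noteq> \<zero>}"] assms unfolding hom_decomp_def by blast

lemma hom_decomp_finsum:
  assumes "hom_decomp R c x" "finite F" "\<And>n. n \<notin> F \<Longrightarrow> c n = \<zero>" shows "x = finsum R c F"
proof -
  have "c n \<in> grade R n" for n using assms(1) unfolding hom_decomp_def by blast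
  then have "hom_decomp R c (finsum R c F)" by (rule hom_decompI[OF assms(2) _ assms(3)])
  then show ?thesis using assms(1) unfolding hom_decomp_def by simp
qed

lemma hom_decomp_carrier: "hom_decomp R c x \<Longrightarrow> x \<in> carrier R"
  using finsum_closed[of c "{n. c n \<noteq> \<zero>}"] grade_carrier unfolding hom_decomp_def by (metis Pi_I)

lemma hom_decomp_homogeneous:
  assumes "x \<in> grade R n" shows "hom_decomp R (\<lambda>m. if m = n then x else \<zero>) x"
proof -
  have "finsum R (\<lambda>m. if m = n then x else \<zero>) {n} = x" using grade_carrier[OF assms] by simp
  moreover have "hom_decomp R (\<lambda>m. if m = n then x else \<zero>) (finsum R (\<lambda>m. if m
      = n then x else \<zero>) {n})"
    by (rule hom_decompI) (use assms grade_zero in auto)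
  ultimately show ?thesis by simp
qed

lemma hom_decomp_add:
  assumes c: "hom_decomp R c x" and d: "hom_decomp R d y" shows "hom_decomp R (\<lambda>n. c n \<oplus> d n) (x \<oplus>
      y)"
proof -
  obtain F where F: "finite F" "\<And>n. c n \<in> grade R n"
      "\<And>n. n \<notin> F \<Longrightarrow> c n = \<zero>" using hom_decompE[OF c] by metis
  obtain H where H: "finite H" "\<And>n. d n \<in> grade R n"
      "\<And>n. n \<notin> H \<Longrightarrow> d n = \<zero>" using hom_decompE[OF d] by metis
  have cc: "c \<in> F \<union> H \<rightarrow> carrier R" and dd: "d \<in> F \<union> H \<rightarrow> carrier R"
      using F(2) H(2) grade_carrier by blast+
  have "x \<oplus> y = finsum R c (F \<union> H) \<oplus> finsum R d (F \<union> H)"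
    using hom_decomp_finsum[OF c, of "F \<union> H"] hom_decomp_finsum[OF d, of "F \<union> H"] F H by simp
  also have "\<dots> = finsum R (\<lambda>n. c n \<oplus> d n) (F \<union> H)" using finsum_addf[OF cc dd] by simp
  finally show ?thesis
    using hom_decompI[of "F \<union> H" "\<lambda>n. c n \<oplus> d n"] F H grade_add by simp
qed

lemma hom_decomp_mult:
  assumes r: "r \<in> grade R a" and c: "hom_decomp R c x"
  shows "hom_decomp R (\<lambda>n. r \<otimes> c (n - a)) (r \<otimes> x)" "hom_decomp R (\<lambda>n. c (n - a) \<otimes> r) (x \<otimes> r)"
proof -
  obtain F where F: "finite F" "\<And>n. c n \<in> grade R n" "\<And>n. n \<notin> F \<Longrightarrow> c n = \<zero>" "x = finsum R c F"
    using hom_decompE[OF c] by metis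
  note cc = grade_carrier[OF F(2)] and rc = grade_carrier[OF r]
  let ?H = "(\<lambda>n. n + a) ` F"
  have inj: "inj_on (\<lambda>n. n + a) F" by (simp add: inj_on_def)
  have out: "n - a \<notin> F" if "n \<notin> ?H" for n using that by (metis diff_add_cancel image_eqI)
  have "r \<otimes> x = finsum R (\<lambda>n. r \<otimes> c n) F" unfolding F(4)
      by (rule finsum_rdistr[OF F(1) rc]) (use cc in blast)
  also have "\<dots> = finsum R (\<lambda>n. r \<otimes> c (n - a)) ?H"
    using add.finprod_reindex[OF _ inj, of "\<lambda>n. r \<otimes> c (n - a)"] cc rc by simp
  finally have 1: "r \<otimes> x = finsum R (\<lambda>n. r \<otimes> c (n - a)) ?H" .
  show "hom_decomp R (\<lambda>n. r \<otimes> c (n - a)) (r \<otimes> x)"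
    unfolding 1 by (rule hom_decompI) (use F(1,3) out rc grade_mult[OF r F(2)] in \<open>auto simp:
        algebra_simps\<close>, metis add.commute diff_add_cancel)
  have "x \<otimes> r = finsum R (\<lambda>n. c n \<otimes> r) F" unfolding F(4)
      by (rule finsum_ldistr[OF F(1) rc]) (use cc in blast)
  also have "\<dots> = finsum R (\<lambda>n. c (n - a) \<otimes> r) ?H"
    using add.finprod_reindex[OF _ inj, of "\<lambda>n. c (n - a) \<otimes> r"] cc rc by simp
  finally have 2: "x \<otimes> r = finsum R (\<lambda>n. c (n - a) \<otimes> r) ?H" .
  show "hom_decomp R (\<lambda>n. c (n - a) \<otimes> r) (x \<otimes> r)"
    unfolding 2 by (rule hom_decompI) (use F(1,3) out rc grade_mult[OF F(2) r] in \<open>auto simp: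
        algebra_simps\<close>, metis diff_add_cancel)
qed

text \<open>Coefficient ideals of graded submodules arise degree by degree, while noetherianity
  speaks of subsets of the ring; \<open>family_hull\<close> passes from the former to the
  latter.\<close>

definition ideal_family :: "(int \<Rightarrow> 'r set) \<Rightarrow> bool" where
  "ideal_family I \<longleftrightarrow> (\<forall>n. I n \<subseteq> grade R n \<and> \<zero> \<in> I n) \<and> (\<forall>n. \<forall>x\<in>I n. \<forall>y\<in>I n. x \<oplus> y \<in> I n) \<and>
    (\<forall>a n. \<forall>r\<in>grade R a. \<forall>x\<in>I n. r \<otimes> x \<in> I (a + n))"

definition family_hull :: "(int \<Rightarrow> 'r set) \<Rightarrow> 'r set" where
  "family_hull I = {x. \<exists>c. hom_decomp R c x \<and> (\<forall>n. c n \<in> I n)}"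

lemma ideal_family_minus: assumes I: "ideal_family I" and x: "x \<in> I n" shows "\<ominus> x \<in> I n"
proof -
  have "\<ominus> \<one> \<otimes> x \<in> I (0 + n)" using I x grade_minus[OF grade_one] unfolding ideal_family_def by blast
  moreover have "x \<in> carrier R" using I x grade_carrier unfolding ideal_family_def by blast
  ultimately show ?thesis by (simp add: l_minus)
qed

text \<open>Right multiples agree with left multiples up to sign, so \<open>ideal_family\<close>
  asks only for left ones.\<close>

lemma ideal_family_mult_right:
  assumes I: "ideal_family I" and x: "x \<in> I n" and r: "r \<in> grade R a" shows "x \<otimes> r \<in> I (n + a)"
proof -
  have "r \<otimes> x \<in> I (a + n)" using I x r unfolding ideal_family_def by blast
  moreover have "x \<in> grade R n" using I x unfolding ideal_family_def by blast
  ultimately show ?thesis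
    using graded_commute[OF \<open>x \<in> grade R n\<close> r] rsign_cases[of "n * a"
        "r \<otimes> x"] ideal_family_minus[OF I] 
    by (auto simp: add.commute)
qed

lemma family_hull_homogeneous:
  assumes I: "ideal_family I" and x: "x \<in> grade R n" shows "x \<in> family_hull I \<longleftrightarrow> x \<in> I n"
proof
  assume "x \<in> family_hull I"
  then obtain c where c: "hom_decomp R c x" "\<forall>n. c n \<in> I n" unfolding family_hull_def by blast
  have "c = (\<lambda>m. if m = n then x else \<zero>)"
    using grade_direct_sum[OF grade_carrier[OF x]] c(1) hom_decomp_homogeneous[OF x] by blast
  then show "x \<in> I n" using c(2) by (metis (full_types))
next
  assume "x \<in> I n"
  then show "x \<in> family_hull I"
    unfolding family_hull_def using hom_decomp_homogeneous[OF x] I unfolding ideal_family_def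
    by (intro CollectI exI[of _ "\<lambda>m. if m = n then x else \<zero>"]) auto
qed

lemma family_hull_homogeneous_ideal: assumes I: "ideal_family I" shows "homogeneous_ideal
    (family_hull I) R"
proof -
  let ?J = "family_hull I"
  have sub: "?J \<subseteq> carrier R" unfolding family_hull_def using hom_decomp_carrier by blast
  have add: "x \<oplus> y \<in> ?J" if "x \<in> ?J" "y \<in> ?J" for x y
  proof -
    obtain c d where c: "hom_decomp R c x" "\<forall>n. c n \<in> I n" and d: "hom_decomp R d y" "\<forall>n. d n \<in> I n"
      using \<open>x \<in> ?J\<close> \<open>y \<in> ?J\<close> unfolding family_hull_def by blast
    have "\<forall>n. c n \<oplus> d n \<in> I n" using c d I unfolding ideal_family_def by blast
    then show ?thesis unfolding family_hull_def using hom_decomp_add[OF c(1) d(1)] by blast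
  qed
  have zero: "\<zero> \<in> ?J" using family_hull_homogeneous[OF I grade_zero[of 0]] I
      unfolding ideal_family_def by blast
  have mult: "r \<otimes> x \<in> ?J" "x \<otimes> r \<in> ?J" if r: "r \<in> grade R a" and "x \<in> ?J" for a r x
  proof -
    obtain c where c: "hom_decomp R c x"
        "\<forall>n. c n \<in> I n" using \<open>x \<in> ?J\<close> unfolding family_hull_def by blast
    have "r \<otimes> c (n - a) \<in> I n" for n
    proof -
      have "r \<otimes> c (n - a) \<in> I (a + (n - a))" using c r I unfolding ideal_family_def by blast
      then show ?thesis by simp
    qed
    then show "r \<otimes> x \<in> ?J" unfolding family_hull_def using hom_decomp_mult(1)[OF r c(1)] by blast
    have "c (n - a) \<otimes> r \<in> I n" for n
      using ideal_family_mult_right[OF I c(2)[rule_format, of "n - a"] r] by simp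
    then show "x \<otimes> r \<in> ?J" unfolding family_hull_def using hom_decomp_mult(2)[OF r c(1)] by blast
  qed
  \<comment> \<open>Multiplication by an arbitrary element is reduced to homogeneous ones by
    induction on the components; both sides are carried along because commutativity holds only up to
    sign.\<close>
  have fs: "finsum R d F \<otimes> x \<in> ?J \<and> x \<otimes> finsum R d F \<in> ?J"
    if "finite F" and d: "\<And>n. d n \<in> grade R n" and x: "x \<in> ?J" for d F x
    using \<open>finite F\<close>
  proof (induction F)
    case empty
    then show ?case using x sub zero by auto
  next
    case (insert n F)
    have dc: "d \<in> A \<rightarrow> carrier R" for A using d grade_carrier by blast
    have "finsum R d (insert n F) = d n \<oplus> finsum R d F"
      using finsum_insert[OF insert(1,2) dc] d grade_carrier by blast
    then show ?case
      using insert(3) add mult[OF d x] l_distr[OF grade_carrier[OF d] finsum_closed[OF dc], of x]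
        r_distr[OF grade_carrier[OF d] finsum_closed[OF dc], of x] x sub by auto
  qed
  have mult': "r \<otimes> x \<in> ?J" "x \<otimes> r \<in> ?J" if r: "r \<in> carrier R" and x: "x \<in> ?J" for r x
  proof -
    obtain d where "hom_decomp R d r" using grade_direct_sum[OF r] by blast
    then obtain F where "finite F" "\<And>n. d n \<in> grade R n"
        "r = finsum R d F" using hom_decompE by metis
    then show "r \<otimes> x \<in> ?J" "x \<otimes> r \<in> ?J" using fs x by blast+
  qed
  have minus: "\<ominus> x \<in> ?J" if x: "x \<in> ?J" for x
    using mult'(1)[OF _ x, of "\<ominus> \<one>"] sub x by (simp add: l_minus subset_iff)
  have "ideal ?J R"
  proof (rule idealI[OF ring_axioms])
    show "subgroup ?J (add_monoid R)"
      by (rule add.subgroupI) (use sub zero add minus in \<open>auto simp: a_inv_def\<close>)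
  qed (use mult' in auto)
  moreover have "c n \<in> ?J" if x: "x \<in> ?J" and c: "hom_decomp R c x" for x c n
  proof -
    obtain d where d: "hom_decomp R d x" "\<forall>n. d n \<in> I n" using x unfolding family_hull_def by blast
    have "c = d" using grade_direct_sum c d(1) hom_decomp_carrier by blast
    moreover have "d n \<in> grade R n" using I d unfolding ideal_family_def by blast
    ultimately show ?thesis using family_hull_homogeneous[OF I] d(2) by blast
  qed
  ultimately show ?thesis unfolding homogeneous_ideal_def by blast
qed

lemma ideal_family_chain:
  assumes noeth: "graded_noetherian R" and I: "\<And>k. ideal_family (I k)"
      and mono: "\<And>k n. I k n \<subseteq> I (Suc k) n"
  obtains K where "\<And>k n. I k n \<subseteq> I K n"
proof -
  have "family_hull (I k) \<subseteq> family_hull (I (Suc k))" for k unfolding family_hull_def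
      using mono by blast
  then obtain K where K: "\<And>k. family_hull (I k) \<subseteq> family_hull (I K)"
    by (rule homogeneous_ideal_chain[of "\<lambda>k. family_hull (I k)", OF family_hull_homogeneous_ideal[OF
        I] _ noeth]) blast+
  have "I k n \<subseteq> I K n" for k n
  proof
    fix x assume x: "x \<in> I k n"
    then have g: "x \<in> grade R n" using I[of k] unfolding ideal_family_def by blast
    then show "x \<in> I K n" using K[of k] family_hull_homogeneous[OF I g] x by blast
  qed
  then show ?thesis by (rule that)
qed

end

section \<open>Graded submodules of Hom^*(C, X) and the ascending chain condition\<close>

context linear_category
begin

abbreviation hom_submodule where "hom_submodule C X \<equiv> graded_submodule R (graded_hom T C X)"

lemma gcomp_graded_hom: "gcomp (graded_hom T C X) i = Hom T C (Sh i X)"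
  by (simp add: graded_hom_def)

lemma hom_submodule_iff:
  "hom_submodule C X N \<longleftrightarrow> (\<forall>i. N i \<subseteq> Hom T C (Sh i X) \<and> Zer T C (Sh i X) \<in> N i) \<and>
    (\<forall>i. \<forall>x\<in>N i. \<forall>y\<in>N i. Add T x y \<in> N i) \<and>
    (\<forall>a i. \<forall>r\<in>grade R a. \<forall>x\<in>N i. smul a r i X x \<in> N (i + a))"
  by (simp add: graded_submodule_def graded_hom_def smul_def)

lemma hom_submoduleD:
  assumes "hom_submodule C X N"
  shows "x \<in> N i \<Longrightarrow> x \<in> Hom T C (Sh i X)" "Zer T C (Sh i X) \<in> N i"
      "x \<in> N i \<Longrightarrow> y \<in> N i \<Longrightarrow> Add T x y \<in> N i"
    "r \<in> grade R a \<Longrightarrow> x \<in> N i \<Longrightarrow> smul a r i X x \<in> N (i + a)"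
  using assms unfolding hom_submodule_iff by blast+

lemma hom_submodule_neg:
  assumes N: "hom_submodule C X N" and X: "X \<in> Ob T" and x: "x \<in> N i" shows "Neg T x \<in> N i"
proof -
  have xh: "x \<in> Hom T C (Sh i X)" using hom_submoduleD(1)[OF N x] .
  have "smul 0 (\<ominus>\<^bsub>R\<^esub> \<one>\<^bsub>R\<^esub>) i X x \<in> N (i + 0)" using hom_submoduleD(4)[OF N grade_minus[OF grade_one]
      x] .
  then show ?thesis using smul_minus[OF grade_one X xh] smul_one[OF X xh] by simp
qed

lemma add_swap:
  assumes "a \<in> Hom T X Y" "b \<in> Hom T X Y" "c \<in> Hom T X Y" "d \<in> Hom T X Y"
  shows "Add T (Add T a b) (Add T c d) = Add T (Add T a c) (Add T b d)"
proof -
  have "Add T (Add T a b) (Add T c d) = Add T a (Add T (Add T b c) d)"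
    using add_assoc[OF assms(1,2) add_in[OF assms(3,4)]] add_assoc[OF assms(2-4)] by simp
  also have "Add T b c = Add T c b" using add_commute[OF assms(2,3)] .
  also have "Add T a (Add T (Add T c b) d) = Add T (Add T a c) (Add T b d)"
    using add_assoc[OF assms(1,3) add_in[OF assms(2,4)]] add_assoc[OF assms(3,2,4)] by simp
  finally show ?thesis .
qed

definition gspan :: "'o \<Rightarrow> 'o \<Rightarrow> (int \<times> 'm) set \<Rightarrow> int \<Rightarrow> 'm set" where
  "gspan C X A i = {z \<in> Hom T C (Sh i X). \<forall>N. hom_submodule C X N \<and> (\<forall>(j, x)\<in>A. x \<in> N j) \<longrightarrow> z \<in> N i}"

lemma gspan_submodule:
  assumes C: "C \<in> Ob T" and X: "X \<in> Ob T" shows "hom_submodule C X (gspan C X A)"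
  unfolding hom_submodule_iff
proof (intro conjI allI ballI)
  fix i
  show "gspan C X A i \<subseteq> Hom T C (Sh i X)" unfolding gspan_def by blast
  show "Zer T C (Sh i X) \<in> gspan C X A i" unfolding gspan_def
      using zer_in[OF C sh_in[OF X]] hom_submoduleD(2) by blast
next
  fix x y i assume "x \<in> gspan C X A i" "y \<in> gspan C X A i"
  then show "Add T x y \<in> gspan C X A i" unfolding gspan_def
      by (auto intro: add_in hom_submoduleD(3))
next
  fix a r i x assume r: "r \<in> grade R a" and "x \<in> gspan C X A i"
  then show "smul a r i X x \<in> gspan C X A (i + a)"
      unfolding gspan_def by (auto intro: smul_in[OF r X] hom_submoduleD(4)[OF _ r])
qed

lemma gspan_insert:
  assumes C: "C \<in> Ob T" and X: "X \<in> Ob T" and x: "x \<in> Hom T C (Sh j X)"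
      and A: "\<forall>(i, y)\<in>A. y \<in> Hom T C (Sh i X)"
    and z: "z \<in> gspan C X (insert (j, x) A) i"
  obtains y r where "y \<in> gspan C X A i" "r \<in> grade R (i - j)" "z = Add T y (smul (i - j) r j X x)"
proof -
  \<comment> \<open>The elements of the required form make up a submodule that contains all
    generators, and hence the span.\<close>
  let ?N = "\<lambda>i. {Add T y (smul (i - j) r j X x) | y r. y \<in> gspan C X A i \<and> r \<in> grade R (i - j)}"
  note g = hom_submoduleD[OF gspan_submodule[OF C X]]
  have rx: "smul (i - j) r j X x \<in> Hom T C (Sh i X)" if "r \<in> grade R (i - j)" for r i
    using smul_in[OF that X x] by simp
  have Zx: "smul (i - j) \<zero>\<^bsub>R\<^esub> j X x = Zer T C (Sh i X)" for i
    unfolding smul_def act_zero[OF X] using sm_zer[OF X sh_in[OF X]] sh_sh[OF X] comp_zer_left[OF x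
        sh_in[OF X]] by simp
  have "hom_submodule C X ?N"
    unfolding hom_submodule_iff
  proof (intro conjI allI ballI)
    show "?N i \<subseteq> Hom T C (Sh i X)" for i using rx g(1) add_in by blast
    show "Zer T C (Sh i X) \<in> ?N i" for i
      using g(2)[of i A] grade_zero[of "i - j"] Zx[of i] add_zer[OF zer_in[OF C sh_in[OF X, of i]]]
      by (intro CollectI exI[of _ "Zer T C (Sh i X)"] exI[of _ "\<zero>\<^bsub>R\<^esub>"]) simp
  next
    fix i u v assume "u \<in> ?N i" "v \<in> ?N i"
    then obtain y r y' r' where u: "u = Add T y (smul (i - j) r j X x)" "y \<in> gspan C X A i"
        "r \<in> grade R (i - j)"
      and v: "v = Add T y' (smul (i - j) r' j X x)" "y' \<in> gspan C X A i"
          "r' \<in> grade R (i - j)" by blast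
    have "Add T u v = Add T (Add T y y') (smul (i - j) (r \<oplus>\<^bsub>R\<^esub> r') j X x)"
      unfolding u v smul_add_left[OF u(3) v(3) X x]
      by (rule add_swap[OF g(1)[OF u(2)] rx[OF u(3)] g(1)[OF v(2)] rx[OF v(3)]])
    then show "Add T u v \<in> ?N i" using g(3)[OF u(2) v(2)] grade_add[OF u(3) v(3)] by blast
  next
    fix a s i u assume s: "s \<in> grade R a" and "u \<in> ?N i"
    then obtain y r where u: "u = Add T y (smul (i - j) r j X x)" "y \<in> gspan C X A i"
        "r \<in> grade R (i - j)" by blast
    have "smul a s i X u = Add T (smul a s i X y) (smul a s i X (smul (i - j) r j X x))"
      unfolding u by (rule smul_add_right[OF s X g(1)[OF u(2)] rx[OF u(3)]])
    also have "smul a s i X (smul (i - j) r j X x) = smul (i + a - j) (s \<otimes>\<^bsub>R\<^esub> r) j X x"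
      using smul_mult[OF s u(3) X x] by (simp add: algebra_simps)
    finally have "smul a s i X u = Add T (smul a s i X y) (smul (i + a - j) (s \<otimes>\<^bsub>R\<^esub> r) j X x)" .
    moreover have "s \<otimes>\<^bsub>R\<^esub> r \<in> grade R (i + a - j)"
        using grade_mult[OF s u(3)] by (simp add: algebra_simps)
    ultimately show "smul a s i X u \<in> ?N (i + a)" using g(4)[OF s u(2)] by blast
  qed
  moreover have "\<forall>(i, y)\<in>insert (j, x) A. y \<in> ?N i"
  proof (clarify)
    fix i y assume "(i, y) \<in> insert (j, x) A"
    then consider "i = j" "y = x" | "(i, y) \<in> A" by blast
    then show "\<exists>ya r. y = Add T ya (smul (i - j) r j X x) \<and> ya \<in> gspan C X A i
        \<and> r \<in> grade R (i - j)"
    proof cases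
      case 1
      then show ?thesis
        using g(2)[of j A] grade_one smul_one[OF X x] zer_add[OF x]
        by (intro exI[of _ "Zer T C (Sh j X)"] exI[of _ "\<one>\<^bsub>R\<^esub>"]) simp
    next
      case 2
      then have "y \<in> Hom T C (Sh i X)" using A by blast
      moreover have "y \<in> gspan C X A i" unfolding gspan_def using 2 calculation by blast
      ultimately show ?thesis using grade_zero[of "i - j"] Zx[of i] add_zer
          by (intro exI[of _ y] exI[of _ "\<zero>\<^bsub>R\<^esub>"]) simp
    qed
  qed
  ultimately have "z \<in> ?N i" using z unfolding gspan_def by blast
  then show ?thesis using that by blast
qed

text \<open>Induction on generators: a chain is controlled by its intersection with the span of
  \<open>A\<close> and by the ideals of coefficients of the new generator, and both
  stabilize.\<close>

lemma gspan_chain: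
  assumes noeth: "graded_noetherian R" and C: "C \<in> Ob T" and X: "X \<in> Ob T" and "finite A"
  shows "\<forall>(i, x)\<in>A. x \<in> Hom T C (Sh i X) \<Longrightarrow> (\<And>k. hom_submodule C X (N k))
      \<Longrightarrow> (\<And>k i. N k i \<subseteq> N (Suc k) i) \<Longrightarrow>
    (\<And>k i. N k i \<subseteq> gspan C X A i) \<Longrightarrow> \<exists>K. \<forall>k i. N k i \<subseteq> N K i"
  using \<open>finite A\<close>
proof (induction A arbitrary: N)
  case empty
  have z: "hom_submodule C X (\<lambda>i. {Zer T C (Sh i X)})"
    unfolding hom_submodule_iff using zer_in[OF C sh_in[OF X]] add_zer smul_zer[OF _ X C] by simp
  have "gspan C X {} i \<subseteq> {Zer T C (Sh i X)}" for i using z unfolding gspan_def by blast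
  then have "N k i \<subseteq> N 0 i" for k i using empty(4)[of k i] hom_submoduleD(2)[OF empty(2)[of 0], of
      i] by blast
  then show ?case by blast
next
  case (insert p A)
  obtain j x where p: "p = (j, x)" by (cases p)
  have x: "x \<in> Hom T C (Sh j X)" and A: "\<forall>(i, y)\<in>A. y \<in> Hom T C (Sh i X)"
      using insert.prems(1) p by auto
  note gs = gspan_submodule[OF C X, of A]
  note g = hom_submoduleD[OF gs] and n = hom_submoduleD[OF insert.prems(2)]
  have mono: "N k i \<subseteq> N l i" if "k \<le> l" for k l i using lift_Suc_mono_le[of "\<lambda>k. N k i", OF
      insert.prems(3) that] .
  have rx: "smul a r j X x \<in> Hom T C (Sh (j + a) X)" if "r \<in> grade R a" for a r
      using smul_in[OF that X x] .
  \<comment> \<open>\<open>I k a\<close> consists of the coefficients of degree \<open>a\<close>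
    that the new generator takes in \<open>N k\<close> modulo the span of \<open>A\<close>.\<close>
  define I where "I k a = {r \<in> grade R a. \<exists>y\<in>gspan C X A (j + a). Add T y (smul a r j X x) \<in> N k (j
      + a)}" for k a
  have "ideal_family (I k)" for k
    unfolding ideal_family_def
  proof (intro conjI allI ballI)
    show "I k a \<subseteq> grade R a" for a unfolding I_def by blast
    show "\<zero>\<^bsub>R\<^esub> \<in> I k a" for a
    proof -
      have "smul a \<zero>\<^bsub>R\<^esub> j X x = Zer T C (Sh (j + a) X)"
        unfolding smul_def act_zero[OF X] using sm_zer[OF X sh_in[OF X]] sh_sh[OF X]
            comp_zer_left[OF x sh_in[OF X]] by simp
      then show ?thesis unfolding I_def using grade_zero g(2)[of "j + a"] n(2)[of "j + a" k]
          add_zer[OF zer_in[OF C sh_in[OF X]]]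
        by (intro CollectI conjI bexI[of _ "Zer T C (Sh (j + a) X)"]) simp_all
    qed
  next
    fix a r r' assume "r \<in> I k a" "r' \<in> I k a"
    then obtain y y' where r: "r \<in> grade R a" "y \<in> gspan C X A (j + a)"
        "Add T y (smul a r j X x) \<in> N k (j + a)"
      and r': "r' \<in> grade R a" "y' \<in> gspan C X A (j + a)"
          "Add T y' (smul a r' j X x) \<in> N k (j + a)" unfolding I_def by blast
    have "Add T (Add T y y') (smul a (r \<oplus>\<^bsub>R\<^esub> r') j X x)
        = Add T (Add T y (smul a r j X x)) (Add T y' (smul a r' j X x))"
      unfolding smul_add_left[OF r(1) r'(1) X x]
      by (rule add_swap[OF g(1)[OF r(2)] g(1)[OF r'(2)] rx[OF r(1)] rx[OF r'(1)]])
    then have "Add T (Add T y y') (smul a (r \<oplus>\<^bsub>R\<^esub> r') j X x) \<in> N k (j + a)"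
        using n(3)[OF r(3) r'(3)] by simp
    then show "r \<oplus>\<^bsub>R\<^esub> r' \<in> I k a" unfolding I_def using grade_add[OF r(1) r'(1)] g(3)[OF r(2) r'(2)]
        by blast
  next
    fix b a s r assume s: "s \<in> grade R b" and "r \<in> I k a"
    then obtain y where r: "r \<in> grade R a" "y \<in> gspan C X A (j + a)"
        "Add T y (smul a r j X x) \<in> N k (j + a)"
      unfolding I_def by blast
    have "smul b s (j + a) X (Add T y (smul a r j X x))
        = Add T (smul b s (j + a) X y) (smul (b + a) (s \<otimes>\<^bsub>R\<^esub> r) j X x)"
      using smul_add_right[OF s X g(1)[OF r(2)] rx[OF r(1)]] smul_mult[OF s r(1) X x] by simp
    then have "Add T (smul b s (j + a) X y) (smul (b + a) (s \<otimes>\<^bsub>R\<^esub> r) j X x) \<in> N k (j + (b + a))"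
      using n(4)[OF s r(3)] by (simp add: ac_simps)
    moreover have "smul b s (j + a) X y \<in> gspan C X A (j + (b + a))"
        using g(4)[OF s r(2)] by (simp add: ac_simps)
    ultimately show "s \<otimes>\<^bsub>R\<^esub> r \<in> I k (b + a)" unfolding I_def using grade_mult[OF s r(1)] by blast
  qed
  moreover have "I k a \<subseteq> I (Suc k) a" for k a unfolding I_def using insert.prems(3) by blast
  ultimately obtain K1 where K1: "\<And>k a. I k a \<subseteq> I K1 a"
      using ideal_family_chain[OF noeth, of I] by blast
  have "\<exists>K. \<forall>k i. N k i \<inter> gspan C X A i \<subseteq> N K i \<inter> gspan C X A i"
  proof (rule insert.IH[OF A, of "\<lambda>k i. N k i \<inter> gspan C X A i"])
    show "hom_submodule C X (\<lambda>i. N k i \<inter> gspan C X A i)" for k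
      using insert.prems(2)[of k] gs unfolding hom_submodule_iff by blast
    show "N k i \<inter> gspan C X A i \<subseteq> N (Suc k) i \<inter> gspan C X A i" for k i
        using insert.prems(3) by blast
  qed blast
  then obtain K2 where K2: "\<And>k i. N k i \<inter> gspan C X A i \<subseteq> N K2 i" by blast
  let ?K = "max K1 K2"
  have "z \<in> N ?K i" if z0: "z \<in> N k i" for k i z
  proof -
    let ?k = "max k ?K"
    have z: "z \<in> N ?k i" using z0 mono[of k ?k i] by auto
    obtain y r where y: "y \<in> gspan C X A i" and r: "r \<in> grade R (i - j)"
        and zy: "z = Add T y (smul (i - j) r j X x)"
      using gspan_insert[OF C X x A] insert.prems(4)[of ?k i] z unfolding p by blast
    have "r \<in> I ?k (i - j)" unfolding I_def using r y z zy by auto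
    then have "r \<in> I K1 (i - j)" using K1 by blast
    then obtain y' where y': "y' \<in> gspan C X A i"
        "Add T y' (smul (i - j) r j X x) \<in> N K1 i" unfolding I_def by auto
    \<comment> \<open>\<open>?w\<close> lies in the stable module and has the same coefficient as
      \<open>z\<close>. The difference lies in the span of \<open>A\<close>, where the chain is
      stable by induction.\<close>
    let ?w = "Add T y' (smul (i - j) r j X x)"
    have rx': "smul (i - j) r j X x \<in> Hom T C (Sh i X)" using rx[OF r] by simp
    have w: "?w \<in> N ?K i" using y'(2) mono[of K1 ?K i] by auto
    have w': "?w \<in> N ?k i" using w mono[of ?K ?k i] by auto
    note yh = g(1)[OF y] and y'h = g(1)[OF y'(1)]
    have d1: "Add T z (Neg T ?w) \<in> N ?k i" using n(3)[OF z hom_submodule_neg[OF insert.prems(2) X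
        w']] .
    have "Neg T ?w = Add T (Neg T y') (Neg T (smul (i - j) r j X x))"
    proof (rule neg_unique[symmetric])
      show "Add T (Add T (Neg T y') (Neg T (smul (i - j) r j X x))) ?w = Zer T C (Sh i X)"
        using add_swap[OF neg_in[OF y'h] neg_in[OF rx'] y'h rx'] neg_add[OF y'h] neg_add[OF rx']
          add_zer[OF zer_in[OF C sh_in[OF X]]] by simp
    qed (use add_in neg_in y'h rx' in blast)+
    then have "Add T z (Neg T ?w) = Add T (Add T y (Neg T y')) (Add T (smul (i - j) r j X x) (Neg T
        (smul (i - j) r j X x)))"
      unfolding zy using add_swap[OF yh rx' neg_in[OF y'h] neg_in[OF rx']] by simp
    then have d2: "Add T z (Neg T ?w) = Add T y (Neg T y')"
      using add_neg[OF rx'] add_zer[OF add_in[OF yh neg_in[OF y'h]]] by simp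
    then have "Add T z (Neg T ?w) \<in> gspan C X A i"
      using g(3)[OF y hom_submodule_neg[OF gs X y'(1)]] by simp
    then have "Add T z (Neg T ?w) \<in> N K2 i" using d1 K2 by blast
    then have d: "Add T z (Neg T ?w) \<in> N ?K i" using mono[of K2 ?K i] by auto
    have zh: "z \<in> Hom T C (Sh i X)" and wh: "?w \<in> Hom T C (Sh i X)" using n(1) z w by blast+
    have "Add T (Add T z (Neg T ?w)) ?w = z"
      using add_assoc[OF zh neg_in[OF wh] wh] neg_add[OF wh] add_zer[OF zh] by simp
    then show ?thesis using n(3)[OF d w] by simp
  qed
  then show ?case by blast
qed

end

context bik_category
begin

text \<open>The hypothesis bounds only endomorphism modules. With \<open>E = C \<oplus> D\<close>,
  submodules of Hom^*(C, D) are pulled back to End^*(E) along the corner map; this map is onto, so a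
  stable pullback means a stable chain.\<close>

lemma hom_submodule_chain:
  assumes noeth: "noetherian_category \<kappa> R T" and C: "C \<in> Cpt" and D: "D \<in> Cpt"
    and N: "\<And>k. hom_submodule C D (N k)" and mono: "\<And>k i. N k i \<subseteq> N (Suc k) i"
  obtains K where "\<And>k i. N k i \<subseteq> N K i"
proof -
  have Cob: "C \<in> Ob T" and Dob: "D \<in> Ob T" using compact_ob C D by blast+
  obtain E i j p q where E: "E \<in> Ob T" and i: "i \<in> Hom T C E" and j: "j \<in> Hom T D E"
    and p: "p \<in> Hom T E C" and q: "q \<in> Hom T E D" and pi: "p \<cdot> i = Idn T C"
        and qj: "q \<cdot> j = Idn T D"
    and s: "Add T (i \<cdot> p) (j \<cdot> q) = Idn T E"
    using ex_biproduct[OF Cob Dob] by metis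
  have EC: "E \<in> Cpt" by (rule compact_biproduct[OF C D E i j p q s])
  have "finitely_generated_module R (graded_hom T E E)"
      using noeth EC unfolding noetherian_category_def by blast
  then obtain A where A: "finite A" "\<forall>(i, x)\<in>A. x \<in> Hom T E (Sh i E)"
    "\<forall>N. hom_submodule E E N \<and> (\<forall>(i, x)\<in>A. x \<in> N i) \<longrightarrow> (\<forall>i. N i = Hom T E (Sh i E))"
    unfolding finitely_generated_module_def by (simp only: gcomp_graded_hom) (elim exE conjE)
  have span: "Hom T E (Sh n E) \<subseteq> gspan E E A n" for n unfolding gspan_def using A(3) by blast
  define M where "M k n = {h \<in> Hom T E (Sh n E). (Sm n q \<cdot> h) \<cdot> i \<in> N k n}" for k n
  note nn = hom_submoduleD[OF N]
  have "hom_submodule E E (M k)" for k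
    unfolding hom_submodule_iff
  proof (intro conjI allI ballI)
    show "M k n \<subseteq> Hom T E (Sh n E)" for n unfolding M_def by blast
    show "Zer T E (Sh n E) \<in> M k n" for n
      unfolding M_def using zer_in[OF E sh_in[OF E]] comp_zer_right[OF sm_in[OF q] E]
          comp_zer_left[OF i sh_in[OF Dob]]
        nn(2) by simp
  next
    fix n x y assume "x \<in> M k n" "y \<in> M k n"
    then have x: "x \<in> Hom T E (Sh n E)" "(Sm n q \<cdot> x) \<cdot> i \<in> N k n" and y: "y \<in> Hom T E (Sh n E)"
        "(Sm n q \<cdot> y) \<cdot> i \<in> N k n"
      unfolding M_def by auto
    have "(Sm n q \<cdot> Add T x y) \<cdot> i = Add T ((Sm n q \<cdot> x) \<cdot> i) ((Sm n q \<cdot> y) \<cdot> i)"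
      using comp_add_right[OF x(1) y(1) sm_in[OF q]] comp_add_left[OF i comp[OF x(1) sm_in[OF q]]
          comp[OF y(1) sm_in[OF q]]]
      by simp
    then show "Add T x y \<in> M k n" unfolding M_def using nn(3)[OF x(2) y(2)] add_in[OF x(1) y(1)]
        by simp
  next
    fix a n r x assume r: "r \<in> grade R a" and "x \<in> M k n"
    then have x: "x \<in> Hom T E (Sh n E)" "(Sm n q \<cdot> x) \<cdot> i \<in> N k n" unfolding M_def by auto
    have "(Sm (n + a) q \<cdot> smul a r n E x) \<cdot> i = smul a r n D ((Sm n q \<cdot> x) \<cdot> i)"
      using smul_nat[OF r q x(1)] smul_comp[OF r Dob comp[OF x(1) sm_in[OF q]] i] by simp
    then show "smul a r n E x \<in> M k (n + a)" unfolding M_def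
        using nn(4)[OF r x(2)] smul_in[OF r E x(1)] by simp
  qed
  moreover have "M k n \<subseteq> M (Suc k) n" for k n unfolding M_def using mono by blast
  moreover have "M k n \<subseteq> gspan E E A n" for k n using span unfolding M_def by blast
  ultimately obtain K where K: "\<And>k n. M k n \<subseteq> M K n"
    using gspan_chain[OF noetherian_ring E E A(1,2), of M] by blast
  have "z \<in> N K n" if z: "z \<in> N k n" for k n z
  proof -
    have zh: "z \<in> Hom T C (Sh n D)" using nn(1)[OF z] .
    \<comment> \<open>The extension of \<open>z\<close> by zero to \<open>E\<close>; its corner is
      \<open>z\<close>.\<close>
    let ?h = "Sm n j \<cdot> (z \<cdot> p)"
    have zp: "z \<cdot> p \<in> Hom T E (Sh n D)" using comp[OF p zh] .
    have "Sm n q \<cdot> ?h = (Sm n q \<cdot> Sm n j) \<cdot> (z \<cdot> p)"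
        using comp_assoc[OF zp sm_in[OF j] sm_in[OF q]] .
    also have "\<dots> = z \<cdot> p" using sm_comp[OF j q, of n] qj sm_idn[OF Dob, of n] comp_idn_left[OF zp]
        by simp
    finally have "(Sm n q \<cdot> ?h) \<cdot> i = z"
      using comp_assoc[OF i p zh] pi comp_idn_right[OF zh] by simp
    moreover from this have "?h \<in> M k n" unfolding M_def using z comp[OF zp sm_in[OF j]] by simp
    ultimately show ?thesis using K[of k n] unfolding M_def by auto
  qed
  then show ?thesis using that by blast
qed

end

section \<open>Essential extensions of a non-torsion element\<close>

context bik_category
begin

text \<open>Morphisms \<open>y : D \<rightarrow> J\<close> with \<open>D\<close> in \<open>G\<close> form a functor on \<open>G\<close>; the last clause says
  that the localization at \<open>\<qq>\<close> of this functor is an essential extension of the subfunctor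
  generated by \<open>x\<close>.\<close>

definition essential :: "'r set \<Rightarrow> 'o set \<Rightarrow> 'o \<Rightarrow> 'o \<Rightarrow> 'm \<Rightarrow> bool" where
  "essential \<qq> G C J x \<longleftrightarrow> x \<in> Hom T C J \<and> \<not> tors \<qq> x \<and>
    (\<forall>D\<in>G. \<forall>y\<in>Hom T D J. y \<noteq> Zer T D J \<longrightarrow> (\<exists>a s g. s \<in> grade R a \<and> s \<notin> \<qq> \<and> g \<in> Hom T C (Sh a D) \<and>
      Sm a y \<cdot> g = act T a s J \<cdot> x))"

text \<open>A subfunctor of Hom(-, Y) on \<open>G\<close> is encoded as the set of all its elements,
  since each morphism carries its domain. Closure of \<open>G\<close> under shifts takes care of the
  grading.\<close>

definition subfunctor :: "'o set \<Rightarrow> 'o \<Rightarrow> 'm set \<Rightarrow> bool" where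
  "subfunctor G Y N \<longleftrightarrow> (\<forall>y\<in>N. Dom T y \<in> G \<and> y \<in> Hom T (Dom T y) Y) \<and> (\<forall>D\<in>G. Zer T D Y \<in> N) \<and>
    (\<forall>D. \<forall>y\<in>N \<inter> Hom T D Y. \<forall>y'\<in>N \<inter> Hom T D Y. Add T y y' \<in> N) \<and>
    (\<forall>y\<in>N. \<forall>D\<in>G. \<forall>u\<in>Hom T D (Dom T y). y \<cdot> u \<in> N)"

text \<open>The desuspension turns \<open>s x\<close> into a morphism to \<open>Y\<close> from a
  shift of \<open>C\<close>, so that it can be an element of \<open>N\<close>. All \<open>s\<close>
  outside \<qq> are excluded, so that a subfunctor which properly contains a maximal
  \<open>N\<close> contains a multiple of \<open>x\<close> by a unit at \<qq>.\<close>

definition avoids :: "'r set \<Rightarrow> 'o \<Rightarrow> 'm \<Rightarrow> 'm set \<Rightarrow> bool" where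
  "avoids \<qq> Y x N \<longleftrightarrow> (\<forall>a. \<forall>s\<in>grade R a - \<qq>. Sm (- a) (act T a s Y \<cdot> x) \<notin> N)"

lemma maximal_subfunctor:
  assumes G: "\<And>D. D \<in> G \<Longrightarrow> D \<in> Ob T" "\<And>D n. D \<in> G \<Longrightarrow> Sh n D \<in> G" and x: "x \<in> Hom T C Y" "\<not> tors \<qq> x"
  obtains N where "subfunctor G Y N" "avoids \<qq> Y x N"
    "\<And>N'. subfunctor G Y N' \<Longrightarrow> avoids \<qq> Y x N' \<Longrightarrow> N \<subseteq> N' \<Longrightarrow> N' = N"
proof -
  let ?A = "{N. subfunctor G Y N \<and> avoids \<qq> Y x N}"
  have ob: "C \<in> Ob T" "Y \<in> Ob T" using hom_ob x by blast+
  have "\<exists>M\<in>?A. \<forall>X\<in>?A. M \<subseteq> X \<longrightarrow> X = M"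
  proof (rule subset_Zorn_nonempty)
    \<comment> \<open>Zorn's lemma starts from the zero subfunctor, which avoids \<open>x\<close>
      because \<open>x\<close> is not torsion at \<qq>.\<close>
    let ?Z = "(\<lambda>D. Zer T D Y) ` G"
    have "subfunctor G Y ?Z"
      unfolding subfunctor_def
    proof (intro conjI ballI allI)
      fix y assume "y \<in> ?Z"
      then obtain D where D: "D \<in> G" "y = Zer T D Y" by blast
      have yh: "y \<in> Hom T D Y" using D zer_in G(1) ob(2) by blast
      then show "Dom T y \<in> G" "y \<in> Hom T (Dom T y) Y" using D hom_dom_cod by auto
      show "y \<cdot> u \<in> ?Z" if "D' \<in> G" "u \<in> Hom T D' (Dom T y)" for D' u
        using comp_zer_left[OF that(2) ob(2)] hom_dom_cod(1)[OF yh] D that(1) by auto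
    next
      show "Zer T D Y \<in> ?Z" if "D \<in> G" for D using that by blast
      fix D y y' assume y: "y \<in> ?Z \<inter> Hom T D Y" and y': "y' \<in> ?Z \<inter> Hom T D Y"
      have zz: "z = Zer T D Y \<and> D \<in> G" if zin: "z \<in> ?Z \<inter> Hom T D Y" for z
      proof -
        obtain D' where D': "D' \<in> G" "z = Zer T D' Y" and zh: "z \<in> Hom T D Y" using zin by blast
        then have "D' = D" using hom_dom_cod(1)[OF zer_in[OF G(1)[OF D'(1)] ob(2)]]
            hom_dom_cod(1)[OF zh] by simp
        then show ?thesis using D' by simp
      qed
      have "Add T y y' = Zer T D Y" using zz[OF y] zz[OF y'] add_zer[of "Zer T D Y" D Y] y by simp
      then show "Add T y y' \<in> ?Z" using zz[OF y] by blast
    qed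
    moreover have "avoids \<qq> Y x ?Z"
      unfolding avoids_def
    proof (intro allI ballI notI)
      fix a s assume s: "s \<in> grade R a - \<qq>" and "Sm (- a) (act T a s Y \<cdot> x) \<in> ?Z"
      then obtain D where D: "D \<in> G" "Sm (- a) (act T a s Y \<cdot> x) = Zer T D Y" by blast
      have h: "act T a s Y \<cdot> x \<in> Hom T C (Sh a Y)" using comp[OF x(1) act_in] s ob by blast
      have "Sm (- a) (act T a s Y \<cdot> x) \<in> Hom T (Sh (- a) C) Y" using sm_in_back[OF h ob(2)] .
      then have "Sh (- a) C = D" using D hom_dom_cod(1) zer_in[OF G(1)[OF D(1)] ob(2)] by metis
      then have "Sm (- a) (act T a s Y \<cdot> x) = Zer T (Sh (- a) C) (Sh (- a) (Sh a Y))"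
          using D sh_back(1)[OF ob(2)] by simp
      then have "act T a s Y \<cdot> x = Zer T C (Sh a Y)" using sm_eq_zer[OF h] by blast
      then show False using torsI[OF x(1)] s x(2) by blast
    qed
    ultimately show "?A \<noteq> {}" by blast
  next
    fix \<C> assume ne: "\<C> \<noteq> {}" and ch: "subset.chain ?A \<C>"
    have sf: "subfunctor G Y N" "avoids \<qq> Y x N" if "N \<in> \<C>" for N
        using ch that unfolding subset_chain_def by blast+
    have "avoids \<qq> Y x (\<Union>\<C>)" using sf(2) unfolding avoids_def by blast
    moreover have "subfunctor G Y (\<Union>\<C>)"
      unfolding subfunctor_def
    proof (intro conjI ballI allI)
      show "Zer T D Y \<in> \<Union>\<C>" if "D \<in> G" for D using ne sf(1) that unfolding subfunctor_def by blast
      fix D y y' assume "y \<in> \<Union>\<C> \<inter> Hom T D Y" "y' \<in> \<Union>\<C> \<inter> Hom T D Y"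
      then obtain N N' where N: "N \<in> \<C>" "y \<in> N" "N' \<in> \<C>" "y' \<in> N'" and h: "y \<in> Hom T D Y"
          "y' \<in> Hom T D Y" by blast
      have "N \<subseteq> N' \<or> N' \<subseteq> N" using ch N unfolding subset_chain_def by blast
      then obtain M where M: "M \<in> \<C>" "y \<in> M" "y' \<in> M" using N by blast
      then have "Add T y y' \<in> M" using sf(1)[OF M(1)] h unfolding subfunctor_def by blast
      then show "Add T y y' \<in> \<Union>\<C>" using M by blast
    next
      fix y assume "y \<in> \<Union>\<C>"
      then obtain N where N: "N \<in> \<C>" "y \<in> N" by blast
      then show "Dom T y \<in> G" "y \<in> Hom T (Dom T y) Y" using sf(1) unfolding subfunctor_def by blast+
      show "y \<cdot> u \<in> \<Union>\<C>" if "D \<in> G" "u \<in> Hom T D (Dom T y)" for D u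
        using sf(1)[OF N(1)] N that unfolding subfunctor_def by blast
    qed
    ultimately show "\<Union>\<C> \<in> ?A" by blast
  qed
  then show ?thesis using that by blast
qed

lemma subfunctorD:
  assumes "subfunctor G Y N"
  shows "y \<in> N \<Longrightarrow> Dom T y \<in> G" "y \<in> N \<Longrightarrow> y \<in> Hom T (Dom T y) Y" "D \<in> G \<Longrightarrow> Zer T D Y \<in> N"
    "y \<in> N \<Longrightarrow> y' \<in> N \<Longrightarrow> y \<in> Hom T D Y \<Longrightarrow> y' \<in> Hom T D Y \<Longrightarrow> Add T y y' \<in> N"
    "y \<in> N \<Longrightarrow> D \<in> G \<Longrightarrow> u \<in> Hom T D (Dom T y) \<Longrightarrow> y \<cdot> u \<in> N"
  using assms unfolding subfunctor_def by blast+

text \<open>\<open>M\<close> is the sum of \<open>N\<close> and the subfunctor generated by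
  \<open>y\<close>.\<close>

lemma subfunctor_adjoin:
  assumes N: "subfunctor G Y N" and y: "y \<in> Hom T D Y" "D \<in> G" and G: "\<And>D. D \<in> G \<Longrightarrow> D \<in> Ob T"
  defines "M \<equiv> {Add T n (y \<cdot> u) | n u D'. D' \<in> G \<and> n \<in> N \<and> n \<in> Hom T D' Y \<and> u \<in> Hom T D' D}"
  shows "subfunctor G Y M" "N \<subseteq> M" "y \<in> M"
proof -
  note n = subfunctorD[OF N]
  have ob: "Y \<in> Ob T" "D \<in> Ob T" using hom_ob y by blast+
  have Mh: "Add T n (y \<cdot> u) \<in> Hom T D' Y" if "n \<in> Hom T D' Y" "u \<in> Hom T D' D" for n u D'
    using add_in[OF that(1) comp[OF that(2) y(1)]] .
  show "subfunctor G Y M"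
    unfolding subfunctor_def
  proof (intro conjI ballI allI)
    fix z assume "z \<in> M"
    then obtain n0 u D' where z: "z = Add T n0 (y \<cdot> u)" "D' \<in> G" "n0 \<in> N" "n0 \<in> Hom T D' Y"
        "u \<in> Hom T D' D"
      unfolding M_def by blast
    have zh: "z \<in> Hom T D' Y" using Mh z by blast
    then show "Dom T z \<in> G" "z \<in> Hom T (Dom T z) Y" using hom_dom_cod z(2) by auto
    fix E v assume E: "E \<in> G" and "v \<in> Hom T E (Dom T z)"
    then have v: "v \<in> Hom T E D'" using hom_dom_cod(1)[OF zh] by simp
    have "z \<cdot> v = Add T (n0 \<cdot> v) (y \<cdot> (u \<cdot> v))"
      unfolding z(1) using comp_add_left[OF v z(4) comp[OF z(5) y(1)]] comp_assoc[OF v z(5) y(1)]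
          by simp
    moreover have "n0 \<cdot> v \<in> N" using n(5)[OF z(3) E] hom_dom_cod(1)[OF z(4)] v by simp
    ultimately show "z \<cdot> v \<in> M" unfolding M_def using E comp[OF v z(4)] comp[OF v z(5)] by blast
  next
    fix E assume E: "E \<in> G"
    note Z = zer_in[OF G[OF E] ob(1)] and Z' = zer_in[OF G[OF E] ob(2)]
    have "Zer T E Y = Add T (Zer T E Y) (y \<cdot> Zer T E D)"
        using comp_zer_right[OF y(1) G[OF E]] add_zer[OF Z] by simp
    then show "Zer T E Y \<in> M" unfolding M_def using E n(3)[OF E] Z Z' by blast
  next
    fix E z z' assume "z \<in> M \<inter> Hom T E Y" "z' \<in> M \<inter> Hom T E Y"
    then have zz: "z \<in> M" "z \<in> Hom T E Y" "z' \<in> M" "z' \<in> Hom T E Y" by auto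
    obtain n0 u D1 where z: "z = Add T n0 (y \<cdot> u)" "D1 \<in> G" "n0 \<in> N" "n0 \<in> Hom T D1 Y"
        "u \<in> Hom T D1 D"
      using zz(1) unfolding M_def by blast
    obtain n1 u' D2 where z': "z' = Add T n1 (y \<cdot> u')" "D2 \<in> G" "n1 \<in> N" "n1 \<in> Hom T D2 Y"
        "u' \<in> Hom T D2 D"
      using zz(3) unfolding M_def by blast
    have D1: "D1 = E" using hom_dom_cod(1)[OF Mh[OF z(4,5)]] hom_dom_cod(1)[OF zz(2)] z(1) by simp
    have D2: "D2 = E" using hom_dom_cod(1)[OF Mh[OF z'(4,5)]] hom_dom_cod(1)[OF zz(4)] z'(1) by simp
    note h = z(4,5)[unfolded D1] z'(4,5)[unfolded D2]
    have "Add T z z' = Add T (Add T n0 n1) (y \<cdot> Add T u u')"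
      unfolding z(1) z'(1) using add_swap[OF h(1) comp[OF h(2) y(1)] h(3) comp[OF h(4) y(1)]]
          comp_add_right[OF h(2,4) y(1)]
      by simp
    then show "Add T z z' \<in> M"
      unfolding M_def using n(4)[OF z(3) z'(3) h(1,3)] add_in[OF h(1,3)] add_in[OF h(2,4)] z(2) D1
          by blast
  qed
  show "N \<subseteq> M"
  proof
    fix z assume z: "z \<in> N"
    note zh = n(2)[OF z] and zG = n(1)[OF z]
    have "z = Add T z (y \<cdot> Zer T (Dom T z) D)" using comp_zer_right[OF y(1) G[OF zG]] add_zer[OF zh]
        by simp
    then show "z \<in> M" unfolding M_def using z zh zG zer_in[OF G[OF zG] ob(2)] by blast
  qed
  have "y = Add T (Zer T D Y) (y \<cdot> Idn T D)" using comp_idn_right[OF y(1)] zer_add[OF y(1)] by simp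
  then show "y \<in> M" unfolding M_def using n(3)[OF y(2)] zer_in[OF ob(2,1)] idn[OF ob(2)] y(2)
      by blast
qed

text \<open>On \<open>G\<close> the kernel of \<open>g\<close> is the maximal subfunctor
  \<open>N\<close>. If \<open>g \<cdot> y\<close> is nonzero, adjoining \<open>y\<close> to
  \<open>N\<close> must hit some \<open>s x\<close>, and applying \<open>g\<close> to this equation
  removes the part in \<open>N\<close>. Nothing is said about morphisms into \<open>Y'\<close> that
  do not come from \<open>Y\<close>.\<close>

lemma essential_step:
  assumes G: "good_generators G" and C: "C \<in> G" and x: "x \<in> Hom T C Y" "\<not> tors \<qq> x"
  obtains Y' g where "g \<in> Hom T Y Y'" "\<not> tors \<qq> (g \<cdot> x)"
    "\<forall>D\<in>G. \<forall>y\<in>Hom T D Y. g \<cdot> y \<noteq> Zer T D Y' \<longrightarrow> (\<exists>a s u. s \<in> grade R a \<and> s \<notin> \<qq>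
        \<and> u \<in> Hom T C (Sh a D) \<and>
      Sm a (g \<cdot> y) \<cdot> u = act T a s Y' \<cdot> (g \<cdot> x))"
proof -
  have GC: "D \<in> Cpt" "D \<in> Ob T" if "D \<in> G" for D using good_generators_sub(1)[OF G] compact_ob that
      by blast+
  have Gsh: "Sh n D \<in> G" if "D \<in> G" for D n using G that unfolding good_generators_def by blast
  have ob: "C \<in> Ob T" "Y \<in> Ob T" using hom_ob x by blast+
  obtain N where N: "subfunctor G Y N" "avoids \<qq> Y x N"
    and max: "\<And>N'. subfunctor G Y N' \<Longrightarrow> avoids \<qq> Y x N' \<Longrightarrow> N \<subseteq> N' \<Longrightarrow> N' = N"
    using maximal_subfunctor[OF GC(2) Gsh x] by blast
  note n = subfunctorD[OF N(1)]
  have "N \<subseteq> (\<Union>D\<in>G. Hom T D Y)" using n(1,2) by blast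
  then have sN: "small \<kappa> N" using small_mono small_homs[OF good_generators_sub[OF G] ob(2)] by blast
  from cone_off[OF ob(2) sN n(2)] obtain P \<iota> m Y' g h where P: "is_coproduct T N (Dom T) P \<iota>"
    and m: "m \<in> Hom T P Y" "\<forall>y\<in>N. m \<cdot> \<iota> y = y" and t: "(m, g, h) \<in> Tri T" and g: "g \<in> Hom T Y Y'"
        and "h \<in> Hom T Y' (Sus T P)" .
  have Y': "Y' \<in> Ob T" using hom_ob g by blast
  have ker: "z \<in> N" if D: "D \<in> G" and z: "z \<in> Hom T D Y" "g \<cdot> z = Zer T D Y'" for D z
    by (rule cone_off_kernel[OF P m t g sN GC(1)[OF D] z, of "\<lambda>z. z \<in> N"])
      (use n(3)[OF D] n(4) n(5)[OF _ D] in blast)+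
  have gs: "Sm a g \<cdot> (act T a s Y \<cdot> x) = act T a s Y' \<cdot> (g \<cdot> x)" if s: "s \<in> grade R a" for a s
    using comp_assoc[OF x(1) act_in[OF s ob(2)] sm_in[OF g]] act_nat[OF s g] comp_assoc[OF x(1) g
        act_in[OF s Y']] by simp
  have nt: "\<not> tors \<qq> (g \<cdot> x)"
  proof
    assume "tors \<qq> (g \<cdot> x)"
    then obtain a s where s: "s \<in> grade R a" "s \<notin> \<qq>" "act T a s Y' \<cdot> (g \<cdot> x) = Zer T C (Sh a Y')"
      using torsE comp[OF x(1) g] by blast
    have sx: "act T a s Y \<cdot> x \<in> Hom T C (Sh a Y)" using comp[OF x(1) act_in[OF s(1) ob(2)]] .
    let ?z = "Sm (- a) (act T a s Y \<cdot> x)"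
    have z: "?z \<in> Hom T (Sh (- a) C) Y" by (rule sm_in_back[OF sx ob(2)])
    have "Sm (- a) (Sm a g \<cdot> (act T a s Y \<cdot> x)) = g \<cdot> ?z"
      using sm_comp[OF sx sm_in[OF g], of "- a"] sm_back(1)[OF hom_mor[OF g]] by simp
    then have "g \<cdot> ?z = Zer T (Sh (- a) C) Y'"
      using gs[OF s(1)] s(3) sm_zer[OF ob(1) sh_in[OF Y'], of "- a" a] sh_back(1)[OF Y'] by simp
    then have "?z \<in> N" using ker[OF Gsh[OF C] z] by blast
    then show False using N(2) s(1,2) unfolding avoids_def by blast
  qed
  have "\<exists>a s u. s \<in> grade R a \<and> s \<notin> \<qq> \<and> u \<in> Hom T C (Sh a D)
      \<and> Sm a (g \<cdot> y) \<cdot> u = act T a s Y' \<cdot> (g \<cdot> x)"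
    if D: "D \<in> G" and y: "y \<in> Hom T D Y" and nz: "g \<cdot> y \<noteq> Zer T D Y'" for D y
  proof -
    let ?M = "{Add T n (y \<cdot> u) | n u D'. D' \<in> G \<and> n \<in> N \<and> n \<in> Hom T D' Y \<and> u \<in> Hom T D' D}"
    note M = subfunctor_adjoin[OF N(1) y D GC(2)]
    have gN: "g \<cdot> n0 = Zer T (Dom T n0) Y'" if "n0 \<in> N" for n0
        using cone_off_kills[OF P m t g that] .
    have "y \<notin> N" using gN hom_dom_cod(1)[OF y] nz by auto
    then have "\<not> avoids \<qq> Y x ?M" using max[OF M(1) _ M(2)] M(3) by blast
    then obtain a s where s: "s \<in> grade R a"
        "s \<notin> \<qq>" and "Sm (- a) (act T a s Y \<cdot> x) \<in> ?M" unfolding avoids_def by blast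
    then obtain n0 u D' where nu: "Sm (- a) (act T a s Y \<cdot> x) = Add T n0 (y \<cdot> u)" "D' \<in> G" "n0 \<in> N"
      "n0 \<in> Hom T D' Y" "u \<in> Hom T D' D" by blast
    have sx: "act T a s Y \<cdot> x \<in> Hom T C (Sh a Y)" using comp[OF x(1) act_in[OF s(1) ob(2)]] .
    have z: "Sm (- a) (act T a s Y \<cdot> x) \<in> Hom T (Sh (- a) C) Y" by (rule sm_in_back[OF sx ob(2)])
    note yu = comp[OF nu(5) y]
    have "D' = Sh (- a) C" using hom_dom_cod(1)[OF z] hom_dom_cod(1)[OF add_in[OF nu(4) yu]] nu(1)
        by simp
    then have saD: "Sh a D' = C" using sh_back(2)[OF ob(1)] by simp
    have u: "Sm a u \<in> Hom T C (Sh a D)" using sm_in[OF nu(5), of a] saD by simp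
    have "act T a s Y \<cdot> x = Sm a (Add T n0 (y \<cdot> u))"
        using nu(1) sm_back(2)[OF hom_mor[OF sx], of a] by simp
    also have "\<dots> = Add T (Sm a n0) (Sm a (y \<cdot> u))" using sm_add[OF nu(4) yu] .
    finally have "Sm a g \<cdot> (act T a s Y \<cdot> x) = Add T (Sm a g \<cdot> Sm a n0) (Sm a g \<cdot> Sm a (y \<cdot> u))"
      using comp_add_right[OF sm_in[OF nu(4)] sm_in[OF yu] sm_in[OF g]] by simp
    also have "Sm a g \<cdot> Sm a n0 = Zer T (Sh a D') (Sh a Y')"
      using sm_comp[OF nu(4) g, of a] gN[OF nu(3)] hom_dom_cod(1)[OF nu(4)] sm_zer[OF GC(2)[OF
          nu(2)] Y'] by simp
    also have "Sm a g \<cdot> Sm a (y \<cdot> u) = Sm a (g \<cdot> y) \<cdot> Sm a u"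
      using sm_comp[OF yu g, of a] comp_assoc[OF nu(5) y g] sm_comp[OF nu(5) comp[OF y g], of a]
          by simp
    also have "Add T (Zer T (Sh a D') (Sh a Y')) (Sm a (g \<cdot> y) \<cdot> Sm a u) = Sm a (g \<cdot> y) \<cdot> Sm a u"
      by (rule zer_add[OF comp[OF sm_in[OF nu(5)] sm_in[OF comp[OF y g]]]])
    finally have "Sm a (g \<cdot> y) \<cdot> Sm a u = act T a s Y' \<cdot> (g \<cdot> x)" using gs[OF s(1)] by simp
    then show ?thesis using s u by blast
  qed
  then show ?thesis using that[OF g nt] by blast
qed

text \<open>A morphism from a compact object to the colimit comes from a finite stage, and at the
  next stage it is the image of a morphism to which \<open>essential_step\<close> applies.\<close>

lemma essential_extension:
  assumes G: "good_generators G" and C: "C \<in> G" and x: "x \<in> Hom T C X" "\<not> tors \<qq> x"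
  obtains J \<phi> where "\<phi> \<in> Hom T X J" "essential \<qq> G C J (\<phi> \<cdot> x)"
proof -
  let ?E = "\<lambda>Y x Y' g. \<forall>D\<in>G. \<forall>y\<in>Hom T D Y. g \<cdot> y \<noteq> Zer T D Y'
      \<longrightarrow> (\<exists>a s u. s \<in> grade R a \<and> s \<notin> \<qq> \<and> u \<in> Hom T C (Sh a D) \<and>
      Sm a (g \<cdot> y) \<cdot> u = act T a s Y' \<cdot> (g \<cdot> x))"
  \<comment> \<open>The state at stage \<open>n\<close> is an object together with the image of
    \<open>x\<close> in it; the last clause anchors the sequence at \<open>X\<close> and
    \<open>x\<close>.\<close>
  let ?P = "\<lambda>(n :: nat) (Y, z). z \<in> Hom T C Y \<and> \<not> tors \<qq> z \<and> (n = 0 \<longrightarrow> Y = X \<and> z = x)"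
  let ?Q = "\<lambda>(n :: nat) (Y, z) (Y', z'). \<exists>g. g \<in> Hom T Y Y' \<and> z' = g \<cdot> z \<and> ?E Y z Y' g"
  have CC: "C \<in> Cpt" and Cob: "C \<in> Ob T" and X: "X \<in> Ob T"
      using good_generators_sub(1)[OF G] C hom_ob[OF x(1)] by blast+
  have GC: "D \<in> Cpt" "D \<in> Ob T" if "D \<in> G" for D using good_generators_sub(1)[OF G] compact_ob that
      by blast+
  have "\<exists>st. \<forall>n. ?P n (st n) \<and> ?Q n (st n) (st (Suc n))"
  proof (rule dependent_nat_choice)
    show "\<exists>p. ?P 0 p" by (rule exI[of _ "(X, x)"]) (use x in simp)
    fix p n assume p: "?P n p"
    obtain Y z where pz: "p = (Y, z)" by (cases p)
    then have z: "z \<in> Hom T C Y" "\<not> tors \<qq> z" using p by auto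
    obtain Y' g where g: "g \<in> Hom T Y Y'" "\<not> tors \<qq> (g \<cdot> z)"
        "?E Y z Y' g" by (rule essential_step[OF G C z])
    have "?P (Suc n) (Y', g \<cdot> z)" using comp[OF z(1) g(1)] g(2) by simp
    moreover have "?Q n p (Y', g \<cdot> z)" unfolding pz using g(1,3) by auto
    ultimately show "\<exists>p'. ?P (Suc n) p' \<and> ?Q n p p'" by blast
  qed
  then obtain st where "\<forall>n. ?P n (st n) \<and> ?Q n (st n) (st (Suc n))" by (elim exE)
  note st = this[THEN spec, THEN conjunct1] this[THEN spec, THEN conjunct2]
  define XX where "XX n = fst (st n)" for n
  define xx where "xx n = snd (st n)" for n
  have xx: "xx n \<in> Hom T C (XX n)" "\<not> tors \<qq> (xx n)" for n
      using st(1)[of n] by (auto simp: XX_def xx_def split: prod.splits)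
  have X0: "XX 0 = X" "xx 0 = x" using st(1)[of 0] by (auto simp: XX_def xx_def split: prod.splits)
  have "\<exists>g. g \<in> Hom T (XX n) (XX (Suc n)) \<and> xx (Suc n) = g \<cdot> xx n
      \<and> ?E (XX n) (xx n) (XX (Suc n)) g" for n
    using st(2)[of n] unfolding XX_def xx_def by (simp add: case_prod_beta)
  then have "\<forall>n. \<exists>g. g \<in> Hom T (XX n) (XX (Suc n)) \<and> xx (Suc n) = g \<cdot> xx n
      \<and> ?E (XX n) (xx n) (XX (Suc n)) g" ..
  from choice[OF this] obtain f
    where fall: "\<forall>n. f n \<in> Hom T (XX n) (XX (Suc n)) \<and> xx (Suc n) = f n \<cdot> xx n
        \<and> ?E (XX n) (xx n) (XX (Suc n)) (f n)"
    by (elim exE)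
  have f: "f n \<in> Hom T (XX n) (XX (Suc n))" and fx: "xx (Suc n) = f n \<cdot> xx n" for n
      using fall by blast+
  have fE: "?E (XX n) (xx n) (XX (Suc n)) (f n)" for n using fall[rule_format, of n] by (elim conjE)
  have Xob: "XX n \<in> Ob T" for n using hom_ob f by blast
  obtain J j where hc: "hocolim XX f J j" using ex_hocolim[of f XX] f by blast
  note jin = hocolim_in[OF hc] and jf = hocolim_compat[OF hc]
  have J: "J \<in> Ob T" using hom_ob(2)[OF jin[of 0]] .
  have j0: "j 0 \<in> Hom T X J" using jin[of 0] X0 by simp
  let ?x = "j 0 \<cdot> x"
  have xJ: "?x \<in> Hom T C J" using comp[OF x(1) j0] .
  have jx: "j n \<cdot> xx n = ?x" for n
  proof (induction n)
    case 0 then show ?case using X0 by simp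
  next
    case (Suc n)
    then show ?case using fx[of n] jf[of n] comp_assoc[OF xx(1) f jin] by simp
  qed
  have nt: "\<not> tors \<qq> ?x"
  proof
    assume "tors \<qq> ?x"
    then obtain a s where s: "s \<in> grade R a" "s \<notin> \<qq>"
        "act T a s J \<cdot> ?x = Zer T C (Sh a J)" using torsE xJ by blast
    have sx: "act T a s (XX n) \<cdot> xx n \<in> Hom T C (Sh a (XX n))" for n
        using comp[OF xx(1) act_in[OF s(1) Xob]] .
    let ?z = "\<lambda>n. Sm (- a) (act T a s (XX n) \<cdot> xx n)"
    have z: "?z n \<in> Hom T (Sh (- a) C) (XX n)" for n by (rule sm_in_back[OF sx Xob])
    have znz: "?z n \<noteq> Zer T (Sh (- a) C) (XX n)" for n
    proof
      assume "?z n = Zer T (Sh (- a) C) (XX n)"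
      then have "?z n = Zer T (Sh (- a) C) (Sh (- a) (Sh a (XX n)))"
          using sh_back(1)[OF Xob] by simp
      then have "act T a s (XX n) \<cdot> xx n = Zer T C (Sh a (XX n))" using sm_eq_zer[OF sx] by blast
      then show False using torsI[OF xx(1) s(1,2)] xx(2) by blast
    qed
    have fz: "f n \<cdot> ?z n = ?z (Suc n)" for n
    proof -
      have "act T a s (XX (Suc n)) \<cdot> xx (Suc n) = Sm a (f n) \<cdot> (act T a s (XX n) \<cdot> xx n)"
        using fx[of n] comp_assoc[OF xx(1) f act_in[OF s(1) Xob]] act_nat[OF s(1) f]
          comp_assoc[OF xx(1) act_in[OF s(1) Xob] sm_in[OF f]] by simp
      then show ?thesis using sm_comp[OF sx sm_in[OF f], of "- a"] sm_back(1)[OF hom_mor[OF f]]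
          by simp
    qed
    have "act T a s J \<cdot> ?x = Sm a (j 0) \<cdot> (act T a s (XX 0) \<cdot> xx 0)"
      using X0 comp_assoc[OF x(1) j0 act_in[OF s(1) J]] act_nat[OF s(1) j0] comp_assoc[OF x(1)
          act_in[OF s(1) X] sm_in[OF j0]]
      by simp
    then have "j 0 \<cdot> ?z 0 = Sm (- a) (act T a s J \<cdot> ?x)"
      using sm_comp[OF sx[of 0] sm_in[OF jin[of 0]], of "- a"] sm_back(1)[OF hom_mor[OF jin]]
          by simp
    then have "j 0 \<cdot> ?z 0 = Zer T (Sh (- a) C) J"
      using s(3) sm_zer[OF Cob sh_in[OF J], of "- a" a] sh_back(1)[OF J] by simp
    \<comment> \<open>With \<open>Q n w\<close> the statement \<open>w \<noteq> ?z n\<close>,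
      vanishing in \<open>J\<close> leads to this absurdity: zero differs from every
      \<open>?z n\<close>, and \<open>f n\<close> carries \<open>?z n\<close> to
      \<open>?z (Suc n)\<close>.\<close>
    then have "?z 0 \<noteq> ?z 0"
    proof (rule hocolim_kernel[OF hc compact_sh[OF CC] z, where Q = "\<lambda>n w. w \<noteq> ?z n"])
      show "Zer T (Sh (- a) C) (XX n) \<noteq> ?z n" for n using znz by metis
      show "w \<noteq> ?z n" if "f n \<cdot> w \<noteq> ?z (Suc n)" for n w using that fz by blast
    qed
    then show False by blast
  qed
  have ess: "\<exists>a s g. s \<in> grade R a \<and> s \<notin> \<qq> \<and> g \<in> Hom T C (Sh a D) \<and> Sm a y \<cdot> g = act T a s J \<cdot> ?x"
    if D: "D \<in> G" and y: "y \<in> Hom T D J" "y \<noteq> Zer T D J" for D y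
  proof -
    obtain n z where z: "z \<in> Hom T D (XX n)"
        "y = j n \<cdot> z" by (rule hocolim_lift[OF hc GC(1)[OF D] y(1)])
    have fz: "f n \<cdot> z \<in> Hom T D (XX (Suc n))" using comp[OF z(1) f] .
    \<comment> \<open>One stage further, because the step property concerns only morphisms in the
      image of \<open>f n\<close>.\<close>
    have yz: "y = j (Suc n) \<cdot> (f n \<cdot> z)" using comp_assoc[OF z(1) f jin] jf[of n] z(2) by simp
    then have "f n \<cdot> z \<noteq> Zer T D (XX (Suc n))" using y(2) comp_zer_right[OF jin GC(2)[OF D]]
        by metis
    then obtain a s u where u: "s \<in> grade R a" "s \<notin> \<qq>" "u \<in> Hom T C (Sh a D)"
      "Sm a (f n \<cdot> z) \<cdot> u = act T a s (XX (Suc n)) \<cdot> (f n \<cdot> xx n)" using fE[of n] D z(1) by blast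
    have "Sm a y \<cdot> u = Sm a (j (Suc n)) \<cdot> (Sm a (f n \<cdot> z) \<cdot> u)"
      unfolding yz using sm_comp[OF fz jin[of "Suc n"], of a] comp_assoc[OF u(3) sm_in[OF fz]
          sm_in[OF jin]] by simp
    also have "\<dots> = Sm a (j (Suc n)) \<cdot> (act T a s (XX (Suc n)) \<cdot> xx (Suc n))"
        using u(4) fx[of n] by simp
    also have "\<dots> = act T a s J \<cdot> (j (Suc n) \<cdot> xx (Suc n))"
      using comp_assoc[OF xx(1) act_in[OF u(1) Xob] sm_in[OF jin]] act_nat[OF u(1) jin]
          comp_assoc[OF xx(1) jin act_in[OF u(1) J]]
      by metis
    finally show ?thesis using jx[of "Suc n"] u(1-3) by auto
  qed
  have "essential \<qq> G C J ?x" unfolding essential_def using xJ nt ess by blast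
  then show ?thesis using that j0 by blast
qed

end

section \<open>Essential extensions lie in \<open>\<Gamma>\<^sub>\<qq>T\<close>\<close>

context graded_commutative_ring
begin

lemma grade_pow: "r \<in> grade R b \<Longrightarrow> r [^] (n :: nat) \<in> grade R (int n * b)"
proof (induction n)
  case 0 then show ?case using grade_one by simp
next
  case (Suc n)
  then show ?case using grade_mult[of "r [^] n" "int n * b" r b] by (simp add: algebra_simps)
qed

lemma Spec_pow:
  assumes p: "\<pp> \<in> Spec R" and r: "r \<in> grade R b" "r \<notin> \<pp>" shows "r [^] (n :: nat) \<notin> \<pp>"
proof (induction n)
  case 0 then show ?case using Spec_one[OF p] by simp
next
  case (Suc n) then show ?case using Spec_mult[OF p grade_pow[OF r(1), of n] Suc r] by simp
qed

lemma Spec_mult_in: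
  assumes "\<pp> \<in> Spec R" "x \<in> \<pp>" "r \<in> carrier R" shows "r \<otimes> x \<in> \<pp>" "x \<otimes> r \<in> \<pp>"
  using ideal.I_l_closed[OF Spec_ideal[OF assms(1)] assms(2,3)] ideal.I_r_closed[OF Spec_ideal[OF
      assms(1)] assms(2,3)] by auto

lemma Spec_add: "\<pp> \<in> Spec R \<Longrightarrow> x \<in> \<pp> \<Longrightarrow> y \<in> \<pp> \<Longrightarrow> x \<oplus> y \<in> \<pp>"
  using additive_subgroup.a_closed[OF ideal.axioms(1)[OF Spec_ideal]] by blast

lemma Spec_carrier: "\<pp> \<in> Spec R \<Longrightarrow> x \<in> \<pp> \<Longrightarrow> x \<in> carrier R"
  using additive_subgroup.a_subset[OF ideal.axioms(1)[OF Spec_ideal]] by blast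

lemma Spec_finsum:
  assumes p: "\<pp> \<in> Spec R" and "finite F" "\<And>n. n \<in> F \<Longrightarrow> c n \<in> \<pp>" shows "finsum R c F \<in> \<pp>"
  using assms(2,3)
proof (induction F)
  case empty then show ?case using Spec_zero[OF p] by simp
next
  case (insert n F)
  have "c \<in> F \<rightarrow> carrier R" "c n \<in> carrier R" using insert.prems Spec_carrier[OF p] by blast+
  then show ?case using finsum_insert[OF insert.hyps] insert Spec_add[OF p] by simp
qed

lemma homogeneous_separation:
  assumes q: "\<qq> \<in> Spec R" and p: "\<pp> \<in> Spec R" and n: "\<not> \<qq> \<subseteq> \<pp>"
  obtains r b where "r \<in> grade R b" "r \<in> \<qq>" "r \<notin> \<pp>"
proof -
  obtain x where x: "x \<in> \<qq>" "x \<notin> \<pp>" using n by blast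
  obtain c where c: "hom_decomp R c x" using grade_direct_sum[OF Spec_carrier[OF q x(1)]] by blast
  obtain F where F: "finite F" "\<And>n. c n \<in> grade R n"
      "x = finsum R c F" using hom_decompE[OF c] by metis
  obtain b where "c b \<notin> \<pp>" using Spec_finsum[OF p F(1), of c] F(3) x(2) by blast
  moreover have "c b \<in> \<qq>" using q x(1) c unfolding Spec_def homogeneous_ideal_def by blast
  ultimately show ?thesis using that F(2) by blast
qed

end

section \<open>Integral dependence, torsion and locality of essential extensions\<close>

context bik_category
begin

lemma gspan_incl: "(i, x) \<in> A \<Longrightarrow> x \<in> Hom T C (Sh i X) \<Longrightarrow> x \<in> gspan C X A i"
  unfolding gspan_def by blast

lemma gspan_least: "hom_submodule C X N \<Longrightarrow> (\<And>j x. (j, x) \<in> A \<Longrightarrow> x \<in> N j) \<Longrightarrow> gspan C X A i \<subseteq> N i"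
  unfolding gspan_def by blast

lemma gspan_mono: "A \<subseteq> B \<Longrightarrow> gspan C X A i \<subseteq> gspan C X B i"
  unfolding gspan_def by blast

text \<open>The power \<open>g^n\<close> in the graded ring End^*(C), where \<open>g\<close> has
  degree \<open>d\<close>.\<close>

primrec end_pow :: "int \<Rightarrow> 'o \<Rightarrow> 'm \<Rightarrow> nat \<Rightarrow> 'm" where
  "end_pow d C g 0 = Idn T C"
| "end_pow d C g (Suc n) = Sm (int n * d) g \<cdot> end_pow d C g n"

lemma end_pow_in:
  assumes C: "C \<in> Ob T" and g: "g \<in> Hom T C (Sh d C)" shows "end_pow d C g n \<in> Hom T C (Sh (int n *
      d) C)"
proof (induction n)
  case 0 then show ?case using idn[OF C] by (simp add: sh_0)
next
  case (Suc n)
  have "Sm (int n * d) g \<in> Hom T (Sh (int n * d) C) (Sh (int (Suc n) * d) C)"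
    using sm_in[OF g, of "int n * d"] sh_sh[OF C] by (simp add: algebra_simps)
  then show ?case using comp[OF Suc] by simp
qed

text \<open>The submodules spanned by the first \<open>k\<close> powers form an ascending chain, so
  some power lies in the span of the lower ones. Quantifying over all submodules \<open>N\<close>
  avoids sums with explicit coefficients.\<close>

lemma end_pow_integral:
  assumes noeth: "noetherian_category \<kappa> R T" and C: "C \<in> Cpt" and g: "g \<in> Hom T C (Sh d C)"
  obtains n where "\<And>N. hom_submodule C C N \<Longrightarrow> (\<And>i. i < n \<Longrightarrow> end_pow d C g i \<in> N (int i * d)) \<Longrightarrow>
    end_pow d C g n \<in> N (int n * d)"
proof -
  have Cob: "C \<in> Ob T" using compact_ob[OF C] .
  let ?A = "\<lambda>k. {(int i * d, end_pow d C g i) | i. i < k}"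
  have mono: "gspan C C (?A k) i \<subseteq> gspan C C (?A (Suc k)) i" for k i
    by (rule gspan_mono) (use less_SucI in blast)
  note sub = gspan_submodule[OF Cob Cob]
  obtain K where K: "\<And>k i. gspan C C (?A k) i \<subseteq> gspan C C (?A K) i"
    using hom_submodule_chain[where N = "\<lambda>k. gspan C C (?A k)", OF noeth C C sub mono] by blast
  have "end_pow d C g K \<in> gspan C C (?A (Suc K)) (int K * d)"
    by (rule gspan_incl[OF _ end_pow_in[OF Cob g]]) blast
  then have *: "end_pow d C g K \<in> gspan C C (?A K) (int K * d)" using K by blast
  show ?thesis
  proof (rule that)
    fix N assume N: "hom_submodule C C N" and i: "\<And>i. i < K \<Longrightarrow> end_pow d C g i \<in> N (int i * d)"
    show "end_pow d C g K \<in> N (int K * d)"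
      using gspan_least[OF N, of "?A K" "int K * d"] i * by blast
  qed
qed

context
  fixes \<qq> G C J x
  assumes noeth: "noetherian_category \<kappa> R T" and q: "\<qq> \<in> Spec R" and G: "good_generators G"
      and C: "C \<in> G"
    and ess: "essential \<qq> G C J x"
begin

lemma ess_x: "x \<in> Hom T C J" "\<not> tors \<qq> x"
  using ess unfolding essential_def by auto

lemma ess_ob: "C \<in> Ob T" "J \<in> Ob T" "C \<in> Cpt"
  using hom_ob ess_x C good_generators_sub[OF G] by blast+

lemma ess_obtain:
  assumes "D \<in> G" "y \<in> Hom T D J" "y \<noteq> Zer T D J"
  obtains a s g where "s \<in> grade R a" "s \<notin> \<qq>" "g \<in> Hom T C (Sh a D)" "Sm a y \<cdot> g = act T a s J \<cdot> x"
  using ess assms unfolding essential_def by blast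

lemma ess_nonzero: "s \<in> grade R a \<Longrightarrow> s \<notin> \<qq> \<Longrightarrow> act T a s J \<cdot> x \<noteq> Zer T C (Sh a J)"
  using torsI[OF ess_x(1)] ess_x(2) by blast

lemma ess_act_in: "s \<in> grade R a \<Longrightarrow> act T a s J \<cdot> x \<in> Hom T C (Sh a J)"
  using comp[OF ess_x(1) act_in] ess_ob by blast

lemma smul_act_x:
  assumes r: "r \<in> grade R a" and s: "s \<in> grade R b"
  shows "smul a r b J (act T b s J \<cdot> x) = act T (a + b) (r \<otimes>\<^bsub>R\<^esub> s) J \<cdot> x"
  using smul_mult[OF r s ess_ob(2), of x C 0] ess_x(1) by (simp add: smul_0 sh_0)

text \<open>Essentiality is applied to \<open>r y\<close>, desuspended by the degree
  \<open>b\<close> of \<open>r\<close>; hence the degree \<open>d = a - b\<close> of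
  \<open>g\<close> relative to \<open>D\<close>.\<close>

lemma ess_obtain_multiple:
  assumes D: "D \<in> G" and y: "y \<in> Hom T D J" and r: "r \<in> grade R b"
      and nz: "act T b r J \<cdot> y \<noteq> Zer T D (Sh b J)"
  obtains d s g where "s \<in> grade R (d + b)" "s \<notin> \<qq>" "g \<in> Hom T C (Sh d D)"
    "smul b r d J (Sm d y \<cdot> g) = act T (d + b) s J \<cdot> x"
proof -
  have Dob: "D \<in> Ob T" using hom_ob y by blast
  have Gsh: "Sh (- b) D \<in> G" using G D unfolding good_generators_def by blast
  have ry: "act T b r J \<cdot> y \<in> Hom T D (Sh b J)" using comp[OF y act_in[OF r ess_ob(2)]] .
  let ?y = "Sm (- b) (act T b r J \<cdot> y)"
  have y': "?y \<in> Hom T (Sh (- b) D) J" by (rule sm_in_back[OF ry ess_ob(2)])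
  have "?y \<noteq> Zer T (Sh (- b) D) J"
    using nz sm_eq_zer[OF ry, of "- b"] sh_back(1)[OF ess_ob(2)] by simp
  then obtain a s g where s: "s \<in> grade R a" "s \<notin> \<qq>" and g: "g \<in> Hom T C (Sh a (Sh (- b) D))"
    and e: "Sm a ?y \<cdot> g = act T a s J \<cdot> x" using ess_obtain[OF Gsh y'] by blast
  let ?d = "a - b"
  have g': "g \<in> Hom T C (Sh ?d D)" using g sh_sh[OF Dob] by simp
  have "Sm a ?y = Sm ?d (act T b r J \<cdot> y)" using sm_sm[OF hom_mor[OF ry]] by simp
  also have "\<dots> = Sm ?d (act T b r J) \<cdot> Sm ?d y" using sm_comp[OF y act_in[OF r ess_ob(2)]] .
  finally have "smul b r ?d J (Sm ?d y \<cdot> g) = act T a s J \<cdot> x"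
    unfolding smul_def using e comp_assoc[OF g' sm_in[OF y] sm_in[OF act_in[OF r ess_ob(2)]]]
        by simp
  then show ?thesis using that[of s ?d g] s g' by simp
qed

text \<open>A sign is absorbed into \<open>s\<close>, since primes are closed under
  negation.\<close>

lemma act_up_to_sign:
  assumes s: "s \<in> grade R a" "s \<notin> \<qq>" and u: "up_to_sign z (act T a s J \<cdot> x)"
  obtains t where "t \<in> grade R a" "t \<notin> \<qq>" "z = act T a t J \<cdot> x"
proof (cases "z = act T a s J \<cdot> x")
  case True
  then show ?thesis using that s by blast
next
  case False
  then have "z = act T a (\<ominus>\<^bsub>R\<^esub> s) J \<cdot> x"
    using u act_minus[OF s(1) ess_ob(2)] comp_neg_left[OF ess_x(1) act_in[OF s(1) ess_ob(2)]]
        unfolding up_to_sign_def by simp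
  then show ?thesis using that grade_minus[OF s(1)] Spec_minus[OF q grade_carrier[OF s(1)]] s(2)
      by blast
qed

text \<open>If \<open>r x \<noteq> 0\<close>, then \<open>s x = r x g\<close> for some \<open>s \<notin> \<qq>\<close>
    and \<open>g\<close> in \<open>End\<^sup>*(C)\<close>. An equation of integral
  dependence for \<open>g\<close>, multiplied by \<open>r\<^sup>n\<close>, shows that \<open>x\<close> is annihilated by the sum of \<open>s\<^sup>n\<close>
  and an element of \<open>\<qq>\<close>, up to signs.\<close>

lemma ess_annihilator:
  assumes r: "r \<in> grade R b" "r \<in> \<qq>" shows "act T b r J \<cdot> x = Zer T C (Sh b J)"
proof (rule ccontr)
  assume "act T b r J \<cdot> x \<noteq> Zer T C (Sh b J)"
  then obtain d s g where s: "s \<in> grade R (d + b)" "s \<notin> \<qq>" and g: "g \<in> Hom T C (Sh d C)"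
    and e: "smul b r d J (Sm d x \<cdot> g) = act T (d + b) s J \<cdot> x"
    using ess_obtain_multiple[OF C ess_x(1) r(1)] by metis
  note ob = ess_ob(1,2) and x = ess_x(1)
  let ?a = "d + b"
  \<comment> \<open>\<open>X i\<close> stands for \<open>x g^i\<close>. The recursion
    \<open>rec\<close> below reads \<open>r x g^(i+1) = s x g^i\<close>.\<close>
  define X where "X i = Sm (int i * d) x \<cdot> end_pow d C g i" for i
  have X: "X i \<in> Hom T C (Sh (int i * d) J)" for i
    unfolding X_def using comp[OF end_pow_in[OF ob(1) g] sm_in[OF x]] .
  have X0: "X 0 = x" unfolding X_def using comp_idn_right[OF x] by (simp add: sm_0)
  have rec: "smul b r (int (Suc i) * d) J (X (Suc i)) = smul ?a s (int i * d) J (X i)" for i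
  proof -
    let ?k = "int i * d"
    have xg: "Sm d x \<cdot> g \<in> Hom T C (Sh d J)" using comp[OF g sm_in[OF x]] .
    note gi = end_pow_in[OF ob(1) g, of i]
    have kd: "int (Suc i) * d = ?k + d" by (simp add: algebra_simps)
    have sg: "Sm ?k g \<in> Hom T (Sh ?k C) (Sh (?k + d) C)"
        using sm_in[OF g, of ?k] sh_sh[OF ob(1)] by simp
    have "X (Suc i) = Sm (?k + d) x \<cdot> (Sm ?k g \<cdot> end_pow d C g i)" unfolding X_def kd by simp
    also have "\<dots> = (Sm (?k + d) x \<cdot> Sm ?k g) \<cdot> end_pow d C g i"
        using comp_assoc[OF gi sg sm_in[OF x]] .
    also have "Sm (?k + d) x \<cdot> Sm ?k g = Sm ?k (Sm d x \<cdot> g)"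
      using sm_comp[OF g sm_in[OF x], of ?k] sm_sm[OF hom_mor[OF x]] by simp
    finally have XS: "X (Suc i) = Sm ?k (Sm d x \<cdot> g) \<cdot> end_pow d C g i" .
    have sxg: "Sm ?k (Sm d x \<cdot> g) \<in> Hom T (Sh ?k C) (Sh (?k + d) J)"
        using sm_in[OF xg, of ?k] sh_sh[OF ob(2)] by simp
    have "smul b r (int (Suc i) * d) J (X (Suc i))
        = smul b r (?k + d) J (Sm ?k (Sm d x \<cdot> g)) \<cdot> end_pow d C g i"
      unfolding XS kd by (rule smul_comp[OF r(1) ob(2) sxg gi])
    also have "smul b r (?k + d) J (Sm ?k (Sm d x \<cdot> g)) = Sm ?k (act T ?a s J \<cdot> x)"
      using smul_shift[OF r(1) ob(2) xg, of ?k] e by simp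
    also have "\<dots> = Sm ?k (act T ?a s J) \<cdot> Sm ?k x" using sm_comp[OF x act_in[OF s(1) ob(2)]] .
    finally show ?thesis
      unfolding smul_def X_def using comp_assoc[OF gi sm_in[OF x] sm_in[OF act_in[OF s(1) ob(2)]]]
          by simp
  qed
  let ?r = "\<lambda>n :: nat. r [^]\<^bsub>R\<^esub> n"
  note rp = grade_pow[OF r(1)]
  \<comment> \<open>Iterating the recursion turns \<open>r^i x g^i\<close> into a multiple of
    \<open>x\<close> by some \<open>t\<close> outside \<qq>, namely the power \<open>s^i\<close> up
    to sign.\<close>
  have "\<exists>t\<in>grade R (int i * ?a) - \<qq>. smul (int i * b) (?r i) (int i * d) J (X i)
      = act T (int i * ?a) t J \<cdot> x" for i
  proof (induction i)
    case 0
    have "smul 0 \<one>\<^bsub>R\<^esub> 0 J x = act T 0 \<one>\<^bsub>R\<^esub> J \<cdot> x" by (simp add: smul_0)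
    then show ?case using grade_one Spec_one[OF q] X0 by auto
  next
    case (Suc i)
    then obtain t where t: "t \<in> grade R (int i * ?a)" "t \<notin> \<qq>"
      "smul (int i * b) (?r i) (int i * d) J (X i) = act T (int i * ?a) t J \<cdot> x" by blast
    let ?k = "int i * d"
    have k1: "int (Suc i) * d + b = ?k + ?a" "?k + int i * b = int i * ?a"
        "?a + int i * ?a = int (Suc i) * ?a"
      "int i * b + b = int (Suc i) * b" by (simp_all add: algebra_simps)
    have "smul (int (Suc i) * b) (?r (Suc i)) (int (Suc i) * d) J (X (Suc i)) =
      smul (int i * b) (?r i) (?k + ?a) J (smul ?a s ?k J (X i))"
      using smul_mult[OF rp[of i] r(1) ob(2) X[of "Suc i"]] rec[of i] unfolding k1 by simp
    moreover have "up_to_sign (smul (int i * b) (?r i) (?k + ?a) J (smul ?a s ?k J (X i)))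
      (smul ?a s (?k + int i * b) J (smul (int i * b) (?r i) ?k J (X i)))"
      by (rule up_to_sign_smul_commute[OF rp[of i] s(1) ob(2) X])
    moreover have "smul ?a s (?k + int i * b) J (smul (int i * b) (?r i) ?k J (X i)) =
      act T (int (Suc i) * ?a) (s \<otimes>\<^bsub>R\<^esub> t) J \<cdot> x"
      using smul_act_x[OF s(1) t(1)] t(3) unfolding k1 by simp
    ultimately have u: "up_to_sign (smul (int (Suc i) * b) (?r (Suc i)) (int (Suc i) * d) J (X (Suc
        i)))
      (act T (int (Suc i) * ?a) (s \<otimes>\<^bsub>R\<^esub> t) J \<cdot> x)" by simp
    have st: "s \<otimes>\<^bsub>R\<^esub> t \<in> grade R (int (Suc i) * ?a)" using grade_mult[OF s(1) t(1)] unfolding k1 .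
    obtain t' where "t' \<in> grade R (int (Suc i) * ?a)" "t' \<notin> \<qq>"
      "smul (int (Suc i) * b) (?r (Suc i)) (int (Suc i) * d) J (X (Suc i))
          = act T (int (Suc i) * ?a) t' J \<cdot> x"
      by (rule act_up_to_sign[OF st Spec_mult[OF q s t(1,2)] u])
    then show ?case by blast
  qed
  then obtain t where t: "\<And>i. t i \<in> grade R (int i * ?a)" "\<And>i. t i \<notin> \<qq>"
    "\<And>i. smul (int i * b) (?r i) (int i * d) J (X i) = act T (int i * ?a) (t i) J \<cdot> x"
        by (metis DiffE)
  obtain n where n: "\<And>N. hom_submodule C C N \<Longrightarrow> (\<And>i. i < n \<Longrightarrow> end_pow d C g i \<in> N (int i * d)) \<Longrightarrow>
    end_pow d C g n \<in> N (int n * d)" using end_pow_integral[OF noeth ess_ob(3) g] by blast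
  let ?B = "int n * b"
  \<comment> \<open>The \<open>h\<close> for which \<open>r^n x h\<close> is a multiple of
    \<open>x\<close> by an element of \<qq>. They form a submodule that contains the powers of
    \<open>g\<close> below \<open>n\<close>, so by integral dependence it contains
    \<open>g^n\<close>.\<close>
  define M where "M k = {h \<in> Hom T C (Sh k C). \<exists>\<beta>\<in>grade R (k + ?B) \<inter> \<qq>. smul ?B (?r n) k J (Sm k x \<cdot>
      h) = act T (k + ?B) \<beta> J \<cdot> x}" for k
  have "hom_submodule C C M"
    unfolding hom_submodule_iff
  proof (intro conjI allI ballI)
    fix k
    show "M k \<subseteq> Hom T C (Sh k C)" unfolding M_def by blast
    have "smul ?B (?r n) k J (Sm k x \<cdot> Zer T C (Sh k C)) = act T (k + ?B) \<zero>\<^bsub>R\<^esub> J \<cdot> x"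
      using comp_zer_right[OF sm_in[OF x] ob(1)] smul_zer[OF rp[of n] ob(2,1)] act_zero[OF ob(2)]
          comp_zer_left[OF x sh_in[OF ob(2)]]
      by simp
    then show "Zer T C (Sh k C) \<in> M k" unfolding M_def
        using zer_in[OF ob(1) sh_in[OF ob(1)]] grade_zero Spec_zero[OF q] by blast
  next
    fix k h h' assume "h \<in> M k" "h' \<in> M k"
    then obtain \<beta> \<beta>' where h: "h \<in> Hom T C (Sh k C)" "\<beta> \<in> grade R (k + ?B)" "\<beta> \<in> \<qq>"
        "smul ?B (?r n) k J (Sm k x \<cdot> h) = act T (k + ?B) \<beta> J \<cdot> x"
      and h': "h' \<in> Hom T C (Sh k C)" "\<beta>' \<in> grade R (k + ?B)" "\<beta>' \<in> \<qq>"
          "smul ?B (?r n) k J (Sm k x \<cdot> h') = act T (k + ?B) \<beta>' J \<cdot> x"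
      unfolding M_def by blast
    have "smul ?B (?r n) k J (Sm k x \<cdot> Add T h h')
        = Add T (act T (k + ?B) \<beta> J \<cdot> x) (act T (k + ?B) \<beta>' J \<cdot> x)"
      using comp_add_right[OF h(1) h'(1) sm_in[OF x]] smul_add_right[OF rp[of n] ob(2) comp[OF h(1)
          sm_in[OF x]] comp[OF h'(1) sm_in[OF x]]]
        h(4) h'(4) by simp
    also have "\<dots> = act T (k + ?B) (\<beta> \<oplus>\<^bsub>R\<^esub> \<beta>') J \<cdot> x"
      using act_add[OF h(2) h'(2) ob(2)] comp_add_left[OF x act_in[OF h(2) ob(2)] act_in[OF h'(2)
          ob(2)]] by simp
    finally show "Add T h h' \<in> M k"
      unfolding M_def using add_in[OF h(1) h'(1)] grade_add[OF h(2) h'(2)] Spec_add[OF q h(3) h'(3)]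
          by blast
  next
    fix e k c h assume c: "c \<in> grade R e" and "h \<in> M k"
    then obtain \<beta> where h: "h \<in> Hom T C (Sh k C)" "\<beta> \<in> grade R (k + ?B)" "\<beta> \<in> \<qq>"
        "smul ?B (?r n) k J (Sm k x \<cdot> h) = act T (k + ?B) \<beta> J \<cdot> x"
      unfolding M_def by blast
    note xh = comp[OF h(1) sm_in[OF x]]
    have eq: "e + (k + ?B) = k + e + ?B" by simp
    have "smul ?B (?r n) (k + e) J (Sm (k + e) x \<cdot> smul e c k C h)
        = smul ?B (?r n) (k + e) J (smul e c k J (Sm k x \<cdot> h))"
      using smul_nat[OF c x h(1)] by simp
    moreover have "up_to_sign (smul ?B (?r n) (k + e) J (smul e c k J (Sm k x \<cdot> h))) (smul e c (k +
        ?B) J (smul ?B (?r n) k J (Sm k x \<cdot> h)))"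
      by (rule up_to_sign_smul_commute[OF rp[of n] c ob(2) xh])
    moreover have "smul e c (k + ?B) J (smul ?B (?r n) k J (Sm k x \<cdot> h))
        = act T (k + e + ?B) (c \<otimes>\<^bsub>R\<^esub> \<beta>) J \<cdot> x"
      using smul_act_x[OF c h(2)] h(4) unfolding eq by simp
    ultimately have u: "up_to_sign (smul ?B (?r n) (k + e) J (Sm (k + e) x \<cdot> smul e c k C h)) (act T
        (k + e + ?B) (c \<otimes>\<^bsub>R\<^esub> \<beta>) J \<cdot> x)"
      by simp
    have cb: "c \<otimes>\<^bsub>R\<^esub> \<beta> \<in> grade R (k + e + ?B)" using grade_mult[OF c h(2)] unfolding eq .
    have cq: "c \<otimes>\<^bsub>R\<^esub> \<beta> \<in> \<qq>" using Spec_mult_in(1)[OF q h(3) grade_carrier[OF c]] .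
    have "act T (k + e + ?B) (\<ominus>\<^bsub>R\<^esub> (c \<otimes>\<^bsub>R\<^esub> \<beta>)) J \<cdot> x = Neg T (act T (k + e + ?B) (c \<otimes>\<^bsub>R\<^esub> \<beta>) J \<cdot> x)"
      using act_minus[OF cb ob(2)] comp_neg_left[OF x act_in[OF cb ob(2)]] by simp
    then have "\<exists>\<beta>'\<in>grade R (k + e + ?B) \<inter> \<qq>. smul ?B (?r n) (k + e) J (Sm (k + e) x \<cdot> smul e c k C
        h) = act T (k + e + ?B) \<beta>' J \<cdot> x"
      using u cb cq grade_minus[OF cb] Spec_minus[OF q grade_carrier[OF cb]]
          unfolding up_to_sign_def by (metis IntI)
    then show "smul e c k C h \<in> M (k + e)" unfolding M_def using smul_in[OF c ob(1) h(1)] by blast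
  qed
  moreover have "end_pow d C g i \<in> M (int i * d)" if i: "i < n" for i
  proof -
    let ?k = "int i * d" and ?m = "n - i"
    \<comment> \<open>Since \<open>i < n\<close>, at least one factor \<open>r\<close> from \<qq> is
      left over when \<open>r^i\<close> is split off from \<open>r^n\<close>.\<close>
    have nm: "n = ?m + i" and m0: "?m = Suc (?m - 1)" using i by auto
    have eqs: "int ?m * b + int i * b = ?B" "?k + int i * b = int i * ?a"
        "int ?m * b + int i * ?a = ?k + ?B"
      using i by (simp_all add: algebra_simps of_nat_diff)
    have "?r n = ?r ?m \<otimes>\<^bsub>R\<^esub> ?r i" using nat_pow_mult[OF grade_carrier[OF r(1)], of ?m i] nm by simp
    then have "smul ?B (?r n) ?k J (X i) = smul (int ?m * b) (?r ?m) (?k + int i * b) J (smul (int i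
        * b) (?r i) ?k J (X i))"
      using smul_mult[OF rp[of ?m] rp[of i] ob(2) X[of i]] unfolding eqs(1) by simp
    also have "\<dots> = act T (?k + ?B) (?r ?m \<otimes>\<^bsub>R\<^esub> t i) J \<cdot> x"
      using smul_act_x[OF rp[of ?m] t(1)[of i]] t(3)[of i] unfolding eqs(2,3) by simp
    finally have "smul ?B (?r n) ?k J (Sm ?k x \<cdot> end_pow d C g i)
        = act T (?k + ?B) (?r ?m \<otimes>\<^bsub>R\<^esub> t i) J \<cdot> x"
      unfolding X_def .
    moreover have "?r ?m \<otimes>\<^bsub>R\<^esub> t i \<in> grade R (?k + ?B)"
        using grade_mult[OF rp[of ?m] t(1)[of i]] unfolding eqs(3) .
    moreover have "?r ?m \<in> \<qq>"
      using Spec_mult_in(1)[OF q r(2) grade_carrier[OF rp[of "?m - 1"]]] nat_pow_Suc[of r "?m - 1"]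
          m0 by metis
    then have "?r ?m \<otimes>\<^bsub>R\<^esub> t i \<in> \<qq>" using Spec_mult_in(2)[OF q _ grade_carrier[OF t(1)]] by blast
    ultimately show ?thesis unfolding M_def using end_pow_in[OF ob(1) g, of i] by blast
  qed
  ultimately have "end_pow d C g n \<in> M (int n * d)" using n by blast
  then obtain \<beta> where \<beta>: "\<beta> \<in> grade R (int n * d + ?B)" "\<beta> \<in> \<qq>"
    "smul ?B (?r n) (int n * d) J (X n) = act T (int n * d + ?B) \<beta> J \<cdot> x"
        unfolding M_def X_def by blast
  have na: "int n * d + ?B = int n * ?a" by (simp add: algebra_simps)
  note b' = \<beta>(1)[unfolded na]
  \<comment> \<open>Both \<open>t n\<close> and \<beta> describe \<open>r^n x g^n\<close>, so their
    difference kills \<open>x\<close> and lies in \<qq>. With \<beta> in \<qq> this forces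
    \<open>t n\<close> into \<qq>.\<close>
  let ?v = "t n \<oplus>\<^bsub>R\<^esub> \<ominus>\<^bsub>R\<^esub> \<beta>"
  have v: "?v \<in> grade R (int n * ?a)" using grade_add[OF t(1) grade_minus[OF b']] .
  have "act T (int n * ?a) ?v J \<cdot> x = Add T (act T (int n * ?a) (t n) J \<cdot> x) (Neg T (act T (int n *
      ?a) \<beta> J \<cdot> x))"
    using act_add[OF t(1) grade_minus[OF b'] ob(2)] act_minus[OF b' ob(2)]
      comp_add_left[OF x act_in[OF t(1) ob(2)] neg_in[OF act_in[OF b' ob(2)]]] comp_neg_left[OF x
          act_in[OF b' ob(2)]] by simp
  also have "\<dots> = Zer T C (Sh (int n * ?a) J)"
    using \<beta>(3) t(3)[of n] add_neg[OF ess_act_in[OF b']] unfolding na by simp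
  finally have "?v \<in> \<qq>" using ess_nonzero[OF v] by blast
  then have "?v \<oplus>\<^bsub>R\<^esub> \<beta> \<in> \<qq>" using Spec_add[OF q _ \<beta>(2)] by blast
  moreover have "?v \<oplus>\<^bsub>R\<^esub> \<beta> = t n" using grade_carrier[OF t(1)] grade_carrier[OF b']
      by (simp add: a_assoc l_neg)
  ultimately show False using t(2) by simp
qed

text \<open>The annihilators of \<open>r^k y\<close> among morphisms from \<open>C\<close> stabilize
  at some \<open>K\<close>. If \<open>r^K y\<close> were nonzero, some \<open>r^K y g\<close> would
  equal \<open>s x\<close> with \<open>s\<close> outside \<qq>. By \<open>ess_annihilator\<close>
  this is killed by \<open>r\<close>, so stability gives \<open>r^K y g = 0\<close>, contrary to
  \<open>s x \<noteq> 0\<close>.\<close>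

lemma ess_power_torsion:
  assumes D: "D \<in> G" and y: "y \<in> Hom T D J" and r: "r \<in> grade R b" "r \<in> \<qq>"
  obtains k :: nat where "act T (int k * b) (r [^]\<^bsub>R\<^esub> k) J \<cdot> y = Zer T D (Sh (int k * b) J)"
proof -
  have DC: "D \<in> Cpt" using good_generators_sub[OF G] D by blast
  note ob = ess_ob(1,2)
  have Dob: "D \<in> Ob T" using compact_ob[OF DC] .
  let ?r = "\<lambda>n :: nat. r [^]\<^bsub>R\<^esub> n"
  note rp = grade_pow[OF r(1)]
  define N where "N k i = {h \<in> Hom T C (Sh i D). smul (int k * b) (?r k) i J (Sm i y \<cdot> h)
      = Zer T C (Sh (i + int k * b) J)}"
    for k :: nat and i
  have yh: "Sm i y \<cdot> h \<in> Hom T C (Sh i J)" if "h \<in> Hom T C (Sh i D)" for h i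
      using comp[OF that sm_in[OF y]] .
  have next_pow: "smul (int (Suc k) * b) (?r (Suc k)) i J z
      = smul (int k * b) (?r k) (i + b) J (smul b r i J z)"
    if "z \<in> Hom T C (Sh i J)" for k i z
    using smul_mult[OF rp[of k] r(1) ob(2) that] by (simp add: algebra_simps)
  have sub: "hom_submodule C D (N k)" for k
    unfolding hom_submodule_iff
  proof (intro conjI allI ballI)
    fix i
    show "N k i \<subseteq> Hom T C (Sh i D)" unfolding N_def by blast
    show "Zer T C (Sh i D) \<in> N k i"
      unfolding N_def using zer_in[OF ob(1) sh_in[OF Dob]] comp_zer_right[OF sm_in[OF y] ob(1)]
          smul_zer[OF rp[of k] ob(2,1)] by simp
  next
    fix i h h' assume "h \<in> N k i" "h' \<in> N k i"
    then have h: "h \<in> Hom T C (Sh i D)" "h' \<in> Hom T C (Sh i D)"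
        "smul (int k * b) (?r k) i J (Sm i y \<cdot> h) = Zer T C (Sh (i + int k * b) J)"
      "smul (int k * b) (?r k) i J (Sm i y \<cdot> h') = Zer T C (Sh (i + int k * b) J)"
          unfolding N_def by auto
    then show "Add T h h' \<in> N k i"
      unfolding N_def using comp_add_right[OF h(1,2) sm_in[OF y]] smul_add_right[OF rp[of k] ob(2)
          yh[OF h(1)] yh[OF h(2)]]
        add_in[OF h(1,2)] add_zer[OF zer_in[OF ob(1) sh_in[OF ob(2)]]] by simp
  next
    fix e c i h assume c: "c \<in> grade R e" and "h \<in> N k i"
    then have h: "h \<in> Hom T C (Sh i D)" "smul (int k * b) (?r k) i J (Sm i y \<cdot> h)
        = Zer T C (Sh (i + int k * b) J)" unfolding N_def by auto
    have "up_to_sign (smul (int k * b) (?r k) (i + e) J (smul e c i J (Sm i y \<cdot> h))) (smul e c (i +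
        int k * b) J (smul (int k * b) (?r k) i J (Sm i y \<cdot> h)))"
      by (rule up_to_sign_smul_commute[OF rp[of k] c ob(2) yh[OF h(1)]])
    then have "smul (int k * b) (?r k) (i + e) J (smul e c i J (Sm i y \<cdot> h))
        = Zer T C (Sh (i + int k * b + e) J)"
      using h(2) smul_zer[OF c ob(2,1)] up_to_sign_zer[OF _ zer_in[OF ob(1) sh_in[OF ob(2)]]]
          by simp
    then show "smul e c i D h \<in> N k (i + e)"
      unfolding N_def using smul_nat[OF c y h(1)] smul_in[OF c Dob h(1)]
          by (simp add: algebra_simps)
  qed
  have mono: "N k i \<subseteq> N (Suc k) i" for k i
  proof
    fix h assume "h \<in> N k i"
    then have h: "h \<in> Hom T C (Sh i D)" "smul (int k * b) (?r k) i J (Sm i y \<cdot> h)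
        = Zer T C (Sh (i + int k * b) J)" unfolding N_def by auto
    have "up_to_sign (smul (int k * b) (?r k) (i + b) J (smul b r i J (Sm i y \<cdot> h))) (smul b r (i +
        int k * b) J (smul (int k * b) (?r k) i J (Sm i y \<cdot> h)))"
      by (rule up_to_sign_smul_commute[OF rp[of k] r(1) ob(2) yh[OF h(1)]])
    then have "smul (int (Suc k) * b) (?r (Suc k)) i J (Sm i y \<cdot> h)
        = Zer T C (Sh (i + int k * b + b) J)"
      using next_pow[OF yh[OF h(1)]] h(2) smul_zer[OF r(1) ob(2,1)] up_to_sign_zer[OF _ zer_in[OF
          ob(1) sh_in[OF ob(2)]]] by simp
    then show "h \<in> N (Suc k) i" unfolding N_def using h(1) by (simp add: algebra_simps)
  qed
  obtain K where K: "\<And>k i. N k i \<subseteq> N K i" using hom_submodule_chain[where N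
      = N, OF noeth ess_ob(3) DC sub mono] by blast
  have "act T (int K * b) (?r K) J \<cdot> y = Zer T D (Sh (int K * b) J)"
  proof (rule ccontr)
    assume "act T (int K * b) (?r K) J \<cdot> y \<noteq> Zer T D (Sh (int K * b) J)"
    then obtain d s g where s: "s \<in> grade R (d + int K * b)" "s \<notin> \<qq>" and g: "g \<in> Hom T C (Sh d D)"
      and e: "smul (int K * b) (?r K) d J (Sm d y \<cdot> g) = act T (d + int K * b) s J \<cdot> x"
      using ess_obtain_multiple[OF D y rp[of K]] by metis
    have "up_to_sign (smul (int K * b) (?r K) (d + b) J (smul b r d J (Sm d y \<cdot> g))) (smul b r (d +
        int K * b) J (smul (int K * b) (?r K) d J (Sm d y \<cdot> g)))"
      by (rule up_to_sign_smul_commute[OF rp[of K] r(1) ob(2) yh[OF g]])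
    moreover have "smul b r (d + int K * b) J (act T (d + int K * b) s J \<cdot> x)
        = Zer T C (Sh (d + int K * b + b) J)"
      using smul_act_x[OF r(1) s(1)] act_kill_right[OF r(1) s(1) ess_x(1) ess_annihilator[OF r]]
          by (simp add: algebra_simps)
    ultimately have "smul (int (Suc K) * b) (?r (Suc K)) d J (Sm d y \<cdot> g)
        = Zer T C (Sh (d + int K * b + b) J)"
      using next_pow[OF yh[OF g]] e up_to_sign_zer[OF _ zer_in[OF ob(1) sh_in[OF ob(2)]]] by simp
    then have "g \<in> N (Suc K) d" unfolding N_def using g by (simp add: algebra_simps)
    then have "g \<in> N K d" using K by blast
    then have "act T (d + int K * b) s J \<cdot> x = Zer T C (Sh (d + int K * b) J)" unfolding N_def
        using e by simp
    then show False using ess_nonzero[OF s] by blast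
  qed
  then show ?thesis by (rule that)
qed

lemma ess_torsion: "J \<in> torsion (Vset R \<qq>)"
proof (rule torsionI_generators[OF G ess_ob(2)])
  fix D \<pp> assume D: "D \<in> G" and p: "\<pp> \<in> Spec R - Vset R \<qq>"
  then have "\<not> \<qq> \<subseteq> \<pp>" unfolding Vset_def by blast
  then obtain r b where r: "r \<in> grade R b" "r \<in> \<qq>"
      "r \<notin> \<pp>" using homogeneous_separation[OF q, of \<pp>] p by blast
  show "tors_hom \<pp> D J"
    unfolding tors_hom_def
  proof
    fix y assume y: "y \<in> Hom T D J"
    obtain k :: nat where "act T (int k * b) (r [^]\<^bsub>R\<^esub> k) J \<cdot> y = Zer T D (Sh (int k * b) J)"
      by (rule ess_power_torsion[OF D y r(1,2)])
    then show "tors \<pp> y" using torsI[OF y grade_pow[OF r(1)] Spec_pow[OF _ r(1,3)]] p by blast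
  qed
qed

text \<open>If \<open>s y = 0\<close> with \<open>y\<close> nonzero, then some \<open>t x\<close> is
  a multiple of \<open>y\<close> with \<open>t\<close> outside \<qq>, and \<open>s t x = 0\<close>
  although \<open>s t\<close> lies outside \<qq>.\<close>

lemma ess_local: "local_for (Zset R \<qq>) J"
proof (rule local_forI[OF q G ess_ob(2)])
  fix D y b s assume D: "D \<in> G" and y: "y \<in> Hom T D J" and s: "s \<in> grade R b" "s \<notin> \<qq>"
    and 0: "act T b s J \<cdot> y = Zer T D (Sh b J)"
  show "y = Zer T D J"
  proof (rule ccontr)
    assume "y \<noteq> Zer T D J"
    then obtain a t g where t: "t \<in> grade R a" "t \<notin> \<qq>" "g \<in> Hom T C (Sh a D)"
        "Sm a y \<cdot> g = act T a t J \<cdot> x"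
      using ess_obtain[OF D y] by blast
    have Dob: "D \<in> Ob T" using hom_ob y by blast
    note sJ = act_in[OF s(1) ess_ob(2)]
    have "smul b s a J (Sm a y \<cdot> g) = Sm a (act T b s J \<cdot> y) \<cdot> g"
      unfolding smul_def using comp_assoc[OF t(3) sm_in[OF y] sm_in[OF sJ]] sm_comp[OF y sJ, of a]
          by simp
    then have "smul b s a J (act T a t J \<cdot> x) = Zer T C (Sh a (Sh b J))"
      using 0 t(4) sm_zer[OF Dob sh_in[OF ess_ob(2)], of a b] comp_zer_left[OF t(3) sh_in[OF
          sh_in[OF ess_ob(2)]]] by simp
    then have "act T (b + a) (s \<otimes>\<^bsub>R\<^esub> t) J \<cdot> x = Zer T C (Sh (b + a) J)"
      using smul_act_x[OF s(1) t(1)] sh_sh[OF ess_ob(2), of a b] by (simp add: add.commute)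
    then show False using ess_nonzero[OF grade_mult[OF s(1) t(1)] Spec_mult[OF q s t(1,2)]] by blast
  qed
qed

end

section \<open>The left perpendicular of a localizing subcategory\<close>

lemma Gamma_p_detects:
  assumes noeth: "noetherian_category \<kappa> R T" and q: "\<qq> \<in> Spec R" and C: "C \<in> Cpt"
      and x: "x \<in> Hom T C X" "\<not> tors \<qq> x"
  obtains J \<phi> where "J \<in> Gamma_p_image \<kappa> R T \<qq>" "\<phi> \<in> Hom T X J" "\<phi> \<noteq> Zer T X J"
proof -
  \<comment> \<open>\<open>C\<close> is put among the generators, so that \<open>x\<close> is an
    element of the functor on \<open>G\<close>.\<close>
  have "small \<kappa> {C}" using small_image[OF small_nat[OF size], of "\<lambda>_. C" "{0}"] by simp
  then obtain G where G: "good_generators G" "C \<in> G" using ex_good_generators[of "{C}"] C by blast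
  obtain J \<phi> where J: "\<phi> \<in> Hom T X J" "essential \<qq> G C J (\<phi> \<cdot> x)"
      by (rule essential_extension[OF G x])
  have ob: "J \<in> Ob T" "C \<in> Ob T" using hom_ob J(1) x(1) by blast+
  have "J \<in> Gamma_p_image \<kappa> R T \<qq>"
    by (rule Gamma_p_imageI[OF ess_torsion[OF noeth q G J(2)] ess_local[OF noeth q G J(2)]])
  moreover have "\<phi> \<noteq> Zer T X J"
  proof
    assume "\<phi> = Zer T X J"
    then have "\<phi> \<cdot> x = Zer T C J" using comp_zer_left[OF x(1) ob(1)] by simp
    then show False using J(2) tors_zer[OF q ob(2,1)] unfolding essential_def by simp
  qed
  ultimately show ?thesis using that J(1) by blast
qed

lemma left_perp_eq_supported_on:
  assumes noeth: "noetherian_category \<kappa> R T" and str: "stratified \<kappa> R T" and S: "localizing \<kappa> T S"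
  shows "left_perp T S = supported_on \<kappa> R T {\<pp> \<in> Spec R. Vset R \<pp> \<inter> support_class \<kappa> R T S = {}}"
proof (intro equalityI subsetI)
  have lg: "local_global_principle \<kappa> R T" using str unfolding stratified_def by blast
  {
    fix X assume X: "X \<in> left_perp T S"
    then have Xob: "X \<in> Ob T" unfolding left_perp_def by blast
    have "Vset R \<pp> \<inter> support_class \<kappa> R T S = {}" if p: "\<pp> \<in> support \<kappa> R T X" for \<pp>
    proof (rule ccontr)
      assume "Vset R \<pp> \<inter> support_class \<kappa> R T S \<noteq> {}"
      then obtain \<qq> Y where q: "\<qq> \<in> Spec R" "\<pp> \<subseteq> \<qq>" and Y: "Y \<in> S" "\<qq> \<in> support \<kappa> R T Y"
        unfolding Vset_def support_class_def by blast
      have Yob: "Y \<in> Ob T" using localizing_ob[OF S] Y(1) by blast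
      let ?I = "Gamma_p_image \<kappa> R T \<qq>" and ?Y = "Gamma_p \<kappa> R T \<qq> Y"
      have YS: "?Y \<in> S" using Loc_Gamma_p[OF lg Yob S] Y(1) q(1) by blast
      have Ynz: "\<not> zero_object T ?Y" using Y(2) unfolding support_def by blast
      have "isomorphic T ?Y ?Y"
        using isomorphicI[OF idn is_iso_idn] Gamma_p_ob[OF Yob] by blast
      then have YI: "?Y \<in> ?I" unfolding Gamma_p_image_def using Gamma_p_ob[OF Yob] Yob by blast
      then have min: "minimal_localizing \<kappa> T ?I"
        using str q(1) Ynz unfolding stratified_def zero_subcategory_def by blast
      then have "localizing \<kappa> T (S \<inter> ?I)" using localizing_Int[OF S]
          unfolding minimal_localizing_def by blast
      then have "S \<inter> ?I = ?I"
        using min YS YI Ynz unfolding minimal_localizing_def zero_subcategory_def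
            by (metis IntI Int_lower2)
      then have IS: "?I \<subseteq> S" by blast
      have "\<not> zero_object T (Gamma_p \<kappa> R T \<pp> X)" using p unfolding support_def by auto
      \<comment> \<open>This yields a prime \<rr> inside \<pp> and an element that is not torsion at
        \<rr>. As \<rr> lies in \<qq>, the element also survives at \<qq>.\<close>
      then have "X \<notin> torsion (Zset R \<pp>)" using Gamma_p_zero by blast
      then obtain C \<rr> where C: "C \<in> Cpt" "\<rr> \<in> Spec R - Zset R \<pp>"
          "\<not> tors_hom \<rr> C X" unfolding torsion_iff using Xob by blast
      then obtain x where x: "x \<in> Hom T C X" "\<not> tors \<rr> x" unfolding tors_hom_def by blast
      have "\<rr> \<subseteq> \<qq>" using C(2) q(2) unfolding Zset_def by blast
      then have "\<not> tors \<qq> x" using x(2) tors_mono by blast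
      then obtain J \<phi> where "J \<in> ?I" "\<phi> \<in> Hom T X J"
          "\<phi> \<noteq> Zer T X J" using Gamma_p_detects[OF noeth q(1) C(1) x(1)] by blast
      then show False using X IS unfolding left_perp_def by blast
    qed
    then show "X \<in> supported_on \<kappa> R T {\<pp> \<in> Spec R. Vset R \<pp> \<inter> support_class \<kappa> R T S = {}}"
      unfolding supported_on_def support_def using Xob by blast
  next
    fix X assume "X \<in> supported_on \<kappa> R T {\<pp> \<in> Spec R. Vset R \<pp> \<inter> support_class \<kappa> R T S = {}}"
    then have X: "X \<in> Ob T" and sup: "\<And>\<pp>. \<pp> \<in> support \<kappa> R T X
        \<Longrightarrow> Vset R \<pp> \<inter> support_class \<kappa> R T S = {}"
      unfolding supported_on_def by blast+
    have "orth X Y" if Y: "Y \<in> S" for Y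
    proof (rule orth_of_supports[OF lg X])
      show "Y \<in> Ob T" using localizing_ob[OF S] Y by blast
      fix \<pp> \<qq> assume p: "\<pp> \<in> support \<kappa> R T X" and q: "\<qq> \<in> support \<kappa> R T Y"
      have "\<qq> \<in> support_class \<kappa> R T S" "\<qq> \<in> Spec R"
          using q Y unfolding support_class_def support_def by blast+
      then show "\<not> \<pp> \<subseteq> \<qq>" using sup[OF p] unfolding Vset_def by blast
    qed
    then show "X \<in> left_perp T S" using X unfolding left_perp_def orth_def by blast
  }
qed

end

theorem theorem1p5:
  fixes \<kappa> :: "'k rel"
    and R :: "('r, 'y) graded_ring_scheme"
    and T :: "('o, 'm, 'r, 'z) lincat_scheme"
    and S :: "'o set"
  assumes "size_bound \<kappa>"
    and "linear_category R T"
    and "small \<kappa> (carrier R)"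
    and "graded_noetherian R"
    and "has_coproducts \<kappa> T"
    and "compactly_generated \<kappa> T"
    and "noetherian_category \<kappa> R T"
    and "stratified \<kappa> R T"
    and "localizing \<kappa> T S"
  shows "localizing \<kappa> T (left_perp T S) \<and>
    left_perp T S =
      supported_on \<kappa> R T {\<pp> \<in> Spec R. Vset R \<pp> \<inter> support_class \<kappa> R T S = {}}"
proof -
  interpret linear_category R T by (rule assms(2))
  interpret bik_category R T \<kappa>
    by unfold_locales (use assms in auto)
  have "localizing \<kappa> T (left_perp T S)"
    by (rule left_perp_localizing[OF localizing_ob[OF assms(9)]])
      (use triangulated_subcategory_sh[OF localizing_triangulated[OF assms(9)]] localizing_ob[OF
          assms(9)] in blast)
  then show ?thesis using left_perp_eq_supported_on[OF assms(7-9)] by blast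
qed

end
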